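(* Let $1\le m\le k\le n-m$ and let $f\in L^1(V_{n,m})$ be right $O(m)$-invariant. Suppose $n-k-m$ is even, put $\ell=(n-k-m)/2$ and $$c_{m,k}=\frac{(-1)^{m\ell}\,4^{-m\ell}\,\Gamma_m(m/2)\,\Gamma_m(k/2)}{\Gamma_m((n-m)/2)\,\Gamma_m((n-k)/2)}.$$ Then $f$ is recovered from its Funk transform $\varphi=F_{m,k}f$ by the formula $$E_{m-n}f=c_{m,k}\,\Delta^\ell E_{-k}F^*_{m,k}\varphi$$ in the sense of tempered distributions on $M_{n,m}$. If the right-hand side is locally integrable in a neighborhood of $V_{n,m}$, then the formula holds pointwise almost everywhere on $V_{n,m}$.
   Context: $M_{n,m}$ is the space of real $n\times m$ matrices with Lebesgue measure. $V_{n,m}=\{v\in M_{n,m}:v'v=I_m\}$ is the Stiefel manifold with $O(n)$-invariant probability measure $d_*v$ (and $L^1$ with respect to it). Right $O(m)$-invariant means $f(v\gamma)=f(v)$, $\gamma\in O(m)$. $\Gamma_m(\alpha)=\pi^{m(m-1)/4}\prod_{j=0}^{m-1}\Gamma(\alpha-j/2)$. Funk transform and its dual: $$(F_{m,k}f)(u)=\int_{V_{n-k,m}} f\Big(g_u\begin{bmatrix}\omega\\ 0\end{bmatrix}\Big)d_*\omega,\quad u\in V_{n,k};\qquad (F^*_{m,k}\varphi)(v)=\int_{V_{n-m,k}}\varphi\Big(g_v\begin{bmatrix}\theta\\ 0\end{bmatrix}\Big)d_*\theta,\quad v\in V_{n,m},$$ where $g_u,g_v\in O(n)$ are any matrices with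 $g_u\begin{bmatrix}0\\ I_k\end{bmatrix}=u$, $g_v\begin{bmatrix}0\\ I_m\end{bmatrix}=v$. For a function $f$ on $V_{n,m}$ and $\lambda\in\mathbb C$, $(E_\lambda f)(x)=(\det r)^{\lambda/2}f(v)$ for $x\in M_{n,m}$ of rank $m$ with polar decomposition $x=vr^{1/2}$, $r=x'x$, $v\in V_{n,m}$ (in particular $E_\lambda f=f$ on $V_{n,m}$). The Cayley–Laplace operator is $\Delta=\det(\partial'\partial)$, where $\partial$ is the $n\times m$ matrix with entries $\partial/\partial x_{i,j}$. Functions on $M_{n,m}$ are viewed as distributions through $(h,\phi)=\int h\overline\phi\,dx$. *)

theory Defs
  imports "HOL-Probability.Probability"
begin

text \<open>
  The matrix space \<open>M\<^bsub>n,m\<^esub>\<close> is \<^typ>\<open>real^'m^'n\<close> (\<open>n\<close> rows, \<open>m\<close> columns), with \<open>n = CARD('n)\<close> and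
  \<open>m = CARD('m)\<close>; index types are nonempty, so \<open>m \<ge> 1\<close> is automatic.
\<close>

section \<open>Stiefel manifolds\<close>

definition stiefel :: "(real^'m^'n) set" where
  "stiefel = {v. transpose v ** v = mat 1}"

definition invariant_prob_on_stiefel :: "(real^'m^'n) measure \<Rightarrow> bool" where
  "invariant_prob_on_stiefel \<mu> \<longleftrightarrow>
     prob_space \<mu> \<and> space \<mu> = stiefel \<and> sets \<mu> = sets (restrict_space borel stiefel) \<and>
     (\<forall>g. orthogonal_matrix g \<longrightarrow> distr \<mu> \<mu> (\<lambda>v. g ** v) = \<mu>)"

text \<open>Existence and uniqueness hold whenever \<open>m \<le> n\<close>; otherwise \<open>stiefel\<close> is empty.\<close>
definition stiefel_measure :: "(real^'m^'n) measure" where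
  "stiefel_measure = (THE \<mu>. invariant_prob_on_stiefel \<mu>)"

text \<open>Elements of \<open>L\<^sup>1\<close> are classes modulo null sets, so for each \<open>\<gamma>\<close> invariance is required
  almost everywhere.\<close>
definition right_invariant :: "(real^'m^'n \<Rightarrow> complex) \<Rightarrow> bool" where
  "right_invariant f \<longleftrightarrow>
     (\<forall>\<gamma>. orthogonal_matrix \<gamma> \<longrightarrow> (AE v in stiefel_measure. f (v ** \<gamma>) = f v))"

section \<open>Funk transforms\<close>

text \<open>Index types carry no order, so the splitting of the \<open>n\<close> rows into an upper block and a lower
  block is given by a bijection \<open>e\<close> from the disjoint sum of the two row index types.\<close>
definition stack :: "('p + 'k \<Rightarrow> 'n) \<Rightarrow> real^'c^'p \<Rightarrow> real^'c^'k \<Rightarrow> real^'c^'n" where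
  "stack e A B = (\<chi> i. case inv e i of Inl a \<Rightarrow> A $ a | Inr b \<Rightarrow> B $ b)"

text \<open>The value of either transform does not depend on the choice of \<open>g\<close>.\<close>
definition funk :: "('p::finite + 'k::finite \<Rightarrow> 'n::finite) \<Rightarrow> (real^'m^'n \<Rightarrow> complex) \<Rightarrow> (real^'k^'n \<Rightarrow> complex)" where
  "funk e f u =
     (let g = (SOME g. orthogonal_matrix g \<and> g ** stack e 0 (mat 1) = u)
      in LINT \<omega>|stiefel_measure. f (g ** stack e \<omega> 0))"

definition dual_funk :: "('q::finite + 'm::finite \<Rightarrow> 'n::finite) \<Rightarrow> (real^'k^'n \<Rightarrow> complex) \<Rightarrow> (real^'m^'n \<Rightarrow> complex)" where
  "dual_funk e \<phi> v =
     (let g = (SOME g. orthogonal_matrix g \<and> g ** stack e 0 (mat 1) = v)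
      in LINT \<theta>|stiefel_measure. \<phi> (g ** stack e \<theta> 0))"

section \<open>Homogeneous extension\<close>

definition posdef :: "real^'m^'m \<Rightarrow> bool" where
  "posdef s \<longleftrightarrow> transpose s = s \<and> (\<forall>z. z \<noteq> 0 \<longrightarrow> z \<bullet> (s *v z) > 0)"

definition polar_part :: "real^'m^'n \<Rightarrow> real^'m^'n" where
  "polar_part x =
     (THE v. v \<in> stiefel \<and> (\<exists>s. posdef s \<and> s ** s = transpose x ** x \<and> x = v ** s))"

text \<open>The value on the Lebesgue null set of matrices of rank less than \<open>m\<close> is immaterial.\<close>
definition E_ext :: "complex \<Rightarrow> (real^'m^'n \<Rightarrow> complex) \<Rightarrow> (real^'m^'n \<Rightarrow> complex)" where
  "E_ext a f x =
     (if rank x = CARD('m)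
      then complex_of_real (det (transpose x ** x)) powr (a / 2) * f (polar_part x) else 0)"

section \<open>Tempered distributions\<close>

fun iter_deriv :: "'a::euclidean_space list \<Rightarrow> ('a \<Rightarrow> complex) \<Rightarrow> ('a \<Rightarrow> complex)" where
  "iter_deriv [] \<phi> = \<phi>"
| "iter_deriv (b # bs) \<phi> = (\<lambda>x. frechet_derivative (iter_deriv bs \<phi>) (at x) b)"

definition smooth :: "('a::euclidean_space \<Rightarrow> complex) \<Rightarrow> bool" where
  "smooth \<phi> \<longleftrightarrow> (\<forall>bs. set bs \<subseteq> Basis \<longrightarrow> (\<forall>x. iter_deriv bs \<phi> differentiable (at x)))"

definition schwartz :: "('a::euclidean_space \<Rightarrow> complex) set" where
  "schwartz = {\<phi>. smooth \<phi> \<and>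
     (\<forall>bs N. set bs \<subseteq> Basis \<longrightarrow> bounded (range (\<lambda>x. (1 + norm x) ^ N *\<^sub>R iter_deriv bs \<phi> x)))}"

definition test_functions :: "'a::euclidean_space set \<Rightarrow> ('a \<Rightarrow> complex) set" where
  "test_functions U = {\<phi>. smooth \<phi> \<and> compact (closure {x. \<phi> x \<noteq> 0}) \<and> closure {x. \<phi> x \<noteq> 0} \<subseteq> U}"

type_synonym 'a distribution = "('a \<Rightarrow> complex) \<Rightarrow> complex"

definition dist_of :: "('a::euclidean_space \<Rightarrow> complex) \<Rightarrow> 'a distribution" where
  "dist_of h = (\<lambda>\<phi>. LINT x|lebesgue. h x * cnj (\<phi> x))"

text \<open>Absolute convergence of all pairings, so that \<open>dist_of h\<close> is not the default value of a
  divergent integral; by the uniform boundedness principle continuity on \<open>schwartz\<close> follows.\<close>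
definition defines_tempered :: "('a::euclidean_space \<Rightarrow> complex) \<Rightarrow> bool" where
  "defines_tempered h \<longleftrightarrow> (\<forall>\<phi>\<in>schwartz. integrable lebesgue (\<lambda>x. h x * cnj (\<phi> x)))"

definition locally_integrable_on :: "('a::euclidean_space \<Rightarrow> complex) \<Rightarrow> 'a set \<Rightarrow> bool" where
  "locally_integrable_on h U \<longleftrightarrow> (\<forall>K. compact K \<longrightarrow> K \<subseteq> U \<longrightarrow> set_integrable lebesgue K h)"

text \<open>\<open>x\<close> is a Lebesgue point of \<open>h\<close> with value \<open>c\<close>. The Stiefel manifold is a Lebesgue null set,
  so this is how a locally integrable function, which is only determined up to null sets, has a
  value at a point of the manifold.\<close>
definition has_lebesgue_value :: "('a::euclidean_space \<Rightarrow> complex) \<Rightarrow> complex \<Rightarrow> 'a \<Rightarrow> bool" where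
  "has_lebesgue_value h c x \<longleftrightarrow>
     ((\<lambda>\<epsilon>. (LINT y:ball x \<epsilon>|lebesgue. norm (h y - c)) / measure lebesgue (ball x \<epsilon>)) \<longlongrightarrow> 0)
       (at_right 0)"

section \<open>Cayley--Laplace operator\<close>

definition dist_partial :: "'n \<Rightarrow> 'm \<Rightarrow> (real^'m^'n) distribution \<Rightarrow> (real^'m^'n) distribution" where
  "dist_partial i j T = (\<lambda>\<phi>. - T (\<lambda>x. frechet_derivative \<phi> (at x) (axis i (axis j 1))))"

text \<open>The entry \<open>(j,l)\<close> of the operator matrix \<open>\<partial>'\<partial>\<close>.\<close>
definition gram_entry :: "'m \<Rightarrow> 'm \<Rightarrow> (real^'m^'n) distribution \<Rightarrow> (real^'m^'n) distribution" where
  "gram_entry j l T = (\<lambda>\<phi>. \<Sum>i\<in>UNIV. dist_partial i j (dist_partial i l T) \<phi>)"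

definition index_list :: "'m::finite list" where
  "index_list = (SOME js. distinct js \<and> set js = UNIV)"

text \<open>Leibniz expansion of \<open>det(\<partial>'\<partial>)\<close>, products being compositions. Partial derivatives
  of Schwartz functions commute, so the order of the factors chosen in \<open>index_list\<close> is immaterial.\<close>
definition cayley_laplace :: "(real^'m^'n) distribution \<Rightarrow> (real^'m^'n) distribution" where
  "cayley_laplace T = (\<lambda>\<phi>. \<Sum>\<sigma> | \<sigma> permutes (UNIV :: 'm set).
     of_int (sign \<sigma>) * foldr (\<lambda>j. gram_entry j (\<sigma> j)) index_list T \<phi>)"

section \<open>Constants\<close>

definition siegel_Gamma :: "nat \<Rightarrow> real \<Rightarrow> real" where
  "siegel_Gamma m \<alpha> = pi powr (real m * (real m - 1) / 4) * (\<Prod>j<m. Gamma (\<alpha> - real j / 2))"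

definition funk_const :: "nat \<Rightarrow> nat \<Rightarrow> nat \<Rightarrow> real" where
  "funk_const n m k =
     (let l = (n - k - m) div 2
      in (- 1) ^ (m * l) * (1 / 4) ^ (m * l) * siegel_Gamma m (real m / 2) * siegel_Gamma m (real k / 2) /
         (siegel_Gamma m ((real n - real m) / 2) * siegel_Gamma m ((real n - real k) / 2)))"

end

theory Submission
  imports Defs
begin

text \<open>
  In polar coordinates \<open>x = v y\<close> the pairing of \<open>E\<^bsub>m-n\<^esub> f\<close> with a test function \<open>\<psi>\<close> is the average over \<open>v\<close> of
  \<open>f(v)\<close> times the integral of \<open>\<psi>(v y)\<close> over square matrices \<open>y\<close>. Likewise the pairing of \<open>E\<^bsub>-k\<^esub> F\<^sup>* \<phi>\<close> with
  \<open>\<Psi>\<close> is the average over \<open>u\<close> of \<open>\<phi>(u)\<close> times the integral of \<open>\<Psi>\<close> over \<open>{x. u'x = 0}\<close>, because this space is swept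
  out by the \<open>m\<close>-frames orthogonal to \<open>u\<close>. For \<open>\<Psi> = \<Delta>\<^sup>l \<psi>\<close>, Fourier inversion turns the inner integral into one of
  \<open>(-1)\<^sup>m\<^sup>l det(\<xi>'\<xi>)\<^sup>l\<close> times the Fourier transform of \<open>\<psi>\<close> over \<open>{u b}\<close>. Passing from \<open>\<phi> = F f\<close> back to \<open>f\<close>, one
  averages over the \<open>k\<close>-frames \<open>u\<close> orthogonal to \<open>v\<close>; there the power \<open>det(b'b)\<^sup>l\<close> is precisely the Jacobian of polar
  coordinates on \<open>{x. v'x = 0}\<close>, and a second Fourier inversion leads back to the integral of \<open>\<psi>(v y)\<close>. The constants
  are Gaussian moments of Gram determinants.

  A locally integrable representative of the right-hand side agrees almost everywhere with \<open>E\<^bsub>m-n\<^esub> f\<close>. Almost every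
  matrix is a Lebesgue point of \<open>E\<^bsub>m-n\<^esub> f\<close>, and the homogeneity of this function transfers the property to almost every
  point of the null set \<open>V\<^bsub>n,m\<^esub>\<close>.
\<close>

section \<open>Polar decomposition\<close>

text \<open>The proof uses no smooth structure, Jacobian or parametrisation of the Stiefel manifold;
  every change of variables comes from invariance. Haar measure on O(n) is the law of the polar
  factor of a Gaussian matrix. Polar coordinates with k-frames follow from the uniqueness of
  relatively invariant measures under GL(m), and inserting a Gaussian gives their constants. The
  pairs (u, w) of frames with u'w = 0 form a single O(n)-orbit. This makes \<open>funk\<close> and
  \<open>dual_funk\<close> adjoint and allows the roles of u and v to be exchanged under the
  integral over O(n). Evenness of n - k - m makes the weight \<open>gvol ^ (n - k - m)\<close> the
  polynomial \<open>gram_det ^ l\<close>, which up to sign is the symbol of a differential operator.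
  Fourier inversion is used only at the origin, for marginals of Schwartz functions. Two measure
  theoretic points shape the lemmas: \<open>funk\<close> takes its rotation from
  \<open>SOME\<close>, so measurability of the transform needs an argument, and f is an L^1 class,
  invariant under each \<gamma> only almost everywhere.\<close>

lemma column_dot:
  fixes x :: "real^'m^'n"
  shows "(transpose x ** (y::real^'k^'n)) $ i $ j = column i x \<bullet> column j y"
  by (simp add: matrix_matrix_mult_def transpose_def column_def inner_vec_def)

lemma column_mult: "column j (A ** B) = A *v column j B"
  by (simp add: column_def vec_eq_iff matrix_matrix_mult_def matrix_vector_mult_def)

lemma matrix_inner_columns:
  fixes x y :: "real^'m^'n"
  shows "x \<bullet> y = (\<Sum>j\<in>UNIV. column j x \<bullet> column j y)"
  unfolding inner_vec_def column_def by (simp) (rule sum.swap)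

lemma matrix_inner_trace:
  fixes x y :: "real^'m^'n"
  shows "x \<bullet> y = trace (transpose x ** y)"
  by (simp add: trace_def column_dot matrix_inner_columns)

lemma norm_matrix_trace:
  fixes x :: "real^'m^'n"
  shows "(norm x)\<^sup>2 = trace (transpose x ** x)"
  by (simp add: matrix_inner_trace power2_norm_eq_inner)

lemma stiefel_columns:
  "(v::real^'m^'n) \<in> stiefel \<longleftrightarrow> (\<forall>i j. column i v \<bullet> column j v = (if i = j then 1 else 0))"
  by (simp add: stiefel_def vec_eq_iff column_dot mat_def)

lemma stiefelD: "v \<in> stiefel \<Longrightarrow> transpose v ** v = mat 1"
  by (simp add: stiefel_def)

lemma orthogonal_matrix_iff_stiefel: "orthogonal_matrix (g::real^'n^'n) \<longleftrightarrow> g \<in> stiefel"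
  by (simp add: stiefel_def orthogonal_matrix)

lemma stiefel_square_right: "(g::real^'n^'n) \<in> stiefel \<Longrightarrow> g ** transpose g = mat 1"
  using orthogonal_matrix_iff_stiefel orthogonal_matrix_def by metis

lemma stiefel_transpose: "(g::real^'n^'n) \<in> stiefel \<Longrightarrow> transpose g \<in> stiefel"
  by (simp add: stiefel_def stiefel_square_right)

lemma mat_1_stiefel: "(mat 1::real^'n^'n) \<in> stiefel"
  by (simp add: stiefel_def)

lemma stiefel_mult:
  assumes "(g::real^'k^'n) \<in> stiefel" "(v::real^'m^'k) \<in> stiefel"
  shows "g ** v \<in> stiefel"
proof -
  have "transpose (g ** v) ** (g ** v) = transpose v ** (transpose g ** g) ** v"
    by (simp add: matrix_transpose_mul matrix_mul_assoc)
  then show ?thesis using assms by (simp add: stiefel_def)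
qed

lemma gram_mult_stiefel:
  assumes "(g::real^'k^'n) \<in> stiefel"
  shows "transpose (g ** x) ** (g ** y) = transpose x ** (y::real^'l^'k)"
proof -
  have "transpose (g ** x) ** (g ** y) = transpose x ** (transpose g ** g) ** y"
    by (simp add: matrix_transpose_mul matrix_mul_assoc)
  then show ?thesis using assms by (simp add: stiefel_def)
qed

lemma norm_stiefel_mult:
  assumes "(g::real^'k^'n) \<in> stiefel"
  shows "norm (g ** (x::real^'m^'k)) = norm x"
  by (metis assms gram_mult_stiefel norm_matrix_trace norm_ge_zero power2_eq_iff_nonneg)

lemma norm_mult_orthogonal:
  assumes "(g::real^'m^'m) \<in> stiefel"
  shows "norm ((x::real^'m^'n) ** g) = norm x"
proof -
  have "(norm (x ** g))\<^sup>2 = trace (transpose g ** (transpose x ** x) ** g)"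
    by (simp add: norm_matrix_trace matrix_transpose_mul matrix_mul_assoc)
  also have "\<dots> = trace (g ** (transpose g ** (transpose x ** x)))"
    by (rule trace_mul_sym)
  also have "\<dots> = (norm x)\<^sup>2"
    by (simp add: matrix_mul_assoc stiefel_square_right[OF assms] norm_matrix_trace)
  finally show ?thesis by simp
qed

lemma norm_stiefel: "(v::real^'m^'n) \<in> stiefel \<Longrightarrow> (norm v)\<^sup>2 = CARD('m)"
  by (simp add: norm_matrix_trace stiefel_def trace_I)

lemma continuous_on_transpose [continuous_intros]:
  fixes f :: "'a::topological_space \<Rightarrow> real^'m^'n"
  assumes "continuous_on S f"
  shows "continuous_on S (\<lambda>x. transpose (f x))"
  unfolding transpose_def
  by (intro continuous_on_vec_lambda continuous_on_component assms)

lemma continuous_on_matrix_mult [continuous_intros]: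
  fixes f :: "'a::topological_space \<Rightarrow> real^'m^'n" and g :: "'a \<Rightarrow> real^'k^'m"
  assumes "continuous_on S f" "continuous_on S g"
  shows "continuous_on S (\<lambda>x. f x ** g x)"
  unfolding matrix_matrix_mult_def
  by (intro continuous_on_vec_lambda continuous_on_component continuous_intros assms)

lemma continuous_on_matrix_vector_mult [continuous_intros]:
  fixes f :: "'a::topological_space \<Rightarrow> real^'m^'n" and g :: "'a \<Rightarrow> real^'m"
  assumes "continuous_on S f" "continuous_on S g"
  shows "continuous_on S (\<lambda>x. f x *v g x)"
  unfolding matrix_vector_mult_def
  by (intro continuous_on_vec_lambda continuous_on_component continuous_intros assms)

lemma continuous_on_det [continuous_intros]:
  fixes f :: "'a::topological_space \<Rightarrow> real^'m^'m"
  assumes "continuous_on S f"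
  shows "continuous_on S (\<lambda>x. det (f x))"
  unfolding det_def
  by (intro continuous_on_sum continuous_on_prod continuous_on_component continuous_intros assms)

lemma closed_stiefel: "closed (stiefel :: (real^'m^'n) set)"
  unfolding stiefel_def by (intro closed_Collect_eq continuous_intros)

lemma compact_stiefel: "compact (stiefel :: (real^'m^'n) set)"
proof -
  have "norm v \<le> 1 + real CARD('m)" if "v \<in> stiefel" for v :: "real^'m^'n"
    proof (rule power2_le_imp_le)
    show "(norm v)\<^sup>2 \<le> (1 + real CARD('m))\<^sup>2"
      unfolding norm_stiefel[OF that] by (simp add: power2_eq_square algebra_simps)
  qed simp
  then have "bounded (stiefel :: (real^'m^'n) set)" by (auto simp: bounded_iff)
  with closed_stiefel show ?thesis by (simp add: compact_eq_bounded_closed)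
qed

lemma stiefel_nonempty:
  assumes "CARD('m::finite) \<le> CARD('n::finite)"
  shows "(stiefel :: (real^'m^'n) set) \<noteq> {}"
proof -
  obtain h :: "'m \<Rightarrow> 'n" where h: "inj h"
    using inj_on_iff_card_le[of "UNIV :: 'm set" "UNIV :: 'n set"] assms by auto
  have "(\<chi> i j. if i = h j then 1 else (0::real)) \<in> (stiefel :: (real^'m^'n) set)"
    using h by (auto simp: stiefel_columns column_def inner_vec_def if_distrib cong: if_cong
        intro!: sum.neutral dest: injD)
  then show ?thesis by auto
qed

section \<open>Positive semidefinite matrices, the polar factor, and transitivity on frames\<close>

definition psd :: "real^'m^'m \<Rightarrow> bool" where
  "psd s \<longleftrightarrow> transpose s = s \<and> (\<forall>z. 0 \<le> z \<bullet> (s *v z))"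

text \<open>A linear form on the unit circle is largest in the direction of its coefficient vector,
  so a maximum at (1, 0) forces b = 0. This is the first order condition for the rotations in
  \<open>polar_exists\<close>, without differentiation.\<close>

lemma circle_max_imp_zero:
  fixes a b :: real
  assumes "\<And>c s. c\<^sup>2 + s\<^sup>2 = 1 \<Longrightarrow> a * c + b * s \<le> a"
  shows "b = 0"
proof (rule ccontr)
  assume b: "b \<noteq> 0"
  define r where "r = sqrt (a\<^sup>2 + b\<^sup>2)"
  have r: "r > 0" "r\<^sup>2 = a\<^sup>2 + b\<^sup>2" unfolding r_def using b
    by (simp_all add: add_nonneg_pos)
  have "(a/r)\<^sup>2 + (b/r)\<^sup>2 = 1" using r b by (simp add: power_divide add_divide_distrib[symmetric])
  from assms[OF this] have "(a\<^sup>2 + b\<^sup>2) / r \<le> a" by (simp add: power2_eq_square add_divide_distrib)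
  moreover have "(a\<^sup>2 + b\<^sup>2) / r = r" using r(1) unfolding r(2)[symmetric] by (simp add: power2_eq_square)
  ultimately have "r \<le> a" by simp
  then have "r\<^sup>2 \<le> a\<^sup>2" using r by (intro power_mono) auto
  then show False using r b by simp
qed

lemma transpose_matrix_vector_dot:
  fixes x :: "real^'m^'n"
  shows "z \<bullet> (transpose x *v w) = (x *v z) \<bullet> w"
  by (metis dot_lmul_matrix inner_commute transpose_matrix_vector)

lemma gram_quadratic:
  fixes x :: "real^'m^'n"
  shows "z \<bullet> ((transpose x ** x) *v z) = (norm (x *v z))\<^sup>2"
  by (simp only: matrix_vector_mul_assoc[symmetric] transpose_matrix_vector_dot power2_norm_eq_inner)

text \<open>The factor \<open>v\<close> maximises the linear functional \<open>v \<mapsto> tr(v'x)\<close> on the compact Stiefel manifold;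
  testing maximality on reflections, plane rotations and rotations towards the orthogonal complement
  of the column space gives positivity, symmetry and \<open>x = v v'x\<close>.\<close>
lemma polar_exists:
  fixes x :: "real^'m^'n"
  assumes "CARD('m) \<le> CARD('n)"
  obtains v where "v \<in> stiefel" "psd (transpose v ** x)" "x = v ** (transpose v ** x)"
proof -
  obtain v :: "real^'m^'n" where v: "v \<in> stiefel" and max: "\<And>w. w \<in> stiefel \<Longrightarrow> w \<bullet> x \<le> v \<bullet> x"
  proof -
    have "continuous_on stiefel (\<lambda>v::real^'m^'n. v \<bullet> x)" by (intro continuous_intros)
    from continuous_attains_sup[OF compact_stiefel stiefel_nonempty[OF assms] this] that
    show ?thesis by blast
  qed
  have vc: "column i v \<bullet> column j v = (if i = j then 1 else 0)" for i j
    using v by (simp add: stiefel_columns)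
  define y where "y = transpose v ** x"
  have y: "y $ i $ j = column i v \<bullet> column j x" for i j by (simp add: y_def column_dot)
  have "0 \<le> z \<bullet> (y *v z)" if z: "norm z = 1" for z
  proof -
    \<comment> \<open>This is v (I - 2 z z'), v composed with a reflection; the functional drops by
      2 z'yz.\<close>
    define w where "w = (\<chi> r l. v $ r $ l - 2 * (v *v z) $ r * z $ l)"
    have wc: "column l w = column l v - (2 * z $ l) *\<^sub>R (v *v z)" for l
      by (simp add: w_def column_def vec_eq_iff)
    have vz: "column l v \<bullet> (v *v z) = z $ l" for l
    proof -
      have "column l v \<bullet> (v *v z) = (transpose v *v (v *v z)) $ l"
        by (simp add: matrix_vector_mult_def transpose_def column_def inner_vec_def)
      then show ?thesis using v by (simp add: matrix_vector_mul_assoc stiefelD)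
    qed
    have vz': "(v *v z) \<bullet> column l v = z $ l" for l using vz by (simp add: inner_commute)
    have nvz: "(v *v z) \<bullet> (v *v z) = 1"
      using gram_quadratic[of z v] z v
      by (simp only: stiefelD matrix_vector_mul_lid power2_norm_eq_inner[symmetric]) simp
    have "w \<in> stiefel"
      unfolding stiefel_columns wc
      by (simp add: inner_diff_left inner_diff_right vc vz vz' nvz)
    from max[OF this] have "(\<Sum>l\<in>UNIV. z $ l * ((v *v z) \<bullet> column l x)) \<ge> 0"
      unfolding matrix_inner_columns wc
      by (simp add: inner_diff_left sum_subtractf sum_distrib_left[symmetric] mult.assoc)
    also have "(\<Sum>l\<in>UNIV. z $ l * ((v *v z) \<bullet> column l x)) = (v *v z) \<bullet> (x *v z)"
      by (simp add: matrix_mult_sum inner_sum_right scalar_mult_eq_scaleR)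
    also have "\<dots> = z \<bullet> (y *v z)"
      by (simp only: y_def matrix_vector_mul_assoc[symmetric] transpose_matrix_vector_dot)
    finally show ?thesis .
  qed
  then have pos: "0 \<le> z \<bullet> (y *v z)" for z
  proof (cases "z = 0")
    case False
    assume *: "\<And>z. norm z = 1 \<Longrightarrow> 0 \<le> z \<bullet> (y *v z)"
    have "0 \<le> (z /\<^sub>R norm z) \<bullet> (y *v (z /\<^sub>R norm z))" by (rule *) (use False in simp)
    also have "\<dots> = (z \<bullet> (y *v z)) / (norm z)\<^sup>2"
      by (simp add: matrix_vector_mult_scaleR power2_eq_square divide_inverse)
    finally show ?thesis using False by (simp add: zero_le_divide_iff)
  qed auto
  have sym: "y $ j $ i = y $ i $ j" for i j
  proof (cases "i = j")
    case False
    have "y $ j $ i - y $ i $ j = 0"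
    proof (rule circle_max_imp_zero)
      fix c s :: real assume cs: "c\<^sup>2 + s\<^sup>2 = 1"
      \<comment> \<open>Columns i and j are rotated in their plane. The affected part of the
        functional becomes (y_ii + y_jj) c + (y_ji - y_ij) s.\<close>
      define w where "w = (\<chi> r l. if l = i then c * v $ r $ i + s * v $ r $ j
          else if l = j then c * v $ r $ j - s * v $ r $ i else v $ r $ l)"
      have wc: "column l w = (if l = i then c *\<^sub>R column i v + s *\<^sub>R column j v
          else if l = j then c *\<^sub>R column j v - s *\<^sub>R column i v else column l v)" for l
        by (simp add: w_def column_def vec_eq_iff)
      have "w \<in> stiefel" using cs False
        unfolding stiefel_columns wc
        by (auto simp: inner_add_left inner_add_right inner_diff_left inner_diff_right vc
            power2_eq_square algebra_simps)
      from max[OF this] have "w \<bullet> x \<le> v \<bullet> x" .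
      moreover have "w \<bullet> x = (\<Sum>l\<in>UNIV - {i,j}. column l v \<bullet> column l x)
          + (c * y$i$i + s * y$j$i) + (c * y$j$j - s * y$i$j)"
      proof -
        have "w \<bullet> x = (\<Sum>l\<in>UNIV - {i,j}. column l w \<bullet> column l x) + (\<Sum>l\<in>{i,j}. column l w \<bullet> column l x)"
          unfolding matrix_inner_columns by (intro sum.subset_diff) auto
        also have "(\<Sum>l\<in>UNIV - {i,j}. column l w \<bullet> column l x) = (\<Sum>l\<in>UNIV - {i,j}. column l v \<bullet> column l x)"
          by (intro sum.cong) (auto simp: wc)
        also have "(\<Sum>l\<in>{i,j}. column l w \<bullet> column l x) = (c * y$i$i + s * y$j$i) + (c * y$j$j - s * y$i$j)"
          using False by (simp add: wc y inner_add_left inner_diff_left)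
        finally show ?thesis by simp
      qed
      moreover have "v \<bullet> x = (\<Sum>l\<in>UNIV - {i,j}. column l v \<bullet> column l x) + y$i$i + y$j$j"
      proof -
        have "v \<bullet> x = (\<Sum>l\<in>UNIV - {i,j}. column l v \<bullet> column l x) + (\<Sum>l\<in>{i,j}. column l v \<bullet> column l x)"
          unfolding matrix_inner_columns by (intro sum.subset_diff) auto
        then show ?thesis using False by (simp add: y)
      qed
      ultimately show "(y$i$i + y$j$j) * c + (y $ j $ i - y $ i $ j) * s \<le> y$i$i + y$j$j"
        by (simp add: algebra_simps)
    qed
    then show ?thesis by simp
  qed simp
  have "column j x - v *v (transpose v *v column j x) = 0" for j
  proof (rule ccontr)
    \<comment> \<open>The part of column j of x that is orthogonal to all columns of v. Rotating
      column j of v towards it would increase the functional unless it is 0.\<close>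
    define p0 where "p0 = column j x - v *v (transpose v *v column j x)"
    assume "column j x - v *v (transpose v *v column j x) \<noteq> 0"
    then have p0: "p0 \<noteq> 0" by (simp add: p0_def)
    have "transpose v *v p0 = 0"
      using v by (simp add: p0_def matrix_vector_mult_diff_distrib matrix_vector_mul_assoc matrix_mul_assoc stiefelD)
    then have orth: "(v *v z) \<bullet> p0 = 0" for z by (simp flip: transpose_matrix_vector_dot)
    have orthc: "column l v \<bullet> p0 = 0" for l
      using orth[of "axis l 1"] by (simp add: matrix_vector_mult_basis)
    define p where "p = p0 /\<^sub>R norm p0"
    have p: "p \<bullet> p = 1" "column l v \<bullet> p = 0" "p \<bullet> column l v = 0" for l using p0 orthc[of l]
      by (auto simp: p_def power2_norm_eq_inner[symmetric] power2_eq_square inner_commute[of p0])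
    have "p \<bullet> column j x = 0"
    proof (rule circle_max_imp_zero[where a="column j v \<bullet> column j x"])
      fix c s :: real assume cs: "c\<^sup>2 + s\<^sup>2 = 1"
      define w where "w = (\<chi> r l. if l = j then c * v $ r $ j + s * p $ r else v $ r $ l)"
      have wc: "column l w = (if l = j then c *\<^sub>R column j v + s *\<^sub>R p else column l v)" for l
        by (simp add: w_def column_def vec_eq_iff)
      have "w \<in> stiefel" using cs
        unfolding stiefel_columns wc
        by (auto simp: inner_add_left inner_add_right vc p power2_eq_square algebra_simps)
      from max[OF this] have "w \<bullet> x \<le> v \<bullet> x" .
      moreover have "w \<bullet> x = column j w \<bullet> column j x + (\<Sum>l\<in>UNIV - {j}. column l v \<bullet> column l x)"
        unfolding matrix_inner_columns by (subst sum.remove[of _ j]) (auto simp: wc intro!: sum.cong)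
      moreover have "v \<bullet> x = column j v \<bullet> column j x + (\<Sum>l\<in>UNIV - {j}. column l v \<bullet> column l x)"
        unfolding matrix_inner_columns by (subst sum.remove[of _ j]) auto
      ultimately show "column j v \<bullet> column j x * c + p \<bullet> column j x * s \<le> column j v \<bullet> column j x"
        by (simp add: wc inner_add_left algebra_simps)
    qed
    then have "p0 \<bullet> column j x = 0" using p0 by (simp add: p_def)
    moreover have "p0 \<bullet> column j x = p0 \<bullet> p0"
    proof -
      define q where "q = v *v (transpose v *v column j x)"
      have "q \<bullet> p0 = 0" unfolding q_def by (rule orth)
      moreover have "column j x = p0 + q" by (simp add: p0_def q_def)
      ultimately show ?thesis by (simp add: inner_add_right inner_commute)
    qed
    ultimately show False using p0 by simp
  qed
  then have "column j x = column j (v ** y)" for j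
    by (simp only: y_def column_mult) simp
  then have "x = v ** y" by (simp add: vec_eq_iff column_def)
  moreover have "psd y" using pos sym by (auto simp: psd_def transpose_def vec_eq_iff)
  ultimately show ?thesis using v that by (auto simp: y_def)
qed

lemma matrix_sum_columns_quadratic:
  fixes d s :: "real^'m^'m"
  shows "trace (transpose d ** s ** d) = (\<Sum>i\<in>UNIV. column i d \<bullet> (s *v column i d))"
  unfolding trace_def
proof (rule sum.cong, rule refl)
  fix i
  have "(transpose d ** (s ** d)) $ i $ i = column i d \<bullet> column i (s ** d)" by (rule column_dot)
  also have "column i (s ** d) = s *v column i d" by (rule column_mult)
  finally show "(transpose d ** s ** d) $ i $ i = column i d \<bullet> (s *v column i d)"
    by (simp add: matrix_mul_assoc)
qed

text \<open>The nonnegative quadratic form has a minimum at z, so its derivative in the direction s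
  z, which is twice the squared norm of s z, vanishes.\<close>

lemma psd_zero:
  assumes s: "psd s" and z: "z \<bullet> (s *v z) = 0"
  shows "s *v z = 0"
proof -
  have *: "0 \<le> 2 * t * (norm (s *v z))\<^sup>2 + t\<^sup>2 * ((s *v z) \<bullet> (s *v (s *v z)))" for t
  proof -
    have "0 \<le> (z + t *\<^sub>R (s *v z)) \<bullet> (s *v (z + t *\<^sub>R (s *v z)))" using s by (auto simp: psd_def)
    also have "\<dots> = 2 * t * (norm (s *v z))\<^sup>2 + t\<^sup>2 * ((s *v z) \<bullet> (s *v (s *v z)))"
    proof -
      have "z \<bullet> (s *v (s *v z)) = (s *v z) \<bullet> (s *v z)"
        using transpose_matrix_vector_dot[of z s "s *v z"] s unfolding psd_def by metis
      then show ?thesis using z unfolding power2_norm_eq_inner power2_eq_square[of t]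
        by (simp add: matrix_vector_right_distrib matrix_vector_mult_scaleR inner_add_left inner_add_right
            algebra_simps)
    qed
    finally show ?thesis .
  qed
  define a where "a = (norm (s *v z))\<^sup>2"
  define b where "b = (s *v z) \<bullet> (s *v (s *v z))"
  have b0: "b \<ge> 0" using s by (auto simp: b_def psd_def)
  \<comment> \<open>The value of t imitates the minimiser -a / b of the quadratic; the added 1 also
    covers b = 0.\<close>
  have "0 \<le> 2 * (- a / (b + 1)) * a + (- a / (b + 1))\<^sup>2 * b" using *[of "- a / (b + 1)"] by (simp add: a_def b_def)
  also have "\<dots> = - (a\<^sup>2 * (b + 2)) / (b + 1)\<^sup>2"
    using b0 by (simp add: divide_simps power2_eq_square) (simp add: algebra_simps)
  finally have "a\<^sup>2 * (b + 2) \<le> 0" using b0 by (simp add: divide_le_0_iff zero_le_divide_iff)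
  then have "a = 0" using b0 by (simp add: mult_le_0_iff)
  then show ?thesis by (simp add: a_def)
qed

text \<open>For d = s - t the hypothesis says s d = - d t, so the traces of d s d and d t d add up
  to 0. Both are sums of nonnegative terms, hence s and t annihilate every column of d, and the
  squared norm of d is the trace of d d = 0.\<close>

lemma psd_sqrt_unique:
  fixes s t :: "real^'m^'m"
  assumes s: "psd s" and t: "psd t" and eq: "s ** s = t ** t"
  shows "s = t"
proof -
  define d where "d = s - t"
  have dt: "transpose d = d" using s t by (simp add: d_def psd_def transpose_def vec_eq_iff)
  have sub: "(A - B) ** C = A ** C - B ** C" "C ** (A - B) = C ** A - C ** B" for A B C :: "real^'m^'m"
    by (simp_all add: matrix_matrix_mult_def vec_eq_iff sum_subtractf algebra_simps)
  have "s ** d + d ** t = 0" using eq by (simp add: d_def sub)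
  then have sd: "s ** d = - (d ** t)" by (simp add: eq_neg_iff_add_eq_0)
  have neg: "A ** (- B) = - (A ** B)" for A B :: "real^'m^'m"
    by (simp add: matrix_matrix_mult_def vec_eq_iff sum_negf)
  have "trace (d ** s ** d) = trace (d ** (- (d ** t)))"
    by (simp add: sd matrix_mul_assoc[symmetric])
  also have "\<dots> = - trace (d ** (d ** t))"
    by (simp add: neg trace_def sum_negf)
  also have "trace (d ** (d ** t)) = trace (d ** t ** d)" by (rule trace_mul_sym)
  finally have "trace (d ** s ** d) + trace (d ** t ** d) = 0" by simp
  then have "(\<Sum>i\<in>UNIV. column i d \<bullet> (s *v column i d)) + (\<Sum>i\<in>UNIV. column i d \<bullet> (t *v column i d)) = 0"
    by (simp flip: matrix_sum_columns_quadratic add: dt)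
  then have "(\<Sum>i\<in>UNIV. column i d \<bullet> (s *v column i d) + column i d \<bullet> (t *v column i d)) = 0"
    by (simp add: sum.distrib)
  then have *: "column i d \<bullet> (s *v column i d) + column i d \<bullet> (t *v column i d) = 0" for i
    using s t by (subst (asm) sum_nonneg_eq_0_iff) (auto simp: psd_def)
  have **: "column i d \<bullet> (s *v column i d) = 0" "column i d \<bullet> (t *v column i d) = 0" for i
    using *[of i] s t unfolding psd_def by (smt (verit))+
  have "s *v column i d = 0" "t *v column i d = 0" for i
    using psd_zero[OF s **(1)] psd_zero[OF t **(2)] by auto
  then have dd: "d *v column i d = 0" for i
    by (simp add: d_def matrix_vector_mult_diff_rdistrib)
  have "(norm d)\<^sup>2 = 0"
    using matrix_sum_columns_quadratic[of "mat 1" "d"] dd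
  proof -
    have "(norm d)\<^sup>2 = trace (d ** d)" using dt by (simp add: norm_matrix_trace)
    also have "d ** d = 0"
    proof -
      have "column i (d ** d) = 0" for i using dd[of i]
        by (simp add: column_def vec_eq_iff matrix_matrix_mult_def matrix_vector_mult_def)
      then show ?thesis by (simp add: column_def vec_eq_iff)
    qed
    finally show ?thesis by (simp add: trace_def)
  qed
  then show ?thesis by (simp add: d_def)
qed

text \<open>The polar factor g of w v' does it: the semidefinite part is the root of v w'w v' = v
  v', that is the projection v v' itself, so w v' = g v v', and multiplication by v from the right
  gives w = g v.\<close>

lemma stiefel_transitive:
  fixes v w :: "real^'m^'n"
  assumes v: "v \<in> stiefel" and w: "w \<in> stiefel"
  obtains g :: "real^'n^'n" where "g \<in> stiefel" "g ** v = w"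
proof -
  define M where "M = w ** transpose v"
  obtain g :: "real^'n^'n" where g: "g \<in> stiefel" "psd (transpose g ** M)" "M = g ** (transpose g ** M)"
    using polar_exists[of M] by auto
  define y where "y = transpose g ** M"
  have "y ** y = transpose y ** y" using g by (simp add: y_def psd_def)
  also have "\<dots> = transpose M ** M"
    using gram_mult_stiefel[OF g(1), of y y] g(3) by (simp add: y_def)
  also have "\<dots> = v ** (transpose w ** w) ** transpose v"
    by (simp add: M_def matrix_transpose_mul matrix_mul_assoc)
  also have "\<dots> = v ** transpose v" using w by (simp add: stiefelD)
  also have "\<dots> = v ** (transpose v ** v) ** transpose v" using v by (simp add: stiefelD)
  also have "\<dots> = (v ** transpose v) ** (v ** transpose v)" by (simp add: matrix_mul_assoc)
  finally have "y = v ** transpose v"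
  proof (rule psd_sqrt_unique[rotated 2])
    show "psd y" using g(2) by (simp add: y_def)
    have "0 \<le> z \<bullet> ((v ** transpose v) *v z)" for z
      using gram_quadratic[of z "transpose v"] by simp
    then show "psd (v ** transpose v)" by (simp add: psd_def matrix_transpose_mul)
  qed
  then have "M ** v = g ** (v ** transpose v) ** v" using g(3) by (simp add: y_def)
  then have "w ** (transpose v ** v) = g ** v ** (transpose v ** v)"
    by (simp add: M_def matrix_mul_assoc)
  then show ?thesis using v g that by (simp add: stiefelD)
qed

section \<open>Gram determinants and uniqueness of the polar part\<close>

definition gram_det :: "real^'m^'n \<Rightarrow> real" where
  "gram_det x = det (transpose x ** x)"

text \<open>x'x and x have the same kernel, because z'x'xz is the squared norm of xz.\<close>

lemma gram_det_iff_inj: "gram_det (x::real^'m^'n) \<noteq> 0 \<longleftrightarrow> inj ((*v) x)"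
proof -
  have "inj ((*v) (transpose x ** x)) \<longleftrightarrow> inj ((*v) x)"
  proof -
    have "(transpose x ** x) *v z = 0 \<longleftrightarrow> x *v z = 0" for z
      using gram_quadratic[of z x] by (auto simp: matrix_vector_mul_assoc[symmetric])
    then show ?thesis
      using matrix_left_invertible_injective[of x] matrix_left_invertible_injective[of "transpose x ** x"]
        matrix_left_invertible_ker[of x] matrix_left_invertible_ker[of "transpose x ** x"] by auto
  qed
  then show ?thesis unfolding gram_det_def
    using det_nz_iff_inj[of "(*v) (transpose x ** x)"] by (simp)
qed

lemma rank_eq_iff_gram_det: "rank (x::real^'m^'n) = CARD('m) \<longleftrightarrow> gram_det x \<noteq> 0"
  by (simp add: gram_det_iff_inj full_rank_injective)

lemma gram_det_mult_left: "(g::real^'k^'n) \<in> stiefel \<Longrightarrow> gram_det (g ** x) = gram_det (x::real^'m^'k)"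
  by (simp add: gram_det_def gram_mult_stiefel)

lemma gram_det_mult_right: "gram_det ((x::real^'m^'n) ** A) = (det A)\<^sup>2 * gram_det x"
proof -
  have "transpose (x ** A) ** (x ** A) = transpose A ** ((transpose x ** x) ** A)"
    by (simp add: matrix_transpose_mul matrix_mul_assoc)
  then show ?thesis
    by (simp only: gram_det_def det_mul det_transpose power2_eq_square) (simp add: mult_ac)
qed

lemma gram_det_square: "gram_det (y::real^'m^'m) = (det y)\<^sup>2"
  by (simp add: gram_det_def det_mul power2_eq_square)

lemma gram_det_stiefel: "v \<in> stiefel \<Longrightarrow> gram_det v = 1"
  by (simp add: gram_det_def stiefelD)

lemma gram_det_nonneg: "gram_det (x::real^'m^'n) \<ge> 0"
proof (cases "gram_det x = 0")
  case False
  then have "CARD('m) \<le> CARD('n)" using rank_eq_iff_gram_det[of x] rank_bound[of x] by simp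
  then obtain v where v: "v \<in> stiefel" "psd (transpose v ** x)" "x = v ** (transpose v ** x)"
    by (rule polar_exists)
  have "gram_det x = gram_det (transpose v ** x)"
    by (subst v(3)) (rule gram_det_mult_left[OF v(1)])
  then show ?thesis by (simp add: gram_det_square)
qed simp

lemma posdef_imp_psd: "posdef s \<Longrightarrow> psd s"
  unfolding posdef_def psd_def by (metis inner_zero_left less_eq_real_def)

lemma psd_imp_posdef:
  assumes "psd s" "det s \<noteq> 0" shows "posdef s"
proof -
  have "z \<bullet> (s *v z) > 0" if "z \<noteq> 0" for z
  proof (rule ccontr)
    assume "\<not> ?thesis"
    then have "z \<bullet> (s *v z) = 0" using assms(1) by (auto simp: psd_def intro: antisym)
    then have "s *v z = 0" using psd_zero assms by blast
    with that assms(2) show False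
      using det_nz_iff_inj[of "(*v) s"] by (auto dest!: injD[where y=0 and x=z])
  qed
  then show ?thesis using assms by (auto simp: posdef_def psd_def)
qed

text \<open>Semidefiniteness of v'x is what \<open>polar_exists\<close> supplies. Full rank makes
  det (v'x) nonzero and thus v'x definite; it is the only semidefinite root of x'x and, being
  invertible, can be cancelled from two competing factorisations.\<close>

lemma polar_part_unique:
  assumes x: "gram_det (x::real^'m^'n) \<noteq> 0" and v: "v \<in> stiefel" and p: "psd (transpose v ** x)"
    and xv: "x = v ** (transpose v ** x)"
  shows "polar_part x = v"
  unfolding polar_part_def
proof (rule the_equality)
  define y where "y = transpose v ** x"
  have yy: "y ** y = transpose x ** x"
    using gram_mult_stiefel[OF v, of y y] p xv unfolding y_def psd_def by metis
  have xvy: "x = v ** y" unfolding y_def by (rule xv)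
  have "gram_det x = det y * det y" unfolding gram_det_def yy[symmetric] by (rule det_mul)
  then have "det y \<noteq> 0" using x by auto
  then have "posdef y" using p psd_imp_posdef by (auto simp: y_def)
  then show "v \<in> stiefel \<and> (\<exists>s. posdef s \<and> s ** s = transpose x ** x \<and> x = v ** s)"
    using v yy xvy by blast
  fix w assume "w \<in> stiefel \<and> (\<exists>s. posdef s \<and> s ** s = transpose x ** x \<and> x = w ** s)"
  then obtain s where w: "w \<in> stiefel" "posdef s" "s ** s = transpose x ** x" "x = w ** s" by auto
  have "s = y"
  proof (rule psd_sqrt_unique)
    show "psd s" by (rule posdef_imp_psd[OF w(2)])
    show "psd y" unfolding y_def by (rule p)
    show "s ** s = y ** y" unfolding yy by (rule w(3))
  qed
  have "w ** y = v ** y" using w(4) xvy unfolding \<open>s = y\<close> by metis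
  moreover have "invertible y" using \<open>det y \<noteq> 0\<close> by (simp add: invertible_det_nz)
  ultimately show "w = v"
    by (metis invertible_right_inverse matrix_mul_assoc matrix_mul_rid)
qed

lemma polar_part:
  assumes x: "gram_det (x::real^'m^'n) \<noteq> 0"
  shows "polar_part x \<in> stiefel" "psd (transpose (polar_part x) ** x)"
    "x = polar_part x ** (transpose (polar_part x) ** x)"
proof -
  have "CARD('m) \<le> CARD('n)" using rank_eq_iff_gram_det[of x] rank_bound[of x] x by simp
  then obtain v where v: "v \<in> stiefel" "psd (transpose v ** x)" "x = v ** (transpose v ** x)"
    by (rule polar_exists)
  with polar_part_unique[OF x v] show "polar_part x \<in> stiefel" "psd (transpose (polar_part x) ** x)"
    "x = polar_part x ** (transpose (polar_part x) ** x)" by auto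
qed

lemma polar_part_mult_left:
  assumes x: "gram_det (x::real^'m^'k) \<noteq> 0" and g: "(g::real^'k^'n) \<in> stiefel"
  shows "polar_part (g ** x) = g ** polar_part x"
proof (rule polar_part_unique)
  show "gram_det (g ** x) \<noteq> 0" using x by (simp add: gram_det_mult_left g)
  show "g ** polar_part x \<in> stiefel" by (intro stiefel_mult g polar_part x)
  show "psd (transpose (g ** polar_part x) ** (g ** x))"
    using polar_part(2)[OF x] by (simp add: gram_mult_stiefel g)
  show "g ** x = g ** polar_part x ** (transpose (g ** polar_part x) ** (g ** x))"
    using polar_part(3)[OF x] by (simp add: gram_mult_stiefel g matrix_mul_assoc[symmetric])
qed

lemma polar_part_mult_right:
  assumes x: "gram_det (x::real^'m^'n) \<noteq> 0" and g: "(g::real^'m^'m) \<in> stiefel"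
  shows "polar_part (x ** g) = polar_part x ** g"
proof (rule polar_part_unique)
  note p = polar_part[OF x]
  have dg: "det g \<noteq> 0" using g gram_det_stiefel[OF g] by (auto simp: gram_det_square)
  show "gram_det (x ** g) \<noteq> 0" using x dg by (simp add: gram_det_mult_right)
  show "polar_part x ** g \<in> stiefel" by (intro stiefel_mult g p)
  have eq: "transpose (polar_part x ** g) ** (x ** g) = transpose g ** (transpose (polar_part x) ** x) ** g"
    by (simp add: matrix_transpose_mul matrix_mul_assoc)
  show "psd (transpose (polar_part x ** g) ** (x ** g))"
    unfolding eq psd_def
  proof (intro conjI allI)
    have "transpose (transpose (polar_part x) ** x) = transpose (polar_part x) ** x"
      using p(2) by (simp add: psd_def)
    then show "transpose (transpose g ** (transpose (polar_part x) ** x) ** g) =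
        transpose g ** (transpose (polar_part x) ** x) ** g"
      by (metis matrix_transpose_mul matrix_mul_assoc transpose_transpose)
    fix z
    show "0 \<le> z \<bullet> ((transpose g ** (transpose (polar_part x) ** x) ** g) *v z)"
      using p(2) by (simp only: matrix_vector_mul_assoc[symmetric] transpose_matrix_vector_dot[of _ g] psd_def)
  qed
  show "x ** g = polar_part x ** g ** (transpose (polar_part x ** g) ** (x ** g))"
    using p(3) stiefel_square_right[OF g] unfolding eq
    by (metis matrix_mul_assoc matrix_mul_rid)
qed

lemma continuous_gram_det [continuous_intros]:
  "continuous_on S f \<Longrightarrow> continuous_on S (\<lambda>x. gram_det (f x :: real^'m^'n))"
  unfolding gram_det_def by (intro continuous_intros)

lemma borel_measurable_gram_det [measurable]: "gram_det \<in> borel_measurable borel"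
  by (intro borel_measurable_continuous_onI continuous_intros)

text \<open>Among matrices of full rank, the preimage of a closed set C is the projection of a
  closed set of pairs (v, x) along the compact Stiefel manifold, hence relatively closed. The
  constant c fills in the matrices of smaller rank.\<close>

lemma measurable_polar_part:
  "(\<lambda>x::real^'m^'n. if gram_det x \<noteq> 0 then polar_part x else c) \<in> borel_measurable borel"
proof (rule borel_measurableI)
  fix S :: "(real^'m^'n) set" assume S: "open S"
  define C where "C = - S"
  have C: "closed C" using S by (simp add: C_def closed_def)
  define T where "T = {p::(real^'m^'n) \<times> (real^'m^'n). transpose (transpose (fst p) ** snd p) = transpose (fst p) ** snd p
     \<and> (\<forall>z. 0 \<le> z \<bullet> ((transpose (fst p) ** snd p) *v z)) \<and> snd p = fst p ** (transpose (fst p) ** snd p)}"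
  have "closed T" unfolding T_def
    by (intro closed_Collect_conj closed_Collect_all closed_Collect_le closed_Collect_eq continuous_intros)
  have cl: "closed {y. \<exists>x. x \<in> stiefel \<inter> C \<and> (x, y) \<in> T}"
    by (rule closed_compact_projection[OF _ \<open>closed T\<close>]) (intro compact_Int_closed compact_stiefel C)
  have eq: "(\<lambda>x. if gram_det x \<noteq> 0 then polar_part x else c) -` C =
     ({x. gram_det x \<noteq> 0} \<inter> {y. \<exists>x. x \<in> stiefel \<inter> C \<and> (x, y) \<in> T}) \<union> (if c \<in> C then {x. gram_det x = 0} else {})"
  proof -
    have "polar_part y \<in> C \<longleftrightarrow> (\<exists>x. x \<in> stiefel \<inter> C \<and> (x, y) \<in> T)" if "gram_det y \<noteq> 0" for y
    proof -
      have T: "(x, y) \<in> T \<longleftrightarrow> psd (transpose x ** y) \<and> y = x ** (transpose x ** y)" for x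
        unfolding T_def psd_def by simp
      have "x = polar_part y" if "x \<in> stiefel" "(x, y) \<in> T" for x
        using polar_part_unique[OF \<open>gram_det y \<noteq> 0\<close> that(1)] that(2) T by metis
      moreover have "(polar_part y, y) \<in> T" "polar_part y \<in> stiefel"
        using polar_part[OF that] T by metis+
      ultimately show ?thesis by (metis IntE IntI)
    qed
    then show ?thesis by (simp add: set_eq_iff)
  qed
  have o: "{x::real^'m^'n. gram_det x \<noteq> 0} \<in> sets borel" "{x::real^'m^'n. gram_det x = 0} \<in> sets borel"
    by measurable
  let ?f = "\<lambda>x::real^'m^'n. if gram_det x \<noteq> 0 then polar_part x else c"
  have C1: "?f -` C \<in> sets borel"
    unfolding eq by (intro sets.Un sets.Int o borel_closed[OF cl]) (simp add: o)
  have C2: "?f -` S = - (?f -` C)" by (simp only: C_def vimage_Compl double_compl)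
  have "?f -` S \<in> sets borel" unfolding C2 by (rule borel_comp[OF C1])
  then show "?f -` S \<inter> space borel \<in> sets borel" by (simp only: space_borel Int_UNIV_right)
qed

section \<open>Lebesgue measure on matrix spaces\<close>

text \<open>Such a map only relabels coordinates, so it carries boxes to boxes with the same side
  lengths. It serves for transposition, for permutations of coordinates and for stacking two
  blocks.\<close>

lemma lborel_distr_basis_map:
  fixes f :: "'a::euclidean_space \<Rightarrow> 'b::euclidean_space"
  assumes f: "linear f" and bij: "bij_betw f Basis Basis"
  shows "distr lborel borel f = lborel"
proof (rule lborel_eqI[symmetric])
  have [measurable]: "f \<in> borel_measurable borel"
    by (rule borel_measurable_continuous_onI) (rule linear_continuous_on, simp add: f linear_linear)
  have ortho: "f x \<bullet> f b = x \<bullet> b" if b: "b \<in> Basis" for x b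
  proof -
    have "f x = (\<Sum>c\<in>Basis. (x \<bullet> c) *\<^sub>R f c)"
      by (subst euclidean_representation[symmetric, of x]) (simp add: linear_sum[OF f] linear_scale[OF f])
    then have "f x \<bullet> f b = (\<Sum>c\<in>Basis. (x \<bullet> c) * (f c \<bullet> f b))" by (simp add: inner_sum_left)
    also have "\<dots> = (\<Sum>c\<in>Basis. (x \<bullet> c) * (if c = b then 1 else 0))"
    proof (intro sum.cong refl arg_cong2[where f="(*)"])
      fix c :: 'a assume c: "c \<in> Basis"
      have "f c = f b \<longleftrightarrow> c = b" using bij b c by (metis bij_betw_def inj_on_eq_iff)
      then show "f c \<bullet> f b = (if c = b then 1 else 0)"
        using bij_betwE[OF bij] b c by (simp add: inner_Basis)
    qed
    also have "\<dots> = x \<bullet> b" using b by (simp add: if_distrib cong: if_cong)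
    finally show ?thesis .
  qed
  fix l u :: 'b assume le: "\<And>b. b \<in> Basis \<Longrightarrow> l \<bullet> b \<le> u \<bullet> b"
  define l' where "l' = (\<Sum>b\<in>Basis. (l \<bullet> f b) *\<^sub>R b)"
  define u' where "u' = (\<Sum>b\<in>Basis. (u \<bullet> f b) *\<^sub>R b)"
  have lu: "b \<in> Basis \<Longrightarrow> l' \<bullet> b = l \<bullet> f b" "b \<in> Basis \<Longrightarrow> u' \<bullet> b = u \<bullet> f b" for b
    by (simp_all add: l'_def u'_def)
  have fB: "f ` Basis = Basis" using bij by (simp add: bij_betw_def)
  have "f -` box l u = box l' u'"
  proof -
    have "(\<forall>c\<in>Basis. l \<bullet> c < f x \<bullet> c \<and> f x \<bullet> c < u \<bullet> c) \<longleftrightarrow> (\<forall>b\<in>Basis. l' \<bullet> b < x \<bullet> b \<and> x \<bullet> b < u' \<bullet> b)" for x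
      by (subst fB[symmetric]) (simp add: ortho lu)
    then show ?thesis by (auto simp: box_def)
  qed
  then have "emeasure (distr lborel borel f) (box l u) = emeasure lborel (box l' u')"
    by (simp add: emeasure_distr)
  also have "\<dots> = (\<Prod>b\<in>Basis. (u' - l') \<bullet> b)"
    using le fB by (intro emeasure_lborel_box) (auto simp: lu)
  also have "(\<Prod>b\<in>Basis. (u' - l') \<bullet> b) = (\<Prod>b\<in>Basis. (u - l) \<bullet> f b)"
    by (intro prod.cong) (auto simp: lu inner_diff_left)
  also have "\<dots> = (\<Prod>b\<in>Basis. (u - l) \<bullet> b)"
    using bij by (rule prod.reindex_bij_betw)
  finally show "emeasure (distr lborel borel f) (box l u) = (\<Prod>b\<in>Basis. (u - l) \<bullet> b)" .
qed simp

lemma Basis_matrix: "(Basis :: (real^'m^'n) set) = (\<lambda>(i, j). axis i (axis j 1)) ` UNIV"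
  by (auto simp: Basis_vec_def)

lemma bij_betw_transpose_Basis: "bij_betw transpose (Basis :: (real^'m^'n) set) Basis"
proof (rule bij_betw_imageI)
  show "inj_on transpose (Basis :: (real^'m^'n) set)" by (metis inj_onI transpose_transpose)
  have t: "transpose (axis i (axis j 1) :: real^'k^'l) = axis j (axis i 1)" for i j
    by (auto simp: transpose_def axis_def vec_eq_iff)
  show "transpose ` (Basis :: (real^'m^'n) set) = Basis"
    unfolding Basis_matrix image_image case_prod_unfold t by (force simp: image_iff)
qed

lemma linear_transpose: "linear (transpose :: real^'m^'n \<Rightarrow> real^'n^'m)"
  by (rule linearI) (auto simp: transpose_def vec_eq_iff)

lemma borel_measurable_transpose [measurable]: "(transpose :: real^'m^'n \<Rightarrow> _) \<in> borel_measurable borel"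
  by (intro borel_measurable_continuous_onI continuous_intros)

lemma nn_integral_transpose:
  fixes F :: "real^'m^'n \<Rightarrow> ennreal"
  assumes [measurable]: "F \<in> borel_measurable borel"
  shows "(\<integral>\<^sup>+x. F (transpose x) \<partial>lborel) = (\<integral>\<^sup>+x. F x \<partial>lborel)"
proof -
  have "(\<integral>\<^sup>+x. F x \<partial>lborel) = (\<integral>\<^sup>+x. F x \<partial>distr lborel borel transpose)"
    by (simp add: lborel_distr_basis_map linear_transpose bij_betw_transpose_Basis)
  then show ?thesis by (simp add: nn_integral_distr)
qed

lemma measurable_vec_lambda_PiM:
  "(vec_lambda :: ('n::finite \<Rightarrow> 'a::euclidean_space) \<Rightarrow> 'a^'n) \<in> (\<Pi>\<^sub>M i\<in>UNIV. lborel) \<rightarrow>\<^sub>M borel"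
proof (subst borel_measurable_euclidean_space, intro ballI)
  fix b :: "'a^'n" assume "b \<in> Basis"
  then obtain i c where b: "b = axis i c" by (auto simp: Basis_vec_def)
  have "(\<lambda>f::'n \<Rightarrow> 'a. f i \<bullet> c) \<in> (\<Pi>\<^sub>M i\<in>UNIV. lborel) \<rightarrow>\<^sub>M borel"
    by measurable
  then show "(\<lambda>f. vec_lambda f \<bullet> b) \<in> borel_measurable (\<Pi>\<^sub>M i\<in>UNIV. lborel)"
    by (simp add: b inner_axis)
qed

lemma vec_box_borel:
  fixes T :: "'n::finite \<Rightarrow> 'a::euclidean_space set"
  assumes "\<And>i. T i \<in> sets borel"
  shows "{x::'a^'n. \<forall>i. x $ i \<in> T i} \<in> sets borel"
proof -
  have "{x::'a^'n. \<forall>i. x $ i \<in> T i} = (\<Inter>i. (\<lambda>x. x $ i) -` T i \<inter> space borel)" by auto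
  moreover have "(\<lambda>x::'a^'n. x $ i) -` T i \<inter> space borel \<in> sets borel" for i
    using assms by (intro measurable_sets[OF borel_measurable_continuous_onI]) (auto intro!: continuous_intros)
  ultimately show ?thesis by (simp add: sets.finite_INT)
qed

lemma emeasure_PiM_vec_box:
  fixes T :: "'n::finite \<Rightarrow> 'a::euclidean_space set"
  assumes T: "\<And>i. T i \<in> sets borel"
  shows "emeasure (distr (\<Pi>\<^sub>M i\<in>UNIV. lborel) borel vec_lambda) {x::'a^'n. \<forall>i. x $ i \<in> T i}
    = (\<Prod>i\<in>UNIV. emeasure lborel (T i))"
proof -
  interpret product_sigma_finite "\<lambda>i::'n. lborel :: 'a measure" by standard
  have pre: "vec_lambda -` {x::'a^'n. \<forall>i. x $ i \<in> T i} \<inter> space (\<Pi>\<^sub>M i\<in>UNIV. lborel) = Pi\<^sub>E UNIV T"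
    by (auto simp: space_PiM)
  have "emeasure (distr (\<Pi>\<^sub>M i\<in>UNIV. lborel) borel vec_lambda) {x::'a^'n. \<forall>i. x $ i \<in> T i}
     = emeasure (\<Pi>\<^sub>M i\<in>UNIV. lborel) (vec_lambda -` {x::'a^'n. \<forall>i. x $ i \<in> T i} \<inter> space (\<Pi>\<^sub>M i\<in>UNIV. lborel))"
    using T by (intro emeasure_distr measurable_vec_lambda_PiM vec_box_borel)
  also have "\<dots> = (\<Prod>i\<in>UNIV. emeasure lborel (T i))"
    unfolding pre using T by (intro emeasure_PiM) auto
  finally show ?thesis .
qed

text \<open>Open boxes are products of boxes in the components, and Lebesgue measure is determined
  by them. For matrices this allows integration row by row.\<close>

lemma lborel_vec_eq:
  "lborel = distr (\<Pi>\<^sub>M i\<in>UNIV. lborel) borel (vec_lambda :: ('n::finite \<Rightarrow> 'a::euclidean_space) \<Rightarrow> 'a^'n)"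
proof (rule lborel_eqI)
  fix l u :: "'a^'n" assume le: "\<And>b. b \<in> Basis \<Longrightarrow> l \<bullet> b \<le> u \<bullet> b"
  have le': "l $ i \<bullet> b \<le> u $ i \<bullet> b" if "b \<in> Basis" for i b
    using le[of "axis i b"] that by (simp add: inner_axis)
  have bx: "box l u = {x. \<forall>i. x $ i \<in> box (l $ i) (u $ i)}"
    by (auto simp: box_def Basis_vec_def inner_axis)
  have "emeasure (distr (\<Pi>\<^sub>M i\<in>UNIV. lborel) borel vec_lambda) (box l u) =
      (\<Prod>i\<in>UNIV. \<Prod>b\<in>Basis. (u $ i - l $ i) \<bullet> b)"
    unfolding bx using le'
    by (subst emeasure_PiM_vec_box) (auto simp: emeasure_lborel_box prod_ennreal prod_nonneg inner_diff_left)
  also have "(\<Prod>i\<in>UNIV. \<Prod>b\<in>Basis. (u $ i - l $ i) \<bullet> b) = (\<Prod>b\<in>Basis. (u - l) \<bullet> b)"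
  proof -
    have inj: "inj_on (\<lambda>(i, b). axis i b) (UNIV \<times> (Basis::'a set))"
      by (auto simp: inj_on_def axis_eq_axis nonzero_Basis)
    have "(Basis :: ('a^'n) set) = (\<lambda>(i, b). axis i b) ` (UNIV \<times> Basis)" by (auto simp: Basis_vec_def)
    then have "(\<Prod>b\<in>Basis. (u - l) \<bullet> b) = (\<Prod>(i,b)\<in>UNIV \<times> Basis. (u - l) \<bullet> axis i b)"
      using prod.reindex[OF inj, of "\<lambda>b. (u - l) \<bullet> b"] by (simp add: case_prod_unfold o_def)
    then show ?thesis by (simp add: prod.cartesian_product inner_axis)
  qed
  finally show "emeasure (distr (\<Pi>\<^sub>M i\<in>UNIV. lborel) borel vec_lambda) (box l u) = (\<Prod>b\<in>Basis. (u - l) \<bullet> b)" .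
qed simp

lemma emeasure_lborel_vec_box:
  fixes S :: "'n::finite \<Rightarrow> 'a::euclidean_space set"
  assumes S: "\<And>i. S i \<in> sets borel"
  shows "emeasure lborel {x::'a^'n. \<forall>i. x $ i \<in> S i} = (\<Prod>i\<in>UNIV. emeasure lborel (S i))"
  unfolding lborel_vec_eq[where 'n='n and 'a='a] by (rule emeasure_PiM_vec_box[OF S])

section \<open>Linear substitutions in integrals over vectors and matrices\<close>

lemma borel_measurable_matrix_vector_mult [measurable]: "(*v) (A::real^'m^'n) \<in> borel_measurable borel"
  by (intro borel_measurable_continuous_onI continuous_intros)

text \<open>With coordinate i integrated first, the shear is a translation of that coordinate by
  \<open>c * x $ j\<close>, which does not change while x_i varies.\<close>

lemma nn_integral_shear:
  fixes F :: "real^'m \<Rightarrow> ennreal"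
  assumes F[measurable]: "F \<in> borel_measurable borel" and ij: "i \<noteq> j"
  shows "(\<integral>\<^sup>+x. F (x + (c * x $ j) *\<^sub>R axis i 1) \<partial>lborel) = (\<integral>\<^sup>+x. F x \<partial>lborel)"
proof -
  interpret product_sigma_finite "\<lambda>i::'m. lborel :: real measure" by standard
  note measurable_vec_lambda_PiM[where 'a=real and 'n='m, measurable]
  define I where "I = UNIV - {i}"
  have I: "finite I" "i \<notin> I" "insert i I = UNIV" by (auto simp: I_def)
  have split: "(\<integral>\<^sup>+x. G x \<partial>lborel) = (\<integral>\<^sup>+x. (\<integral>\<^sup>+y. G (vec_lambda (x(i := y))) \<partial>lborel) \<partial>(\<Pi>\<^sub>M i\<in>I. lborel))"
    if G[measurable]: "G \<in> borel_measurable borel" for G :: "real^'m \<Rightarrow> ennreal"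
  proof -
    have "(\<integral>\<^sup>+x. G x \<partial>lborel) = (\<integral>\<^sup>+x. G (vec_lambda x) \<partial>(\<Pi>\<^sub>M i\<in>UNIV. lborel))"
      by (subst lborel_vec_eq) (simp add: nn_integral_distr)
    also have "\<dots> = (\<integral>\<^sup>+x. (\<integral>\<^sup>+y. G (vec_lambda (x(i := y))) \<partial>lborel) \<partial>(\<Pi>\<^sub>M i\<in>I. lborel))"
      unfolding I(3)[symmetric] using I(1,2) by (rule product_nn_integral_insert) (simp add: I(3))
    finally show ?thesis .
  qed
  have [measurable]: "(\<lambda>x. x + (c * x $ j) *\<^sub>R axis i 1 :: real^'m) \<in> borel_measurable borel"
    by (intro borel_measurable_continuous_onI continuous_intros)
  have upd: "vec_lambda (x(i := y)) + (c * vec_lambda (x(i := y)) $ j) *\<^sub>R axis i 1 = (vec_lambda (x(i := c * x j + y)) :: real^'m)"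
    for x :: "'m \<Rightarrow> real" and y using ij by (auto simp: vec_eq_iff axis_def)
  have "(\<integral>\<^sup>+x. F (x + (c * x $ j) *\<^sub>R axis i 1) \<partial>lborel)
    = (\<integral>\<^sup>+x. (\<integral>\<^sup>+y. F (vec_lambda (x(i := c * x j + y))) \<partial>lborel) \<partial>(\<Pi>\<^sub>M i\<in>I. lborel))"
    by (subst split) (simp_all only: upd, measurable)
  also have "\<dots> = (\<integral>\<^sup>+x. (\<integral>\<^sup>+y. F (vec_lambda (x(i := y))) \<partial>lborel) \<partial>(\<Pi>\<^sub>M i\<in>I. lborel))"
  proof (rule nn_integral_cong)
    fix x assume x: "x \<in> space (\<Pi>\<^sub>M i\<in>I. lborel :: real measure)"
    have "(\<lambda>y. x(i := y)) \<in> lborel \<rightarrow>\<^sub>M (\<Pi>\<^sub>M i\<in>insert i I. lborel)"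
      using measurable_component_update[OF x I(2)] by simp
    then have [measurable]: "(\<lambda>y. F (vec_lambda (x(i := y)))) \<in> borel_measurable borel"
      using measurable_compose[of "\<lambda>y. x(i := y)" lborel _ "\<lambda>f. F (vec_lambda f)" borel] unfolding I(3) by simp
    have "(\<integral>\<^sup>+y. F (vec_lambda (x(i := y))) \<partial>lborel) = (\<integral>\<^sup>+y. F (vec_lambda (x(i := y))) \<partial>distr lborel borel ((+) (c * x j)))"
      by (simp add: lborel_distr_plus)
    also have "\<dots> = (\<integral>\<^sup>+y. F (vec_lambda (x(i := c * x j + y))) \<partial>lborel)"
      by (subst nn_integral_distr) auto
    finally show "(\<integral>\<^sup>+y. F (vec_lambda (x(i := c * x j + y))) \<partial>lborel) = (\<integral>\<^sup>+y. F (vec_lambda (x(i := y))) \<partial>lborel)" by simp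
  qed
  also have "\<dots> = (\<integral>\<^sup>+x. F x \<partial>lborel)" by (rule split[symmetric]) fact
  finally show ?thesis .
qed

text \<open>The formula is multiplicative in A, so elementary matrices suffice: diagonal ones scale
  the coordinates, swaps permute the standard basis, and the remaining ones are shears.\<close>

lemma nn_integral_matrix_vector_mult:
  fixes A :: "real^'m^'m"
  assumes "det A \<noteq> 0" "F \<in> borel_measurable borel"
  shows "ennreal \<bar>det A\<bar> * (\<integral>\<^sup>+x. F (A *v x) \<partial>lborel) = (\<integral>\<^sup>+x. F x \<partial>lborel)"
proof -
  have "det A \<noteq> 0 \<longrightarrow> (\<forall>F\<in>borel_measurable borel. ennreal \<bar>det A\<bar> * (\<integral>\<^sup>+x. F (A *v x) \<partial>lborel) = (\<integral>\<^sup>+x. F x \<partial>lborel))"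
  proof (induction A rule: induct_matrix_elementary)
    case (1 A B)
    show ?case
    proof (intro impI ballI)
      fix F :: "real^'m \<Rightarrow> ennreal" assume F[measurable]: "F \<in> borel_measurable borel" and d: "det (A ** B) \<noteq> 0"
      then have d: "det A \<noteq> 0" "det B \<noteq> 0" by (auto simp: det_mul)
      have "ennreal \<bar>det B\<bar> * (\<integral>\<^sup>+x. F (A *v (B *v x)) \<partial>lborel) = (\<integral>\<^sup>+x. F (A *v x) \<partial>lborel)"
        using 1(2) d by (rule_tac bspec[where x="\<lambda>x. F (A *v x)"]) auto
      moreover have "ennreal \<bar>det A\<bar> * (\<integral>\<^sup>+x. F (A *v x) \<partial>lborel) = (\<integral>\<^sup>+x. F x \<partial>lborel)"
        using 1(1) d F by auto
      ultimately show "ennreal \<bar>det (A ** B)\<bar> * (\<integral>\<^sup>+x. F ((A ** B) *v x) \<partial>lborel) = (\<integral>\<^sup>+x. F x \<partial>lborel)"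
        by (simp add: det_mul abs_mult ennreal_mult matrix_vector_mul_assoc[symmetric] mult.assoc)
    qed
  next
    \<comment> \<open>A zero row makes the determinant 0, so the implication is vacuous.\<close>
    case (2 A i)
    then show ?case using det_zero_row(2)[of i A] by (simp add: row_def vec_eq_iff)
  next
    case (3 A)
    show ?case
    proof (intro impI ballI)
      fix F :: "real^'m \<Rightarrow> ennreal" assume F[measurable]: "F \<in> borel_measurable borel" and d: "det A \<noteq> 0"
      have dA: "det A = (\<Prod>i\<in>UNIV. A $ i $ i)" by (rule det_diagonal[OF 3])
      then have nz: "A $ i $ i \<noteq> 0" for i using d by simp
      define c where "c b = A $ axis_index b $ axis_index b" for b :: "real^'m"
      have B: "(Basis :: (real^'m) set) = (\<lambda>i. axis i 1) ` UNIV" by (auto simp: Basis_vec_def)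
      have inj: "inj (\<lambda>i. axis i 1 :: real^'m)" by (auto simp: inj_on_def axis_eq_axis)
      have Ax: "A *v x = (\<Sum>b\<in>Basis. (c b * (x \<bullet> b)) *\<^sub>R b)" for x
      proof -
        have "(A *v x) $ i = A $ i $ i * x $ i" for i
          using 3[of i] by (simp add: matrix_vector_mult_def) (subst sum.remove[of _ i], auto)
        moreover have "(\<Sum>b\<in>Basis. (c b * (x \<bullet> b)) *\<^sub>R b) $ i = A $ i $ i * x $ i" for i
        proof -
          have ax: "axis k (1::real) $ i = (if k = i then 1 else 0)" for k :: 'm by (simp add: axis_def)
          show ?thesis
            unfolding B by (subst sum.reindex[OF inj]) (simp add: c_def inner_axis ax if_distrib cong: if_cong)
        qed
        ultimately show ?thesis by (simp add: vec_eq_iff)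
      qed
      have cp: "(\<Prod>b\<in>Basis. \<bar>c b\<bar>) = \<bar>det A\<bar>"
        unfolding B by (subst prod.reindex[OF inj]) (simp add: c_def dA abs_prod)
      have "(lborel :: (real^'m) measure) = density (distr lborel borel ((*v) A)) (\<lambda>_. \<bar>det A\<bar>)"
        using lborel_affine_euclidean[of c 0] nz unfolding cp Ax[symmetric] by (auto simp: c_def)
      then have "(\<integral>\<^sup>+x. F x \<partial>lborel) = (\<integral>\<^sup>+x. F x \<partial>density (distr lborel borel ((*v) A)) (\<lambda>_. \<bar>det A\<bar>))" by simp
      also have "\<dots> = ennreal \<bar>det A\<bar> * (\<integral>\<^sup>+x. F (A *v x) \<partial>lborel)"
        by (subst nn_integral_density) (auto simp: nn_integral_distr nn_integral_cmult)
      finally show "ennreal \<bar>det A\<bar> * (\<integral>\<^sup>+x. F (A *v x) \<partial>lborel) = (\<integral>\<^sup>+x. F x \<partial>lborel)" by simp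
    qed
  next
    case (4 m n)
    define S :: "real^'m^'m" where "S = (\<chi> i j. mat 1 $ i $ Transposition.transpose m n j)"
    have Sx: "S *v x = (\<chi> i. x $ Transposition.transpose m n i)" for x
    proof -
      have "(S *v x) $ i = (\<Sum>j\<in>UNIV. if j = Transposition.transpose m n i then x $ j else 0)" for i
      proof -
        have "i = Transposition.transpose m n j \<longleftrightarrow> j = Transposition.transpose m n i" for j
          by (metis transpose_involutory)
        then show ?thesis unfolding S_def matrix_vector_mult_def mat_def
          by (simp add: if_distrib[where f="\<lambda>z. z * _"] cong: if_cong)
      qed
      then show ?thesis by (simp add: vec_eq_iff)
    qed
    have "S ** S = mat 1"
      by (simp add: matrix_eq matrix_vector_mul_assoc[symmetric] Sx vec_eq_iff)
    then have "det S * det S = 1" by (metis det_I det_mul)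
    then have dS: "\<bar>det S\<bar> = 1" by (auto simp: square_eq_1_iff)
    have axis: "S *v axis i 1 = axis (Transposition.transpose m n i) 1" for i
      by (auto simp: Sx vec_eq_iff axis_def)
    have "bij_betw ((*v) S) Basis Basis"
    proof (rule bij_betw_byWitness[where f'="(*v) S"])
      show "\<forall>a\<in>Basis. S *v (S *v a) = a" "\<forall>a'\<in>Basis. S *v (S *v a') = a'"
        using \<open>S ** S = mat 1\<close> by (simp_all add: matrix_vector_mul_assoc)
      show "(*v) S ` Basis \<subseteq> Basis" "(*v) S ` Basis \<subseteq> Basis"
        by (auto simp: Basis_vec_def axis)
    qed
    then have D: "distr lborel borel ((*v) S) = lborel" by (intro lborel_distr_basis_map) auto
    have "(\<integral>\<^sup>+x. F (S *v x) \<partial>lborel) = (\<integral>\<^sup>+x. F x \<partial>lborel)" if "F \<in> borel_measurable borel" for F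
    proof -
      have "(\<integral>\<^sup>+x. F x \<partial>distr lborel borel ((*v) S)) = (\<integral>\<^sup>+x. F (S *v x) \<partial>lborel)"
        by (rule nn_integral_distr) (use that in auto)
      then show ?thesis unfolding D by simp
    qed
    then show ?case unfolding S_def[symmetric] dS by simp
  next
    case (5 m n c)
    define S :: "real^'m^'m" where "S = (\<chi> i j. if i = m \<and> j = n then c else of_bool (i = j))"
    have "det S = 1"
    proof -
      have "S = (\<chi> k. if k = m then row m (mat 1) + c *s row n (mat 1) else row k (mat 1))"
        using 5 by (auto simp: S_def vec_eq_iff row_def mat_def)
      then show ?thesis using det_row_operation[OF 5, of "mat 1" c] by simp
    qed
    moreover have Sx: "S *v x = x + (c * x $ n) *\<^sub>R axis m 1" for x
    proof -
      have "(S *v x) $ i = (\<Sum>j\<in>UNIV. (if j = i then x $ j else 0) + (if j = n \<and> i = m then c * x $ j else 0))" for i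
        unfolding S_def matrix_vector_mult_def using 5 by (auto intro!: sum.cong)
      then show ?thesis by (auto simp: vec_eq_iff axis_def sum.distrib)
    qed
    ultimately show ?case using nn_integral_shear[OF _ 5] unfolding S_def[symmetric] by simp
  qed
  then show ?thesis using assms by blast
qed

lemma emeasure_lborel_vec_mult:
  fixes A :: "real^'m^'m"
  assumes A: "det A \<noteq> 0" and le: "\<And>b. b \<in> Basis \<Longrightarrow> l \<bullet> b \<le> u \<bullet> b"
  shows "ennreal \<bar>det A\<bar> * emeasure lborel {r. r v* A \<in> box l u} = (\<Prod>b\<in>Basis. (u - l) \<bullet> b)"
proof -
  have "(*v) (transpose A) -` box l u \<inter> space borel \<in> sets borel"
    by (rule measurable_sets[OF borel_measurable_matrix_vector_mult]) simp
  then have m: "{r. r v* A \<in> box l u} \<in> sets lborel" by (simp add: vimage_def)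
  have "emeasure lborel {r. r v* A \<in> box l u} = (\<integral>\<^sup>+r. indicator (box l u) (transpose A *v r) \<partial>lborel)"
    by (subst nn_integral_indicator[OF m, symmetric]) (auto simp: indicator_def intro!: nn_integral_cong)
  then have "ennreal \<bar>det A\<bar> * emeasure lborel {r. r v* A \<in> box l u} = emeasure lborel (box l u)"
    using nn_integral_matrix_vector_mult[of "transpose A" "indicator (box l u)"] A by simp
  then show ?thesis using le by (simp add: emeasure_lborel_box)
qed

lemma borel_measurable_matrix_mult [measurable]:
  fixes f :: "'a \<Rightarrow> real^'m^'n" and g :: "'a \<Rightarrow> real^'k^'m"
  assumes "f \<in> borel_measurable M" "g \<in> borel_measurable M"
  shows "(\<lambda>x. f x ** g x) \<in> borel_measurable M"
  by (rule borel_measurable_continuous_Pair[OF assms]) (intro continuous_intros)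

text \<open>A acts on each row of x separately, so every row contributes one factor |det A|.\<close>

lemma nn_integral_matrix_mult_right:
  fixes F :: "real^'m^'n \<Rightarrow> ennreal" and A :: "real^'m^'m"
  assumes A: "det A \<noteq> 0" and F[measurable]: "F \<in> borel_measurable borel"
  shows "ennreal (\<bar>det A\<bar> ^ CARD('n)) * (\<integral>\<^sup>+x. F (x ** A) \<partial>lborel) = (\<integral>\<^sup>+x. F x \<partial>lborel)"
proof -
  let ?c = "ennreal (\<bar>det A\<bar> ^ CARD('n))"
  have eq: "(lborel :: (real^'m^'n) measure) = density (distr lborel borel (\<lambda>x. x ** A)) (\<lambda>_. ?c)"
  proof (rule lborel_eqI)
    fix l u :: "real^'m^'n" assume le: "\<And>b. b \<in> Basis \<Longrightarrow> l \<bullet> b \<le> u \<bullet> b"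
    have le': "l $ i \<bullet> b \<le> u $ i \<bullet> b" if "b \<in> Basis" for i b
      using le[of "axis i b"] that by (simp add: inner_axis)
    have row: "(x ** A) $ i = x $ i v* A" for x :: "real^'m^'n" and i
      by (simp add: matrix_matrix_mult_def vector_matrix_mult_def vec_eq_iff mult.commute)
    have bx: "x ** A \<in> box l u \<longleftrightarrow> (\<forall>i. x $ i v* A \<in> box (l $ i) (u $ i))" for x :: "real^'m^'n"
      by (auto simp: box_def Basis_vec_def inner_axis row)
    have mb: "{r. r v* A \<in> box (l $ i) (u $ i)} \<in> sets borel" for i
    proof -
      have "(*v) (transpose A) -` box (l $ i) (u $ i) \<inter> space borel \<in> sets borel"
        by (rule measurable_sets[OF borel_measurable_matrix_vector_mult]) simp
      then show ?thesis by (simp add: vimage_def)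
    qed
    have "emeasure (density (distr lborel borel (\<lambda>x. x ** A)) (\<lambda>_. ?c)) (box l u)
        = ?c * emeasure lborel {x::real^'m^'n. \<forall>i. x $ i \<in> {r. r v* A \<in> box (l $ i) (u $ i)}}"
      by (simp add: emeasure_density_const emeasure_distr vimage_def bx)
    also have "\<dots> = ?c * (\<Prod>i\<in>UNIV. emeasure lborel {r. r v* A \<in> box (l $ i) (u $ i)})"
      by (subst emeasure_lborel_vec_box[OF mb]) simp
    also have "\<dots> = (\<Prod>i\<in>UNIV. ennreal \<bar>det A\<bar> * emeasure lborel {r. r v* A \<in> box (l $ i) (u $ i)})"
      by (simp add: prod.distrib ennreal_power)
    also have "\<dots> = (\<Prod>i\<in>UNIV. ennreal (\<Prod>b\<in>Basis. (u $ i - l $ i) \<bullet> b))"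
      by (intro prod.cong refl emeasure_lborel_vec_mult A le')
    also have "\<dots> = emeasure lborel {x::real^'m^'n. \<forall>i. x $ i \<in> box (l $ i) (u $ i)}"
      by (subst emeasure_lborel_vec_box) (auto simp: emeasure_lborel_box le' inner_diff_left)
    also have "{x::real^'m^'n. \<forall>i. x $ i \<in> box (l $ i) (u $ i)} = box l u"
      by (auto simp: box_def Basis_vec_def inner_axis)
    also have "emeasure lborel (box l u) = (\<Prod>b\<in>Basis. (u - l) \<bullet> b)"
      using le by (rule emeasure_lborel_box)
    finally show "emeasure (density (distr lborel borel (\<lambda>x. x ** A)) (\<lambda>_. ?c)) (box l u) = (\<Prod>b\<in>Basis. (u - l) \<bullet> b)" .
  qed simp
  have "(\<integral>\<^sup>+x. F x \<partial>lborel) = (\<integral>\<^sup>+x. F x \<partial>density (distr lborel borel (\<lambda>x. x ** A)) (\<lambda>_. ?c))"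
    using eq by simp
  also have "\<dots> = ?c * (\<integral>\<^sup>+x. F (x ** A) \<partial>lborel)"
    by (subst nn_integral_density) (auto simp: nn_integral_distr nn_integral_cmult)
  finally show ?thesis by simp
qed

lemma nn_integral_matrix_mult_left:
  fixes F :: "real^'m^'n \<Rightarrow> ennreal" and A :: "real^'n^'n"
  assumes A: "det A \<noteq> 0" and F[measurable]: "F \<in> borel_measurable borel"
  shows "ennreal (\<bar>det A\<bar> ^ CARD('m)) * (\<integral>\<^sup>+x. F (A ** x) \<partial>lborel) = (\<integral>\<^sup>+x. F x \<partial>lborel)"
proof -
  have "(\<integral>\<^sup>+x. F (A ** x) \<partial>lborel) = (\<integral>\<^sup>+x. F (A ** transpose x) \<partial>lborel)"
    by (rule nn_integral_transpose[symmetric]) measurable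
  also have "\<dots> = (\<integral>\<^sup>+x. F (transpose (x ** transpose A)) \<partial>lborel)"
    by (simp add: matrix_transpose_mul)
  also have "ennreal (\<bar>det A\<bar> ^ CARD('m)) * \<dots> = (\<integral>\<^sup>+x. F (transpose x) \<partial>lborel)"
    using nn_integral_matrix_mult_right[of "transpose A" "\<lambda>x. F (transpose x)"] A by simp
  also have "\<dots> = (\<integral>\<^sup>+x. F x \<partial>lborel)" by (rule nn_integral_transpose) measurable
  finally show ?thesis .
qed

lemma abs_det_stiefel: "(g::real^'n^'n) \<in> stiefel \<Longrightarrow> \<bar>det g\<bar> = 1"
  using gram_det_stiefel[of g] by (auto simp: gram_det_square power2_eq_1_iff)

text \<open>Every line x + t w in the direction of a frame w meets the rank deficient matrices in
  finitely many points. Fubini along these lines turns this into a null set.\<close>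

lemma AE_gram_det_nonzero:
  assumes le: "CARD('m) \<le> CARD('n)"
  shows "AE x in lborel. gram_det (x :: real^'m^'n) \<noteq> 0"
proof -
  obtain w :: "real^'m^'n" where w: "w \<in> stiefel" using stiefel_nonempty[OF le] by auto
  define N where "N = {x :: real^'m^'n. gram_det x = 0}"
  have [measurable]: "N \<in> sets borel" by (simp add: N_def)
  have fin: "finite {t. x + t *\<^sub>R w \<in> N}" for x
  proof -
    define y where "y = transpose w ** x"
    \<comment> \<open>The polynomial t -> det (w'x + t I). If (x + t w) z = 0, then w'w = I makes z
      an eigenvector of w'x for -t, so t is a root.\<close>
    define q where "q = (\<Sum>\<sigma> | \<sigma> permutes (UNIV :: 'm set). smult (of_int (sign \<sigma>))
        (\<Prod>i\<in>UNIV. [:y $ i $ \<sigma> i, if i = \<sigma> i then 1 else 0:]))"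
    have q: "poly q t = det (y + t *\<^sub>R mat 1)" for t
      unfolding q_def det_def by (auto simp: poly_sum poly_prod mat_def intro!: sum.cong prod.cong)
    have ker: "\<exists>z. z \<noteq> 0 \<and> y *v z = - (t *\<^sub>R z)" if "x + t *\<^sub>R w \<in> N" for t
    proof -
      have "\<not> inj ((*v) (x + t *\<^sub>R w))" using that by (simp add: N_def flip: gram_det_iff_inj)
      then obtain z where z: "z \<noteq> 0" "(x + t *\<^sub>R w) *v z = 0"
        using matrix_left_invertible_injective[of "x + t *\<^sub>R w"] matrix_left_invertible_ker[of "x + t *\<^sub>R w"] by metis
      then have "transpose w *v ((x + t *\<^sub>R w) *v z) = 0" by simp
      then have "y *v z + t *\<^sub>R z = 0"
        using stiefelD[OF w]
        by (simp del: transpose_matrix_vector add: matrix_vector_mult_add_rdistrib matrix_vector_right_distrib y_def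
            matrix_vector_mul_assoc[symmetric] scaleR_matrix_vector_assoc[symmetric] matrix_vector_mult_scaleR)
           (simp del: transpose_matrix_vector add: matrix_vector_mul_assoc)
      then show ?thesis using z by (auto simp: eq_neg_iff_add_eq_0)
    qed
    have root: "poly q t = 0" if "z \<noteq> 0" "y *v z = - (t *\<^sub>R z)" for t z
    proof -
      have "(y + t *\<^sub>R mat 1) *v z = 0"
        using that by (simp add: matrix_vector_mult_add_rdistrib scaleR_matrix_vector_assoc[symmetric])
      then have "\<not> inj ((*v) (y + t *\<^sub>R mat 1))"
        using that(1) by (metis injD matrix_vector_mult_0_right)
      then show ?thesis using det_nz_iff_inj[of "(*v) (y + t *\<^sub>R mat 1)"] by (simp add: q)
    qed
    have "q \<noteq> 0"
    proof
      assume "q = 0"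
      \<comment> \<open>Since t exceeds the operator norm of y, -t is no eigenvalue of y, and q
        cannot be the zero polynomial.\<close>
      define t where "t = onorm ((*v) y) + 1"
      have "t > 0" unfolding t_def using onorm_pos_le[OF matrix_vector_mul_bounded_linear, of y] by linarith
      have "det (y + t *\<^sub>R mat 1) = 0" using q[of t] \<open>q = 0\<close> by simp
      then have "\<not> inj ((*v) (y + t *\<^sub>R mat 1))" using det_nz_iff_inj[of "(*v) (y + t *\<^sub>R mat 1)"] by simp
      then obtain z where z: "z \<noteq> 0" "(y + t *\<^sub>R mat 1) *v z = 0"
        using matrix_left_invertible_injective matrix_left_invertible_ker by metis
      then have "y *v z = - (t *\<^sub>R z)"
        by (simp add: matrix_vector_mult_add_rdistrib scaleR_matrix_vector_assoc[symmetric] eq_neg_iff_add_eq_0)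
      then have "t * norm z \<le> onorm ((*v) y) * norm z"
        using onorm[OF matrix_vector_mul_bounded_linear, of y z] \<open>t > 0\<close> by simp
      then show False using z by (simp add: t_def algebra_simps)
    qed
    then have "finite {t. poly q t = 0}" by (rule poly_roots_finite)
    then show ?thesis by (rule rev_finite_subset) (use ker root in blast)
  qed
  \<comment> \<open>The unit interval gives the extra variable t total mass 1; for each t the set is
    translated by a multiple of w, which preserves its measure.\<close>
  have "emeasure lborel N = (\<integral>\<^sup>+t. emeasure lborel N * indicator {0..1} t \<partial>(lborel :: real measure))"
    by (simp add: nn_integral_cmult)
  also have "\<dots> = (\<integral>\<^sup>+t. (\<integral>\<^sup>+x. indicator N (x + t *\<^sub>R w) * indicator {0..1} t \<partial>lborel) \<partial>lborel)"
  proof (intro nn_integral_cong)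
    fix t :: real
    have "(\<integral>\<^sup>+x. indicator N (x + t *\<^sub>R w) \<partial>lborel) = (\<integral>\<^sup>+x. indicator N x \<partial>distr lborel borel ((+) (t *\<^sub>R w)))"
      by (subst nn_integral_distr) (auto simp: add.commute)
    then show "emeasure lborel N * indicator {0..1} t = (\<integral>\<^sup>+x. indicator N (x + t *\<^sub>R w) * indicator {0..1} t \<partial>lborel)"
      by (simp add: lborel_distr_plus nn_integral_multc)
  qed
  also have "\<dots> = (\<integral>\<^sup>+x. (\<integral>\<^sup>+t. indicator N (x + t *\<^sub>R w) * indicator {0..1} t \<partial>lborel) \<partial>lborel)"
    by (rule lborel_pair.Fubini') measurable
  also have "\<dots> = (\<integral>\<^sup>+(x::real^'m^'n). 0 \<partial>lborel)"
  proof (intro nn_integral_cong)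
    fix x
    have "emeasure lborel {t. x + t *\<^sub>R w \<in> N} = 0"
      by (rule emeasure_lborel_countable) (use fin in \<open>simp add: countable_finite\<close>)
    then have "AE t in lborel. t \<notin> {t. x + t *\<^sub>R w \<in> N}"
      by (intro AE_not_in) (use fin in \<open>auto simp: null_sets_def finite_imp_closed\<close>)
    then have "(\<integral>\<^sup>+t. indicator N (x + t *\<^sub>R w) * indicator {0..1} t \<partial>lborel) = (\<integral>\<^sup>+t. 0 \<partial>(lborel::real measure))"
      by (intro nn_integral_cong_AE) (auto simp: indicator_def)
    then show "(\<integral>\<^sup>+t. indicator N (x + t *\<^sub>R w) * indicator {0..1} t \<partial>lborel) = 0" by simp
  qed
  finally have "N \<in> null_sets lborel" by (auto simp: null_sets_def)
  then show ?thesis by (rule AE_I') (auto simp: N_def)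
qed

section \<open>The invariant probability measure\<close>

text \<open>Not normalised: the total mass is a power of \<open>sqrt pi\<close>, and the powers of
  pi in the constants of polar coordinates stem from it. Invariance under orthogonal factors on both
  sides is the property that matters.\<close>

definition gauss :: "'a::euclidean_space \<Rightarrow> real" where
  "gauss x = exp (- (norm x)\<^sup>2)"

lemma gauss_pos: "gauss x > 0" by (simp add: gauss_def)

lemma gauss_nonneg [simp]: "0 \<le> gauss x" by (simp add: gauss_def)

lemma borel_measurable_gauss [measurable]: "gauss \<in> borel_measurable borel"
  unfolding gauss_def by measurable

lemma gauss_prod: "gauss (x::'a::euclidean_space) = (\<Prod>b\<in>Basis. exp (- (x \<bullet> b)\<^sup>2))"
proof -
  have "(norm x)\<^sup>2 = (\<Sum>b\<in>Basis. (x \<bullet> b)\<^sup>2)"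
    unfolding power2_norm_eq_inner by (subst euclidean_inner) (simp add: power2_eq_square)
  then show ?thesis by (simp add: gauss_def exp_sum flip: sum_negf)
qed

lemma nn_integral_exp_square: "(\<integral>\<^sup>+t. ennreal (exp (- t\<^sup>2)) \<partial>lborel) = ennreal (sqrt pi)"
proof -
  have "prob_space (density lborel (normal_density 0 (1 / sqrt 2)))"
    by (rule prob_space_normal_density) simp
  then have "(\<integral>\<^sup>+t. ennreal (normal_density 0 (1 / sqrt 2) t) \<partial>lborel) = 1"
    using prob_space.emeasure_space_1 by (fastforce simp: emeasure_density)
  then have "ennreal (sqrt pi) * (\<integral>\<^sup>+t. ennreal (normal_density 0 (1 / sqrt 2) t) \<partial>lborel) = ennreal (sqrt pi)"
    by simp
  also have "ennreal (sqrt pi) * (\<integral>\<^sup>+t. ennreal (normal_density 0 (1 / sqrt 2) t) \<partial>lborel)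
      = (\<integral>\<^sup>+t. ennreal (exp (- t\<^sup>2)) \<partial>lborel)"
    by (subst nn_integral_cmult[symmetric])
       (auto simp: normal_density_def power_divide ennreal_mult[symmetric])
  finally show ?thesis .
qed

lemma nn_integral_gauss: "(\<integral>\<^sup>+x. ennreal (gauss (x::'a::euclidean_space)) \<partial>lborel) = ennreal (sqrt pi ^ DIM('a))"
proof -
  have "(\<integral>\<^sup>+x. ennreal (gauss (x::'a)) \<partial>lborel) = (\<integral>\<^sup>+x. (\<Prod>b\<in>Basis. ennreal (exp (- ((x::'a) \<bullet> b)\<^sup>2))) \<partial>lborel)"
    by (simp add: gauss_prod prod_ennreal)
  also have "\<dots> = (\<Prod>b\<in>(Basis::'a set). \<integral>\<^sup>+t. ennreal (exp (- t\<^sup>2)) \<partial>lborel)"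
    by (rule nn_integral_lborel_prod) auto
  finally show ?thesis by (simp add: nn_integral_exp_square ennreal_power)
qed

abbreviation stiefel_borel :: "(real^'m^'n) measure" where
  "stiefel_borel \<equiv> restrict_space borel stiefel"

lemma sets_stiefel_borel: "A \<in> sets (stiefel_borel :: (real^'m^'n) measure) \<longleftrightarrow> A \<in> sets borel \<and> A \<subseteq> stiefel"
  by (subst sets_restrict_space_iff) (auto simp: closed_stiefel)

lemma space_stiefel_borel: "space (stiefel_borel :: (real^'m^'n) measure) = stiefel"
  by (simp add: space_restrict_space)

lemma measurable_into_stiefel:
  assumes "f \<in> borel_measurable M" "\<And>x. x \<in> space M \<Longrightarrow> f x \<in> stiefel"
  shows "f \<in> M \<rightarrow>\<^sub>M stiefel_borel"
  using assms by (intro measurable_restrict_space2) auto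

lemma measurable_stiefel_borel_ident:
  assumes "sets M = sets (stiefel_borel :: (real^'m^'n) measure)"
  shows "(\<lambda>x. x) \<in> borel_measurable M"
proof -
  have "(\<lambda>x. x) \<in> borel_measurable (stiefel_borel :: (real^'m^'n) measure)"
    by (intro measurable_restrict_space1) simp
  then show ?thesis by (simp cong: measurable_cong_sets[OF assms refl])
qed

lemma measurable_from_stiefel:
  assumes "sets M = sets (stiefel_borel :: (real^'m^'n) measure)" "f \<in> borel \<rightarrow>\<^sub>M N"
  shows "f \<in> M \<rightarrow>\<^sub>M N"
  using measurable_compose[OF measurable_stiefel_borel_ident[OF assms(1)] assms(2)] by simp

lemma measure_eq_on_stiefel:
  assumes "sets M = sets (stiefel_borel :: (real^'m^'n) measure)" "sets N = sets (stiefel_borel :: (real^'m^'n) measure)"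
    and "\<And>F. F \<in> borel_measurable borel \<Longrightarrow> (\<integral>\<^sup>+x. F x \<partial>M) = (\<integral>\<^sup>+x. F x \<partial>N)"
  shows "M = N"
proof (rule measure_eqI)
  show "sets M = sets N" using assms by simp
  fix A assume A: "A \<in> sets M"
  then have "A \<in> sets borel" using assms(1) by (simp add: sets_stiefel_borel)
  then have "(\<integral>\<^sup>+x. indicator A x \<partial>M) = (\<integral>\<^sup>+x. indicator A x \<partial>N)" by (intro assms(3)) simp
  then show "emeasure M A = emeasure N A" using A assms by simp
qed

text \<open>Haar measure on O(n), realised as the law of the polar factor of a Gaussian matrix:
  polar factors commute with orthogonal factors on either side, and the Gaussian is invariant under
  them. The value \<open>mat 1\<close> at singular matrices keeps the map inside the group and
  concerns a null set only.\<close>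

definition haar :: "(real^'n^'n) measure" where
  "haar = distr (density lborel (\<lambda>x. ennreal (gauss x / sqrt pi ^ DIM(real^'n^'n)))) stiefel_borel
     (\<lambda>x. if gram_det x \<noteq> 0 then polar_part x else mat 1)"

lemma sets_haar [simp]: "sets (haar :: (real^'n^'n) measure) = sets stiefel_borel"
  by (simp add: haar_def)

lemma space_haar [simp]: "space (haar :: (real^'n^'n) measure) = stiefel"
  by (simp add: haar_def space_stiefel_borel)

lemma measurable_polar_stiefel:
  "(\<lambda>x. if gram_det x \<noteq> 0 then polar_part x else mat 1) \<in> borel \<rightarrow>\<^sub>M (stiefel_borel :: (real^'n^'n) measure)"
  by (rule measurable_into_stiefel[OF measurable_polar_part]) (auto simp: polar_part mat_1_stiefel)

lemma nn_integral_haar: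
  fixes F :: "real^'n^'n \<Rightarrow> ennreal"
  assumes F[measurable]: "F \<in> borel_measurable borel"
  shows "(\<integral>\<^sup>+g. F g \<partial>haar) = (\<integral>\<^sup>+x. ennreal (gauss x / sqrt pi ^ DIM(real^'n^'n)) *
     F (if gram_det x \<noteq> 0 then polar_part x else mat 1) \<partial>lborel)"
proof -
  note measurable_polar_stiefel[where 'n='n, measurable] measurable_polar_part[where 'n='n and 'm='n and c="mat 1", measurable]
  have "(\<integral>\<^sup>+g. F g \<partial>haar) = (\<integral>\<^sup>+x. F (if gram_det x \<noteq> 0 then polar_part x else mat 1)
      \<partial>density lborel (\<lambda>x. ennreal (gauss x / sqrt pi ^ DIM(real^'n^'n))))"
    unfolding haar_def by (subst nn_integral_distr) (auto intro!: measurable_from_stiefel[OF refl])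
  also have "\<dots> = (\<integral>\<^sup>+x. ennreal (gauss x / sqrt pi ^ DIM(real^'n^'n)) *
     F (if gram_det x \<noteq> 0 then polar_part x else mat 1) \<partial>lborel)"
    by (subst nn_integral_density) auto
  finally show ?thesis .
qed

lemma prob_space_haar: "prob_space (haar :: (real^'n^'n) measure)"
proof
  have "emeasure (haar :: (real^'n^'n) measure) (space haar) = (\<integral>\<^sup>+g. 1 \<partial>(haar :: (real^'n^'n) measure))"
    by simp
  also have "\<dots> = (\<integral>\<^sup>+x. ennreal (gauss (x::real^'n^'n)) * ennreal (1 / sqrt pi ^ DIM(real^'n^'n)) \<partial>lborel)"
    by (subst nn_integral_haar) (auto simp: ennreal_mult[symmetric])
  also have "\<dots> = ennreal (sqrt pi ^ DIM(real^'n^'n)) * ennreal (1 / sqrt pi ^ DIM(real^'n^'n))"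
    by (subst nn_integral_multc) (simp_all add: nn_integral_gauss)
  also have "\<dots> = 1" by (simp add: ennreal_mult[symmetric] del: DIM_cart)
  finally show "emeasure (haar :: (real^'n^'n) measure) (space haar) = 1" .
qed

lemma gauss_mult_left: "g \<in> stiefel \<Longrightarrow> gauss (g ** (x::real^'m^'k) :: real^'m^'n) = gauss x"
  by (simp add: gauss_def norm_stiefel_mult)

lemma gauss_mult_right: "(g::real^'m^'m) \<in> stiefel \<Longrightarrow> gauss ((x::real^'m^'n) ** g) = gauss x"
  by (simp add: gauss_def norm_mult_orthogonal)

lemma nn_integral_haar_left:
  fixes F :: "real^'n^'n \<Rightarrow> ennreal"
  assumes F[measurable]: "F \<in> borel_measurable borel" and h: "h \<in> stiefel"
  shows "(\<integral>\<^sup>+g. F (h ** g) \<partial>haar) = (\<integral>\<^sup>+g. F g \<partial>haar)"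
proof -
  note measurable_polar_part[where 'n='n and 'm='n and c="mat 1", measurable]
  have "(\<integral>\<^sup>+g. F (h ** g) \<partial>haar) = (\<integral>\<^sup>+x. ennreal (gauss x / sqrt pi ^ DIM(real^'n^'n)) *
     F (h ** (if gram_det x \<noteq> 0 then polar_part x else mat 1)) \<partial>lborel)"
    by (rule nn_integral_haar) measurable
  also have "\<dots> = (\<integral>\<^sup>+x. ennreal (gauss (h ** x) / sqrt pi ^ DIM(real^'n^'n)) *
     F (if gram_det (h ** x) \<noteq> 0 then polar_part (h ** x) else mat 1) \<partial>lborel)"
    using AE_gram_det_nonzero[where 'm='n and 'n='n, OF order_refl]
    by (intro nn_integral_cong_AE)
       (auto elim!: eventually_mono simp: gauss_mult_left gram_det_mult_left h polar_part_mult_left)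
  also have "\<dots> = (\<integral>\<^sup>+x. ennreal (gauss x / sqrt pi ^ DIM(real^'n^'n)) *
     F (if gram_det x \<noteq> 0 then polar_part x else mat 1) \<partial>lborel)"
    using nn_integral_matrix_mult_left[of h "\<lambda>x. ennreal (gauss x / sqrt pi ^ DIM(real^'n^'n)) *
     F (if gram_det x \<noteq> 0 then polar_part x else mat 1)"] abs_det_stiefel[OF h] by force
  also have "\<dots> = (\<integral>\<^sup>+g. F g \<partial>haar)" by (rule nn_integral_haar[symmetric]) fact
  finally show ?thesis .
qed

lemma nn_integral_haar_right:
  fixes F :: "real^'n^'n \<Rightarrow> ennreal"
  assumes F[measurable]: "F \<in> borel_measurable borel" and h: "h \<in> stiefel"
  shows "(\<integral>\<^sup>+g. F (g ** h) \<partial>haar) = (\<integral>\<^sup>+g. F g \<partial>haar)"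
proof -
  note measurable_polar_part[where 'n='n and 'm='n and c="mat 1", measurable]
  have dh: "det h \<noteq> 0" using abs_det_stiefel[OF h] by auto
  have "(\<integral>\<^sup>+g. F (g ** h) \<partial>haar) = (\<integral>\<^sup>+x. ennreal (gauss x / sqrt pi ^ DIM(real^'n^'n)) *
     F ((if gram_det x \<noteq> 0 then polar_part x else mat 1) ** h) \<partial>lborel)"
    by (rule nn_integral_haar) measurable
  also have "\<dots> = (\<integral>\<^sup>+x. ennreal (gauss (x ** h) / sqrt pi ^ DIM(real^'n^'n)) *
     F (if gram_det (x ** h) \<noteq> 0 then polar_part (x ** h) else mat 1) \<partial>lborel)"
    using AE_gram_det_nonzero[where 'm='n and 'n='n, OF order_refl]
    by (intro nn_integral_cong_AE)
       (auto elim!: eventually_mono simp: gauss_mult_right gram_det_mult_right h dh polar_part_mult_right)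
  also have "\<dots> = (\<integral>\<^sup>+x. ennreal (gauss x / sqrt pi ^ DIM(real^'n^'n)) *
     F (if gram_det x \<noteq> 0 then polar_part x else mat 1) \<partial>lborel)"
    using nn_integral_matrix_mult_right[of h "\<lambda>x. ennreal (gauss x / sqrt pi ^ DIM(real^'n^'n)) *
     F (if gram_det x \<noteq> 0 then polar_part x else mat 1)"] abs_det_stiefel[OF h] by force
  also have "\<dots> = (\<integral>\<^sup>+g. F g \<partial>haar)" by (rule nn_integral_haar[symmetric]) fact
  finally show ?thesis .
qed

text \<open>The law of g v for Haar distributed g. Transitivity together with right invariance of
  \<open>haar\<close> makes it the same for all frames v.\<close>

definition orbit_measure :: "real^'m^'n \<Rightarrow> (real^'m^'n) measure" where
  "orbit_measure v = distr haar stiefel_borel (\<lambda>g. g ** v)"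

lemma sets_orbit_measure [simp]: "sets (orbit_measure v) = sets stiefel_borel"
  by (simp add: orbit_measure_def)

lemma space_orbit_measure [simp]: "space (orbit_measure v) = stiefel"
  by (simp add: orbit_measure_def space_stiefel_borel)

lemma measurable_haar_mult:
  assumes "v \<in> (stiefel :: (real^'m^'n) set)"
  shows "(\<lambda>g. g ** v) \<in> haar \<rightarrow>\<^sub>M stiefel_borel"
  using assms by (intro measurable_into_stiefel measurable_from_stiefel[OF sets_haar]) (auto intro: stiefel_mult)

lemma nn_integral_orbit:
  assumes v: "v \<in> (stiefel :: (real^'m^'n) set)" and F[measurable]: "F \<in> borel_measurable borel"
  shows "(\<integral>\<^sup>+x. F x \<partial>orbit_measure v) = (\<integral>\<^sup>+g. F (g ** v) \<partial>haar)"
  unfolding orbit_measure_def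
  by (rule nn_integral_distr) (auto intro!: measurable_haar_mult v measurable_from_stiefel[OF refl])

lemma orbit_measure_unique_orbit:
  assumes v: "v \<in> (stiefel :: (real^'m^'n) set)" and w: "w \<in> stiefel"
  shows "orbit_measure v = orbit_measure w"
proof (rule measure_eq_on_stiefel)
  obtain h :: "real^'n^'n" where h: "h \<in> stiefel" "h ** w = v" using stiefel_transitive[OF w v] .
  fix F :: "real^'m^'n \<Rightarrow> ennreal" assume F[measurable]: "F \<in> borel_measurable borel"
  have "(\<integral>\<^sup>+x. F x \<partial>orbit_measure v) = (\<integral>\<^sup>+g. F ((g ** h) ** w) \<partial>haar)"
    using h by (simp add: nn_integral_orbit v matrix_mul_assoc[symmetric])
  also have "\<dots> = (\<integral>\<^sup>+g. F (g ** w) \<partial>haar)"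
    by (rule nn_integral_haar_right[of "\<lambda>g. F (g ** w)"]) (use h in auto)
  finally show "(\<integral>\<^sup>+x. F x \<partial>orbit_measure v) = (\<integral>\<^sup>+x. F x \<partial>orbit_measure w)"
    by (simp add: nn_integral_orbit w)
qed auto

lemma invariant_orbit_measure:
  assumes v: "v \<in> (stiefel :: (real^'m^'n) set)"
  shows "invariant_prob_on_stiefel (orbit_measure v)"
  unfolding invariant_prob_on_stiefel_def
proof (intro conjI allI impI)
  show "prob_space (orbit_measure v)"
    unfolding orbit_measure_def by (rule prob_space.prob_space_distr[OF prob_space_haar measurable_haar_mult[OF v]])
  fix g :: "real^'n^'n" assume "orthogonal_matrix g"
  then have g: "g \<in> stiefel" by (simp add: orthogonal_matrix_iff_stiefel)
  have m: "(\<lambda>x. g ** x) \<in> orbit_measure v \<rightarrow>\<^sub>M orbit_measure v"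
    unfolding measurable_cong_sets[OF refl sets_orbit_measure]
    by (rule measurable_into_stiefel)
       (auto intro!: measurable_from_stiefel[OF sets_orbit_measure] stiefel_mult g)
  show "distr (orbit_measure v) (orbit_measure v) (\<lambda>x. g ** x) = orbit_measure v"
  proof (rule measure_eq_on_stiefel)
    fix F :: "real^'m^'n \<Rightarrow> ennreal" assume F[measurable]: "F \<in> borel_measurable borel"
    have "(\<integral>\<^sup>+x. F x \<partial>distr (orbit_measure v) (orbit_measure v) (\<lambda>x. g ** x)) = (\<integral>\<^sup>+x. F (g ** x) \<partial>orbit_measure v)"
      by (rule nn_integral_distr) (auto intro!: m measurable_from_stiefel[OF sets_orbit_measure])
    also have "\<dots> = (\<integral>\<^sup>+h. F ((g ** h) ** v) \<partial>haar)"
      by (subst nn_integral_orbit[OF v]) (auto simp: matrix_mul_assoc)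
    also have "\<dots> = (\<integral>\<^sup>+h. F (h ** v) \<partial>haar)"
      by (rule nn_integral_haar_left[of "\<lambda>g. F (g ** v)"]) (use g in auto)
    finally show "(\<integral>\<^sup>+x. F x \<partial>distr (orbit_measure v) (orbit_measure v) (\<lambda>x. g ** x)) = (\<integral>\<^sup>+x. F x \<partial>orbit_measure v)"
      by (simp add: nn_integral_orbit v)
  qed auto
qed auto

text \<open>Averaging an invariant measure over the group turns it into the orbit measure, because the
  inner average does not depend on the starting point.\<close>
lemma invariant_imp_orbit_measure:
  assumes \<mu>: "invariant_prob_on_stiefel \<mu>" and v: "v \<in> (stiefel :: (real^'m^'n) set)"
  shows "\<mu> = orbit_measure v"
proof (rule measure_eq_on_stiefel)
  interpret \<mu>: prob_space \<mu> using \<mu> by (simp add: invariant_prob_on_stiefel_def)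
  interpret H: prob_space "haar :: (real^'n^'n) measure" by (rule prob_space_haar)
  interpret P: pair_sigma_finite "haar :: (real^'n^'n) measure" \<mu> ..
  show s: "sets \<mu> = sets stiefel_borel" using \<mu> by (simp add: invariant_prob_on_stiefel_def)
  have sp: "space \<mu> = stiefel" using \<mu> by (simp add: invariant_prob_on_stiefel_def)
  fix F :: "real^'m^'n \<Rightarrow> ennreal" assume F[measurable]: "F \<in> borel_measurable borel"
  have inv: "(\<integral>\<^sup>+x. F (g ** x) \<partial>\<mu>) = (\<integral>\<^sup>+x. F x \<partial>\<mu>)" if g: "g \<in> stiefel" for g
  proof -
    have m: "(\<lambda>x. g ** x) \<in> \<mu> \<rightarrow>\<^sub>M \<mu>"
      unfolding measurable_cong_sets[OF refl s]
      by (rule measurable_into_stiefel)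
         (auto intro!: measurable_from_stiefel[OF s] stiefel_mult g simp: sp)
    have "(\<integral>\<^sup>+x. F x \<partial>\<mu>) = (\<integral>\<^sup>+x. F x \<partial>distr \<mu> \<mu> (\<lambda>x. g ** x))"
      using \<mu> g by (simp add: invariant_prob_on_stiefel_def orthogonal_matrix_iff_stiefel)
    also have "\<dots> = (\<integral>\<^sup>+x. F (g ** x) \<partial>\<mu>)"
      by (rule nn_integral_distr) (auto intro!: m measurable_from_stiefel[OF s])
    finally show ?thesis by simp
  qed
  have [measurable]: "fst \<in> borel_measurable (haar \<Otimes>\<^sub>M \<mu>)" "snd \<in> borel_measurable (haar \<Otimes>\<^sub>M \<mu>)"
    using measurable_compose[OF measurable_fst measurable_stiefel_borel_ident[OF sets_haar]]
      measurable_compose[OF measurable_snd measurable_stiefel_borel_ident[OF s]] by (auto simp: comp_def)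
  have "(\<integral>\<^sup>+x. F x \<partial>\<mu>) = (\<integral>\<^sup>+g. (\<integral>\<^sup>+x. F x \<partial>\<mu>) \<partial>(haar :: (real^'n^'n) measure))"
    using H.emeasure_space_1 by simp
  also have "\<dots> = (\<integral>\<^sup>+g. (\<integral>\<^sup>+x. F (g ** x) \<partial>\<mu>) \<partial>(haar :: (real^'n^'n) measure))"
    by (rule nn_integral_cong) (simp only: space_haar inv)
  also have "\<dots> = (\<integral>\<^sup>+x. (\<integral>\<^sup>+g. F (g ** x) \<partial>(haar :: (real^'n^'n) measure)) \<partial>\<mu>)"
    by (rule P.Fubini'[symmetric]) (simp add: case_prod_unfold)
  also have "\<dots> = (\<integral>\<^sup>+x. (\<integral>\<^sup>+y. F y \<partial>orbit_measure v) \<partial>\<mu>)"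
    by (intro nn_integral_cong) (auto simp: sp nn_integral_orbit[symmetric] orbit_measure_unique_orbit[OF v])
  also have "\<dots> = (\<integral>\<^sup>+y. F y \<partial>orbit_measure v)" by (simp add: \<mu>.emeasure_space_1)
  finally show "(\<integral>\<^sup>+x. F x \<partial>\<mu>) = (\<integral>\<^sup>+x. F x \<partial>orbit_measure v)" .
qed auto

text \<open>Settles the definite description. From here on, integrals over the Stiefel manifold are
  Haar integrals of functions of g v, with any convenient base frame v.\<close>

lemma stiefel_measure_eq:
  assumes v: "v \<in> (stiefel :: (real^'m^'n) set)"
  shows "stiefel_measure = orbit_measure v"
  unfolding stiefel_measure_def
  by (rule the_equality) (fact invariant_orbit_measure[OF v], rule invariant_imp_orbit_measure[OF _ v])

context
  fixes TM :: "'m::finite itself" and TN :: "'n::finite itself"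
  assumes le: "CARD('m) \<le> CARD('n)"
begin

lemma invariant_stiefel_measure: "invariant_prob_on_stiefel (stiefel_measure :: (real^'m^'n) measure)"
proof -
  obtain v :: "real^'m^'n" where v: "v \<in> stiefel" using stiefel_nonempty[OF le] by auto
  show ?thesis unfolding stiefel_measure_eq[OF v] by (rule invariant_orbit_measure[OF v])
qed

lemma prob_space_stiefel: "prob_space (stiefel_measure :: (real^'m^'n) measure)"
  using invariant_stiefel_measure by (simp add: invariant_prob_on_stiefel_def)

lemma sets_stiefel: "sets (stiefel_measure :: (real^'m^'n) measure) = sets stiefel_borel"
  using invariant_stiefel_measure by (simp add: invariant_prob_on_stiefel_def)

lemma space_stiefel: "space (stiefel_measure :: (real^'m^'n) measure) = stiefel"
  using invariant_stiefel_measure by (simp add: invariant_prob_on_stiefel_def)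

end

section \<open>Integration in polar coordinates\<close>

text \<open>The volume of the parallelotope spanned by the columns. It is the modulus of the
  determinant for square x and takes the place of the radius in polar coordinates.\<close>

definition gvol :: "real^'m^'n \<Rightarrow> real" where
  "gvol x = sqrt (gram_det x)"

lemma gvol_nonneg [simp]: "0 \<le> gvol x" by (simp add: gvol_def gram_det_nonneg)

lemma gvol_eq_0_iff [simp]: "gvol x = 0 \<longleftrightarrow> gram_det x = 0" by (simp add: gvol_def)

lemma borel_measurable_gvol [measurable]: "gvol \<in> borel_measurable borel"
  unfolding gvol_def by measurable

lemma gvol_mult_left: "g \<in> stiefel \<Longrightarrow> gvol ((g::real^'k^'n) ** x) = gvol (x::real^'m^'k)"
  by (simp add: gvol_def gram_det_mult_left)

lemma gvol_mult_right: "gvol ((x::real^'m^'n) ** A) = \<bar>det A\<bar> * gvol x"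
  by (simp add: gvol_def gram_det_mult_right real_sqrt_mult)

lemma gvol_square: "gvol (y::real^'m^'m) = \<bar>det y\<bar>"
  by (simp add: gvol_def gram_det_square)

lemma gvol_power2: "(gvol x)\<^sup>2 = gram_det x"
  by (simp add: gvol_def gram_det_nonneg)

lemma full_rank_factor:
  assumes "gram_det (x::real^'m^'n) \<noteq> 0"
  obtains v t where "v \<in> stiefel" "x = v ** t" "det t \<noteq> 0" "gvol x = \<bar>det t\<bar>"
proof -
  define v where "v = polar_part x"
  define t where "t = transpose v ** x"
  have v: "v \<in> stiefel" "x = v ** t" using polar_part[OF assms] by (auto simp: v_def t_def)
  moreover have "gvol x = \<bar>det t\<bar>"
    by (subst v(2)) (simp add: gvol_mult_left[OF v(1)] gvol_square)
  moreover have "det t \<noteq> 0" using calculation(3) assms by (metis abs_zero gvol_eq_0_iff)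
  ultimately show ?thesis using that by blast
qed

text \<open>The inverse by Cramer's rule, so that its entries are quotients of polynomials and
  measurability in A is visible. It is the inverse only where the determinant is nonzero.\<close>

definition minv :: "real^'m^'m \<Rightarrow> real^'m^'m" where
  "minv A = (\<chi> k l. det (\<chi> i j. if j = k then axis l 1 $ i else A $ i $ j) / det A)"

lemma minv_right: "det A \<noteq> 0 \<Longrightarrow> A ** minv A = mat 1"
proof -
  assume A: "det A \<noteq> 0"
  have "column l (A ** minv A) = axis l 1" for l
  proof -
    have "column l (minv A) = (\<chi> k. det (\<chi> i j. if j = k then axis l 1 $ i else A $ i $ j) / det A)"
      by (simp add: minv_def column_def vec_eq_iff)
    then have "A *v column l (minv A) = axis l 1" using cramer[OF A] by blast
    then show ?thesis by (simp add: column_mult)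
  qed
  then show ?thesis by (auto simp: vec_eq_iff column_def mat_def axis_def)
qed

lemma minv_left: "det A \<noteq> 0 \<Longrightarrow> minv A ** A = mat 1"
  using minv_right matrix_left_right_inverse by metis

lemma minv_mult: "det A \<noteq> 0 \<Longrightarrow> det B \<noteq> 0 \<Longrightarrow> minv (A ** B) = minv B ** minv A"
proof -
  assume A: "det A \<noteq> 0" and B: "det B \<noteq> 0"
  have "minv (A ** B) = minv (A ** B) ** (A ** (B ** minv B) ** minv A)"
    using A B by (simp add: minv_right)
  also have "\<dots> = (minv (A ** B) ** (A ** B)) ** (minv B ** minv A)"
    by (simp only: matrix_mul_assoc)
  also have "\<dots> = minv B ** minv A" using A B by (simp add: minv_left det_mul)
  finally show ?thesis .
qed

lemma det_minv: "det A \<noteq> 0 \<Longrightarrow> det (minv A) = 1 / det A"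
  by (metis det_I det_mul minv_right nonzero_eq_divide_eq mult.commute)

lemma borel_measurable_det [measurable]: "(det :: real^'m^'m \<Rightarrow> real) \<in> borel_measurable borel"
  by (intro borel_measurable_continuous_onI continuous_intros)

lemma borel_measurable_matrixI:
  fixes f :: "'a \<Rightarrow> real^'m^'n"
  assumes "\<And>i j. (\<lambda>x. f x $ i $ j) \<in> borel_measurable M"
  shows "f \<in> borel_measurable M"
  using assms by (subst borel_measurable_euclidean_space) (auto simp: Basis_matrix inner_axis)

lemma borel_measurable_minv [measurable]: "(minv :: real^'m^'m \<Rightarrow> _) \<in> borel_measurable borel"
proof (rule borel_measurable_matrixI)
  fix k l :: 'm
  have "(\<lambda>A::real^'m^'m. det (\<chi> i j. if j = k then axis l 1 $ i else A $ i $ j)) \<in> borel_measurable borel"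
  proof (intro borel_measurable_continuous_onI continuous_on_det continuous_on_vec_lambda)
    fix i j :: 'm
    show "continuous_on UNIV (\<lambda>A::real^'m^'m. if j = k then axis l 1 $ i else A $ i $ j)"
      by (cases "j = k") (auto intro!: continuous_intros)
  qed
  then have "(\<lambda>A::real^'m^'m. det (\<chi> i j. if j = k then axis l 1 $ i else A $ i $ j) / det A) \<in> borel_measurable borel"
    by measurable
  then show "(\<lambda>A::real^'m^'m. minv A $ k $ l) \<in> borel_measurable borel" by (simp add: minv_def)
qed

lemma AE_det_nonzero: "AE A in lborel. det (A::real^'m^'m) \<noteq> 0"
  using AE_gram_det_nonzero[where 'm='m and 'n='m] by (simp add: gram_det_square)

text \<open>Two evaluations of the integral of \<open>\<Phi>(xA)\<close> against \<open>gauss(x) gvol(x)\<^sup>\<beta> \<bar>det A\<bar>\<^sup>\<alpha>\<close>: substituting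
  in \<open>A\<close> for fixed \<open>x\<close>, and in \<open>x\<close> for fixed \<open>A\<close>. This is the uniqueness argument for relatively invariant
  measures on a homogeneous space of the general linear group.\<close>
lemma relatively_invariant_integral:
  fixes \<Phi> :: "real^'m^'a \<Rightarrow> ennreal" and \<Psi> :: "real^'m^'m \<Rightarrow> ennreal"
  assumes le: "CARD('m) \<le> CARD('a)"
    and [measurable]: "\<Phi> \<in> borel_measurable borel" "\<Psi> \<in> borel_measurable borel"
    and \<Phi>: "\<And>v A. v \<in> stiefel \<Longrightarrow> \<Phi> (v ** A) = \<Psi> A"
  shows "ennreal (sqrt pi ^ DIM(real^'m^'a)) *
      (\<integral>\<^sup>+A. \<Psi> A * ennreal (\<bar>det A\<bar> ^ (CARD('a) + j - CARD('m))) \<partial>lborel)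
    = (\<integral>\<^sup>+A. ennreal (gauss (minv A) / \<bar>det A\<bar> ^ (CARD('a) + CARD('m))) \<partial>(lborel :: (real^'m^'m) measure)) *
      (\<integral>\<^sup>+x. \<Phi> x * ennreal (gvol x ^ j) \<partial>lborel)"
    (is "?c * ?L = ?K * ?R")
proof -
  define \<alpha> where "\<alpha> = CARD('a) + j - CARD('m)"
  \<comment> \<open>The exponents fit the substitution A -> t A: its Jacobian |det t|^m and the
    power \<open>\<alpha>\<close> of |det t| together use up
    \<open>gvol x ^ (CARD('a) + j)\<close>.\<close>
  have \<alpha>: "CARD('a) + j = \<alpha> + CARD('m)" using le by (simp add: \<alpha>_def)
  define Z where "Z = (\<integral>\<^sup>+x. (\<integral>\<^sup>+A. \<Phi> (x ** A) * ennreal (gauss x * \<bar>det A\<bar> ^ \<alpha> * gvol x ^ (CARD('a) + j))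
      \<partial>(lborel :: (real^'m^'m) measure)) \<partial>(lborel :: (real^'m^'a) measure))"
  have "Z = (\<integral>\<^sup>+x. ennreal (gauss x) * ?L \<partial>(lborel :: (real^'m^'a) measure))"
    unfolding Z_def
  proof (rule nn_integral_cong_AE, use AE_gram_det_nonzero[OF le] in eventually_elim)
    fix x :: "real^'m^'a" assume "gram_det x \<noteq> 0"
    then obtain v t where vt: "v \<in> stiefel" "x = v ** t" "det t \<noteq> 0" "gvol x = \<bar>det t\<bar>"
      by (rule full_rank_factor)
    have "(\<integral>\<^sup>+A. \<Phi> (x ** A) * ennreal (gauss x * \<bar>det A\<bar> ^ \<alpha> * gvol x ^ (CARD('a) + j)) \<partial>(lborel :: (real^'m^'m) measure))
       = (\<integral>\<^sup>+A. ennreal (gauss x) * (ennreal (\<bar>det t\<bar> ^ CARD('m)) * (\<Psi> (t ** A) * ennreal (\<bar>det (t ** A)\<bar> ^ \<alpha>))) \<partial>lborel)"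
    proof (rule nn_integral_cong)
      fix A :: "real^'m^'m"
      have e1: "\<Phi> (x ** A) = \<Psi> (t ** A)" using \<Phi>[OF vt(1)] vt(2) by (simp add: matrix_mul_assoc[symmetric])
      have e2: "gauss x * \<bar>det A\<bar> ^ \<alpha> * gvol x ^ (CARD('a) + j) = gauss x * (\<bar>det t\<bar> ^ CARD('m) * \<bar>det (t ** A)\<bar> ^ \<alpha>)"
        unfolding \<alpha> vt(4) by (simp add: det_mul abs_mult power_mult_distrib power_add)
      show "\<Phi> (x ** A) * ennreal (gauss x * \<bar>det A\<bar> ^ \<alpha> * gvol x ^ (CARD('a) + j)) =
          ennreal (gauss x) * (ennreal (\<bar>det t\<bar> ^ CARD('m)) * (\<Psi> (t ** A) * ennreal (\<bar>det (t ** A)\<bar> ^ \<alpha>)))"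
        unfolding e1 e2 by (simp add: ennreal_mult mult_ac)
    qed
    also have "\<dots> = ennreal (gauss x) * (ennreal (\<bar>det t\<bar> ^ CARD('m)) * (\<integral>\<^sup>+A. \<Psi> (t ** A) * ennreal (\<bar>det (t ** A)\<bar> ^ \<alpha>) \<partial>lborel))"
      by (simp add: nn_integral_cmult)
    also have "\<dots> = ennreal (gauss x) * ?L"
      using nn_integral_matrix_mult_left[OF vt(3), of "\<lambda>A. \<Psi> A * ennreal (\<bar>det A\<bar> ^ \<alpha>)"] by (simp add: \<alpha>_def)
    finally show "(\<integral>\<^sup>+A. \<Phi> (x ** A) * ennreal (gauss x * \<bar>det A\<bar> ^ \<alpha> * gvol x ^ (CARD('a) + j)) \<partial>(lborel :: (real^'m^'m) measure))
      = ennreal (gauss x) * ?L" .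
  qed
  also have "\<dots> = ?c * ?L" by (simp add: nn_integral_multc nn_integral_gauss)
  finally have Z1: "Z = ?c * ?L" .
  have "Z = (\<integral>\<^sup>+A. (\<integral>\<^sup>+x. \<Phi> (x ** A) * ennreal (gauss x * \<bar>det A\<bar> ^ \<alpha> * gvol x ^ (CARD('a) + j)) \<partial>lborel) \<partial>lborel)"
    unfolding Z_def by (rule lborel_pair.Fubini') measurable
  \<comment> \<open>Substituting z = x A costs |det A|^(-CARD('a)). What remains under the integral
    over A depends on z only through \<open>gvol z\<close>, as the second exchange of integrals
    shows.\<close>
  also have "\<dots> = (\<integral>\<^sup>+A. (\<integral>\<^sup>+z. \<Phi> z * ennreal (gvol z ^ (CARD('a) + j)) *
      ennreal (gauss (z ** minv A) / \<bar>det A\<bar> ^ (CARD('a) + CARD('m))) \<partial>lborel) \<partial>lborel)"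
  proof (rule nn_integral_cong_AE, use AE_det_nonzero in eventually_elim)
    fix A :: "real^'m^'m" assume A: "det A \<noteq> 0"
    define H where "H z = \<Phi> z * ennreal (gauss (z ** minv A) * \<bar>det A\<bar> ^ \<alpha> * gvol (z ** minv A) ^ (CARD('a) + j))" for z
    have [measurable]: "H \<in> borel_measurable borel" unfolding H_def by measurable
    have "(\<integral>\<^sup>+x. \<Phi> (x ** A) * ennreal (gauss x * \<bar>det A\<bar> ^ \<alpha> * gvol x ^ (CARD('a) + j)) \<partial>lborel) = (\<integral>\<^sup>+x. H (x ** A) \<partial>lborel)"
      unfolding H_def by (simp add: matrix_mul_assoc[symmetric] minv_right[OF A])
    also have "\<dots> = ennreal (1 / \<bar>det A\<bar> ^ CARD('a)) * (ennreal (\<bar>det A\<bar> ^ CARD('a)) * (\<integral>\<^sup>+x. H (x ** A) \<partial>lborel))"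
      using A by (simp add: mult.assoc[symmetric] ennreal_mult[symmetric])
    also have "\<dots> = ennreal (1 / \<bar>det A\<bar> ^ CARD('a)) * (\<integral>\<^sup>+z. H z \<partial>lborel)"
      using A by (subst nn_integral_matrix_mult_right) auto
    also have "\<dots> = (\<integral>\<^sup>+z. ennreal (1 / \<bar>det A\<bar> ^ CARD('a)) * H z \<partial>lborel)"
      by (rule nn_integral_cmult[symmetric]) simp
    also have "\<dots> = (\<integral>\<^sup>+z. \<Phi> z * ennreal (gvol z ^ (CARD('a) + j)) *
      ennreal (gauss (z ** minv A) / \<bar>det A\<bar> ^ (CARD('a) + CARD('m))) \<partial>lborel)"
    proof (rule nn_integral_cong)
      fix z :: "real^'m^'a"
      have "1 / \<bar>det A\<bar> ^ CARD('a) * (gauss (z ** minv A) * \<bar>det A\<bar> ^ \<alpha> * gvol (z ** minv A) ^ (CARD('a) + j))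
        = gvol z ^ (CARD('a) + j) * (gauss (z ** minv A) / \<bar>det A\<bar> ^ (CARD('a) + CARD('m)))"
        unfolding \<alpha> using A by (simp add: gvol_mult_right det_minv power_mult_distrib power_add power_divide)
      then show "ennreal (1 / \<bar>det A\<bar> ^ CARD('a)) * H z = \<Phi> z * ennreal (gvol z ^ (CARD('a) + j)) *
        ennreal (gauss (z ** minv A) / \<bar>det A\<bar> ^ (CARD('a) + CARD('m)))"
        unfolding H_def mult.left_commute[of "ennreal (1 / _)"] mult.assoc
        by (subst (1 2) ennreal_mult[symmetric]) (simp_all add: mult.assoc)
    qed
    finally show "(\<integral>\<^sup>+x. \<Phi> (x ** A) * ennreal (gauss x * \<bar>det A\<bar> ^ \<alpha> * gvol x ^ (CARD('a) + j)) \<partial>lborel) =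
      (\<integral>\<^sup>+z. \<Phi> z * ennreal (gvol z ^ (CARD('a) + j)) *
      ennreal (gauss (z ** minv A) / \<bar>det A\<bar> ^ (CARD('a) + CARD('m))) \<partial>lborel)" .
  qed
  also have "\<dots> = (\<integral>\<^sup>+z. (\<integral>\<^sup>+A. \<Phi> z * ennreal (gvol z ^ (CARD('a) + j)) *
      ennreal (gauss (z ** minv A) / \<bar>det A\<bar> ^ (CARD('a) + CARD('m))) \<partial>lborel) \<partial>lborel)"
    by (rule lborel_pair.Fubini') measurable
  also have "\<dots> = (\<integral>\<^sup>+z. \<Phi> z * ennreal (gvol z ^ j) * ?K \<partial>lborel)"
  proof (rule nn_integral_cong_AE, use AE_gram_det_nonzero[OF le] in eventually_elim)
    fix z :: "real^'m^'a" assume "gram_det z \<noteq> 0"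
    then obtain v t where vt: "v \<in> stiefel" "z = v ** t" "det t \<noteq> 0" "gvol z = \<bar>det t\<bar>"
      by (rule full_rank_factor)
    define Q where "Q A = ennreal (gauss (t ** minv A) / \<bar>det A\<bar> ^ (CARD('a) + CARD('m)))" for A
    have [measurable]: "Q \<in> borel_measurable borel" unfolding Q_def by measurable
    have g: "gauss (z ** minv A) = gauss (t ** minv A)" for A
      by (simp add: vt(2) matrix_mul_assoc[symmetric] gauss_mult_left[OF vt(1)])
    have "(\<integral>\<^sup>+A. Q A \<partial>lborel) = ennreal (\<bar>det t\<bar> ^ CARD('m)) * (\<integral>\<^sup>+A. Q (A ** t) \<partial>lborel)"
      by (rule nn_integral_matrix_mult_right[symmetric, OF vt(3)]) measurable
    also have "(\<integral>\<^sup>+A. Q (A ** t) \<partial>lborel) = (\<integral>\<^sup>+A. ennreal (1 / \<bar>det t\<bar> ^ (CARD('a) + CARD('m))) *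
        ennreal (gauss (minv A) / \<bar>det A\<bar> ^ (CARD('a) + CARD('m))) \<partial>(lborel :: (real^'m^'m) measure))"
    proof (rule nn_integral_cong_AE, use AE_det_nonzero in eventually_elim)
      fix A :: "real^'m^'m" assume A: "det A \<noteq> 0"
      have "t ** minv (A ** t) = minv A"
        by (simp add: minv_mult A vt(3) matrix_mul_assoc minv_right)
      then show "Q (A ** t) = ennreal (1 / \<bar>det t\<bar> ^ (CARD('a) + CARD('m))) *
        ennreal (gauss (minv A) / \<bar>det A\<bar> ^ (CARD('a) + CARD('m)))"
        unfolding Q_def by (simp add: det_mul abs_mult power_mult_distrib ennreal_mult[symmetric] mult.commute)
    qed
    also have "\<dots> = ennreal (1 / \<bar>det t\<bar> ^ (CARD('a) + CARD('m))) * ?K"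
      by (rule nn_integral_cmult) measurable
    finally have Q: "(\<integral>\<^sup>+A. Q A \<partial>lborel) = ennreal (\<bar>det t\<bar> ^ CARD('m)) * (ennreal (1 / \<bar>det t\<bar> ^ (CARD('a) + CARD('m))) * ?K)" .
    have "(\<integral>\<^sup>+A. \<Phi> z * ennreal (gvol z ^ (CARD('a) + j)) *
      ennreal (gauss (z ** minv A) / \<bar>det A\<bar> ^ (CARD('a) + CARD('m))) \<partial>lborel)
      = \<Phi> z * ennreal (gvol z ^ (CARD('a) + j)) * (\<integral>\<^sup>+A. Q A \<partial>lborel)"
      unfolding g Q_def by (rule nn_integral_cmult) measurable
    also have "\<dots> = \<Phi> z * (ennreal (gvol z ^ (CARD('a) + j)) * ennreal (\<bar>det t\<bar> ^ CARD('m)) *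
        ennreal (1 / \<bar>det t\<bar> ^ (CARD('a) + CARD('m)))) * ?K"
      unfolding Q by (simp add: mult_ac)
    also have "ennreal (gvol z ^ (CARD('a) + j)) * ennreal (\<bar>det t\<bar> ^ CARD('m)) *
        ennreal (1 / \<bar>det t\<bar> ^ (CARD('a) + CARD('m))) = ennreal (gvol z ^ j)"
      unfolding vt(4) using vt(3) by (simp add: ennreal_mult[symmetric] power_add)
    finally show "(\<integral>\<^sup>+A. \<Phi> z * ennreal (gvol z ^ (CARD('a) + j)) *
      ennreal (gauss (z ** minv A) / \<bar>det A\<bar> ^ (CARD('a) + CARD('m))) \<partial>lborel) = \<Phi> z * ennreal (gvol z ^ j) * ?K" .
  qed
  also have "\<dots> = ?K * ?R" by (simp add: nn_integral_multc mult.commute)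
  finally show ?thesis using Z1 by simp
qed

lemma measurable_haar_snd [measurable]: "snd \<in> borel_measurable (M \<Otimes>\<^sub>M (haar :: (real^'n^'n) measure))"
  by (rule measurable_compose[OF measurable_snd measurable_stiefel_borel_ident[OF sets_haar]])

lemma measurable_haar_fst [measurable]: "fst \<in> borel_measurable ((haar :: (real^'n^'n) measure) \<Otimes>\<^sub>M M)"
  by (rule measurable_compose[OF measurable_fst measurable_stiefel_borel_ident[OF sets_haar]])

lemma sigma_finite_haar: "sigma_finite_measure (haar :: (real^'n^'n) measure)"
  using prob_space_haar prob_space_imp_sigma_finite by blast

lemma borel_measurable_haar_average [measurable]:
  fixes F :: "real^'m^'n \<Rightarrow> ennreal" and w :: "real^'m^'k \<Rightarrow> real^'m^'n"
  assumes [measurable]: "F \<in> borel_measurable borel" "w \<in> borel_measurable borel"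
  shows "(\<lambda>x. \<integral>\<^sup>+g. F (g ** w x) \<partial>haar) \<in> borel_measurable borel"
proof -
  interpret sigma_finite_measure "haar :: (real^'n^'n) measure" by (rule sigma_finite_haar)
  show ?thesis by (rule borel_measurable_nn_integral) (simp add: case_prod_unfold)
qed

lemma nn_integral_haar_average:
  fixes F :: "real^'m^'n \<Rightarrow> ennreal"
  assumes [measurable]: "F \<in> borel_measurable borel"
  shows "(\<integral>\<^sup>+x. F x \<partial>lborel) = (\<integral>\<^sup>+x. (\<integral>\<^sup>+g. F (g ** x) \<partial>haar) \<partial>lborel)"
proof -
  interpret H: prob_space "haar :: (real^'n^'n) measure" by (rule prob_space_haar)
  interpret P: pair_sigma_finite "haar :: (real^'n^'n) measure" "lborel :: (real^'m^'n) measure" ..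
  have "(\<integral>\<^sup>+x. F x \<partial>lborel) = (\<integral>\<^sup>+g. (\<integral>\<^sup>+x. F x \<partial>lborel) \<partial>(haar :: (real^'n^'n) measure))"
    using H.emeasure_space_1 by simp
  also have "\<dots> = (\<integral>\<^sup>+g. (\<integral>\<^sup>+x. F (g ** x) \<partial>lborel) \<partial>(haar :: (real^'n^'n) measure))"
  proof (rule nn_integral_cong)
    fix g :: "real^'n^'n" assume "g \<in> space haar"
    then have "\<bar>det g\<bar> = 1" by (simp add: abs_det_stiefel)
    then show "(\<integral>\<^sup>+x. F x \<partial>lborel) = (\<integral>\<^sup>+x. F (g ** x) \<partial>lborel)"
      using nn_integral_matrix_mult_left[of g F] by force
  qed
  also have "\<dots> = (\<integral>\<^sup>+x. (\<integral>\<^sup>+g. F (g ** x) \<partial>haar) \<partial>lborel)"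
    by (rule P.Fubini'[symmetric]) (simp add: case_prod_unfold)
  finally show ?thesis .
qed

text \<open>The average over the group forgets which frame was used. This supplies the hypothesis on
  \<open>\<Phi>\<close> and \<open>\<Psi>\<close> in
  \<open>relatively_invariant_integral\<close>.\<close>

lemma haar_average_stiefel:
  fixes F :: "real^'m^'n \<Rightarrow> ennreal" and v w :: "real^'k^'n"
  assumes [measurable]: "F \<in> borel_measurable borel" and v: "v \<in> stiefel" and w: "w \<in> stiefel"
  shows "(\<integral>\<^sup>+g. F (g ** (v ** A)) \<partial>haar) = (\<integral>\<^sup>+g. F (g ** (w ** A)) \<partial>haar)"
proof -
  obtain h :: "real^'n^'n" where h: "h \<in> stiefel" "h ** v = w" using stiefel_transitive[OF v w] .
  have "(\<integral>\<^sup>+g. F (g ** (w ** A)) \<partial>haar) = (\<integral>\<^sup>+g. F ((g ** h) ** (v ** A)) \<partial>haar)"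
    by (simp add: h(2)[symmetric] matrix_mul_assoc)
  also have "\<dots> = (\<integral>\<^sup>+g. F (g ** (v ** A)) \<partial>haar)"
    by (rule nn_integral_haar_right[of "\<lambda>g. F (g ** (v ** A))"]) (use h in auto)
  finally show ?thesis by simp
qed

section \<open>Growth of \<open>gvol\<close>, Gaussian moments and polar coordinates\<close>

lemma gvol_scaleR: "gvol (c *\<^sub>R (x::real^'m^'n)) = \<bar>c\<bar> ^ CARD('m) * gvol x"
proof -
  have "c *\<^sub>R x = x ** (c *\<^sub>R mat 1)"
    by (simp add: vec_eq_iff matrix_matrix_mult_def mat_def if_distrib cong: if_cong)
  moreover have "det (c *\<^sub>R (mat 1 :: real^'m^'m)) = c ^ CARD('m)"
    by (subst det_diagonal) (auto simp: mat_def)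
  ultimately show ?thesis by (simp add: gvol_mult_right power_abs)
qed

lemma continuous_on_gvol: "continuous_on S (gvol :: real^'m^'n \<Rightarrow> real)"
  unfolding gvol_def by (intro continuous_intros)

text \<open>\<open>gvol\<close> is homogeneous of degree m, and it is bounded on the compact unit
  sphere.\<close>

lemma gvol_bound:
  obtains C where "C > 0" "\<And>x::real^'m^'n. gvol x \<le> C * norm x ^ CARD('m)"
proof -
  have "compact (sphere (0::real^'m^'n) 1)" by simp
  then have "bounded (gvol ` sphere (0::real^'m^'n) 1)"
    by (intro compact_imp_bounded compact_continuous_image continuous_on_gvol)
  then obtain C where C: "C > 0" "\<And>x::real^'m^'n. norm x = 1 \<Longrightarrow> gvol x \<le> C"
    by (auto simp: bounded_pos)
  have "gvol x \<le> C * norm x ^ CARD('m)" for x :: "real^'m^'n"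
  proof (cases "x = 0")
    case True
    then show ?thesis using gvol_scaleR[of 0 x] by (simp add: zero_power gvol_def)
  next
    case False
    have "gvol x = gvol (norm x *\<^sub>R (x /\<^sub>R norm x))" using False by simp
    also have "\<dots> = norm x ^ CARD('m) * gvol (x /\<^sub>R norm x)" by (subst gvol_scaleR) simp
    also have "\<dots> \<le> norm x ^ CARD('m) * C" using False C by (intro mult_left_mono C) auto
    finally show ?thesis by (simp add: mult.commute)
  qed
  then show ?thesis using C that by blast
qed

lemma power_le_fact_mult_exp: "0 \<le> (s::real) \<Longrightarrow> s ^ n \<le> fact n * exp s"
proof -
  assume s: "0 \<le> s"
  have "(\<Sum>k\<in>{n}. s ^ k /\<^sub>R fact k) \<le> (\<Sum>k. s ^ k /\<^sub>R fact k)"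
    using s by (intro sum_le_suminf summable_exp_generic) auto
  then show ?thesis by (simp add: exp_def field_simps)
qed

text \<open>The Gaussian splits into exp (-3/4 |x|^2), which absorbs every power of the norm, and
  \<open>gauss (x /\<^sub>R 2)\<close>, which is still integrable.\<close>

lemma power_mult_gauss_bound: "\<exists>C. \<forall>x::'a::euclidean_space. norm x ^ N * gauss x \<le> C * gauss (x /\<^sub>R 2)"
proof (intro exI allI)
  fix x :: 'a
  define t where "t = norm x"
  define s where "s = 3 * t\<^sup>2 / 4"
  have t: "t \<ge> 0" "s \<ge> 0" "t\<^sup>2 = 4 / 3 * s" by (auto simp: t_def s_def)
  have "t ^ N \<le> 1 + (t\<^sup>2) ^ N"
  proof (cases "t \<le> 1")
    case True
    then show ?thesis using t power_le_one[of t N] by (smt (verit) zero_le_power zero_le_power2)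
  next
    case False
    then have "t ^ N \<le> t ^ (2 * N)" by (intro power_increasing) auto
    then show ?thesis by (simp add: power_mult)
  qed
  also have "\<dots> \<le> exp s + (4 / 3) ^ N * (fact N * exp s)"
    unfolding t(3) power_mult_distrib using t(2) power_le_fact_mult_exp[of s N]
    by (intro add_mono mult_left_mono) auto
  finally have "t ^ N \<le> (1 + (4 / 3) ^ N * fact N) * exp s" by (simp add: algebra_simps)
  then have "t ^ N * exp (- t\<^sup>2) \<le> (1 + (4 / 3) ^ N * fact N) * exp s * exp (- t\<^sup>2)"
    by (rule mult_right_mono) simp
  also have "\<dots> = (1 + (4 / 3) ^ N * fact N) * exp (- (t/2)\<^sup>2)"
  proof -
    have "exp s * exp (- t\<^sup>2) = exp (- (t/2)\<^sup>2)"
    proof -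
      have "s + - t\<^sup>2 = - (t / 2)\<^sup>2" unfolding s_def power_divide by simp
      then show ?thesis by (simp only: exp_add[symmetric])
    qed
    then show ?thesis by (simp only: mult.assoc)
  qed
  finally show "norm x ^ N * gauss x \<le> (1 + (4 / 3) ^ N * fact N) * gauss (x /\<^sub>R 2)"
  proof -
    have "norm (x /\<^sub>R 2) = t / 2" by (simp add: t_def)
    then have "gauss (x /\<^sub>R 2) = exp (- (t/2)\<^sup>2)" by (simp only: gauss_def)
    moreover assume "t ^ N * exp (- t\<^sup>2) \<le> (1 + (4 / 3) ^ N * fact N) * exp (- (t/2)\<^sup>2)"
    ultimately show ?thesis by (simp only: gauss_def[of x] t_def[symmetric])
  qed
qed

lemma nn_integral_gauss_half: "(\<integral>\<^sup>+x. ennreal (gauss (x /\<^sub>R 2)) \<partial>(lborel :: 'a::euclidean_space measure)) < \<infinity>"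
proof -
  have "(\<integral>\<^sup>+x. ennreal (gauss (x /\<^sub>R 2)) \<partial>(lborel :: 'a measure))
     = (\<integral>\<^sup>+x. ennreal (gauss (x /\<^sub>R 2)) \<partial>density (distr lborel borel (\<lambda>x::'a. 0 + 2 *\<^sub>R x)) (\<lambda>_. ennreal (\<bar>2\<bar> ^ DIM('a))))"
    by (subst lborel_affine[of 2 "0::'a"]) simp_all
  also have "\<dots> = (\<integral>\<^sup>+x. ennreal (2 ^ DIM('a)) * ennreal (gauss (x::'a)) \<partial>lborel)"
    by (subst nn_integral_density) (simp_all add: nn_integral_distr nn_integral_cmult)
  also have "\<dots> = ennreal (2 ^ DIM('a)) * ennreal (sqrt pi ^ DIM('a))"
    by (simp add: nn_integral_cmult nn_integral_gauss)
  also have "\<dots> = ennreal (2 ^ DIM('a) * sqrt pi ^ DIM('a))" by (rule ennreal_mult[symmetric]) auto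
  also have "\<dots> < \<infinity>" by simp
  finally show ?thesis .
qed

lemma nn_integral_gauss_power: "(\<integral>\<^sup>+x. ennreal (gauss x * norm x ^ N) \<partial>(lborel :: 'a::euclidean_space measure)) < \<infinity>"
proof -
  obtain C where C: "\<And>x::'a. norm x ^ N * gauss x \<le> C * gauss (x /\<^sub>R 2)" using power_mult_gauss_bound by blast
  have "(\<integral>\<^sup>+x. ennreal (gauss x * norm x ^ N) \<partial>(lborel :: 'a measure)) \<le> (\<integral>\<^sup>+x. ennreal \<bar>C\<bar> * ennreal (gauss (x /\<^sub>R 2)) \<partial>(lborel :: 'a measure))"
  proof (rule nn_integral_mono)
    fix x :: 'a
    have "gauss x * norm x ^ N \<le> \<bar>C\<bar> * gauss (x /\<^sub>R 2)"
      using C[of x] mult_right_mono[OF abs_ge_self[of C] gauss_nonneg[of "x /\<^sub>R 2"]] by (simp add: mult.commute)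
    then show "ennreal (gauss x * norm x ^ N) \<le> ennreal \<bar>C\<bar> * ennreal (gauss (x /\<^sub>R 2))"
      by (simp add: ennreal_mult[symmetric] ennreal_leI)
  qed
  also have "\<dots> < \<infinity>" using nn_integral_gauss_half[where 'a='a]
    by (simp add: nn_integral_cmult ennreal_mult_less_top)
  finally show ?thesis .
qed

text \<open>The dimensions are passed as types, because the integral ranges over the matrix space
  they index. These moments normalise polar coordinates.\<close>

definition gauss_moment :: "'a::finite itself \<Rightarrow> 'm::finite itself \<Rightarrow> nat \<Rightarrow> real" where
  "gauss_moment _ _ j = integral\<^sup>L lborel (\<lambda>x::real^'m^'a. gauss x * gvol x ^ j)"

lemma integrable_gauss_moment: "integrable lborel (\<lambda>x::real^'m^'a. gauss x * gvol x ^ j)"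
proof (rule integrableI_bounded)
  obtain C where C: "C > 0" "\<And>x::real^'m^'a. gvol x \<le> C * norm x ^ CARD('m)" using gvol_bound[where 'm='m and 'n='a] by blast
  have "(\<integral>\<^sup>+x. ennreal (norm (gauss x * gvol x ^ j)) \<partial>(lborel::(real^'m^'a) measure)) \<le>
     (\<integral>\<^sup>+x. ennreal (C ^ j) * ennreal (gauss x * norm x ^ (CARD('m) * j)) \<partial>(lborel::(real^'m^'a) measure))"
  proof (rule nn_integral_mono)
    fix x :: "real^'m^'a"
    have "gvol x ^ j \<le> (C * norm x ^ CARD('m)) ^ j" using C(2) by (intro power_mono) auto
    then have "gvol x ^ j \<le> C ^ j * norm x ^ (CARD('m) * j)" by (simp add: power_mult_distrib power_mult)
    then have "gauss x * gvol x ^ j \<le> gauss x * (C ^ j * norm x ^ (CARD('m) * j))" by (rule mult_left_mono) simp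
    then have "gauss x * gvol x ^ j \<le> C ^ j * (gauss x * norm x ^ (CARD('m) * j))" by (simp only: mult.left_commute)
    then show "ennreal (norm (gauss x * gvol x ^ j)) \<le> ennreal (C ^ j) * ennreal (gauss x * norm x ^ (CARD('m) * j))"
      using C(1) by (subst ennreal_mult[symmetric]) (auto simp: abs_mult intro!: ennreal_leI)
  qed
  also have "\<dots> < \<infinity>" using nn_integral_gauss_power[where 'a="real^'m^'a"] by (simp add: nn_integral_cmult ennreal_mult_less_top)
  finally show "(\<integral>\<^sup>+x. ennreal (norm (gauss x * gvol x ^ j)) \<partial>(lborel::(real^'m^'a) measure)) < \<infinity>" .
qed simp

lemma nn_integral_gauss_moment:
  "(\<integral>\<^sup>+x. ennreal (gauss x * gvol x ^ j) \<partial>(lborel::(real^'m^'a) measure)) = ennreal (gauss_moment TYPE('a) TYPE('m) j)"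
  unfolding gauss_moment_def by (rule nn_integral_eq_integral[OF integrable_gauss_moment]) simp

lemma gauss_moment_pos:
  assumes le: "CARD('m) \<le> CARD('a)"
  shows "gauss_moment TYPE('a::finite) TYPE('m::finite) j > 0"
proof -
  have "gauss_moment TYPE('a) TYPE('m) j \<noteq> 0"
  proof
    assume "gauss_moment TYPE('a) TYPE('m) j = 0"
    then have "AE x::real^'m^'a in lborel. gauss x * gvol x ^ j = 0"
      unfolding gauss_moment_def
      by (subst (asm) integral_nonneg_eq_0_iff_AE[OF integrable_gauss_moment]) auto
    then have "AE x::real^'m^'a in lborel. False"
      using AE_gram_det_nonzero[OF le] by eventually_elim (simp add: gauss_pos[THEN less_imp_neq, symmetric])
    then show False by (simp add: eventually_False ae_filter_eq_bot_iff)
  qed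
  moreover have "gauss_moment TYPE('a) TYPE('m) j \<ge> 0"
    unfolding gauss_moment_def by (intro integral_nonneg_AE) auto
  ultimately show ?thesis by simp
qed

text \<open>The analogue of polar coordinates with \<open>k\<close>-frames in place of unit vectors.\<close>
theorem polar_integration:
  fixes F :: "real^'m^'a \<Rightarrow> ennreal" and u :: "real^'k^'a"
  assumes le: "CARD('m) \<le> CARD('k)" "CARD('k) \<le> CARD('a)"
    and F[measurable]: "F \<in> borel_measurable borel" and u: "u \<in> stiefel"
  shows "ennreal (gauss_moment TYPE('k) TYPE('m) (CARD('a) - CARD('k))) * (\<integral>\<^sup>+x. F x \<partial>lborel) =
    ennreal (sqrt pi ^ DIM(real^'m^'a)) *
    (\<integral>\<^sup>+y. (\<integral>\<^sup>+g. F (g ** (u ** y)) \<partial>haar) * ennreal (gvol y ^ (CARD('a) - CARD('k))) \<partial>(lborel :: (real^'m^'k) measure))"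
proof -
  define j where "j = CARD('a) - CARD('k)"
  define \<alpha> where "\<alpha> = CARD('a) - CARD('m)"
  obtain w :: "real^'m^'k" where w: "w \<in> stiefel" using stiefel_nonempty[OF le(1)] by auto
  define c where "c n = ennreal (sqrt pi ^ (n * CARD('m)))" for n
  define K where "K n = (\<integral>\<^sup>+A. ennreal (gauss (minv A) / \<bar>det A\<bar> ^ (n + CARD('m))) \<partial>(lborel :: (real^'m^'m) measure))" for n
  have c: "c n \<noteq> 0" "c n \<noteq> \<top>" for n by (auto simp: c_def)
  \<comment> \<open>\<open>relatively_invariant_integral\<close> is applied twice: to matrices with
    CARD('a) rows and weight exponent 0, and in B to matrices with CARD('k) rows and weight exponent
    j. Both times the same integral over A appears, with exponent \<open>\<alpha>\<close>, and it is
    eliminated in AB.\<close>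
  have A: "c CARD('a) * (\<integral>\<^sup>+A. (\<integral>\<^sup>+g. F (g ** (u ** w ** A)) \<partial>haar) * ennreal (\<bar>det A\<bar> ^ \<alpha>) \<partial>lborel)
     = K CARD('a) * (\<integral>\<^sup>+x. F x \<partial>lborel)" if F[measurable]: "F \<in> borel_measurable borel" for F :: "real^'m^'a \<Rightarrow> ennreal"
  proof -
    have "c CARD('a) * (\<integral>\<^sup>+A. (\<integral>\<^sup>+g. F (g ** (u ** w ** A)) \<partial>haar) * ennreal (\<bar>det A\<bar> ^ \<alpha>) \<partial>lborel)
      = K CARD('a) * (\<integral>\<^sup>+x. (\<integral>\<^sup>+g. F (g ** x) \<partial>haar) * ennreal (gvol x ^ 0) \<partial>lborel)"
      using relatively_invariant_integral[of "\<lambda>x. \<integral>\<^sup>+g. F (g ** x) \<partial>haar" "\<lambda>A. \<integral>\<^sup>+g. F (g ** (u ** w ** A)) \<partial>haar" 0]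
        haar_average_stiefel[OF F _ stiefel_mult[OF u w]] le
      by (simp add: c_def K_def \<alpha>_def)
    then show ?thesis using nn_integral_haar_average[OF F] by simp
  qed
  have B: "c CARD('k) * (\<integral>\<^sup>+A. (\<integral>\<^sup>+g. F (g ** (u ** w ** A)) \<partial>haar) * ennreal (\<bar>det A\<bar> ^ \<alpha>) \<partial>lborel)
     = K CARD('k) * (\<integral>\<^sup>+y. (\<integral>\<^sup>+g. F (g ** (u ** y)) \<partial>haar) * ennreal (gvol y ^ j) \<partial>(lborel :: (real^'m^'k) measure))"
    if F[measurable]: "F \<in> borel_measurable borel" for F :: "real^'m^'a \<Rightarrow> ennreal"
  proof -
    have "(\<integral>\<^sup>+g. F (g ** (u ** (v ** A))) \<partial>haar) = (\<integral>\<^sup>+g. F (g ** (u ** w ** A)) \<partial>haar)"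
      if v: "v \<in> stiefel" for v :: "real^'m^'k" and A
      using haar_average_stiefel[OF F stiefel_mult[OF u v] stiefel_mult[OF u w]] by (simp add: matrix_mul_assoc)
    moreover have "CARD('k) + j - CARD('m) = \<alpha>" using le by (simp add: j_def \<alpha>_def)
    ultimately show ?thesis
      using relatively_invariant_integral[of "\<lambda>y::real^'m^'k. \<integral>\<^sup>+g. F (g ** (u ** y)) \<partial>haar" "\<lambda>A. \<integral>\<^sup>+g. F (g ** (u ** w ** A)) \<partial>haar" j] le
      by (simp add: c_def K_def)
  qed
  have AB: "c CARD('k) * K CARD('a) * (\<integral>\<^sup>+x. F x \<partial>lborel) = c CARD('a) * K CARD('k) *
     (\<integral>\<^sup>+y. (\<integral>\<^sup>+g. F (g ** (u ** y)) \<partial>haar) * ennreal (gvol y ^ j) \<partial>(lborel :: (real^'m^'k) measure))"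
    if "F \<in> borel_measurable borel" for F :: "real^'m^'a \<Rightarrow> ennreal"
    unfolding mult.assoc A[OF that, symmetric] B[OF that, symmetric] by (rule mult.left_commute)
  interpret H: prob_space "haar :: (real^'a^'a) measure" by (rule prob_space_haar)
  have gy: "(\<integral>\<^sup>+g. ennreal (gauss (g ** (u ** y))) \<partial>haar) = ennreal (gauss y)" for y :: "real^'m^'k"
  proof -
    have "(\<integral>\<^sup>+g. ennreal (gauss (g ** (u ** y))) \<partial>haar) = (\<integral>\<^sup>+g. ennreal (gauss y) \<partial>(haar :: (real^'a^'a) measure))"
      by (intro nn_integral_cong) (simp add: gauss_mult_left u)
    then show ?thesis using H.emeasure_space_1 by simp
  qed
  define G where "G = gauss_moment TYPE('k) TYPE('m) j"
  have G: "G > 0" unfolding G_def by (rule gauss_moment_pos[OF le(1)])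
  \<comment> \<open>For the Gaussian both integrals are known, because it does not see g and u. This
    determines the ratio of the two constants K.\<close>
  have e1: "c CARD('k) * K CARD('a) * c CARD('a) = c CARD('a) * K CARD('k) * ennreal G"
    using AB[of "\<lambda>x. ennreal (gauss x)"]
    by (simp add: gy nn_integral_gauss ennreal_mult[symmetric] nn_integral_gauss_moment G_def c_def)
  \<comment> \<open>Cancelling K in \<open>ennreal\<close> requires it to be finite and nonzero;
    evaluation of B at the Gaussian shows both.\<close>
  have Kk: "K CARD('k) \<noteq> \<top> \<and> K CARD('k) \<noteq> 0"
  proof -
    obtain v0 :: "real^'m^'m" where v0: "v0 = mat 1" by simp
    have "c CARD('k) * (\<integral>\<^sup>+A. ennreal (gauss A) * ennreal (\<bar>det A\<bar> ^ \<alpha>) \<partial>(lborel :: (real^'m^'m) measure)) = K CARD('k) * ennreal G"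
      using B[of "\<lambda>x. ennreal (gauss x)"]
      by (simp add: gy ennreal_mult[symmetric] nn_integral_gauss_moment G_def matrix_mul_assoc[symmetric] gauss_mult_left[OF w])
    then have e: "c CARD('k) * ennreal (gauss_moment TYPE('m) TYPE('m) \<alpha>) = K CARD('k) * ennreal G"
      using nn_integral_gauss_moment[where 'a='m and 'm='m, of \<alpha>] by (simp add: gvol_square ennreal_mult[symmetric])
    have "gauss_moment TYPE('m) TYPE('m) \<alpha> > 0" by (rule gauss_moment_pos) simp
    with e G c[of "CARD('k)"] show ?thesis
      by (auto simp: ennreal_mult_eq_top_iff ennreal_eq_0_iff)
  qed
  have e2: "c CARD('k) * K CARD('a) = K CARD('k) * ennreal G"
  proof -
    have "c CARD('a) * (c CARD('k) * K CARD('a)) = c CARD('a) * (K CARD('k) * ennreal G)"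
      using e1 by (simp only: mult_ac)
    then show ?thesis using c[of "CARD('a)"] by (simp only: ennreal_mult_cancel_left) simp
  qed
  define R where "R = (\<integral>\<^sup>+y. (\<integral>\<^sup>+g. F (g ** (u ** y)) \<partial>haar) * ennreal (gvol y ^ j) \<partial>(lborel :: (real^'m^'k) measure))"
  have "K CARD('k) * (ennreal G * (\<integral>\<^sup>+x. F x \<partial>lborel)) = K CARD('k) * (c CARD('a) * R)"
    using AB[OF F] unfolding e2 R_def by (simp add: mult_ac)
  then have "ennreal G * (\<integral>\<^sup>+x. F x \<partial>lborel) = c CARD('a) * R"
    using Kk by (simp add: ennreal_mult_cancel_left)
  then show ?thesis by (simp add: G_def R_def j_def c_def)
qed

section \<open>Gaussian moments of Gram determinants\<close>

lemma lborel_integral_translate: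
  fixes f :: "'a::euclidean_space \<Rightarrow> 'b::{banach, second_countable_topology}"
  assumes "f \<in> borel_measurable borel"
  shows "integral\<^sup>L lborel (\<lambda>x. f (x + b)) = integral\<^sup>L lborel f"
    and "integrable lborel (\<lambda>x. f (x + b)) \<longleftrightarrow> integrable lborel f"
proof -
  have eq: "lborel = distr lborel borel ((+) b)" by (simp add: lborel_distr_plus)
  have "integral\<^sup>L lborel f = integral\<^sup>L (distr lborel borel ((+) b)) f" using eq by simp
  also have "\<dots> = integral\<^sup>L lborel (\<lambda>x. f (b + x))" by (rule integral_distr) (use assms in auto)
  finally show "integral\<^sup>L lborel (\<lambda>x. f (x + b)) = integral\<^sup>L lborel f" by (simp add: add.commute)
  have "integrable lborel f \<longleftrightarrow> integrable (distr lborel borel ((+) b)) f" using eq by simp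
  also have "\<dots> \<longleftrightarrow> integrable lborel (\<lambda>x. f (b + x))" by (rule integrable_distr_eq) (use assms in auto)
  finally show "integrable lborel (\<lambda>x. f (x + b)) \<longleftrightarrow> integrable lborel f" by (simp add: add.commute)
qed

text \<open>The integral of F (x + b) - F x vanishes by translation invariance. By the fundamental
  theorem it is also the integral of F' (x + t b) over x and 0 <= t <= 1, which is the integral of
  F' for the same reason.\<close>

lemma integral_directional_derivative:
  fixes F F' :: "'a::euclidean_space \<Rightarrow> 'c::euclidean_space"
  assumes deriv: "\<And>x. ((\<lambda>t. F (x + t *\<^sub>R b)) has_vector_derivative F' x) (at 0)"
    and F: "integrable lborel F" and F': "integrable lborel F'" and cont: "continuous_on UNIV F'"
  shows "integral\<^sup>L lborel F' = 0"
proof -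
  have [measurable]: "F \<in> borel_measurable borel" "F' \<in> borel_measurable borel" using F F' by auto
  have ftc: "(\<integral>t. indicator {0..1} t *\<^sub>R F' (x + t *\<^sub>R b) \<partial>lborel) = F (x + b) - F x" for x
  proof -
    have "((\<lambda>t. F (x + t *\<^sub>R b)) has_vector_derivative F' (x + t *\<^sub>R b)) (at t within {0..1})" for t
    proof -
      have "((\<lambda>s. F (x + t *\<^sub>R b + s *\<^sub>R b)) has_vector_derivative F' (x + t *\<^sub>R b)) (at (t - t))" using deriv by simp
      then have "((\<lambda>s. F (x + t *\<^sub>R b + s *\<^sub>R b)) \<circ> (\<lambda>r. r - t) has_vector_derivative 1 *\<^sub>R F' (x + t *\<^sub>R b)) (at t)"
        by (intro vector_diff_chain_at) (auto intro!: derivative_eq_intros)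
      then have "((\<lambda>r. F (x + r *\<^sub>R b)) has_vector_derivative F' (x + t *\<^sub>R b)) (at t)"
        by (simp add: o_def algebra_simps)
      then show ?thesis by (rule has_vector_derivative_at_within)
    qed
    then have "(\<integral>t. indicator {0..1} t *\<^sub>R F' (x + t *\<^sub>R b) \<partial>lborel) = F (x + 1 *\<^sub>R b) - F (x + 0 *\<^sub>R b)"
      by (intro integral_FTC_atLeastAtMost)
         (auto intro!: continuous_on_compose2[OF cont] continuous_intros)
    then show ?thesis by simp
  qed
  have int: "integrable (lborel \<Otimes>\<^sub>M lborel) (\<lambda>(t::real, x). indicator {0..1} t *\<^sub>R F' (x + t *\<^sub>R b))"
  proof (rule lborel_pair.Fubini_integrable)
    show "integrable lborel (\<lambda>t. \<integral>x. norm (case (t, x) of (t::real, x) \<Rightarrow> indicator {0..1} t *\<^sub>R F' (x + t *\<^sub>R b)) \<partial>lborel)"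
      using lborel_integral_translate(1)[of "\<lambda>x. norm (F' x)"]
      by (simp add: integrable_mult_indicator)
    show "AE t in lborel. integrable lborel (\<lambda>x. case (t, x) of (t::real, x) \<Rightarrow> indicator {0..1} t *\<^sub>R F' (x + t *\<^sub>R b))"
      using F' lborel_integral_translate(2)[of F'] by simp
  qed measurable
  have "(\<integral>x. F (x + b) - F x \<partial>lborel) = (\<integral>x. (\<integral>t. indicator {0..1} t *\<^sub>R F' (x + t *\<^sub>R b) \<partial>lborel) \<partial>lborel)"
    by (simp add: ftc)
  also have "\<dots> = (\<integral>t. (\<integral>x. indicator {0..1} t *\<^sub>R F' (x + t *\<^sub>R b) \<partial>lborel) \<partial>lborel)"
    by (rule lborel_pair.Fubini_integral[OF int])
  also have "\<dots> = (\<integral>t. indicator {0..1::real} t *\<^sub>R integral\<^sup>L lborel F' \<partial>lborel)"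
    using lborel_integral_translate(1)[of F'] by simp
  also have "\<dots> = integral\<^sup>L lborel F'" by simp
  also have "(\<integral>x. F (x + b) - F x \<partial>lborel) = 0"
    using F lborel_integral_translate[of F b] by simp
  finally show ?thesis by simp
qed

text \<open>Stands in for the polynomials in the matrix entries: continuity and polynomial growth
  are all that integrability against \<open>gauss\<close> asks for, and both survive sums and
  products.\<close>

definition polyb :: "('a::euclidean_space \<Rightarrow> real) \<Rightarrow> bool" where
  "polyb f \<longleftrightarrow> continuous_on UNIV f \<and> (\<exists>C N. \<forall>x. \<bar>f x\<bar> \<le> C * (1 + norm x) ^ N)"

lemma polybI:
  assumes "continuous_on UNIV f" "\<And>x. \<bar>f x\<bar> \<le> C * (1 + norm x) ^ N"
  shows "polyb f"
  using assms unfolding polyb_def by blast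

lemma polyb_const: "polyb (\<lambda>_. c)"
  by (rule polybI[where C="\<bar>c\<bar>" and N=0]) auto

lemma polyb_inner: "polyb (\<lambda>x. x \<bullet> b)"
proof (rule polybI[where C="norm b" and N=1])
  show "\<bar>x \<bullet> b\<bar> \<le> norm b * (1 + norm x) ^ 1" for x
  proof -
    have "norm b * norm x \<le> norm b * (1 + norm x)" by (rule mult_left_mono) auto
    then show ?thesis using Cauchy_Schwarz_ineq2[of x b] by (simp add: mult.commute[of "norm x"])
  qed
qed (intro continuous_intros)

lemma polyb_mult:
  assumes "polyb f" "polyb g" shows "polyb (\<lambda>x. f x * g x)"
proof -
  obtain C N where f: "continuous_on UNIV f" "\<And>x. \<bar>f x\<bar> \<le> C * (1 + norm x) ^ N" using assms(1) by (auto simp: polyb_def)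
  obtain D M where g: "continuous_on UNIV g" "\<And>x. \<bar>g x\<bar> \<le> D * (1 + norm x) ^ M" using assms(2) by (auto simp: polyb_def)
  show ?thesis
  proof (rule polybI[where C="C * D" and N="N + M"])
    fix x
    have "\<bar>f x\<bar> * \<bar>g x\<bar> \<le> (C * (1 + norm x) ^ N) * (D * (1 + norm x) ^ M)"
      using f(2)[of x] g(2)[of x] by (intro mult_mono) (auto intro: order_trans[OF abs_ge_zero])
    then show "\<bar>f x * g x\<bar> \<le> C * D * (1 + norm x) ^ (N + M)" by (simp add: abs_mult power_add mult_ac)
  qed (intro continuous_intros f g)
qed

lemma polyb_add:
  assumes "polyb f" "polyb g" shows "polyb (\<lambda>x. f x + g x)"
proof -
  obtain C N where f: "continuous_on UNIV f" "\<And>x. \<bar>f x\<bar> \<le> C * (1 + norm x) ^ N" using assms(1) by (auto simp: polyb_def)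
  obtain D M where g: "continuous_on UNIV g" "\<And>x. \<bar>g x\<bar> \<le> D * (1 + norm x) ^ M" using assms(2) by (auto simp: polyb_def)
  have CD: "C \<ge> 0" "D \<ge> 0" using f(2)[of 0] g(2)[of 0] by auto
  show ?thesis
  proof (rule polybI[where C="C + D" and N="N + M"])
    fix x :: 'a
    have "(1 + norm x) ^ N \<le> (1 + norm x) ^ (N + M)" "(1 + norm x) ^ M \<le> (1 + norm x) ^ (N + M)"
      by (intro power_increasing; simp)+
    then have "C * (1 + norm x) ^ N \<le> C * (1 + norm x) ^ (N + M)" "D * (1 + norm x) ^ M \<le> D * (1 + norm x) ^ (N + M)"
      using CD by (auto intro: mult_left_mono)
    then show "\<bar>f x + g x\<bar> \<le> (C + D) * (1 + norm x) ^ (N + M)"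
      using f(2)[of x] g(2)[of x] by (simp add: distrib_right)
  qed (intro continuous_intros f g)
qed

lemma polyb_sum: "(\<And>i. i \<in> I \<Longrightarrow> polyb (f i)) \<Longrightarrow> polyb (\<lambda>x. \<Sum>i\<in>I. f i x)"
  by (induction I rule: infinite_finite_induct) (auto intro: polyb_const polyb_add)

lemma polyb_prod: "(\<And>i. i \<in> I \<Longrightarrow> polyb (f i)) \<Longrightarrow> polyb (\<lambda>x. \<Prod>i\<in>I. f i x)"
  by (induction I rule: infinite_finite_induct) (auto intro: polyb_const polyb_mult)

lemma polyb_power: "polyb f \<Longrightarrow> polyb (\<lambda>x. f x ^ n)"
  by (induction n) (auto intro: polyb_const polyb_mult)

lemma polyb_det: "(\<And>i j. polyb (\<lambda>x. f x $ i $ j)) \<Longrightarrow> polyb (\<lambda>x. det (f x :: real^'m^'m))"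
  unfolding det_def by (intro polyb_sum polyb_mult polyb_prod polyb_const) auto

lemma polyb_entry: "polyb (\<lambda>y::real^'m^'a. y $ i $ c)"
  using polyb_inner[of "axis i (axis c 1) :: real^'m^'a"] by (simp add: inner_axis)

lemmas polyb_intros = polyb_const polyb_mult polyb_add polyb_sum polyb_prod polyb_power polyb_det polyb_entry

lemma polyb_continuous: "polyb f \<Longrightarrow> continuous_on UNIV f"
  by (simp add: polyb_def)

lemma continuous_on_gauss: "continuous_on S gauss"
  unfolding gauss_def by (intro continuous_intros)

lemma integrable_polyb_gauss:
  fixes f :: "'a::euclidean_space \<Rightarrow> real"
  assumes "polyb f" shows "integrable lborel (\<lambda>x. f x * gauss x)"
proof (rule integrableI_bounded)
  obtain C N where f: "\<And>x. \<bar>f x\<bar> \<le> C * (1 + norm x) ^ N" using assms by (auto simp: polyb_def)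
  have [measurable]: "f \<in> borel_measurable borel" using assms by (auto simp: polyb_def borel_measurable_continuous_onI)
  show "(\<lambda>x. f x * gauss x) \<in> borel_measurable lborel" by measurable
  have C: "C \<ge> 0" using f[of 0] by auto
  have "(\<integral>\<^sup>+x. ennreal (norm (f x * gauss x)) \<partial>lborel) \<le>
     (\<integral>\<^sup>+x. ennreal (C * 2 ^ N) * (ennreal (gauss x * norm x ^ 0) + ennreal (gauss x * norm x ^ N)) \<partial>(lborel :: 'a measure))"
  proof (rule nn_integral_mono)
    fix x :: 'a
    have "(1 + norm x) ^ N \<le> 2 ^ N * (1 + norm x ^ N)"
    proof (cases "norm x \<le> 1")
      case True
      then have "(1 + norm x) ^ N \<le> 2 ^ N" by (intro power_mono) auto
      also have "\<dots> \<le> 2 ^ N * (1 + norm x ^ N)" by simp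
      finally show ?thesis .
    next
      case False
      then have "(1 + norm x) ^ N \<le> (2 * norm x) ^ N" by (intro power_mono) auto
      also have "\<dots> \<le> 2 ^ N * (1 + norm x ^ N)" by (simp add: power_mult_distrib)
      finally show ?thesis .
    qed
    then have "C * (1 + norm x) ^ N \<le> C * (2 ^ N * (1 + norm x ^ N))" using C by (rule mult_left_mono)
    then have "\<bar>f x\<bar> \<le> C * 2 ^ N * (1 + norm x ^ N)" using f[of x] by (simp add: mult.assoc)
    then have "\<bar>f x\<bar> * gauss x \<le> C * 2 ^ N * (1 + norm x ^ N) * gauss x" by (rule mult_right_mono) simp
    then have "\<bar>f x\<bar> * gauss x \<le> (C * 2 ^ N) * (gauss x * norm x ^ 0 + gauss x * norm x ^ N)"
      by (simp add: algebra_simps)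
    then show "ennreal (norm (f x * gauss x)) \<le> ennreal (C * 2 ^ N) * (ennreal (gauss x * norm x ^ 0) + ennreal (gauss x * norm x ^ N))"
      using C by (subst ennreal_plus[symmetric], simp, simp, subst ennreal_mult[symmetric]) (auto simp: abs_mult intro!: ennreal_leI)
  qed
  also have "\<dots> < \<infinity>"
    using nn_integral_gauss_power[where 'a='a, of N] nn_integral_gauss_power[where 'a='a, of 0]
    by (simp add: nn_integral_cmult nn_integral_add ennreal_mult_less_top)
  finally show "(\<integral>\<^sup>+x. ennreal (norm (f x * gauss x)) \<partial>lborel) < \<infinity>" .
qed

text \<open>Columns outside \<open>S\<close> are replaced by extra unit vectors, so that all Gram matrices of subsets of the
  columns have the same index type; column \<open>j\<close> is a free vector.\<close>
definition gram_ext :: "'m set \<Rightarrow> 'm \<Rightarrow> real^'m^'a \<Rightarrow> real^'a \<Rightarrow> real^'m^('a + 'm)" where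
  "gram_ext S j y z = (\<chi> r c. case r of
      Inl i \<Rightarrow> if c = j then z $ i else if c \<in> S then y $ i $ c else 0
    | Inr l \<Rightarrow> if l = c \<and> c \<noteq> j \<and> c \<notin> S then 1 else 0)"

definition gram_sub :: "'m set \<Rightarrow> real^'m^'a \<Rightarrow> real^'m^('a + 'm)" where
  "gram_sub S y = (\<chi> r c. case r of
      Inl i \<Rightarrow> if c \<in> S then y $ i $ c else 0
    | Inr l \<Rightarrow> if l = c \<and> c \<notin> S then 1 else 0)"

text \<open>The Gram determinant polarised in its free column j, so that its derivatives with
  respect to that column can be read off.\<close>

definition gram_form :: "'m::finite set \<Rightarrow> 'm \<Rightarrow> real^'m^'a \<Rightarrow> real^'a \<Rightarrow> real^'a \<Rightarrow> real" where
  "gram_form S j y z z' = det (transpose (gram_ext S j y z) ** gram_ext S j y z')"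

lemma sum_UNIV_Plus: "(\<Sum>r\<in>UNIV. f r) = (\<Sum>i\<in>UNIV. f (Inl i)) + (\<Sum>l\<in>UNIV. f (Inr l))"
  for f :: "'a::finite + 'b::finite \<Rightarrow> 'c::comm_monoid_add"
  unfolding UNIV_Plus_UNIV[symmetric] by (subst sum.Plus) (auto simp: o_def)

definition ext_col :: "'m set \<Rightarrow> 'm \<Rightarrow> real^'m^'a \<Rightarrow> real^'a \<Rightarrow> 'm \<Rightarrow> real^'a" where
  "ext_col S j y z c = (if c = j then z else if c \<in> S then column c y else 0)"

lemma gram_ext_entry:
  "(transpose (gram_ext S j y z) ** gram_ext S j y z') $ c $ d =
     ext_col S j y z c \<bullet> ext_col S j y z' d + (if c = d \<and> c \<noteq> j \<and> c \<notin> S then 1 else 0)"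
proof -
  have "(transpose (gram_ext S j y z) ** gram_ext S j y z') $ c $ d
     = (\<Sum>i\<in>UNIV. (if c = j then z $ i else if c \<in> S then y $ i $ c else 0) * (if d = j then z' $ i else if d \<in> S then y $ i $ d else 0))
     + (\<Sum>l\<in>UNIV. (if l = c \<and> c \<noteq> j \<and> c \<notin> S then 1 else 0) * (if l = d \<and> d \<noteq> j \<and> d \<notin> S then 1 else 0))"
    by (simp add: matrix_matrix_mult_def transpose_def gram_ext_def sum_UNIV_Plus)
  also have "(\<Sum>l\<in>UNIV. (if l = c \<and> c \<noteq> j \<and> c \<notin> S then 1 else 0) * (if l = d \<and> d \<noteq> j \<and> d \<notin> S then 1 else 0))
     = (\<Sum>l\<in>UNIV. if l = c then (if c = d \<and> c \<noteq> j \<and> c \<notin> S then 1 else 0) else (0::real))"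
    by (intro sum.cong) auto
  finally show ?thesis by (simp add: ext_col_def inner_vec_def column_def)
qed

lemma gram_sub_entry:
  "(transpose (gram_sub S y) ** gram_sub S y) $ c $ d =
     (if c \<in> S then column c y else 0) \<bullet> (if d \<in> S then column d y else 0) + (if c = d \<and> c \<notin> S then 1 else 0)"
proof -
  have "(transpose (gram_sub S y) ** gram_sub S y) $ c $ d
     = (\<Sum>i\<in>UNIV. (if c \<in> S then y $ i $ c else 0) * (if d \<in> S then y $ i $ d else 0))
     + (\<Sum>l\<in>UNIV. (if l = c \<and> c \<notin> S then 1 else 0) * (if l = d \<and> d \<notin> S then 1 else 0))"
    by (simp add: matrix_matrix_mult_def transpose_def gram_sub_def sum_UNIV_Plus)
  also have "(\<Sum>l\<in>UNIV. (if l = c \<and> c \<notin> S then 1 else 0) * (if l = d \<and> d \<notin> S then 1 else 0))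
     = (\<Sum>l\<in>UNIV. if l = c then (if c = d \<and> c \<notin> S then 1 else 0) else (0::real))"
    by (intro sum.cong) auto
  finally show ?thesis by (simp add: inner_vec_def column_def)
qed

lemma gram_form_sym: "gram_form S j y z z' = gram_form S j y z' z"
proof -
  have "gram_form S j y z z' = det (transpose (transpose (gram_ext S j y z) ** gram_ext S j y z'))"
    by (simp add: gram_form_def)
  then show ?thesis by (simp add: gram_form_def matrix_transpose_mul)
qed

lemma gram_form_add: "gram_form S j y (z + w) z' = gram_form S j y z z' + gram_form S j y w z'"
proof -
  define b where "b z = (\<chi> d. z \<bullet> ext_col S j y z' d)" for z
  define c where "c k = (\<chi> d. ext_col S j y 0 k \<bullet> ext_col S j y z' d + (if k = d \<and> k \<noteq> j \<and> k \<notin> S then 1 else 0))" for k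
  have M: "transpose (gram_ext S j y z) ** gram_ext S j y z' = (\<chi> k. if k = j then b z else c k)" for z
    by (auto simp: vec_eq_iff gram_ext_entry b_def c_def ext_col_def)
  have "b (z + w) = b z + b w" by (simp add: b_def vec_eq_iff inner_add_left)
  then show ?thesis
    by (simp only: gram_form_def M det_row_add)
qed

context
  fixes S :: "'m::finite set" and j :: 'm and y :: "real^'m^'a"
  assumes j: "j \<notin> S"
begin

text \<open>The span of the columns of y with index in S, written as a linear image so that its
  dimension can be computed from injectivity.\<close>

definition col_space :: "(real^'a) set" where
  "col_space = (*v) y ` {v. \<forall>c. c \<notin> S \<longrightarrow> v $ c = 0}"

lemma subspace_col_space: "subspace col_space"
  unfolding col_space_def
  by (intro linear_subspace_image) (auto simp: subspace_def)

lemma column_in_col_space: "c \<in> S \<Longrightarrow> column c y \<in> col_space"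
  unfolding col_space_def
  by (intro image_eqI[of _ _ "axis c 1"], simp only: matrix_vector_mult_basis) (auto simp: axis_def)

text \<open>If w = y v with v supported in S, then v - e_j lies in the kernel of
  \<open>gram_ext S j y w\<close>, so the determinant vanishes.\<close>

lemma gram_form_col_space:
  assumes w: "w \<in> col_space"
  shows "gram_form S j y w z' = 0"
proof -
  obtain v where v: "\<And>c. c \<notin> S \<Longrightarrow> v $ c = 0" "w = y *v v" using w by (auto simp: col_space_def)
  \<comment> \<open>Since j lies outside S, entry j of v is 0 and entry j of this vector is -1; in
    particular it is nonzero.\<close>
  define v' where "v' = v - axis j 1"
  have vj: "v' $ j = -1" using v(1)[OF j] by (simp add: v'_def)
  have "gram_ext S j y w *v v' = 0"
  proof -
    have "(gram_ext S j y w *v v') $ r = 0" for r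
    proof (cases r)
      case (Inl i)
      have "(gram_ext S j y w *v v') $ r = (\<Sum>c\<in>UNIV. (if c = j then w $ i else if c \<in> S then y $ i $ c else 0) * v' $ c)"
        by (simp add: matrix_vector_mult_def gram_ext_def Inl)
      also have "\<dots> = - (w $ i) + (\<Sum>c\<in>UNIV - {j}. (if c = j then w $ i else if c \<in> S then y $ i $ c else 0) * v' $ c)"
        by (subst sum.remove[of _ j]) (auto simp: vj)
      also have "(\<Sum>c\<in>UNIV - {j}. (if c = j then w $ i else if c \<in> S then y $ i $ c else 0) * v' $ c)
          = (\<Sum>c\<in>UNIV - {j}. y $ i $ c * v $ c)"
        by (intro sum.cong) (auto simp: v'_def axis_def v(1))
      also have "\<dots> = (\<Sum>c\<in>UNIV. y $ i $ c * v $ c)"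
        by (intro sum.mono_neutral_left) (auto simp: v(1)[OF j])
      finally show ?thesis by (simp add: v(2) matrix_vector_mult_def)
    next
      case (Inr l)
      have "(gram_ext S j y w *v v') $ r = (\<Sum>c\<in>UNIV. (if l = c \<and> c \<noteq> j \<and> c \<notin> S then 1 else 0) * v' $ c)"
        by (simp add: matrix_vector_mult_def gram_ext_def Inr)
      also have "\<dots> = 0" by (intro sum.neutral) (auto simp: v'_def axis_def v(1))
      finally show ?thesis .
    qed
    then show ?thesis by (simp add: vec_eq_iff)
  qed
  then have z: "(transpose (gram_ext S j y z') ** gram_ext S j y w) *v v' = 0"
    by (simp add: matrix_vector_mul_assoc[symmetric] del: transpose_matrix_vector)
  have "v' \<noteq> 0" using vj by auto
  then have "\<not> inj ((*v) (transpose (gram_ext S j y z') ** gram_ext S j y w))"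
    using z by (metis injD matrix_vector_mult_0_right)
  then have "gram_form S j y z' w = 0"
    unfolding gram_form_def using det_nz_iff_inj[of "(*v) (transpose (gram_ext S j y z') ** gram_ext S j y w)"] by simp
  then show ?thesis by (simp add: gram_form_sym)
qed

text \<open>Orthogonality turns row j of the product into p . p' times a unit row. With the unit row
  itself, the matrix is the Gram matrix of \<open>gram_sub S y\<close>.\<close>

lemma gram_form_orthogonal:
  assumes p: "\<And>w. w \<in> col_space \<Longrightarrow> p \<bullet> w = 0" and p': "\<And>w. w \<in> col_space \<Longrightarrow> p' \<bullet> w = 0"
  shows "gram_form S j y p p' = (p \<bullet> p') * gram_det (gram_sub S y)"
proof -
  define N where "N = transpose (gram_sub S y) ** gram_sub S y"
  have "transpose (gram_ext S j y p) ** gram_ext S j y p' = (\<chi> k. if k = j then (p \<bullet> p') *s axis j 1 else N $ k)"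
  proof -
    have "(transpose (gram_ext S j y p) ** gram_ext S j y p') $ c $ d = (\<chi> k. if k = j then (p \<bullet> p') *s axis j 1 else N $ k) $ c $ d" for c d
      using p[OF column_in_col_space] p'[OF column_in_col_space] j
      by (auto simp: gram_ext_entry N_def gram_sub_entry ext_col_def axis_def inner_commute[of "column _ y"])
    then show ?thesis by (simp add: vec_eq_iff)
  qed
  then have "gram_form S j y p p' = (p \<bullet> p') * det (\<chi> k. if k = j then axis j 1 else N $ k)"
    unfolding gram_form_def using det_row_mul[of j "p \<bullet> p'" "\<lambda>_. axis j 1" "\<lambda>k. N $ k"] by simp
  also have "(\<chi> k. if k = j then axis j 1 else N $ k) = N"
    using j by (auto simp: vec_eq_iff N_def gram_sub_entry axis_def)
  finally show ?thesis by (simp add: N_def gram_det_def)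
qed

lemma dim_col_space:
  assumes "gram_det (gram_sub S y) \<noteq> 0"
  shows "dim col_space = card S"
proof -
  define X where "X = {v::real^'m. \<forall>c. c \<notin> S \<longrightarrow> v $ c = 0}"
  have X: "subspace X" by (auto simp: X_def subspace_def)
  have "inj_on ((*v) y) (span X)"
  proof (subst span_eq_iff[THEN iffD2, OF X], rule inj_onI)
    fix v w assume vw: "v \<in> X" "w \<in> X" "y *v v = y *v w"
    have "(gram_sub S y *v u) $ r = (case r of Inl i \<Rightarrow> (y *v u) $ i | Inr l \<Rightarrow> 0)" if "u \<in> X" for u r
      using that by (auto simp: gram_sub_def matrix_vector_mult_def X_def split: sum.splits intro!: sum.cong sum.neutral)
    then have "gram_sub S y *v v = gram_sub S y *v w" using vw by (simp add: vec_eq_iff split: sum.splits)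
    then show "v = w" using assms by (meson gram_det_iff_inj injD)
  qed
  then have "dim ((*v) y ` X) = dim X" by (intro dim_image_eq) auto
  also have "dim X = card S"
    unfolding X_def using dim_substandard_cart[of S, where 'a=real] by (simp add: dim_vec_eq)
  finally show ?thesis by (simp add: col_space_def X_def)
qed

text \<open>Base times height: only the component orthogonal to the columns in S contributes to the
  determinant. P is the orthogonal projection onto the complement of \<open>col_space\<close>, and
  for independent columns its trace is the codimension.\<close>

lemma gram_form_projection:
  obtains P where "\<And>z z'. gram_form S j y z z' = gram_det (gram_sub S y) * (P z \<bullet> P z')"
    and "\<And>z z'. P z \<bullet> P z' = z \<bullet> P z'" and "linear P"
    and "gram_det (gram_sub S y) \<noteq> 0 \<Longrightarrow> (\<Sum>i\<in>UNIV. P (axis i 1) \<bullet> P (axis i 1)) = real CARD('a) - real (card S)"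
proof -
  obtain Q where Q: "Q \<subseteq> col_space" "pairwise orthogonal Q" "\<And>x. x \<in> Q \<Longrightarrow> norm x = 1"
      "independent Q" "card Q = dim col_space" "span Q = col_space"
    using orthonormal_basis_subspace[OF subspace_col_space] by metis
  have finQ: "finite Q" using Q(4) by (rule independent_imp_finite)
  have QQ: "q \<bullet> q' = (if q = q' then 1 else 0)" if "q \<in> Q" "q' \<in> Q" for q q'
    using Q(2,3) that by (auto simp: pairwise_def orthogonal_def norm_eq_1)
  define P where "P z = z - (\<Sum>q\<in>Q. (z \<bullet> q) *\<^sub>R q)" for z
  have Pq: "P z \<bullet> q = 0" if "q \<in> Q" for z q
    using that finQ by (simp add: P_def inner_diff_left inner_sum_left QQ if_distrib cong: if_cong)
  have Pw: "P z \<bullet> w = 0" if "w \<in> col_space" for z w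
  proof -
    have "w \<in> span Q" using that Q by simp
    then have "orthogonal (P z) w"
      by (rule orthogonal_to_span) (use Pq in \<open>auto simp: orthogonal_def\<close>)
    then show ?thesis by (simp add: orthogonal_def)
  qed
  have dW: "z - P z \<in> col_space" for z
    using Q(1) subspace_col_space by (auto simp: P_def intro!: subspace_sum subspace_scale)
  have PP: "P z \<bullet> P z' = z \<bullet> P z'" for z z'
    using Pw[OF dW, of z' z] by (simp add: inner_diff_right inner_diff_left inner_commute)
  have form: "gram_form S j y z z' = gram_det (gram_sub S y) * (P z \<bullet> P z')" for z z'
  proof -
    have 1: "gram_form S j y z z' = gram_form S j y (P z) z'" for z z'
      using gram_form_add[of S j y "P z" "z - P z" z'] gram_form_col_space[OF dW] by simp
    have "gram_form S j y z z' = gram_form S j y (P z) (P z')"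
      using 1 gram_form_sym by metis
    also have "\<dots> = (P z \<bullet> P z') * gram_det (gram_sub S y)" by (rule gram_form_orthogonal) (auto intro: Pw)
    finally show ?thesis by simp
  qed
  have lin: "linear P"
    by (rule linearI) (simp_all add: P_def inner_add_left sum.distrib algebra_simps scaleR_sum_right)
  have tr: "(\<Sum>i\<in>UNIV. P (axis i 1) \<bullet> P (axis i 1)) = real CARD('a) - real (card S)" if "gram_det (gram_sub S y) \<noteq> 0"
  proof -
    have "(\<Sum>i\<in>UNIV. P (axis i 1) \<bullet> P (axis i 1)) = (\<Sum>i\<in>UNIV. 1 - (\<Sum>q\<in>Q. q $ i * q $ i))"
      unfolding PP by (intro sum.cong refl)
        (simp add: P_def inner_axis')
    also have "\<dots> = real CARD('a) - (\<Sum>q\<in>Q. q \<bullet> q)"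
      by (simp add: sum_subtractf inner_vec_def sum.swap[of _ UNIV])
    also have "(\<Sum>q\<in>Q. q \<bullet> q) = real (card Q)" by (simp add: QQ)
    finally show ?thesis using Q(5) dim_col_space[OF that] by simp
  qed
  show ?thesis by (rule that[OF form PP lin tr])
qed

text \<open>The Taylor expansion in the free column, and the three identities that evaluate the
  divergence in \<open>gram_moment_step\<close>. All of them are facts about the quadratic form of a
  projection.\<close>

lemma
  shows gram_form_line: "gram_form S j y (z + t *\<^sub>R e) (z + t *\<^sub>R e) = gram_form S j y z z + 2 * t * gram_form S j y e z + t\<^sup>2 * gram_form S j y e e"
    and gram_form_line1: "gram_form S j y e (z + t *\<^sub>R e) = gram_form S j y e z + t * gram_form S j y e e"
    and gram_form_trace: "(\<Sum>i\<in>UNIV. gram_form S j y (axis i 1) (axis i 1)) = (real CARD('a) - real (card S)) * gram_det (gram_sub S y)"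
    and gram_form_euler: "(\<Sum>i\<in>UNIV. z $ i * gram_form S j y (axis i 1) z) = gram_form S j y z z"
    and gram_form_gradient: "(\<Sum>i\<in>UNIV. (gram_form S j y (axis i 1) z)\<^sup>2) = gram_det (gram_sub S y) * gram_form S j y z z"
proof -
  obtain P where P: "\<And>z z'. gram_form S j y z z' = gram_det (gram_sub S y) * (P z \<bullet> P z')"
    "\<And>z z'. P z \<bullet> P z' = z \<bullet> P z'" "linear P"
    "gram_det (gram_sub S y) \<noteq> 0 \<Longrightarrow> (\<Sum>i\<in>UNIV. P (axis i 1) \<bullet> P (axis i 1)) = real CARD('a) - real (card S)"
    using gram_form_projection by blast
  show "gram_form S j y (z + t *\<^sub>R e) (z + t *\<^sub>R e) = gram_form S j y z z + 2 * t * gram_form S j y e z + t\<^sup>2 * gram_form S j y e e"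
    by (simp add: P(1) linear_add[OF P(3)] linear_scale[OF P(3)] inner_add_left inner_add_right power2_eq_square algebra_simps inner_commute)
  show "gram_form S j y e (z + t *\<^sub>R e) = gram_form S j y e z + t * gram_form S j y e e"
    by (simp add: P(1) linear_add[OF P(3)] linear_scale[OF P(3)] inner_add_right algebra_simps)
  show "(\<Sum>i\<in>UNIV. gram_form S j y (axis i 1) (axis i 1)) = (real CARD('a) - real (card S)) * gram_det (gram_sub S y)"
    using P(4) by (cases "gram_det (gram_sub S y) = 0") (simp_all add: P(1) sum_distrib_left[symmetric])
  have comp: "P (axis i 1) \<bullet> P z = P z $ i" for i z by (simp add: P(2)[of "axis i 1"] inner_axis')
  show "(\<Sum>i\<in>UNIV. z $ i * gram_form S j y (axis i 1) z) = gram_form S j y z z"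
    by (simp add: P(1) comp P(2)[of z] inner_vec_def[of z] sum_distrib_left mult_ac)
  show "(\<Sum>i\<in>UNIV. (gram_form S j y (axis i 1) z)\<^sup>2) = gram_det (gram_sub S y) * gram_form S j y z z"
    by (simp add: P(1) comp inner_vec_def[of "P z"] power2_eq_square sum_distrib_left mult_ac)
qed

lemma gram_sub_insert: "gram_det (gram_sub (insert j S) y) = gram_form S j y (column j y) (column j y)"
proof -
  have "gram_sub (insert j S) y = gram_ext S j y (column j y)"
    by (auto simp: gram_sub_def gram_ext_def vec_eq_iff column_def split: sum.splits)
  then show ?thesis by (simp add: gram_form_def gram_det_def)
qed

end

lemma gram_sub_shift:
  assumes "j \<notin> S"
  shows "gram_sub S (y + t *\<^sub>R axis i (axis j 1)) = gram_sub S y"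
    "gram_form S j (y + t *\<^sub>R axis i (axis j 1)) = gram_form S j y"
    "column j (y + t *\<^sub>R axis i (axis j 1)) = column j y + t *\<^sub>R axis i 1"
proof -
  have e: "(y + t *\<^sub>R axis i (axis j 1)) $ r $ c = y $ r $ c + (if r = i \<and> c = j then t else 0)" for r c
    by (simp add: axis_def)
  show "gram_sub S (y + t *\<^sub>R axis i (axis j 1)) = gram_sub S y"
    using assms unfolding gram_sub_def e by (auto simp: vec_eq_iff split: sum.splits)
  have "gram_ext S j (y + t *\<^sub>R axis i (axis j 1)) z = gram_ext S j y z" for z
    using assms unfolding gram_ext_def e by (auto simp: vec_eq_iff split: sum.splits)
  then show "gram_form S j (y + t *\<^sub>R axis i (axis j 1)) = gram_form S j y"
    by (simp add: gram_form_def fun_eq_iff)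
  show "column j (y + t *\<^sub>R axis i (axis j 1)) = column j y + t *\<^sub>R axis i 1"
    by (auto simp: vec_eq_iff column_def axis_def)
qed

lemma polyb_gram:
  shows "polyb (\<lambda>y::real^'m^'a. gram_det (gram_sub S y))"
    "polyb (\<lambda>y::real^'m^'a. gram_form S j y e (column j y))"
    "polyb (\<lambda>y::real^'m^'a. gram_form S j y e e)"
proof -
  have z: "polyb (\<lambda>y::real^'m^'a. (if P then y $ i $ c else if Q then y $ k $ d else r))" for P Q i c k d r
    by (cases P; cases Q) (auto intro: polyb_intros)
  have z1: "polyb (\<lambda>y::real^'m^'a. (if P then s else if Q then y $ k $ d else r))" for P Q k d r s
    by (cases P; cases Q) (auto intro: polyb_intros)
  have z2: "polyb (\<lambda>y::real^'m^'a. (if Q then y $ k $ d else r))" for Q k d r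
    by (cases Q) (auto intro: polyb_intros)
  show "polyb (\<lambda>y::real^'m^'a. gram_det (gram_sub S y))"
    unfolding gram_det_def matrix_matrix_mult_def transpose_def gram_sub_def
    by (auto simp: sum_UNIV_Plus intro!: polyb_intros z2)
  show "polyb (\<lambda>y::real^'m^'a. gram_form S j y e (column j y))"
    unfolding gram_form_def matrix_matrix_mult_def transpose_def gram_ext_def column_def vec_lambda_beta
    by (auto simp: sum_UNIV_Plus intro!: polyb_intros z z1)
  show "polyb (\<lambda>y::real^'m^'a. gram_form S j y e e)"
    unfolding gram_form_def matrix_matrix_mult_def transpose_def gram_ext_def
    by (auto simp: sum_UNIV_Plus intro!: polyb_intros z1)
qed

lemma gauss_line: "gauss (y + t *\<^sub>R axis i (axis j 1) :: real^'m^'a) = gauss y * exp (- (2 * t * y $ i $ j + t\<^sup>2))"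
proof -
  have "(norm (y + t *\<^sub>R axis i (axis j 1) :: real^'m^'a))\<^sup>2 = (norm y)\<^sup>2 + (2 * t * y $ i $ j + t\<^sup>2)"
    unfolding power2_norm_eq_inner
    by (simp add: inner_add_left inner_add_right inner_axis inner_axis' power2_eq_square[of t] algebra_simps)
  then show ?thesis by (simp add: gauss_def exp_add[symmetric])
qed

text \<open>Integration by parts in column j. Let T and D be the Gram determinants with and without
  column j, and let G be half the gradient of T in that column. The divergence of T^s D^t gauss G is
  evaluated by the gradient, trace and Euler identities, and its integral is 0.\<close>

lemma gram_moment_step:
  fixes S :: "'m::finite set" and TA :: "'a::finite itself"
  assumes j: "j \<notin> S"
  defines "I s t \<equiv> integral\<^sup>L lborel (\<lambda>y::real^'m^'a. gram_det (gram_sub (insert j S) y) ^ s * gram_det (gram_sub S y) ^ t * gauss y)"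
  shows "I (Suc s) t = ((real CARD('a) - real (card S)) / 2 + real s) * I s (Suc t)"
proof -
  let ?T = "\<lambda>y::real^'m^'a. gram_det (gram_sub (insert j S) y)"
  let ?D = "\<lambda>y::real^'m^'a. gram_det (gram_sub S y)"
  let ?G = "\<lambda>i y::real^'m^'a. gram_form S j y (axis i 1) (column j y)"
  let ?H = "\<lambda>i y::real^'m^'a. gram_form S j y (axis i 1) (axis i 1)"
  define F where "F i y = ?T y ^ s * ?D y ^ t * ?G i y * gauss y" for i y
  define F' where "F' i y = (2 * s * ?T y ^ (s - 1) * (?G i y)\<^sup>2 * ?D y ^ t + ?T y ^ s * ?D y ^ t * ?H i y
     + (- 2) * y $ i $ j * ?T y ^ s * ?D y ^ t * ?G i y) * gauss y" for i y
  have int: "integrable lborel (F' i)" for i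
    unfolding F'_def by (intro integrable_polyb_gauss polyb_intros polyb_gram)
  have "integral\<^sup>L lborel (F' i) = 0" for i
  proof (rule integral_directional_derivative[where F="F i" and b="axis i (axis j 1)"])
    show "integrable lborel (F i)"
      unfolding F_def by (intro integrable_polyb_gauss polyb_intros polyb_gram)
    show "continuous_on UNIV (F' i)"
      unfolding F'_def by (intro continuous_on_mult[OF polyb_continuous continuous_on_gauss] polyb_intros polyb_gram)
    fix y :: "real^'m^'a"
    have "(\<lambda>t'. F i (y + t' *\<^sub>R axis i (axis j 1))) = (\<lambda>t'. (?T y + 2 * t' * ?G i y + t'\<^sup>2 * ?H i y) ^ s * ?D y ^ t *
        (?G i y + t' * ?H i y) * (gauss y * exp (- (2 * t' * y $ i $ j + t'\<^sup>2))))"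
      unfolding F_def gram_sub_insert[OF j] gram_sub_shift[OF j] gauss_line gram_form_line[OF j] gram_form_line1[OF j] ..
    moreover have "((\<lambda>t'. (?T y + 2 * t' * ?G i y + t'\<^sup>2 * ?H i y) ^ s * ?D y ^ t *
        (?G i y + t' * ?H i y) * (gauss y * exp (- (2 * t' * y $ i $ j + t'\<^sup>2)))) has_real_derivative F' i y) (at 0)"
      unfolding F'_def by (auto intro!: derivative_eq_intros simp: power2_eq_square algebra_simps)
    ultimately show "((\<lambda>t'. F i (y + t' *\<^sub>R axis i (axis j 1))) has_vector_derivative F' i y) (at 0)"
      by (simp add: has_real_derivative_iff_has_vector_derivative)
  qed (rule int)
  then have "0 = (\<Sum>i\<in>UNIV. integral\<^sup>L lborel (F' i))" by simp
  also have "\<dots> = integral\<^sup>L lborel (\<lambda>y. \<Sum>i\<in>UNIV. F' i y)" by (rule Bochner_Integration.integral_sum[symmetric]) (rule int)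
  also have "(\<lambda>y. \<Sum>i\<in>UNIV. F' i y) = (\<lambda>y. (2 * s + (real CARD('a) - real (card S))) * (?T y ^ s * ?D y ^ Suc t * gauss y)
     - 2 * (?T y ^ Suc s * ?D y ^ t * gauss y))"
  proof
    fix y :: "real^'m^'a"
    have "(\<Sum>i\<in>UNIV. F' i y) = (2 * s * ?T y ^ (s - 1) * (\<Sum>i\<in>UNIV. (?G i y)\<^sup>2) * ?D y ^ t + ?T y ^ s * ?D y ^ t * (\<Sum>i\<in>UNIV. ?H i y)
     + (- 2) * ?T y ^ s * ?D y ^ t * (\<Sum>i\<in>UNIV. column j y $ i * ?G i y)) * gauss y"
      unfolding F'_def sum_distrib_right[symmetric] sum.distrib sum_distrib_left[symmetric]
      by (simp add: sum_distrib_left sum_distrib_right column_def mult_ac)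
    also have "\<dots> = (2 * (s * ?T y ^ (s - 1) * ?T y) * ?D y ^ Suc t + ?T y ^ s * ?D y ^ Suc t * (real CARD('a) - real (card S))
     - 2 * ?T y ^ Suc s * ?D y ^ t) * gauss y"
      unfolding gram_form_gradient[OF j] gram_form_trace[OF j] gram_form_euler[OF j] gram_sub_insert[OF j]
      by (simp add: algebra_simps)
    \<comment> \<open>For s = 0 the truncated exponent s - 1 does no harm, because of the factor
      s.\<close>
    also have "s * ?T y ^ (s - 1) * ?T y = s * ?T y ^ s" by (cases s) auto
    finally show "(\<Sum>i\<in>UNIV. F' i y) = (2 * s + (real CARD('a) - real (card S))) * (?T y ^ s * ?D y ^ Suc t * gauss y)
     - 2 * (?T y ^ Suc s * ?D y ^ t * gauss y)" by (simp add: algebra_simps)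
  qed
  also have "integral\<^sup>L lborel \<dots> = (2 * s + (real CARD('a) - real (card S))) * I s (Suc t) - 2 * I (Suc s) t"
    unfolding I_def
    by (subst Bochner_Integration.integral_diff)
       (auto intro!: integrable_polyb_gauss polyb_intros polyb_gram Bochner_Integration.integrable_mult_right simp del: power_Suc)
  finally show ?thesis by (simp add: field_simps)
qed

text \<open>Columns are added one at a time. Iterating \<open>gram_moment_step\<close> converts the
  power s of the larger determinant into a Pochhammer symbol times the power s of the smaller one;
  this is Bartlett's decomposition on the level of moments.\<close>

lemma gram_moment:
  fixes S :: "'m::finite set"
  shows "integral\<^sup>L lborel (\<lambda>y::real^'m^'a. gram_det (gram_sub S y) ^ s * gauss y)
    = sqrt pi ^ DIM(real^'m^'a) * (\<Prod>i<card S. pochhammer ((real CARD('a) - real i) / 2) s)"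
  using finite[of S]
proof (induction S rule: finite_induct)
  case empty
  have "gram_det (gram_sub {} y) = 1" for y :: "real^'m^'a"
  proof -
    have "transpose (gram_sub {} y) ** gram_sub {} y = mat 1"
      by (simp add: vec_eq_iff gram_sub_entry mat_def)
    then show ?thesis by (simp add: gram_det_def)
  qed
  moreover have "integral\<^sup>L lborel (\<lambda>y::real^'m^'a. gauss y) = sqrt pi ^ DIM(real^'m^'a)"
    by (subst integral_eq_nn_integral) (simp_all add: nn_integral_gauss)
  ultimately show ?case by simp
next
  case (insert j S)
  define I where "I s t = integral\<^sup>L lborel (\<lambda>y::real^'m^'a. gram_det (gram_sub (insert j S) y) ^ s * gram_det (gram_sub S y) ^ t * gauss y)" for s t
  have step: "I (Suc s) t = ((real CARD('a) - real (card S)) / 2 + real s) * I s (Suc t)" for s t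
    unfolding I_def by (rule gram_moment_step[OF insert(2)])
  have "I s t = pochhammer ((real CARD('a) - real (card S)) / 2) s * I 0 (s + t)" for s t
  proof (induction s arbitrary: t)
    case (Suc s)
    show ?case unfolding step Suc.IH by (simp add: pochhammer_Suc mult_ac)
  qed simp
  from this[of s 0] have "I s 0 = pochhammer ((real CARD('a) - real (card S)) / 2) s * I 0 s" by simp
  then show ?case using insert by (simp add: I_def mult_ac)
qed

lemma gauss_moment_even:
  "gauss_moment TYPE('a::finite) TYPE('m::finite) (2 * l) =
    sqrt pi ^ DIM(real^'m^'a) * (\<Prod>i<CARD('m). pochhammer ((real CARD('a) - real i) / 2) l)"
proof -
  have "gram_det (gram_sub UNIV y) = gram_det y" for y :: "real^'m^'a"
  proof -
    have "transpose (gram_sub UNIV y) ** gram_sub UNIV y = transpose y ** y"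
      by (simp only: vec_eq_iff gram_sub_entry) (simp add: column_dot)
    then show ?thesis by (simp add: gram_det_def)
  qed
  moreover have "gvol y ^ (2 * l) = gram_det y ^ l" for y :: "real^'m^'a"
    by (simp only: power_mult gvol_power2)
  ultimately have eq: "(\<lambda>y::real^'m^'a. gauss y * gvol y ^ (2 * l)) = (\<lambda>y. gram_det (gram_sub UNIV y) ^ l * gauss y)"
    by (simp only: mult.commute)
  show ?thesis
    unfolding gauss_moment_def eq using gram_moment[where S="UNIV :: 'm set" and 'a='a and s=l] by simp
qed

section \<open>Fourier inversion at the origin\<close>

lemma lborel_integral_scale:
  fixes f :: "'a::euclidean_space \<Rightarrow> 'b::{banach, second_countable_topology}"
  assumes f: "f \<in> borel_measurable borel" and c: "c \<noteq> 0"
  shows "integral\<^sup>L lborel f = \<bar>c\<bar> ^ DIM('a) *\<^sub>R integral\<^sup>L lborel (\<lambda>x. f (c *\<^sub>R x))"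
    and "integrable lborel (\<lambda>x. f (c *\<^sub>R x)) \<longleftrightarrow> integrable lborel f"
proof -
  have eq: "lborel = density (distr lborel borel (\<lambda>x::'a. c *\<^sub>R x)) (\<lambda>_. ennreal (\<bar>c\<bar> ^ DIM('a)))"
    using lborel_affine[OF c, of "0::'a"] by simp
  have "integral\<^sup>L lborel f = integral\<^sup>L (density (distr lborel borel (\<lambda>x::'a. c *\<^sub>R x)) (\<lambda>_. ennreal (\<bar>c\<bar> ^ DIM('a)))) f"
    using eq by simp
  also have "\<dots> = integral\<^sup>L (distr lborel borel (\<lambda>x::'a. c *\<^sub>R x)) (\<lambda>x. (\<bar>c\<bar> ^ DIM('a)) *\<^sub>R f x)"
    by (rule integral_density) (use f in auto)
  also have "\<dots> = integral\<^sup>L lborel (\<lambda>x. (\<bar>c\<bar> ^ DIM('a)) *\<^sub>R f (c *\<^sub>R x))"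
    by (rule integral_distr) (use f in auto)
  finally show "integral\<^sup>L lborel f = \<bar>c\<bar> ^ DIM('a) *\<^sub>R integral\<^sup>L lborel (\<lambda>x. f (c *\<^sub>R x))" by simp
  have "integrable lborel f \<longleftrightarrow> integrable (density (distr lborel borel (\<lambda>x::'a. c *\<^sub>R x)) (\<lambda>_. ennreal (\<bar>c\<bar> ^ DIM('a)))) f"
    using eq by simp
  also have "\<dots> \<longleftrightarrow> integrable (distr lborel borel (\<lambda>x::'a. c *\<^sub>R x)) (\<lambda>x. (\<bar>c\<bar> ^ DIM('a)) *\<^sub>R f x)"
    by (rule integrable_density) (use f in auto)
  also have "\<dots> \<longleftrightarrow> integrable lborel (\<lambda>x. (\<bar>c\<bar> ^ DIM('a)) *\<^sub>R f (c *\<^sub>R x))"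
    by (rule integrable_distr_eq) (use f in auto)
  finally have 1: "integrable lborel f \<longleftrightarrow> integrable lborel (\<lambda>x. (\<bar>c\<bar> ^ DIM('a)) *\<^sub>R f (c *\<^sub>R x))" .
  have "integrable lborel (\<lambda>x. f (c *\<^sub>R x))" if "integrable lborel (\<lambda>x. (\<bar>c\<bar> ^ DIM('a)) *\<^sub>R f (c *\<^sub>R x))"
    using integrable_scaleR_right[of "inverse (\<bar>c\<bar> ^ DIM('a))", OF that] c by simp
  then show "integrable lborel (\<lambda>x. f (c *\<^sub>R x)) \<longleftrightarrow> integrable lborel f" unfolding 1 by auto
qed

lemma lborel_integral_prod:
  fixes f :: "'a::euclidean_space \<Rightarrow> real \<Rightarrow> 'b::{real_normed_field,banach,second_countable_topology}"
  assumes f: "\<And>b. b \<in> Basis \<Longrightarrow> integrable lborel (f b)"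
  shows "integral\<^sup>L lborel (\<lambda>x::'a. \<Prod>b\<in>Basis. f b (x \<bullet> b)) = (\<Prod>b\<in>Basis. integral\<^sup>L lborel (f b))"
proof -
  interpret product_sigma_finite "\<lambda>b::'a. lborel :: real measure" by standard
  have [measurable]: "\<And>b. b \<in> Basis \<Longrightarrow> f b \<in> borel_measurable borel" using f by auto
  have "integral\<^sup>L lborel (\<lambda>x::'a. \<Prod>b\<in>Basis. f b (x \<bullet> b))
     = integral\<^sup>L (\<Pi>\<^sub>M b\<in>Basis. lborel) (\<lambda>g. \<Prod>b\<in>Basis. f b ((\<Sum>c\<in>Basis. g c *\<^sub>R c) \<bullet> b))"
  proof -
    have D: "(lborel :: 'a measure) = distr (\<Pi>\<^sub>M b\<in>Basis. lborel) borel (\<lambda>g. \<Sum>c\<in>Basis. g c *\<^sub>R c)"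
      unfolding lborel_def[where 'a='a] lborel_eq_real ..
    show ?thesis by (subst D, rule integral_distr) auto
  qed
  also have "\<dots> = integral\<^sup>L (\<Pi>\<^sub>M b\<in>Basis. lborel) (\<lambda>g. \<Prod>b\<in>Basis. f b (g b))"
    by (intro Bochner_Integration.integral_cong prod.cong refl) simp
  also have "\<dots> = (\<Prod>b\<in>Basis. integral\<^sup>L lborel (f b))"
    by (rule product_integral_prod) (use f in auto)
  finally show ?thesis .
qed

text \<open>Unlike \<open>gauss\<close> this has total mass 1 and unit variance, which makes it its
  own Fourier transform up to a constant factor.\<close>

definition std_gauss :: "'a::euclidean_space \<Rightarrow> real" where
  "std_gauss x = (\<Prod>b\<in>Basis. std_normal_density (x \<bullet> b))"

lemma std_gauss_nonneg [simp]: "0 \<le> std_gauss x"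
  by (simp add: std_gauss_def prod_nonneg)

lemma continuous_std_gauss: "continuous_on S std_gauss"
  unfolding std_gauss_def std_normal_density_def by (intro continuous_intros) auto

lemma borel_measurable_std_gauss [measurable]: "std_gauss \<in> borel_measurable borel"
  by (intro borel_measurable_continuous_onI continuous_std_gauss)

lemma integrable_std_gauss: "integrable lborel (std_gauss :: 'a::euclidean_space \<Rightarrow> real)"
  and integral_std_gauss: "integral\<^sup>L lborel (std_gauss :: 'a::euclidean_space \<Rightarrow> real) = 1"
proof -
  have "prob_space (density lborel (normal_density 0 1))" by (rule prob_space_normal_density) simp
  then have 1: "(\<integral>\<^sup>+t. ennreal (std_normal_density t) \<partial>lborel) = 1"
    using prob_space.emeasure_space_1 by (fastforce simp: emeasure_density)
  have "(\<integral>\<^sup>+x. ennreal (std_gauss (x::'a)) \<partial>lborel) = (\<integral>\<^sup>+x. (\<Prod>b\<in>Basis. ennreal (std_normal_density ((x::'a) \<bullet> b))) \<partial>lborel)"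
    by (simp add: std_gauss_def prod_ennreal)
  also have "\<dots> = 1" by (subst nn_integral_lborel_prod) (auto simp: 1)
  finally have 2: "(\<integral>\<^sup>+x. ennreal (std_gauss (x::'a)) \<partial>lborel) = 1" .
  show "integrable lborel (std_gauss :: 'a \<Rightarrow> real)"
    by (rule integrableI_nonneg) (auto simp: 2)
  show "integral\<^sup>L lborel (std_gauss :: 'a::euclidean_space \<Rightarrow> real) = 1"
    by (subst integral_eq_nn_integral) (auto simp: 2)
qed

lemma std_gauss_eq: "std_gauss (x::'a::euclidean_space) = exp (- (norm x)\<^sup>2 / 2) / sqrt (2 * pi) ^ DIM('a)"
proof -
  have "(norm x)\<^sup>2 = (\<Sum>b\<in>Basis. (x \<bullet> b)\<^sup>2)"
    unfolding power2_norm_eq_inner by (subst euclidean_inner) (simp add: power2_eq_square)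
  then show ?thesis
    by (simp add: std_gauss_def std_normal_density_def prod_dividef exp_sum sum_negf sum_divide_distrib flip: sum_negf)
qed

lemma fourier_std_gauss:
  "integral\<^sup>L lborel (\<lambda>\<eta>::'a::euclidean_space. of_real (std_gauss \<eta>) * cis (z \<bullet> \<eta>)) = of_real (exp (- (norm z)\<^sup>2 / 2))"
proof -
  have 1: "integral\<^sup>L lborel (\<lambda>t. of_real (std_normal_density t) * cis (s * t)) = of_real (exp (- s\<^sup>2 / 2))" for s
  proof -
    have "char std_normal_distribution s = integral\<^sup>L lborel (\<lambda>t. std_normal_density t *\<^sub>R iexp (s * t))"
      unfolding char_def by (rule integral_density) auto
    then show ?thesis by (simp add: char_std_normal_distribution scaleR_conv_of_real cis_conv_exp)
  qed
  have int: "integrable lborel (\<lambda>t. complex_of_real (std_normal_density t) * cis (s * t))" for s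
    by (rule Bochner_Integration.integrable_bound[of _ std_normal_density]) (auto simp: norm_mult cis_conv_exp)
  have "of_real (std_gauss \<eta>) * cis (z \<bullet> \<eta>) = (\<Prod>b\<in>Basis. of_real (std_normal_density (\<eta> \<bullet> b)) * cis ((z \<bullet> b) * (\<eta> \<bullet> b)))" for \<eta>
  proof -
    have "cis (z \<bullet> \<eta>) = (\<Prod>b\<in>Basis. cis ((z \<bullet> b) * (\<eta> \<bullet> b)))"
      by (subst euclidean_inner) (simp add: cis_conv_exp exp_sum[symmetric] sum_distrib_left)
    then show ?thesis by (simp add: std_gauss_def prod.distrib)
  qed
  then have "integral\<^sup>L lborel (\<lambda>\<eta>. of_real (std_gauss \<eta>) * cis (z \<bullet> \<eta>)) =
      (\<Prod>b\<in>Basis. integral\<^sup>L lborel (\<lambda>t. complex_of_real (std_normal_density t) * cis ((z \<bullet> b) * t)))"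
    by (simp add: lborel_integral_prod[OF int, of "\<lambda>b. z \<bullet> b"])
  also have "\<dots> = (\<Prod>b\<in>Basis. of_real (exp (- (z \<bullet> b)\<^sup>2 / 2)))" by (simp add: 1)
  also have "\<dots> = of_real (exp (- (norm z)\<^sup>2 / 2))"
  proof -
    have "(norm z)\<^sup>2 = (\<Sum>b\<in>Basis. (z \<bullet> b)\<^sup>2)"
      unfolding power2_norm_eq_inner by (subst euclidean_inner) (simp add: power2_eq_square)
    then show ?thesis by (simp add: exp_sum[symmetric] sum_negf sum_divide_distrib flip: sum_negf of_real_prod)
  qed
  finally show ?thesis .
qed

text \<open>The kernel is exp (i x.\<xi>) without a constant in front, so the whole factor
  \<open>(2 * pi) ^ DIM('a)\<close> appears in the inversion formula.\<close>

definition fourier :: "('a::euclidean_space \<Rightarrow> complex) \<Rightarrow> 'a \<Rightarrow> complex" where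
  "fourier f \<xi> = integral\<^sup>L lborel (\<lambda>x. f x * cis (x \<bullet> \<xi>))"

lemma borel_measurable_cis [measurable]: "cis \<in> borel_measurable borel"
  by (intro borel_measurable_continuous_onI continuous_on_cis continuous_on_id)

lemma integrable_cis_mult:
  assumes "integrable lborel (f :: 'a::euclidean_space \<Rightarrow> complex)"
  shows "integrable lborel (\<lambda>x. f x * cis (x \<bullet> \<xi>))"
proof -
  have [measurable]: "f \<in> borel_measurable borel" using assms by auto
  show ?thesis
    by (rule Bochner_Integration.integrable_bound[OF assms]) (auto simp: norm_mult)
qed

lemma norm_fourier_le: "norm (fourier f \<xi>) \<le> integral\<^sup>L lborel (\<lambda>x. norm (f x))"
  unfolding fourier_def using integral_norm_bound[of lborel "\<lambda>x. f x * cis (x \<bullet> \<xi>)"] by (simp add: norm_mult)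

text \<open>Regularising with the dilated Gaussian \<open>std_gauss(\<epsilon>\<eta>)\<close> and using that the Gaussian is its own Fourier
  transform moves the dilation to the argument of \<open>\<Phi>\<close>.\<close>
lemma fourier_inversion_at_0:
  fixes \<Phi> :: "'a::euclidean_space \<Rightarrow> complex"
  assumes int: "integrable lborel \<Phi>" and cont: "isCont \<Phi> 0" and bound: "\<And>x. norm (\<Phi> x) \<le> B"
    and intF: "integrable lborel (fourier \<Phi>)"
  shows "integral\<^sup>L lborel (fourier \<Phi>) = of_real ((2 * pi) ^ DIM('a)) * \<Phi> 0"
proof -
  have [measurable]: "\<Phi> \<in> borel_measurable borel" "fourier \<Phi> \<in> borel_measurable borel" using int intF by auto
  have key: "integral\<^sup>L lborel (\<lambda>\<eta>. fourier \<Phi> \<eta> * of_real (std_gauss (\<epsilon> *\<^sub>R \<eta>)))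
     = integral\<^sup>L lborel (\<lambda>z. \<Phi> (\<epsilon> *\<^sub>R z) * of_real (exp (- (norm z)\<^sup>2 / 2)))" if e: "\<epsilon> > 0" for \<epsilon>
  proof -
    have i1: "integrable lborel (\<lambda>z. \<Phi> (\<epsilon> *\<^sub>R z))" using int e lborel_integral_scale(2)[of \<Phi> \<epsilon>] by simp
    have "integral\<^sup>L lborel (\<lambda>\<eta>. fourier \<Phi> \<eta> * of_real (std_gauss (\<epsilon> *\<^sub>R \<eta>)))
       = integral\<^sup>L lborel (\<lambda>\<eta>. (\<epsilon> ^ DIM('a)) *\<^sub>R (integral\<^sup>L lborel (\<lambda>z. \<Phi> (\<epsilon> *\<^sub>R z) * cis (z \<bullet> (\<epsilon> *\<^sub>R \<eta>))) * of_real (std_gauss (\<epsilon> *\<^sub>R \<eta>))))"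
    proof (rule Bochner_Integration.integral_cong[OF refl])
      fix \<eta> :: 'a
      have "fourier \<Phi> \<eta> = \<epsilon> ^ DIM('a) *\<^sub>R integral\<^sup>L lborel (\<lambda>z. \<Phi> (\<epsilon> *\<^sub>R z) * cis (z \<bullet> (\<epsilon> *\<^sub>R \<eta>)))"
        unfolding fourier_def using lborel_integral_scale(1)[of "\<lambda>x. \<Phi> x * cis (x \<bullet> \<eta>)" \<epsilon>] e by simp
      then show "fourier \<Phi> \<eta> * of_real (std_gauss (\<epsilon> *\<^sub>R \<eta>)) =
         (\<epsilon> ^ DIM('a)) *\<^sub>R (integral\<^sup>L lborel (\<lambda>z. \<Phi> (\<epsilon> *\<^sub>R z) * cis (z \<bullet> (\<epsilon> *\<^sub>R \<eta>))) * of_real (std_gauss (\<epsilon> *\<^sub>R \<eta>)))"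
        by simp
    qed
    also have "\<dots> = integral\<^sup>L lborel (\<lambda>\<zeta>. integral\<^sup>L lborel (\<lambda>z. \<Phi> (\<epsilon> *\<^sub>R z) * cis (z \<bullet> \<zeta>)) * of_real (std_gauss \<zeta>))"
      using lborel_integral_scale(1)[of "\<lambda>\<zeta>. integral\<^sup>L lborel (\<lambda>z. \<Phi> (\<epsilon> *\<^sub>R z) * cis (z \<bullet> \<zeta>)) * of_real (std_gauss \<zeta>)" \<epsilon>] e
      by simp
    also have "\<dots> = integral\<^sup>L lborel (\<lambda>\<zeta>. integral\<^sup>L lborel (\<lambda>z. \<Phi> (\<epsilon> *\<^sub>R z) * cis (z \<bullet> \<zeta>) * of_real (std_gauss \<zeta>)))"
      by simp
    also have "\<dots> = integral\<^sup>L lborel (\<lambda>z. integral\<^sup>L lborel (\<lambda>\<zeta>. \<Phi> (\<epsilon> *\<^sub>R z) * cis (z \<bullet> \<zeta>) * of_real (std_gauss \<zeta>)))"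
    proof (rule lborel_pair.Fubini_integral, rule lborel_pair.Fubini_integrable)
      show "integrable lborel (\<lambda>z. integral\<^sup>L lborel (\<lambda>\<zeta>. norm (case (z, \<zeta>) of (z, \<zeta>) \<Rightarrow> \<Phi> (\<epsilon> *\<^sub>R z) * cis (z \<bullet> \<zeta>) * of_real (std_gauss \<zeta>))))"
        using i1 by (simp add: norm_mult integral_std_gauss)
      show "AE z in lborel. integrable lborel (\<lambda>\<zeta>. case (z, \<zeta>) of (z, \<zeta>) \<Rightarrow> \<Phi> (\<epsilon> *\<^sub>R z) * cis (z \<bullet> \<zeta>) * of_real (std_gauss \<zeta>))"
      proof (rule AE_I2)
        fix z :: 'a
        have "integrable lborel (\<lambda>\<zeta>. complex_of_real (std_gauss \<zeta>) * cis (\<zeta> \<bullet> z))"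
          by (intro integrable_cis_mult) (simp add: integrable_std_gauss)
        then have "integrable lborel (\<lambda>\<zeta>. \<Phi> (\<epsilon> *\<^sub>R z) * (complex_of_real (std_gauss \<zeta>) * cis (\<zeta> \<bullet> z)))" by simp
        then show "integrable lborel (\<lambda>\<zeta>. case (z, \<zeta>) of (z, \<zeta>) \<Rightarrow> \<Phi> (\<epsilon> *\<^sub>R z) * cis (z \<bullet> \<zeta>) * of_real (std_gauss \<zeta>))"
          by (simp add: mult_ac inner_commute)
      qed
    qed measurable
    also have "\<dots> = integral\<^sup>L lborel (\<lambda>z. \<Phi> (\<epsilon> *\<^sub>R z) * of_real (exp (- (norm z)\<^sup>2 / 2)))"
    proof (rule Bochner_Integration.integral_cong[OF refl])
      fix z :: 'a
      have "integral\<^sup>L lborel (\<lambda>\<zeta>. \<Phi> (\<epsilon> *\<^sub>R z) * cis (z \<bullet> \<zeta>) * of_real (std_gauss \<zeta>))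
        = integral\<^sup>L lborel (\<lambda>\<zeta>. \<Phi> (\<epsilon> *\<^sub>R z) * (of_real (std_gauss \<zeta>) * cis (z \<bullet> \<zeta>)))" by (simp add: mult_ac)
      also have "\<dots> = \<Phi> (\<epsilon> *\<^sub>R z) * of_real (exp (- (norm z)\<^sup>2 / 2))"
        by (subst integral_mult_right_zero) (simp only: fourier_std_gauss)
      finally show "integral\<^sup>L lborel (\<lambda>\<zeta>. \<Phi> (\<epsilon> *\<^sub>R z) * cis (z \<bullet> \<zeta>) * of_real (std_gauss \<zeta>)) = \<Phi> (\<epsilon> *\<^sub>R z) * of_real (exp (- (norm z)\<^sup>2 / 2))" .
    qed
    finally show ?thesis .
  qed
  define e where "e = (\<lambda>n. inverse (real (Suc n)))"
  have e: "e \<longlonglongrightarrow> 0" "e n > 0" for n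
    unfolding e_def by (rule LIMSEQ_inverse_real_of_nat) simp
  \<comment> \<open>\<open>1 / q\<close> is the value of \<open>std_gauss\<close> at 0. Each of the
    two limits L1 and L2 brings in one factor q, and together they make
    \<open>(2 * pi) ^ DIM('a)\<close>.\<close>
  define q where "q = sqrt (2 * pi) ^ DIM('a)"
  have q: "q > 0" by (simp add: q_def)
  have qq: "q * q = (2 * pi) ^ DIM('a)"
    unfolding q_def power_mult_distrib[symmetric] by simp
  have g0: "std_gauss (0::'a) = 1 / q" by (simp add: std_gauss_eq q_def)
  have eg: "exp (- (norm z)\<^sup>2 / 2) = q * std_gauss z" for z :: 'a using q by (simp add: std_gauss_eq q_def)
  have gle: "std_gauss z \<le> 1 / q" for z :: 'a using q by (simp add: std_gauss_eq q_def divide_right_mono)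
  have L1: "(\<lambda>n. integral\<^sup>L lborel (\<lambda>\<eta>. fourier \<Phi> \<eta> * of_real (std_gauss (e n *\<^sub>R \<eta>)))) \<longlonglongrightarrow> integral\<^sup>L lborel (\<lambda>\<eta>. fourier \<Phi> \<eta> * of_real (1 / q))"
  proof (rule integral_dominated_convergence[where w="\<lambda>\<eta>. norm (fourier \<Phi> \<eta>) * (1 / q)"])
    show "integrable lborel (\<lambda>\<eta>. norm (fourier \<Phi> \<eta>) * (1 / q))" using intF by simp
    show "AE \<eta> in lborel. (\<lambda>n. fourier \<Phi> \<eta> * of_real (std_gauss (e n *\<^sub>R \<eta>))) \<longlonglongrightarrow> fourier \<Phi> \<eta> * of_real (1 / q)"
    proof (rule AE_I2)
      fix \<eta> :: 'a
      have "(\<lambda>n. e n *\<^sub>R \<eta>) \<longlonglongrightarrow> 0 *\<^sub>R \<eta>" by (intro tendsto_intros e)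
      moreover have "isCont (std_gauss :: 'a \<Rightarrow> real) 0"
        using continuous_std_gauss[of "UNIV :: 'a set"] by (simp add: continuous_on_eq_continuous_at)
      ultimately have "(\<lambda>n. std_gauss (e n *\<^sub>R \<eta>)) \<longlonglongrightarrow> std_gauss (0::'a)" by (auto intro: isCont_tendsto_compose)
      then show "(\<lambda>n. fourier \<Phi> \<eta> * of_real (std_gauss (e n *\<^sub>R \<eta>))) \<longlonglongrightarrow> fourier \<Phi> \<eta> * of_real (1 / q)"
        unfolding g0 by (intro tendsto_intros)
    qed
    show "AE \<eta> in lborel. norm (fourier \<Phi> \<eta> * of_real (std_gauss (e n *\<^sub>R \<eta>))) \<le> norm (fourier \<Phi> \<eta>) * (1 / q)" for n
      by (rule AE_I2) (simp only: norm_mult norm_of_real abs_of_nonneg[OF std_gauss_nonneg] mult_left_mono[OF gle norm_ge_zero])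
  qed measurable
  have L2: "(\<lambda>n. integral\<^sup>L lborel (\<lambda>z. \<Phi> (e n *\<^sub>R z) * of_real (exp (- (norm z)\<^sup>2 / 2)))) \<longlonglongrightarrow>
      integral\<^sup>L lborel (\<lambda>z. \<Phi> 0 * of_real (q * std_gauss (z::'a)))"
    unfolding eg
  proof (rule integral_dominated_convergence[where w="\<lambda>z. B * (q * std_gauss z)"])
    show "integrable lborel (\<lambda>z::'a. B * (q * std_gauss z))" by (intro integrable_mult_right integrable_std_gauss)
    show "AE z in lborel. (\<lambda>n. \<Phi> (e n *\<^sub>R z) * of_real (q * std_gauss z)) \<longlonglongrightarrow> \<Phi> 0 * of_real (q * std_gauss z)"
    proof (rule AE_I2)
      fix z :: 'a
      have "(\<lambda>n. e n *\<^sub>R z) \<longlonglongrightarrow> 0 *\<^sub>R z" by (intro tendsto_intros e)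
      then have "(\<lambda>n. \<Phi> (e n *\<^sub>R z)) \<longlonglongrightarrow> \<Phi> 0" using cont by (auto intro: isCont_tendsto_compose)
      then show "(\<lambda>n. \<Phi> (e n *\<^sub>R z) * of_real (q * std_gauss z)) \<longlonglongrightarrow> \<Phi> 0 * of_real (q * std_gauss z)"
        by (intro tendsto_intros)
    qed
    show "AE z in lborel. norm (\<Phi> (e n *\<^sub>R z) * of_real (q * std_gauss z)) \<le> B * (q * std_gauss z)" for n
    proof (rule AE_I2)
      fix z :: 'a
      have "norm (\<Phi> (e n *\<^sub>R z)) * (q * std_gauss z) \<le> B * (q * std_gauss z)"
        using q by (intro mult_right_mono bound mult_nonneg_nonneg) auto
      then show "norm (\<Phi> (e n *\<^sub>R z) * of_real (q * std_gauss z)) \<le> B * (q * std_gauss z)"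
        using q by (simp add: norm_mult abs_mult)
    qed
  qed measurable
  have "integral\<^sup>L lborel (\<lambda>\<eta>. fourier \<Phi> \<eta> * of_real (1 / q)) = integral\<^sup>L lborel (\<lambda>z. \<Phi> 0 * of_real (q * std_gauss (z::'a)))"
    by (rule LIMSEQ_unique[OF L1]) (use L2 key e(2) in simp)
  also have "\<dots> = \<Phi> 0 * of_real q"
    by (simp add: integral_std_gauss)
  finally have "integral\<^sup>L lborel (fourier \<Phi>) / of_real q = \<Phi> 0 * of_real q" by simp
  then have "integral\<^sup>L lborel (fourier \<Phi>) = of_real (q * q) * \<Phi> 0" using q by (simp add: field_simps)
  then show ?thesis unfolding qq .
qed

section \<open>Rapidly decreasing functions\<close>

text \<open>Decay and continuity without smoothness. The class contains the Fourier transforms of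
  Schwartz functions and is stable under conjugation and isometric embeddings, which is all that the
  integrals below require.\<close>

definition rapid :: "('a::euclidean_space \<Rightarrow> complex) \<Rightarrow> bool" where
  "rapid f \<longleftrightarrow> continuous_on UNIV f \<and> (\<forall>N. \<exists>C. \<forall>x. (1 + norm x) ^ N * norm (f x) \<le> C)"

text \<open>Each 1 + (x.b)^2 is at most (1 + |x|)^2, so the function is dominated by a product of
  one-dimensional functions 1 / (1 + t^2). This is where the exponent \<open>2 * DIM('a)\<close>
  comes from.\<close>

lemma integrable_inverse_power: "integrable lborel (\<lambda>x::'a::euclidean_space. 1 / (1 + norm x) ^ (2 * DIM('a)))"
proof (rule integrableI_nonneg)
  have 1: "(\<integral>\<^sup>+t. ennreal (inverse (1 + t\<^sup>2)) \<partial>lborel) < \<infinity>"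
    using integrable_inverse_1_plus_square
    by (simp add: set_integrable_def einterval_eq integrable_iff_bounded less_top[symmetric])
  have "(\<integral>\<^sup>+x. ennreal (1 / (1 + norm (x::'a)) ^ (2 * DIM('a))) \<partial>lborel) \<le> (\<integral>\<^sup>+x. (\<Prod>b\<in>Basis. ennreal (inverse (1 + ((x::'a) \<bullet> b)\<^sup>2))) \<partial>lborel)"
  proof (rule nn_integral_mono)
    fix x :: 'a
    have "(\<Prod>b\<in>Basis. 1 + (x \<bullet> b)\<^sup>2) \<le> (\<Prod>b\<in>(Basis::'a set). (1 + norm x)\<^sup>2)"
    proof (intro prod_mono conjI)
      fix b :: 'a assume b: "b \<in> Basis"
      have "\<bar>x \<bullet> b\<bar> \<le> norm x" using b by (rule Basis_le_norm)
      then have "(x \<bullet> b)\<^sup>2 \<le> (norm x)\<^sup>2" by (metis abs_norm_cancel abs_le_square_iff)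
      moreover have "(1 + norm x)\<^sup>2 = 1 + 2 * norm x + (norm x)\<^sup>2" by (simp add: power2_sum)
      ultimately show "1 + (x \<bullet> b)\<^sup>2 \<le> (1 + norm x)\<^sup>2" using norm_ge_zero[of x] by linarith
    qed auto
    then have "(\<Prod>b\<in>Basis. 1 + (x \<bullet> b)\<^sup>2) \<le> (1 + norm x) ^ (2 * DIM('a))" by (simp add: power_mult)
    moreover have "(\<Prod>b\<in>Basis. 1 + (x \<bullet> b)\<^sup>2) > 0" by (intro prod_pos) (auto intro: add_pos_nonneg)
    ultimately have "1 / (1 + norm x) ^ (2 * DIM('a)) \<le> inverse (\<Prod>b\<in>Basis. 1 + (x \<bullet> b)\<^sup>2)"
      by (simp add: inverse_eq_divide frac_le)
    also have "\<dots> = (\<Prod>b\<in>Basis. inverse (1 + (x \<bullet> b)\<^sup>2))" by (rule prod_inversef[symmetric, unfolded o_def])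
    finally show "ennreal (1 / (1 + norm x) ^ (2 * DIM('a))) \<le> (\<Prod>b\<in>Basis. ennreal (inverse (1 + (x \<bullet> b)\<^sup>2)))"
      by (subst prod_ennreal) (auto intro!: ennreal_leI)
  qed
  also have "\<dots> = (\<Prod>b\<in>(Basis::'a set). (\<integral>\<^sup>+t. ennreal (inverse (1 + t\<^sup>2)) \<partial>lborel))"
    by (rule nn_integral_lborel_prod) auto
  also have "\<dots> < \<infinity>" using 1 by (simp add: power_less_top_ennreal)
  finally show "(\<integral>\<^sup>+x. ennreal (1 / (1 + norm (x::'a)) ^ (2 * DIM('a))) \<partial>lborel) < \<infinity>" .
qed auto

lemma rapidD: "rapid f \<Longrightarrow> \<exists>C. \<forall>x. norm (f x) \<le> C / (1 + norm x) ^ N"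
proof -
  assume "rapid f"
  then obtain C where C: "\<And>x. (1 + norm x) ^ N * norm (f x) \<le> C" unfolding rapid_def by blast
  have "norm (f x) \<le> C / (1 + norm x) ^ N" for x
    using C[of x] by (subst pos_le_divide_eq) (auto simp: mult.commute intro!: zero_less_power add_pos_nonneg)
  then show ?thesis by blast
qed

lemma rapid_bound: "rapid f \<Longrightarrow> \<exists>B. \<forall>x. norm (f x) \<le> B"
  using rapidD[of f 0] by simp

lemma rapid_measurable: "rapid f \<Longrightarrow> f \<in> borel_measurable borel"
  by (simp add: rapid_def borel_measurable_continuous_onI)

lemma rapid_integrable:
  fixes f :: "'a::euclidean_space \<Rightarrow> complex"
  assumes f: "rapid f" shows "integrable lborel f"
proof -
  obtain C where C: "\<And>x. norm (f x) \<le> C / (1 + norm x) ^ (2 * DIM('a))" using rapidD[OF f] by blast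
  show ?thesis
  proof (rule Bochner_Integration.integrable_bound)
    show "integrable lborel (\<lambda>x::'a. C * (1 / (1 + norm x) ^ (2 * DIM('a))))"
      by (intro integrable_mult_right integrable_inverse_power)
    show "AE x in lborel. norm (f x) \<le> norm (C * (1 / (1 + norm x) ^ (2 * DIM('a))))"
    proof (rule AE_I2)
      fix x :: 'a
      have "C / (1 + norm x) ^ (2 * DIM('a)) \<le> \<bar>C\<bar> / (1 + norm x) ^ (2 * DIM('a))"
        by (intro divide_right_mono) auto
      then show "norm (f x) \<le> norm (C * (1 / (1 + norm x) ^ (2 * DIM('a))))"
        using C[of x] by simp
    qed
  qed (use rapid_measurable[OF f] in simp)
qed

lemma rapid_compose_norm_le:
  assumes f: "rapid f" and w: "continuous_on UNIV w" "\<And>x. norm x \<le> norm (w x)"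
  shows "rapid (\<lambda>x. f (w x))"
  unfolding rapid_def
proof (intro conjI allI)
  show "continuous_on UNIV (\<lambda>x. f (w x))"
    using f w(1) by (auto simp: rapid_def intro: continuous_on_compose2)
  fix N
  obtain C where C: "\<And>x. (1 + norm x) ^ N * norm (f x) \<le> C" using f unfolding rapid_def by blast
  have "(1 + norm x) ^ N * norm (f (w x)) \<le> C" for x
    using C[of "w x"] w(2)[of x] by (intro order_trans[OF mult_right_mono C]) (auto intro!: power_mono)
  then show "\<exists>C. \<forall>x. (1 + norm x) ^ N * norm (f (w x)) \<le> C" by blast
qed

lemma continuous_on_fourier:
  assumes f: "integrable lborel f" shows "continuous_on UNIV (fourier f)"
proof -
  have [measurable]: "f \<in> borel_measurable borel" using f by auto
  have "continuous (at \<xi>) (fourier f)" for \<xi>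
    unfolding continuous_at_sequentially o_def fourier_def
  proof (intro allI impI)
    fix X assume X: "X \<longlonglongrightarrow> \<xi>"
    show "(\<lambda>n. integral\<^sup>L lborel (\<lambda>x. f x * cis (x \<bullet> X n))) \<longlonglongrightarrow> integral\<^sup>L lborel (\<lambda>x. f x * cis (x \<bullet> \<xi>))"
    proof (rule integral_dominated_convergence[where w="\<lambda>x. norm (f x)"])
      show "AE x in lborel. (\<lambda>n. f x * cis (x \<bullet> X n)) \<longlonglongrightarrow> f x * cis (x \<bullet> \<xi>)"
        using X by (intro AE_I2 tendsto_intros isCont_tendsto_compose[where g=cis])
          (auto intro: continuous_intros)
    qed (use f in \<open>auto simp: norm_mult\<close>)
  qed
  then show ?thesis by (simp add: continuous_on_eq_continuous_at)
qed

text \<open>Inversion at the origin, applied to the marginal of \<open>\<psi>\<close> in the second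
  variable: its Fourier transform is that of \<open>\<psi>\<close> restricted to {0} x 'b, and its
  value at 0 is the integral over the complementary subspace.\<close>

lemma integral_subspace_fourier:
  fixes \<psi> :: "'a::euclidean_space \<times> 'b::euclidean_space \<Rightarrow> complex"
  assumes \<psi>: "rapid \<psi>" and F: "rapid (fourier \<psi>)"
  shows "integral\<^sup>L lborel (\<lambda>\<eta>. fourier \<psi> (0, \<eta>)) = of_real ((2 * pi) ^ DIM('b)) * integral\<^sup>L lborel (\<lambda>x. \<psi> (x, 0))"
proof -
  note [measurable] = rapid_measurable[OF \<psi>]
  have int: "integrable (lborel \<Otimes>\<^sub>M lborel) (\<lambda>(x, y). \<psi> (x, y))"
    using rapid_integrable[OF \<psi>] by (simp add: lborel_prod case_prod_unfold)
  define \<Phi> where "\<Phi> y = integral\<^sup>L lborel (\<lambda>x. \<psi> (x, y))" for y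
  obtain C where C: "\<And>p. norm (\<psi> p) \<le> C / (1 + norm p) ^ (2 * DIM('a))" using rapidD[OF \<psi>] by blast
  have C0: "C \<ge> 0" using C[of 0] by (auto intro: order_trans[OF norm_ge_zero])
  define w where "w x = C * (1 / (1 + norm x) ^ (2 * DIM('a)))" for x :: 'a
  have Cw: "norm (\<psi> (x, y)) \<le> w x" for x y
  proof -
    have "norm x \<le> norm (x, y)" by (metis norm_fst_le fst_conv)
    then have "(1 + norm x) ^ (2 * DIM('a)) \<le> (1 + norm (x, y)) ^ (2 * DIM('a))" by (intro power_mono) auto
    then have "C / (1 + norm (x, y)) ^ (2 * DIM('a)) \<le> C / (1 + norm x) ^ (2 * DIM('a))"
      using C0 by (intro divide_left_mono mult_pos_pos) (auto intro!: zero_less_power add_pos_nonneg)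
    then show ?thesis using C[of "(x, y)"] by (simp add: w_def)
  qed
  have w: "integrable lborel w" unfolding w_def by (intro integrable_mult_right integrable_inverse_power)
  have cont: "isCont \<Phi> y" for y
    unfolding continuous_at_sequentially o_def \<Phi>_def
  proof (intro allI impI)
    fix X assume X: "X \<longlonglongrightarrow> y"
    show "(\<lambda>n. integral\<^sup>L lborel (\<lambda>x. \<psi> (x, X n))) \<longlonglongrightarrow> integral\<^sup>L lborel (\<lambda>x. \<psi> (x, y))"
    proof (rule integral_dominated_convergence[where w=w])
      show "AE x in lborel. (\<lambda>n. \<psi> (x, X n)) \<longlonglongrightarrow> \<psi> (x, y)"
      proof (rule AE_I2)
        fix x
        have "isCont \<psi> (x, y)" using \<psi> by (simp add: rapid_def continuous_on_eq_continuous_at)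
        then show "(\<lambda>n. \<psi> (x, X n)) \<longlonglongrightarrow> \<psi> (x, y)"
          by (rule isCont_tendsto_compose) (intro tendsto_intros X)
      qed
    qed (use w Cw in auto)
  qed
  have int\<Phi>: "integrable lborel \<Phi>"
    unfolding \<Phi>_def using lborel_pair.integrable_snd[OF int] by simp
  have FT: "fourier \<Phi> \<eta> = fourier \<psi> (0, \<eta>)" for \<eta>
  proof -
    have i2: "integrable (lborel \<Otimes>\<^sub>M lborel) (\<lambda>(x, y). \<psi> (x, y) * cis (y \<bullet> \<eta>))"
      using integrable_cis_mult[OF rapid_integrable[OF \<psi>], of "(0, \<eta>)"]
      by (simp add: lborel_prod case_prod_unfold inner_prod_def)
    have "fourier \<psi> (0, \<eta>) = integral\<^sup>L (lborel \<Otimes>\<^sub>M lborel) (\<lambda>(x, y). \<psi> (x, y) * cis (y \<bullet> \<eta>))"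
      by (simp add: fourier_def lborel_prod case_prod_unfold inner_prod_def)
    also have "\<dots> = integral\<^sup>L lborel (\<lambda>y. integral\<^sup>L lborel (\<lambda>x. \<psi> (x, y) * cis (y \<bullet> \<eta>)))"
      by (rule lborel_pair.integral_snd[symmetric, OF i2])
    also have "\<dots> = fourier \<Phi> \<eta>" by (simp add: fourier_def \<Phi>_def)
    finally show ?thesis by simp
  qed
  have "rapid (\<lambda>\<eta>. fourier \<psi> (0, \<eta>))"
    by (rule rapid_compose_norm_le[OF F]) (auto intro!: continuous_intros simp: norm_Pair)
  then have intF: "integrable lborel (fourier \<Phi>)"
    unfolding FT[abs_def] by (rule rapid_integrable)
  have bound: "norm (\<Phi> y) \<le> integral\<^sup>L lborel w" for y
  proof -
    have w0: "0 \<le> w x" for x using Cw[of x y] norm_ge_zero order_trans by blast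
    have "norm (\<Phi> y) \<le> integral\<^sup>L lborel (\<lambda>x. norm (\<psi> (x, y)))" unfolding \<Phi>_def by (rule integral_norm_bound)
    also have "\<dots> \<le> integral\<^sup>L lborel w" by (rule integral_mono'[OF w Cw w0])
    finally show ?thesis .
  qed
  show ?thesis
    using fourier_inversion_at_0[OF int\<Phi> cont bound intF] unfolding FT[abs_def] \<Phi>_def by simp
qed

section \<open>Schwartz functions and the Cayley--Laplace operator\<close>

lemma iter_deriv_append: "iter_deriv (bs @ cs) \<phi> = iter_deriv bs (iter_deriv cs \<phi>)"
  by (induction bs) auto

definition pd :: "'a::euclidean_space \<Rightarrow> ('a \<Rightarrow> complex) \<Rightarrow> 'a \<Rightarrow> complex" where
  "pd b \<phi> = (\<lambda>x. frechet_derivative \<phi> (at x) b)"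

lemma iter_deriv_pd: "iter_deriv bs (pd b \<phi>) = iter_deriv (bs @ [b]) \<phi>"
  by (simp add: iter_deriv_append pd_def)

lemma smooth_pd: "smooth \<phi> \<Longrightarrow> b \<in> Basis \<Longrightarrow> smooth (pd b \<phi>)"
  unfolding smooth_def iter_deriv_pd by auto

lemma smooth_differentiable: "smooth \<phi> \<Longrightarrow> \<phi> differentiable (at x)"
  unfolding smooth_def by (metis empty_subsetI iter_deriv.simps(1) list.set(1))

lemma smooth_has_derivative: "smooth \<phi> \<Longrightarrow> (\<phi> has_derivative frechet_derivative \<phi> (at x)) (at x)"
  using smooth_differentiable frechet_derivative_works by blast

lemma smooth_iter_deriv: "smooth \<phi> \<Longrightarrow> set bs \<subseteq> Basis \<Longrightarrow> smooth (iter_deriv bs \<phi>)"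
  unfolding smooth_def iter_deriv_append[symmetric] by auto

lemma iter_deriv_add:
  assumes "smooth \<phi>" "smooth \<eta>" "set bs \<subseteq> Basis"
  shows "iter_deriv bs (\<lambda>x. \<phi> x + \<eta> x) = (\<lambda>x. iter_deriv bs \<phi> x + iter_deriv bs \<eta> x)"
  using assms(3)
proof (induction bs)
  case (Cons b bs)
  have "frechet_derivative (\<lambda>x. iter_deriv bs \<phi> x + iter_deriv bs \<eta> x) (at x) =
      (\<lambda>h. frechet_derivative (iter_deriv bs \<phi>) (at x) h + frechet_derivative (iter_deriv bs \<eta>) (at x) h)" for x
    using Cons.prems assms(1,2)
    by (intro frechet_derivative_at[symmetric] has_derivative_add smooth_has_derivative smooth_iter_deriv) auto
  then show ?case using Cons by simp
qed simp

lemma iter_deriv_cmult: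
  assumes "smooth \<phi>" "set bs \<subseteq> Basis"
  shows "iter_deriv bs (\<lambda>x. c * \<phi> x) = (\<lambda>x. c * iter_deriv bs \<phi> x)"
  using assms(2)
proof (induction bs)
  case (Cons b bs)
  have "frechet_derivative (\<lambda>x. c * iter_deriv bs \<phi> x) (at x) = (\<lambda>h. c * frechet_derivative (iter_deriv bs \<phi>) (at x) h)" for x
    using Cons.prems assms(1)
    by (intro frechet_derivative_at[symmetric] has_derivative_mult_right smooth_has_derivative smooth_iter_deriv) auto
  then show ?case using Cons by simp
qed simp

lemma smooth_add: "smooth \<phi> \<Longrightarrow> smooth \<eta> \<Longrightarrow> smooth (\<lambda>x. \<phi> x + \<eta> x)"
  unfolding smooth_def[of "\<lambda>x. \<phi> x + \<eta> x"]
  by (simp add: iter_deriv_add differentiable_add smooth_differentiable smooth_iter_deriv)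

lemma smooth_cmult: "smooth \<phi> \<Longrightarrow> smooth (\<lambda>x. c * \<phi> x)"
  unfolding smooth_def[of "\<lambda>x. c * \<phi> x"]
  by (simp add: iter_deriv_cmult differentiable_mult smooth_differentiable smooth_iter_deriv)

lemma schwartz_smooth: "\<phi> \<in> schwartz \<Longrightarrow> smooth \<phi>"
  by (simp add: schwartz_def)

lemma schwartz_bounded:
  "\<phi> \<in> schwartz \<Longrightarrow> set bs \<subseteq> Basis \<Longrightarrow> bounded (range (\<lambda>x. (1 + norm x) ^ N *\<^sub>R iter_deriv bs \<phi> x))"
  by (auto simp: schwartz_def)

lemma schwartz_pd: "\<phi> \<in> schwartz \<Longrightarrow> b \<in> Basis \<Longrightarrow> pd b \<phi> \<in> schwartz"
  by (auto simp: schwartz_def smooth_pd iter_deriv_pd)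

lemma schwartz_add: "\<phi> \<in> schwartz \<Longrightarrow> \<eta> \<in> schwartz \<Longrightarrow> (\<lambda>x. \<phi> x + \<eta> x) \<in> schwartz"
proof -
  assume *: "\<phi> \<in> schwartz" "\<eta> \<in> schwartz"
  have "bounded (range (\<lambda>x. (1 + norm x) ^ N *\<^sub>R iter_deriv bs \<phi> x + (1 + norm x) ^ N *\<^sub>R iter_deriv bs \<eta> x))"
    if "set bs \<subseteq> Basis" for bs N
    using * that by (intro bounded_plus_comp) (auto simp: schwartz_def)
  then show ?thesis using *
    by (auto simp: schwartz_def iter_deriv_add smooth_add scaleR_add_right)
qed

lemma schwartz_cmult: "\<phi> \<in> schwartz \<Longrightarrow> (\<lambda>x. c * \<phi> x) \<in> schwartz"
proof -
  assume *: "\<phi> \<in> schwartz"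
  have "bounded (range (\<lambda>x. c * ((1 + norm x) ^ N *\<^sub>R iter_deriv bs \<phi> x)))" if "set bs \<subseteq> Basis" for bs N
    using * that bounded_linear_image[of "range (\<lambda>x. (1 + norm x) ^ N *\<^sub>R iter_deriv bs \<phi> x)" "\<lambda>z. c * z"]
    by (auto simp: schwartz_def image_image bounded_linear_mult_right)
  then show ?thesis using *
    by (auto simp: schwartz_def iter_deriv_cmult smooth_cmult)
qed

lemma schwartz_0: "(\<lambda>x. 0) \<in> schwartz"
proof -
  have "iter_deriv bs (\<lambda>x. 0) = (\<lambda>x. 0 :: complex)" for bs :: "'a list"
  proof (induction bs)
    case (Cons b bs)
    have "frechet_derivative (\<lambda>x::'a. 0::complex) (at x) = (\<lambda>_. 0)" for x
      by (rule frechet_derivative_at[symmetric]) (rule has_derivative_const)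
    then show ?case using Cons by simp
  qed simp
  then show ?thesis by (simp add: schwartz_def smooth_def)
qed

lemma schwartz_sum: "(\<And>i. i \<in> I \<Longrightarrow> \<phi> i \<in> schwartz) \<Longrightarrow> (\<lambda>x. \<Sum>i\<in>I. \<phi> i x) \<in> schwartz"
  by (induction I rule: infinite_finite_induct) (auto intro: schwartz_0 schwartz_add)

lemma schwartz_rapid: "\<phi> \<in> schwartz \<Longrightarrow> rapid \<phi>"
  unfolding rapid_def
proof (intro conjI allI)
  assume \<phi>: "\<phi> \<in> schwartz"
  then show "continuous_on UNIV \<phi>"
    using smooth_differentiable[OF schwartz_smooth[OF \<phi>]]
    by (simp add: continuous_on_eq_continuous_at differentiable_imp_continuous_within)
  fix N
  have "bounded (range (\<lambda>x. (1 + norm x) ^ N *\<^sub>R iter_deriv [] \<phi> x))" by (rule schwartz_bounded[OF \<phi>]) simp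
  then obtain C where "\<And>x. norm ((1 + norm x) ^ N *\<^sub>R \<phi> x) \<le> C" by (auto simp: bounded_iff)
  then show "\<exists>C. \<forall>x. (1 + norm x) ^ N * norm (\<phi> x) \<le> C" by auto
qed

lemma smooth_directional_derivative:
  assumes "smooth \<phi>"
  shows "((\<lambda>t. \<phi> (x + t *\<^sub>R b)) has_vector_derivative pd b \<phi> x) (at 0)"
proof -
  let ?D = "frechet_derivative \<phi> (at x)"
  have D: "(\<phi> has_derivative ?D) (at (x + 0 *\<^sub>R b))" using smooth_has_derivative[OF assms, of x] by simp
  have "((\<lambda>t. x + t *\<^sub>R b) has_derivative (\<lambda>h. h *\<^sub>R b)) (at 0)"
    by (auto intro!: derivative_eq_intros)
  from has_derivative_compose[OF this D] have "((\<lambda>t. \<phi> (x + t *\<^sub>R b)) has_derivative (\<lambda>h. ?D (h *\<^sub>R b))) (at 0)" .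
  moreover have "(\<lambda>h. ?D (h *\<^sub>R b)) = (\<lambda>h. h *\<^sub>R ?D b)"
    using linear_scale[OF has_derivative_linear[OF D]] by auto
  ultimately show ?thesis by (simp add: has_vector_derivative_def pd_def)
qed

text \<open>The derivative along b of \<open>\<phi> x * cis (x \<bullet> \<xi>)\<close> has integral
  0; moving the term from the exponential to the other side produces the minus sign.\<close>

lemma fourier_pd:
  assumes \<phi>: "\<phi> \<in> schwartz" and b: "b \<in> Basis"
  shows "fourier (pd b \<phi>) \<xi> = - (\<i> * of_real (b \<bullet> \<xi>)) * fourier \<phi> \<xi>"
proof -
  have i1: "integrable lborel (\<lambda>x. pd b \<phi> x * cis (x \<bullet> \<xi>))" "integrable lborel (\<lambda>x. \<phi> x * cis (x \<bullet> \<xi>))"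
    by (intro integrable_cis_mult rapid_integrable schwartz_rapid schwartz_pd \<phi> b)+
  define F' where "F' x = pd b \<phi> x * cis (x \<bullet> \<xi>) + (\<i> * of_real (b \<bullet> \<xi>)) * (\<phi> x * cis (x \<bullet> \<xi>))" for x
  have "integral\<^sup>L lborel F' = 0"
  proof (rule integral_directional_derivative[where F="\<lambda>x. \<phi> x * cis (x \<bullet> \<xi>)" and b=b])
    fix x
    have c: "((\<lambda>t. cis ((x + t *\<^sub>R b) \<bullet> \<xi>)) has_vector_derivative (\<i> * of_real (b \<bullet> \<xi>)) * cis (x \<bullet> \<xi>)) (at 0)"
    proof -
      have "((\<lambda>t. exp (\<i> * of_real (x \<bullet> \<xi> + t * (b \<bullet> \<xi>)))) has_vector_derivative (\<i> * of_real (b \<bullet> \<xi>)) * exp (\<i> * of_real (x \<bullet> \<xi>))) (at 0)"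
      proof -
        have "((\<lambda>z. exp (\<i> * (of_real (x \<bullet> \<xi>) + z * of_real (b \<bullet> \<xi>)))) has_field_derivative (\<i> * of_real (b \<bullet> \<xi>)) * exp (\<i> * of_real (x \<bullet> \<xi>))) (at (of_real 0))"
          by (auto intro!: derivative_eq_intros)
        from has_vector_derivative_real_field[OF this] show ?thesis by simp
      qed
      then show ?thesis by (simp add: cis_conv_exp inner_add_left)
    qed
    show "((\<lambda>t. \<phi> (x + t *\<^sub>R b) * cis ((x + t *\<^sub>R b) \<bullet> \<xi>)) has_vector_derivative F' x) (at 0)"
      using has_vector_derivative_mult[OF smooth_directional_derivative[OF schwartz_smooth[OF \<phi>], of x b] c]
      by (simp add: F'_def algebra_simps)
    have co: "continuous_on UNIV (\<lambda>x. cis (x \<bullet> \<xi>))"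
      by (intro continuous_on_cis continuous_intros)
    show "continuous_on UNIV F'"
      unfolding F'_def using schwartz_rapid[OF \<phi>] schwartz_rapid[OF schwartz_pd[OF \<phi> b]]
      by (intro continuous_intros co) (auto simp: rapid_def)
    show "integrable lborel F'" unfolding F'_def
      by (intro Bochner_Integration.integrable_add integrable_mult_right i1)
  qed (rule i1)
  moreover have "integral\<^sup>L lborel F' = fourier (pd b \<phi>) \<xi> + (\<i> * of_real (b \<bullet> \<xi>)) * fourier \<phi> \<xi>"
    unfolding F'_def fourier_def
    by (subst Bochner_Integration.integral_add) (auto intro!: i1 integrable_mult_right)
  ultimately show ?thesis by (simp add: add_eq_0_iff2)
qed

lemma rapid_fourier:
  fixes \<phi> :: "'a::euclidean_space \<Rightarrow> complex"
  assumes \<phi>: "\<phi> \<in> schwartz" shows "rapid (fourier \<phi>)"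
  unfolding rapid_def
proof (intro conjI allI)
  show "continuous_on UNIV (fourier \<phi>)" by (intro continuous_on_fourier rapid_integrable schwartz_rapid \<phi>)
  fix N
  have pw: "(pd b ^^ n) \<phi> \<in> schwartz \<and> norm (fourier ((pd b ^^ n) \<phi>) \<xi>) = \<bar>b \<bullet> \<xi>\<bar> ^ n * norm (fourier \<phi> \<xi>)"
    if "b \<in> Basis" for b n \<xi>
    using that \<phi> by (induction n) (auto simp: schwartz_pd fourier_pd norm_mult)
  define K where "K b n = integral\<^sup>L lborel (\<lambda>x. norm ((pd b ^^ n) \<phi> x))" for b n
  have B: "\<bar>b \<bullet> \<xi>\<bar> ^ n * norm (fourier \<phi> \<xi>) \<le> K b n" if "b \<in> Basis" for b n \<xi>
    using pw[OF that, of n \<xi>] norm_fourier_le[of "(pd b ^^ n) \<phi>" \<xi>] by (simp add: K_def)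
  define K0 where "K0 = integral\<^sup>L lborel (\<lambda>x. norm (\<phi> x))"
  define C where "C = (real DIM('a) + 1) ^ N * (K0 + (\<Sum>b\<in>Basis. K b N))"
  have "(1 + norm \<xi>) ^ N * norm (fourier \<phi> \<xi>) \<le> C" for \<xi> :: 'a
  proof -
    \<comment> \<open>1 + |\<xi>| is at most (dim + 1) M, and M^N is either 1 or the N-th power of a
      single coordinate. Hence bounds for pure derivatives in one direction at a time are
      enough.\<close>
    define M where "M = Max (insert 1 ((\<lambda>b. \<bar>b \<bullet> \<xi>\<bar>) ` Basis))"
    have M: "1 \<le> M" "b \<in> Basis \<Longrightarrow> \<bar>b \<bullet> \<xi>\<bar> \<le> M" for b
      unfolding M_def by (rule Max_ge; simp)+
    have "norm \<xi> \<le> (\<Sum>b\<in>Basis. \<bar>\<xi> \<bullet> b\<bar>)" by (rule norm_le_l1)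
    also have "\<dots> \<le> (\<Sum>b\<in>(Basis::'a set). M)" by (intro sum_mono) (metis M(2) inner_commute)
    finally have "1 + norm \<xi> \<le> (real DIM('a) + 1) * M" using M(1) by (simp add: algebra_simps)
    then have "(1 + norm \<xi>) ^ N \<le> ((real DIM('a) + 1) * M) ^ N" by (intro power_mono) auto
    then have 1: "(1 + norm \<xi>) ^ N * norm (fourier \<phi> \<xi>) \<le> (real DIM('a) + 1) ^ N * (M ^ N * norm (fourier \<phi> \<xi>))"
      using mult_right_mono[OF _ norm_ge_zero[of "fourier \<phi> \<xi>"]] by (fastforce simp: power_mult_distrib mult.assoc)
    have Kpos: "K b n \<ge> 0" for b n unfolding K_def by simp
    have "M \<in> insert 1 ((\<lambda>b. \<bar>b \<bullet> \<xi>\<bar>) ` Basis)" unfolding M_def by (intro Max_in) auto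
    then have "M ^ N * norm (fourier \<phi> \<xi>) \<le> K0 + (\<Sum>b\<in>Basis. K b N)"
    proof
      assume "M = 1"
      then show ?thesis using norm_fourier_le[of \<phi> \<xi>] sum_nonneg[of Basis "\<lambda>b. K b N"] Kpos by (simp add: K0_def)
    next
      assume "M \<in> (\<lambda>b. \<bar>b \<bullet> \<xi>\<bar>) ` Basis"
      then obtain b where b: "b \<in> Basis" "M = \<bar>b \<bullet> \<xi>\<bar>" by auto
      have "K b N \<le> (\<Sum>b\<in>Basis. K b N)" using b Kpos by (intro member_le_sum) auto
      moreover have "K0 \<ge> 0" by (simp add: K0_def)
      ultimately show ?thesis using B[OF b(1), of \<xi> N] unfolding b(2) by linarith
    qed
    then have "(real DIM('a) + 1) ^ N * (M ^ N * norm (fourier \<phi> \<xi>)) \<le> C"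
      unfolding C_def by (intro mult_left_mono) auto
    with 1 show ?thesis by linarith
  qed
  then show "\<exists>C. \<forall>\<xi>. (1 + norm \<xi>) ^ N * norm (fourier \<phi> \<xi>) \<le> C" by blast
qed

lemma fourier_sum:
  assumes "\<And>i. i \<in> I \<Longrightarrow> integrable lborel (\<phi> i)"
  shows "fourier (\<lambda>x. \<Sum>i\<in>I. \<phi> i x) \<xi> = (\<Sum>i\<in>I. fourier (\<phi> i) \<xi>)"
  unfolding fourier_def sum_distrib_right
  by (intro Bochner_Integration.integral_sum integrable_cis_mult assms)

lemma fourier_cmult: "fourier (\<lambda>x. c * \<phi> x) \<xi> = c * fourier \<phi> \<xi>"
  by (simp add: fourier_def mult.assoc)

lemma axis_axis_Basis: "axis i (axis j 1) \<in> (Basis :: (real^'m^'n) set)"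
  by (simp)

text \<open>The transpose of \<open>gram_entry\<close> on test functions: the minus signs of the two
  distributional derivatives cancel, and their order is reversed.\<close>

definition gram_op :: "'m \<Rightarrow> 'm \<Rightarrow> (real^'m^'n \<Rightarrow> complex) \<Rightarrow> (real^'m^'n \<Rightarrow> complex)" where
  "gram_op j k \<phi> = (\<lambda>x. \<Sum>i\<in>UNIV. pd (axis i (axis k 1)) (pd (axis i (axis j 1)) \<phi>) x)"

lemma schwartz_gram_op: "\<phi> \<in> schwartz \<Longrightarrow> gram_op j k \<phi> \<in> schwartz"
  unfolding gram_op_def by (intro schwartz_sum schwartz_pd axis_axis_Basis)

lemma fourier_gram_op:
  assumes \<phi>: "\<phi> \<in> schwartz"
  shows "fourier (gram_op j k \<phi>) \<xi> = - of_real ((transpose \<xi> ** \<xi>) $ j $ k) * fourier \<phi> \<xi>"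
proof -
  have "fourier (gram_op j k \<phi>) \<xi> = (\<Sum>i\<in>UNIV. fourier (pd (axis i (axis k 1)) (pd (axis i (axis j 1)) \<phi>)) \<xi>)"
    unfolding gram_op_def
    by (intro fourier_sum rapid_integrable schwartz_rapid schwartz_pd axis_axis_Basis \<phi>)
  also have "\<dots> = (\<Sum>i\<in>UNIV. - of_real (\<xi> $ i $ j * \<xi> $ i $ k) * fourier \<phi> \<xi>)"
  proof (rule sum.cong[OF refl])
    fix i
    have "fourier (pd (axis i (axis k 1)) (pd (axis i (axis j 1)) \<phi>)) \<xi>
       = (\<i> * \<i>) * (of_real (\<xi> $ i $ k) * of_real (\<xi> $ i $ j)) * fourier \<phi> \<xi>"
      by (simp add: fourier_pd schwartz_pd \<phi> axis_axis_Basis inner_axis' del: i_squared)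
    then show "fourier (pd (axis i (axis k 1)) (pd (axis i (axis j 1)) \<phi>)) \<xi> = - of_real (\<xi> $ i $ j * \<xi> $ i $ k) * fourier \<phi> \<xi>"
      by simp
  qed
  also have "\<dots> = - of_real ((transpose \<xi> ** \<xi>) $ j $ k) * fourier \<phi> \<xi>"
    by (simp add: matrix_matrix_mult_def transpose_def sum_negf sum_distrib_right)
  finally show ?thesis .
qed

text \<open>The transpose of \<open>cayley_laplace\<close>. Transposition reverses compositions, so
  \<open>foldr\<close> on distributions becomes \<open>fold\<close> on functions.\<close>

definition cl_op :: "(real^'m^'n \<Rightarrow> complex) \<Rightarrow> (real^'m^'n \<Rightarrow> complex)" where
  "cl_op \<phi> = (\<lambda>x. \<Sum>\<sigma> | \<sigma> permutes (UNIV :: 'm set).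
     of_int (sign \<sigma>) * fold (\<lambda>j. gram_op j (\<sigma> j)) index_list \<phi> x)"

lemma index_list: "distinct (index_list :: 'm::finite list)" "set (index_list :: 'm list) = UNIV"
proof -
  have "\<exists>js :: 'm list. distinct js \<and> set js = UNIV"
    using finite_distinct_list[of "UNIV :: 'm set"] by auto
  from someI_ex[OF this] show "distinct (index_list :: 'm::finite list)" "set (index_list :: 'm list) = UNIV"
    unfolding index_list_def by auto
qed

lemma schwartz_fold_gram_op: "\<phi> \<in> schwartz \<Longrightarrow> fold (\<lambda>j. gram_op j (\<sigma> j)) js \<phi> \<in> schwartz"
  by (induction js arbitrary: \<phi>) (auto simp: schwartz_gram_op)

lemma schwartz_cl_op: "\<phi> \<in> schwartz \<Longrightarrow> cl_op \<phi> \<in> schwartz"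
  unfolding cl_op_def by (intro schwartz_sum schwartz_cmult schwartz_fold_gram_op)

text \<open>Entry (j, k) of the operator matrix acts as multiplication by minus the corresponding
  entry of \<xi>'\<xi>. Each Leibniz term has m such factors, whence the sign (-1)^m.\<close>

lemma fourier_cl_op:
  fixes \<phi> :: "real^'m^'n \<Rightarrow> complex"
  assumes \<phi>: "\<phi> \<in> schwartz"
  shows "fourier (cl_op \<phi>) \<xi> = of_real ((- 1) ^ CARD('m) * gram_det \<xi>) * fourier \<phi> \<xi>"
proof -
  have f: "fourier (fold (\<lambda>j. gram_op j (\<sigma> j)) js \<phi>) \<xi> =
     prod_list (map (\<lambda>j. - of_real ((transpose \<xi> ** \<xi>) $ j $ \<sigma> j)) js) * fourier \<phi> \<xi>" if "\<phi> \<in> schwartz"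
    for js \<sigma> and \<phi> :: "real^'m^'n \<Rightarrow> complex"
    using that by (induction js arbitrary: \<phi>) (auto simp: schwartz_gram_op fourier_gram_op)
  have "fourier (cl_op \<phi>) \<xi> = (\<Sum>\<sigma> | \<sigma> permutes (UNIV :: 'm set). of_int (sign \<sigma>) * fourier (fold (\<lambda>j. gram_op j (\<sigma> j)) index_list \<phi>) \<xi>)"
    unfolding cl_op_def
    by (subst fourier_sum) (auto simp: fourier_cmult intro!: rapid_integrable schwartz_rapid schwartz_cmult schwartz_fold_gram_op \<phi>)
  also have "\<dots> = (\<Sum>\<sigma> | \<sigma> permutes (UNIV :: 'm set). of_int (sign \<sigma>) *
      ((- 1) ^ CARD('m) * of_real (\<Prod>j\<in>UNIV. (transpose \<xi> ** \<xi>) $ j $ \<sigma> j)) * fourier \<phi> \<xi>)"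
  proof (rule sum.cong[OF refl])
    fix \<sigma> :: "'m \<Rightarrow> 'm"
    have "prod_list (map (\<lambda>j. - complex_of_real ((transpose \<xi> ** \<xi>) $ j $ \<sigma> j)) index_list)
        = (\<Prod>j\<in>UNIV. - complex_of_real ((transpose \<xi> ** \<xi>) $ j $ \<sigma> j))"
      using prod.distinct_set_conv_list[OF index_list(1), of "\<lambda>j. - complex_of_real ((transpose \<xi> ** \<xi>) $ j $ \<sigma> j)"]
      by (simp only: index_list(2))
    also have "\<dots> = (- 1) ^ CARD('m) * of_real (\<Prod>j\<in>UNIV. (transpose \<xi> ** \<xi>) $ j $ \<sigma> j)"
      by (simp add: prod_uminus)
    finally show "of_int (sign \<sigma>) * fourier (fold (\<lambda>j. gram_op j (\<sigma> j)) index_list \<phi>) \<xi> = of_int (sign \<sigma>) *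
      ((- 1) ^ CARD('m) * of_real (\<Prod>j\<in>UNIV. (transpose \<xi> ** \<xi>) $ j $ \<sigma> j)) * fourier \<phi> \<xi>"
      by (simp add: f[OF \<phi>] mult.assoc)
  qed
  also have "\<dots> = of_real ((- 1) ^ CARD('m) * gram_det \<xi>) * fourier \<phi> \<xi>"
    by (simp add: gram_det_def det_def sum_distrib_left sum_distrib_right mult_ac)
  finally show ?thesis .
qed

lemma schwartz_cl_op_power: "\<phi> \<in> schwartz \<Longrightarrow> (cl_op ^^ l) \<phi> \<in> schwartz"
  by (induction l) (auto simp: schwartz_cl_op)

lemma fourier_cl_op_power:
  fixes \<phi> :: "real^'m^'n \<Rightarrow> complex"
  assumes "\<phi> \<in> schwartz"
  shows "fourier ((cl_op ^^ l) \<phi>) \<xi> = of_real ((- 1) ^ (CARD('m) * l) * gram_det \<xi> ^ l) * fourier \<phi> \<xi>"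
  by (induction l) (simp_all add: fourier_cl_op schwartz_cl_op_power assms power_add mult_ac)

text \<open>Homogeneity is required for integers only: \<open>dist_of\<close> is conjugate linear,
  and the coefficients of the Leibniz expansion are 1 and -1.\<close>

definition schwartz_linear :: "('a::euclidean_space) distribution \<Rightarrow> bool" where
  "schwartz_linear T \<longleftrightarrow> (\<forall>\<phi>\<in>schwartz. \<forall>\<eta>\<in>schwartz. T (\<lambda>x. \<phi> x + \<eta> x) = T \<phi> + T \<eta>) \<and>
     (\<forall>\<phi>\<in>schwartz. \<forall>r::int. T (\<lambda>x. of_int r * \<phi> x) = of_int r * T \<phi>)"

lemma schwartz_linear_addD:
  "schwartz_linear T \<Longrightarrow> \<phi> \<in> schwartz \<Longrightarrow> \<eta> \<in> schwartz \<Longrightarrow> T (\<lambda>x. \<phi> x + \<eta> x) = T \<phi> + T \<eta>"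
  by (simp add: schwartz_linear_def)

lemma schwartz_linear_cmultD:
  "schwartz_linear T \<Longrightarrow> \<phi> \<in> schwartz \<Longrightarrow> T (\<lambda>x. of_int r * \<phi> x) = of_int r * T \<phi>"
  by (simp add: schwartz_linear_def)

lemma schwartz_linear_sum:
  assumes T: "schwartz_linear T" and "\<And>i. i \<in> I \<Longrightarrow> \<phi> i \<in> schwartz"
  shows "T (\<lambda>x. \<Sum>i\<in>I. \<phi> i x) = (\<Sum>i\<in>I. T (\<phi> i))"
proof -
  have T0: "T (\<lambda>x. 0) = 0"
  proof -
    have "T (\<lambda>x. of_int 0 * 0) = of_int 0 * T (\<lambda>x. 0)" by (rule schwartz_linear_cmultD[OF T schwartz_0])
    then show ?thesis by simp
  qed
  show ?thesis using assms(2)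
  proof (induction I rule: infinite_finite_induct)
    case (insert i I)
    have "T (\<lambda>x. \<phi> i x + (\<Sum>i\<in>I. \<phi> i x)) = T (\<phi> i) + T (\<lambda>x. \<Sum>i\<in>I. \<phi> i x)"
      using insert.prems by (intro schwartz_linear_addD[OF T] schwartz_sum) auto
    then show ?case using insert by simp
  qed (auto simp: T0)
qed

lemma schwartz_linear_dist_of:
  assumes G: "defines_tempered G" shows "schwartz_linear (dist_of G)"
  unfolding schwartz_linear_def dist_of_def
proof (intro conjI ballI allI)
  fix \<phi> \<eta> :: "'a \<Rightarrow> complex" assume "\<phi> \<in> schwartz" "\<eta> \<in> schwartz"
  then show "(LINT x|lebesgue. G x * cnj (\<phi> x + \<eta> x)) = (LINT x|lebesgue. G x * cnj (\<phi> x)) + (LINT x|lebesgue. G x * cnj (\<eta> x))"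
    using G by (simp add: defines_tempered_def distrib_left)
next
  fix \<phi> :: "'a \<Rightarrow> complex" and r :: int
  have "(LINT x|lebesgue. G x * cnj (of_int r * \<phi> x)) = (LINT x|lebesgue. of_int r * (G x * cnj (\<phi> x)))"
    by (simp add: mult_ac)
  also have "\<dots> = of_int r * (LINT x|lebesgue. G x * cnj (\<phi> x))" by (rule integral_mult_right_zero)
  finally show "(LINT x|lebesgue. G x * cnj (of_int r * \<phi> x)) = of_int r * (LINT x|lebesgue. G x * cnj (\<phi> x))" .
qed

lemma gram_entry_eq:
  assumes T: "schwartz_linear T" and \<phi>: "\<phi> \<in> schwartz"
  shows "gram_entry j k T \<phi> = T (gram_op j k \<phi>)"
proof -
  have "dist_partial i j (dist_partial i k T) \<phi> = T (pd (axis i (axis k 1)) (pd (axis i (axis j 1)) \<phi>))" for i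
    by (simp add: dist_partial_def pd_def)
  then show ?thesis
    unfolding gram_entry_def gram_op_def
    by (subst schwartz_linear_sum[OF T]) (auto intro!: schwartz_pd \<phi>)
qed

lemma pd_add: "smooth \<phi> \<Longrightarrow> smooth \<eta> \<Longrightarrow> b \<in> Basis \<Longrightarrow> pd b (\<lambda>x. \<phi> x + \<eta> x) = (\<lambda>x. pd b \<phi> x + pd b \<eta> x)"
  using iter_deriv_add[of \<phi> \<eta> "[b]"] by (simp add: pd_def)

lemma pd_cmult: "smooth \<phi> \<Longrightarrow> b \<in> Basis \<Longrightarrow> pd b (\<lambda>x. c * \<phi> x) = (\<lambda>x. c * pd b \<phi> x)"
  using iter_deriv_cmult[of \<phi> "[b]" c] by (simp add: pd_def)

lemma gram_op_add: "\<phi> \<in> schwartz \<Longrightarrow> \<eta> \<in> schwartz \<Longrightarrow> gram_op j k (\<lambda>x. \<phi> x + \<eta> x) = (\<lambda>x. gram_op j k \<phi> x + gram_op j k \<eta> x)"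
  by (simp add: gram_op_def pd_add smooth_pd schwartz_smooth sum.distrib)

lemma gram_op_cmult: "\<phi> \<in> schwartz \<Longrightarrow> gram_op j k (\<lambda>x. c * \<phi> x) = (\<lambda>x. c * gram_op j k \<phi> x)"
  by (simp add: gram_op_def pd_cmult smooth_pd schwartz_smooth sum_distrib_left)

lemma schwartz_linear_gram_entry:
  assumes T: "schwartz_linear T" shows "schwartz_linear (gram_entry j k T)"
  unfolding schwartz_linear_def
proof (intro conjI ballI allI)
  fix \<phi> \<eta> :: "real^'a^'b \<Rightarrow> complex" assume *: "\<phi> \<in> schwartz" "\<eta> \<in> schwartz"
  have "gram_entry j k T (\<lambda>x. \<phi> x + \<eta> x) = T (\<lambda>x. gram_op j k \<phi> x + gram_op j k \<eta> x)"
    using * by (simp add: gram_entry_eq[OF T] schwartz_add gram_op_add)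
  also have "\<dots> = T (gram_op j k \<phi>) + T (gram_op j k \<eta>)"
    using * by (intro schwartz_linear_addD[OF T] schwartz_gram_op)
  finally show "gram_entry j k T (\<lambda>x. \<phi> x + \<eta> x) = gram_entry j k T \<phi> + gram_entry j k T \<eta>"
    using * by (simp add: gram_entry_eq[OF T])
next
  fix \<phi> :: "real^'a^'b \<Rightarrow> complex" and r :: int assume *: "\<phi> \<in> schwartz"
  have "gram_entry j k T (\<lambda>x. of_int r * \<phi> x) = T (\<lambda>x. of_int r * gram_op j k \<phi> x)"
    using * by (simp add: gram_entry_eq[OF T] schwartz_cmult gram_op_cmult)
  also have "\<dots> = of_int r * T (gram_op j k \<phi>)"
    using * by (intro schwartz_linear_cmultD[OF T] schwartz_gram_op)
  finally show "gram_entry j k T (\<lambda>x. of_int r * \<phi> x) = of_int r * gram_entry j k T \<phi>"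
    using * by (simp add: gram_entry_eq[OF T])
qed

lemma foldr_gram_entry:
  assumes T: "schwartz_linear T"
  shows "schwartz_linear (foldr (\<lambda>j. gram_entry j (\<sigma> j)) js T) \<and>
    (\<forall>\<phi>\<in>schwartz. foldr (\<lambda>j. gram_entry j (\<sigma> j)) js T \<phi> = T (fold (\<lambda>j. gram_op j (\<sigma> j)) js \<phi>))"
  by (induction js) (auto simp: T schwartz_linear_gram_entry gram_entry_eq schwartz_gram_op)

lemma cayley_laplace_eq:
  assumes T: "schwartz_linear T" and \<phi>: "\<phi> \<in> schwartz"
  shows "cayley_laplace T \<phi> = T (cl_op \<phi>)"
proof -
  have *: "T (\<lambda>x. of_int r * fold (\<lambda>j. gram_op j (\<sigma> j)) js \<phi> x) = of_int r * T (fold (\<lambda>j. gram_op j (\<sigma> j)) js \<phi>)" for r \<sigma> js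
    by (intro schwartz_linear_cmultD[OF T] schwartz_fold_gram_op \<phi>)
  show ?thesis
    unfolding cayley_laplace_def cl_op_def
    by (subst schwartz_linear_sum[OF T]) (auto intro!: schwartz_cmult schwartz_fold_gram_op \<phi> sum.cong simp: * foldr_gram_entry[OF T] \<phi>)
qed

lemma cl_op_add: "\<phi> \<in> schwartz \<Longrightarrow> \<eta> \<in> schwartz \<Longrightarrow> cl_op (\<lambda>x. \<phi> x + \<eta> x) = (\<lambda>x. cl_op \<phi> x + cl_op \<eta> x)"
proof -
  assume *: "\<phi> \<in> schwartz" "\<eta> \<in> schwartz"
  have "fold (\<lambda>j. gram_op j (\<sigma> j)) js (\<lambda>x. \<phi> x + \<eta> x) = (\<lambda>x. fold (\<lambda>j. gram_op j (\<sigma> j)) js \<phi> x + fold (\<lambda>j. gram_op j (\<sigma> j)) js \<eta> x)" for js \<sigma>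
    using * by (induction js arbitrary: \<phi> \<eta>) (auto simp: gram_op_add schwartz_gram_op)
  then show ?thesis by (simp add: cl_op_def distrib_left sum.distrib)
qed

lemma cl_op_cmult: "\<phi> \<in> schwartz \<Longrightarrow> cl_op (\<lambda>x. c * \<phi> x) = (\<lambda>x. c * cl_op \<phi> x)"
proof -
  assume *: "\<phi> \<in> schwartz"
  have "fold (\<lambda>j. gram_op j (\<sigma> j)) js (\<lambda>x. c * \<phi> x) = (\<lambda>x. c * fold (\<lambda>j. gram_op j (\<sigma> j)) js \<phi> x)" for js \<sigma>
    using * by (induction js arbitrary: \<phi>) (auto simp: gram_op_cmult schwartz_gram_op)
  then show ?thesis by (simp add: cl_op_def sum_distrib_left mult_ac)
qed

lemma schwartz_linear_cayley_laplace:
  assumes T: "schwartz_linear T" shows "schwartz_linear (cayley_laplace T)"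
  unfolding schwartz_linear_def
proof (intro conjI ballI allI)
  fix \<phi> \<eta> :: "real^'a^'b \<Rightarrow> complex" assume *: "\<phi> \<in> schwartz" "\<eta> \<in> schwartz"
  have "T (\<lambda>x. cl_op \<phi> x + cl_op \<eta> x) = T (cl_op \<phi>) + T (cl_op \<eta>)"
    using * by (intro schwartz_linear_addD[OF T] schwartz_cl_op)
  then show "cayley_laplace T (\<lambda>x. \<phi> x + \<eta> x) = cayley_laplace T \<phi> + cayley_laplace T \<eta>"
    using * by (simp add: cayley_laplace_eq[OF T] cl_op_add schwartz_add)
next
  fix \<phi> :: "real^'a^'b \<Rightarrow> complex" and r :: int assume *: "\<phi> \<in> schwartz"
  have "T (\<lambda>x. of_int r * cl_op \<phi> x) = of_int r * T (cl_op \<phi>)"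
    using * by (intro schwartz_linear_cmultD[OF T] schwartz_cl_op)
  then show "cayley_laplace T (\<lambda>x. of_int r * \<phi> x) = of_int r * cayley_laplace T \<phi>"
    using * by (simp add: cayley_laplace_eq[OF T] cl_op_cmult schwartz_cmult)
qed

lemma cayley_laplace_power:
  assumes T: "schwartz_linear T" and \<phi>: "\<phi> \<in> schwartz"
  shows "(cayley_laplace ^^ l) T \<phi> = T ((cl_op ^^ l) \<phi>)"
proof -
  have "schwartz_linear ((cayley_laplace ^^ l) T) \<and> (\<forall>\<phi>\<in>schwartz. (cayley_laplace ^^ l) T \<phi> = T ((cl_op ^^ l) \<phi>))"
  proof (induction l)
    case (Suc l)
    then show ?case
      by (auto simp: schwartz_linear_cayley_laplace cayley_laplace_eq schwartz_cl_op funpow_swap1[of cl_op])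
  qed (auto simp: T)
  then show ?thesis using \<phi> by blast
qed

section \<open>Block decompositions\<close>

lemma stack_nth: "bij e \<Longrightarrow> stack e A B $ e s = (case s of Inl a \<Rightarrow> A $ a | Inr b \<Rightarrow> B $ b)"
  by (simp add: stack_def bij_is_inj inv_f_f)

lemma sum_reindex_Plus:
  fixes e :: "'p::finite + 'k::finite \<Rightarrow> 'n::finite" and F :: "'n \<Rightarrow> 'c::comm_monoid_add"
  assumes "bij e"
  shows "(\<Sum>i\<in>UNIV. F i) = (\<Sum>a\<in>UNIV. F (e (Inl a))) + (\<Sum>b\<in>UNIV. F (e (Inr b)))"
proof -
  have "(\<Sum>i\<in>UNIV. F i) = (\<Sum>s\<in>UNIV. F (e s))"
    using sum.reindex_bij_betw[of e UNIV UNIV F] assms by simp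
  then show ?thesis by (simp add: sum_UNIV_Plus)
qed

lemma CARD_Plus:
  fixes e :: "'p::finite + 'k::finite \<Rightarrow> 'n::finite"
  assumes "bij e" shows "CARD('n) = CARD('p) + CARD('k)"
  using bij_betw_same_card[of e UNIV UNIV] assms by simp

lemma transpose_0: "transpose (0 :: real^'m^'n) = 0"
  by (simp add: transpose_def vec_eq_iff)

context
  fixes e :: "'p::finite + 'k::finite \<Rightarrow> 'n::finite"
  assumes bij: "bij e"
begin

lemma vec_eq_stack: "(x = y) \<longleftrightarrow> (\<forall>a. x $ e (Inl a) = y $ e (Inl a)) \<and> (\<forall>b. x $ e (Inr b) = y $ e (Inr b))"
  for x y :: "'c^'n"
proof -
  have "(\<forall>i. x $ i = y $ i) \<longleftrightarrow> (\<forall>s. x $ e s = y $ e s)"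
    using bij by (metis bij_pointE)
  also have "\<dots> \<longleftrightarrow> (\<forall>a. x $ e (Inl a) = y $ e (Inl a)) \<and> (\<forall>b. x $ e (Inr b) = y $ e (Inr b))"
    by (metis sum.exhaust)
  finally show ?thesis by (simp add: vec_eq_iff)
qed

lemma stack_surj: "\<exists>A B. (x :: real^'c^'n) = stack e A B"
  by (rule exI[of _ "\<chi> a. x $ e (Inl a)"], rule exI[of _ "\<chi> b. x $ e (Inr b)"])
     (simp add: vec_eq_stack stack_nth[OF bij])

lemma stack_mult: "stack e A B ** M = stack e (A ** M) (B ** M)"
  by (simp add: vec_eq_stack stack_nth[OF bij]) (simp add: matrix_matrix_mult_def vec_eq_iff stack_nth[OF bij])

lemma gram_stack: "transpose (stack e A B) ** stack e C D = transpose A ** C + transpose B ** D"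
  by (simp add: vec_eq_iff matrix_matrix_mult_def transpose_def sum_reindex_Plus[OF bij] stack_nth[OF bij])

lemma stack_stiefel: "\<omega> \<in> stiefel \<Longrightarrow> stack e \<omega> 0 \<in> stiefel" "\<theta> \<in> stiefel \<Longrightarrow> stack e 0 \<theta> \<in> stiefel"
  by (simp_all add: stiefel_def gram_stack transpose_0)

lemma stack_orthogonal: "transpose (stack e 0 \<theta>) ** stack e \<omega> 0 = 0" "transpose (stack e \<omega> 0) ** stack e 0 \<theta> = 0"
  by (simp_all add: gram_stack transpose_0)

lemma inner_stack: "stack e A B \<bullet> stack e C D = A \<bullet> C + B \<bullet> D"
  by (simp add: inner_vec_def sum_reindex_Plus[OF bij] stack_nth[OF bij])

lemma norm_stack: "norm (stack e A B) = norm (A, B)"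
  by (simp add: norm_eq_sqrt_inner inner_stack inner_prod_def)

lemma linear_stack: "linear (\<lambda>p. stack e (fst p) (snd p))"
  by (rule linearI) (simp_all add: vec_eq_stack stack_nth[OF bij])

lemma bij_betw_stack_Basis:
  "bij_betw (\<lambda>p. stack e (fst p) (snd p)) (Basis :: ((real^'c^'p) \<times> (real^'c^'k)) set) (Basis :: (real^'c^'n) set)"
proof (rule bij_betw_imageI)
  show "inj_on (\<lambda>p. stack e (fst p) (snd p)) (Basis :: ((real^'c^'p) \<times> (real^'c^'k)) set)"
    by (rule inj_onI) (simp add: vec_eq_stack stack_nth[OF bij] prod_eq_iff vec_eq_iff)
  have l: "stack e (axis a v) 0 = axis (e (Inl a)) v" for a and v :: "real^'c"
    using bij by (auto simp: vec_eq_stack stack_nth[OF bij] axis_def dest: bij_is_inj[THEN injD])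
  have r: "stack e 0 (axis b v) = axis (e (Inr b)) v" for b and v :: "real^'c"
    using bij by (auto simp: vec_eq_stack stack_nth[OF bij] axis_def dest: bij_is_inj[THEN injD])
  show "(\<lambda>p. stack e (fst p) (snd p)) ` (Basis :: ((real^'c^'p) \<times> (real^'c^'k)) set) = Basis"
  proof
    show "(\<lambda>p. stack e (fst p) (snd p)) ` (Basis :: ((real^'c^'p) \<times> (real^'c^'k)) set) \<subseteq> Basis"
    proof
      fix x :: "real^'c^'n" assume "x \<in> (\<lambda>p. stack e (fst p) (snd p)) ` (Basis :: ((real^'c^'p) \<times> (real^'c^'k)) set)"
      then consider a v where "v \<in> Basis" "x = stack e (axis a v) 0" | b v where "v \<in> Basis" "x = stack e 0 (axis b v)"
        by (auto simp: Basis_prod_def Basis_vec_def[where 'b='p] Basis_vec_def[where 'b='k])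
      then show "x \<in> Basis" by cases (simp_all only: l r axis_in_Basis_iff)
    qed
    show "(Basis :: (real^'c^'n) set) \<subseteq> (\<lambda>p. stack e (fst p) (snd p)) ` Basis"
    proof
      fix x :: "real^'c^'n" assume "x \<in> Basis"
      then obtain i v where x: "x = axis i v" "v \<in> Basis" by (auto simp: Basis_vec_def)
      obtain s where s: "i = e s" using bij by (metis bij_pointE)
      show "x \<in> (\<lambda>p. stack e (fst p) (snd p)) ` Basis"
      proof (cases s)
        case (Inl a)
        show ?thesis using x s Inl by (intro image_eqI[of _ _ "(axis a v, 0)"]) (auto simp: l Basis_prod_def)
      next
        case (Inr b)
        show ?thesis using x s Inr by (intro image_eqI[of _ _ "(0, axis b v)"]) (auto simp: r Basis_prod_def)
      qed
    qed
  qed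
qed

lemma continuous_on_stack:
  fixes f :: "'b::topological_space \<Rightarrow> real^'c^'p" and h :: "'b \<Rightarrow> real^'c^'k"
  assumes "continuous_on S f" "continuous_on S h"
  shows "continuous_on S (\<lambda>x. stack e (f x) (h x))"
proof -
  have "continuous_on UNIV (\<lambda>p. stack e (fst p) (snd p) :: real^'c^'n)"
    by (rule linear_continuous_on) (simp add: linear_linear linear_stack)
  from continuous_on_compose2[OF this, of S "\<lambda>x. (f x, h x)"] show ?thesis
    using assms by (simp add: continuous_on_Pair)
qed

lemma borel_measurable_stack [measurable]:
  fixes f :: "'b \<Rightarrow> real^'c^'p" and h :: "'b \<Rightarrow> real^'c^'k"
  assumes "f \<in> borel_measurable M" "h \<in> borel_measurable M"
  shows "(\<lambda>x. stack e (f x) (h x)) \<in> borel_measurable M"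
  by (rule borel_measurable_continuous_Pair[OF assms]) (intro continuous_on_stack continuous_intros)

lemma integral_stack:
  fixes F :: "real^'c^'n \<Rightarrow> 'b::{banach, second_countable_topology}"
  assumes F: "F \<in> borel_measurable borel"
  shows "integral\<^sup>L lborel F = integral\<^sup>L lborel (\<lambda>p. F (stack e (fst p) (snd p)))"
proof -
  have D: "lborel = distr lborel borel (\<lambda>p. stack e (fst p) (snd p) :: real^'c^'n)"
    by (rule lborel_distr_basis_map[OF linear_stack bij_betw_stack_Basis, symmetric])
  have "integral\<^sup>L lborel F = integral\<^sup>L (distr lborel borel (\<lambda>p. stack e (fst p) (snd p) :: real^'c^'n)) F"
    using D by simp
  also have "\<dots> = integral\<^sup>L lborel (\<lambda>p. F (stack e (fst p) (snd p)))"
  proof (rule integral_distr)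
    show "(\<lambda>p. stack e (fst p) (snd p) :: real^'c^'n) \<in> lborel \<rightarrow>\<^sub>M borel"
      unfolding lborel_prod[symmetric] by measurable
  qed (use F in simp)
  finally show ?thesis .
qed

end

section \<open>Orthogonal pairs of frames\<close>

text \<open>Written side by side, two mutually orthogonal frames are one (k+m)-frame, and O(n) acts
  transitively on those.\<close>

lemma pair_transitive:
  fixes u u' :: "real^'k^'n" and w w' :: "real^'m^'n"
  assumes "u \<in> stiefel" "w \<in> stiefel" "transpose u ** w = 0"
    and "u' \<in> stiefel" "w' \<in> stiefel" "transpose u' ** w' = 0"
  obtains h :: "real^'n^'n" where "h \<in> stiefel" "h ** u = u'" "h ** w = w'"
proof -
  define hs where "hs u w = (\<chi> i s. case s of Inl a \<Rightarrow> u $ i $ a | Inr b \<Rightarrow> w $ i $ b)" for u :: "real^'k^'n" and w :: "real^'m^'n"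
  have col: "column (Inl a) (hs u w) = column a u" "column (Inr b) (hs u w) = column b w" for a b u w
    by (simp_all add: hs_def column_def)
  have "hs u w \<in> stiefel" if "u \<in> stiefel" "w \<in> stiefel" "transpose u ** w = 0" for u :: "real^'k^'n" and w :: "real^'m^'n"
  proof -
    have 0: "column a u \<bullet> column b w = 0" for a b using column_dot[of u w a b] that(3) by simp
    have zz: "column b w \<bullet> column a u = 0" for a b using 0[of a b] by (simp only: inner_commute)
    have "column i (hs u w) \<bullet> column j (hs u w) = (if i = j then 1 else 0)" for i j
      using that(1,2) 0 zz by (cases i; cases j) (simp_all add: col stiefel_columns)
    then show ?thesis by (simp add: stiefel_columns)
  qed
  then have "hs u w \<in> stiefel" "hs u' w' \<in> stiefel" using assms by blast+
  then obtain h :: "real^'n^'n" where h: "h \<in> stiefel" "h ** hs u w = hs u' w'"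
    by (rule stiefel_transitive)
  have hc: "h *v column i (hs u w) = column i (hs u' w')" for i by (simp only: h(2) column_mult[symmetric])
  have "column a (h ** u) = column a u'" for a using hc[of "Inl a"] by (simp only: column_mult col)
  moreover have "column b (h ** w) = column b w'" for b using hc[of "Inr b"] by (simp only: column_mult col)
  ultimately have "h ** u = u'" "h ** w = w'" by (simp_all add: vec_eq_iff column_def)
  then show ?thesis using h that by blast
qed

lemma measurable_haar_ident: "(\<lambda>g. g) \<in> borel_measurable (haar :: (real^'n^'n) measure)"
  by (rule measurable_stiefel_borel_ident[OF sets_haar])

lemma haar_distr_right:
  assumes h: "h \<in> stiefel"
  shows "distr haar borel (\<lambda>g. g ** h) = distr haar borel (\<lambda>g. g :: real^'n^'n)"
proof (rule measure_eqI)
  note measurable_haar_ident[measurable]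
  fix A :: "(real^'n^'n) set" assume "A \<in> sets (distr haar borel (\<lambda>g. g ** h))"
  then have A[measurable]: "A \<in> sets borel" by simp
  have "emeasure (distr haar borel (\<lambda>g. g ** h)) A = (\<integral>\<^sup>+g. indicator A g \<partial>distr haar borel (\<lambda>g. g ** h))" by simp
  also have "\<dots> = (\<integral>\<^sup>+g. indicator A (g ** h) \<partial>haar)" by (rule nn_integral_distr) (auto intro!: measurable_from_stiefel[OF sets_haar])
  also have "\<dots> = (\<integral>\<^sup>+g. indicator A g \<partial>haar)" by (rule nn_integral_haar_right[OF _ h]) measurable
  also have "\<dots> = (\<integral>\<^sup>+g. indicator A g \<partial>distr haar borel (\<lambda>g. g))" by (rule nn_integral_distr[where T="\<lambda>g. g", symmetric]) (simp_all add: measurable_haar_ident)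
  finally show "emeasure (distr haar borel (\<lambda>g. g ** h)) A = emeasure (distr haar borel (\<lambda>g. g)) A" by simp
qed simp

lemma haar_integral_right:
  fixes F :: "real^'n^'n \<Rightarrow> 'b::{banach, second_countable_topology}"
  assumes h: "h \<in> stiefel" and F: "F \<in> borel_measurable borel"
  shows "integral\<^sup>L haar (\<lambda>g. F (g ** h)) = integral\<^sup>L haar F"
    and "integrable haar (\<lambda>g. F (g ** h)) \<longleftrightarrow> integrable haar F"
proof -
  note measurable_haar_ident[measurable]
  have "integral\<^sup>L haar (\<lambda>g. F (g ** h)) = integral\<^sup>L (distr haar borel (\<lambda>g. g ** h)) F"
    by (rule integral_distr[symmetric]) (use F in measurable)
  also have "\<dots> = integral\<^sup>L haar F"
    unfolding haar_distr_right[OF h] by (rule integral_distr) (use F in measurable)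
  finally show "integral\<^sup>L haar (\<lambda>g. F (g ** h)) = integral\<^sup>L haar F" .
  have "integrable haar (\<lambda>g. F (g ** h)) \<longleftrightarrow> integrable (distr haar borel (\<lambda>g. g ** h)) F"
    by (rule integrable_distr_eq[symmetric]) (use F in measurable)
  also have "\<dots> \<longleftrightarrow> integrable haar F"
    unfolding haar_distr_right[OF h] by (rule integrable_distr_eq) (use F in measurable)
  finally show "integrable haar (\<lambda>g. F (g ** h)) \<longleftrightarrow> integrable haar F" .
qed

text \<open>The exchange principle of the proof: under the Haar integral one orthogonal pair of
  frames may be replaced by any other. It makes the Funk transforms adjoint and moves between pairs
  adapted to u and pairs adapted to v.\<close>

lemma haar_integral_pair:
  fixes K :: "real^'k^'n \<Rightarrow> real^'m^'n \<Rightarrow> 'b::{banach, second_countable_topology}"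
  assumes o: "u \<in> stiefel" "w \<in> stiefel" "transpose u ** w = 0"
    "u' \<in> stiefel" "w' \<in> stiefel" "transpose u' ** w' = 0"
    and K: "(\<lambda>(x, y). K x y) \<in> borel_measurable borel"
  shows "integral\<^sup>L haar (\<lambda>g. K (g ** u) (g ** w)) = integral\<^sup>L haar (\<lambda>g. K (g ** u') (g ** w'))"
    and "integrable haar (\<lambda>g. K (g ** u) (g ** w)) \<longleftrightarrow> integrable haar (\<lambda>g. K (g ** u') (g ** w'))"
proof -
  obtain h :: "real^'n^'n" where h: "h \<in> stiefel" "h ** u = u'" "h ** w = w'" using pair_transitive[OF o] .
  have m: "(\<lambda>g. K (g ** u) (g ** w)) \<in> borel_measurable borel"
  proof -
    have "(\<lambda>g::real^'n^'n. (g ** u, g ** w)) \<in> borel_measurable borel" by measurable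
    from measurable_compose[OF this K] show ?thesis by simp
  qed
  show "integral\<^sup>L haar (\<lambda>g. K (g ** u) (g ** w)) = integral\<^sup>L haar (\<lambda>g. K (g ** u') (g ** w'))"
    using haar_integral_right(1)[OF h(1) m] by (simp add: h(2,3) matrix_mul_assoc[symmetric])
  show "integrable haar (\<lambda>g. K (g ** u) (g ** w)) \<longleftrightarrow> integrable haar (\<lambda>g. K (g ** u') (g ** w'))"
    using haar_integral_right(2)[OF h(1) m] by (simp add: h(2,3) matrix_mul_assoc[symmetric])
qed

lemma integral_stiefel:
  fixes F :: "real^'m^'n \<Rightarrow> 'b::{banach, second_countable_topology}"
  assumes v: "v \<in> (stiefel :: (real^'m^'n) set)" and F: "F \<in> borel_measurable borel"
  shows "integral\<^sup>L stiefel_measure F = integral\<^sup>L haar (\<lambda>g. F (g ** v))"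
    and "integrable stiefel_measure F \<longleftrightarrow> integrable haar (\<lambda>g. F (g ** v))"
proof -
  have m: "F \<in> borel_measurable stiefel_borel" by (rule measurable_from_stiefel[OF refl F])
  show "integral\<^sup>L stiefel_measure F = integral\<^sup>L haar (\<lambda>g. F (g ** v))"
    unfolding stiefel_measure_eq[OF v] orbit_measure_def by (rule integral_distr[OF measurable_haar_mult[OF v] m])
  show "integrable stiefel_measure F \<longleftrightarrow> integrable haar (\<lambda>g. F (g ** v))"
    unfolding stiefel_measure_eq[OF v] orbit_measure_def by (rule integrable_distr_eq[OF measurable_haar_mult[OF v] m])
qed

text \<open>The numerator is a moment over matrices with CARD('k) rows, whereas the denominator is
  the Gaussian mass for CARD('a) rows; this is how the two come out of
  \<open>polar_integration\<close>.\<close>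

definition polar_const :: "'a::finite itself \<Rightarrow> 'k::finite itself \<Rightarrow> 'm::finite itself \<Rightarrow> real" where
  "polar_const _ _ _ = gauss_moment TYPE('k) TYPE('m) (CARD('a) - CARD('k)) / sqrt pi ^ DIM(real^'m^'a)"

lemma polar_const_pos:
  "CARD('m) \<le> CARD('k) \<Longrightarrow> polar_const TYPE('a::finite) TYPE('k::finite) TYPE('m::finite) > 0"
  unfolding polar_const_def by (simp add: gauss_moment_pos)

text \<open>\<open>polar_integration\<close> is read as an identity of measures: the image of the
  weighted product of Lebesgue and Haar measure under (y, g) -> g u y is a positive multiple of
  Lebesgue measure. Integrability and the value of complex integrals follow together.\<close>

lemma polar_integral:
  fixes F :: "real^'m^'a \<Rightarrow> complex" and u :: "real^'k^'a"
  assumes le: "CARD('m) \<le> CARD('k)" "CARD('k) \<le> CARD('a)"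
    and F: "F \<in> borel_measurable borel" and u: "u \<in> stiefel"
  shows "integrable lborel F \<longleftrightarrow>
      integrable (lborel \<Otimes>\<^sub>M haar) (\<lambda>(y, g). of_real (gvol (y::real^'m^'k) ^ (CARD('a) - CARD('k))) * F (g ** (u ** y)))"
    and "of_real (polar_const TYPE('a) TYPE('k) TYPE('m)) * integral\<^sup>L lborel F =
      integral\<^sup>L (lborel \<Otimes>\<^sub>M haar) (\<lambda>(y, g). of_real (gvol (y::real^'m^'k) ^ (CARD('a) - CARD('k))) * F (g ** (u ** y)))"
proof -
  define j where "j = CARD('a) - CARD('k)"
  define \<kappa> where "\<kappa> = polar_const TYPE('a) TYPE('k) TYPE('m)"
  have \<kappa>: "\<kappa> > 0" unfolding \<kappa>_def by (rule polar_const_pos[OF le(1)])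
  interpret H: sigma_finite_measure "haar :: (real^'a^'a) measure" by (rule sigma_finite_haar)
  interpret P: pair_sigma_finite "lborel :: (real^'m^'k) measure" "haar :: (real^'a^'a) measure" ..
  let ?N = "density ((lborel :: (real^'m^'k) measure) \<Otimes>\<^sub>M (haar :: (real^'a^'a) measure)) (\<lambda>(y, g). ennreal (gvol y ^ j))"
  let ?T = "\<lambda>(y :: real^'m^'k, g :: real^'a^'a). g ** (u ** y)"
  have T[measurable]: "?T \<in> borel_measurable ((lborel :: (real^'m^'k) measure) \<Otimes>\<^sub>M (haar :: (real^'a^'a) measure))"
    unfolding case_prod_unfold by measurable
  have eq: "distr ?N borel ?T = density lborel (\<lambda>_. ennreal \<kappa>)"
  proof (rule measure_eqI)
    fix A assume "A \<in> sets (distr ?N borel ?T)"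
    then have A[measurable]: "A \<in> sets borel" by simp
    have "emeasure (distr ?N borel ?T) A = (\<integral>\<^sup>+x. indicator A x \<partial>distr ?N borel ?T)" by simp
    also have "\<dots> = (\<integral>\<^sup>+p. indicator A (?T p) \<partial>?N)"
      by (rule nn_integral_distr) (simp_all add: T)
    also have "\<dots> = (\<integral>\<^sup>+p. ennreal (gvol (fst p) ^ j) * indicator A (?T p) \<partial>(lborel \<Otimes>\<^sub>M haar))"
      by (subst nn_integral_density) (auto simp: case_prod_unfold)
    also have "\<dots> = (\<integral>\<^sup>+y. \<integral>\<^sup>+g. ennreal (gvol y ^ j) * indicator A (g ** (u ** y)) \<partial>haar \<partial>lborel)"
      by (subst H.nn_integral_fst[symmetric]) (auto simp: case_prod_unfold)
    also have "\<dots> = (\<integral>\<^sup>+y. (\<integral>\<^sup>+g. indicator A (g ** (u ** y)) \<partial>haar) * ennreal (gvol y ^ j) \<partial>lborel)"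
    proof (rule nn_integral_cong)
      fix y :: "real^'m^'k"
      have "(\<lambda>g. indicator A (g ** (u ** y)) :: ennreal) \<in> borel_measurable (haar :: (real^'a^'a) measure)"
        by (intro measurable_from_stiefel[OF sets_haar]) measurable
      then show "(\<integral>\<^sup>+g. ennreal (gvol y ^ j) * indicator A (g ** (u ** y)) \<partial>haar) = (\<integral>\<^sup>+g. indicator A (g ** (u ** y)) \<partial>haar) * ennreal (gvol y ^ j)"
        by (subst nn_integral_cmult) (assumption, rule mult.commute)
    qed
    also have "\<dots> = ennreal \<kappa> * emeasure lborel A"
    proof -
      define q where "q = sqrt pi ^ DIM(real^'m^'a)"
      have q: "q > 0" by (simp add: q_def)
      define R where "R = (\<integral>\<^sup>+y. (\<integral>\<^sup>+g. indicator A (g ** (u ** y)) \<partial>haar) * ennreal (gvol y ^ j) \<partial>(lborel :: (real^'m^'k) measure))"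
      have "ennreal (q * \<kappa>) * (\<integral>\<^sup>+x. indicator A x \<partial>lborel) = ennreal q * R"
        using polar_integration[OF le _ u, of "indicator A"] q unfolding R_def j_def q_def \<kappa>_def polar_const_def by simp
      then have "ennreal q * R = ennreal q * (ennreal \<kappa> * emeasure lborel A)"
        using q \<kappa> by (simp add: ennreal_mult mult.assoc)
      then show ?thesis using q unfolding R_def[symmetric] by (simp add: ennreal_mult_cancel_left)
    qed
    also have "\<dots> = emeasure (density lborel (\<lambda>_. ennreal \<kappa>)) A"
      by (simp add: emeasure_density_const)
    finally show "emeasure (distr ?N borel ?T) A = emeasure (density lborel (\<lambda>_. ennreal \<kappa>)) A" .
  qed simp
  have FT: "(\<lambda>p. F (?T p)) \<in> borel_measurable (lborel \<Otimes>\<^sub>M haar)" using F by measurable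
  have w: "(\<lambda>(y, g). gvol y ^ j) \<in> borel_measurable ((lborel :: (real^'m^'k) measure) \<Otimes>\<^sub>M (haar :: (real^'a^'a) measure))"
    unfolding case_prod_unfold by measurable
  have s: "(\<lambda>p. (case p of (y, g) \<Rightarrow> gvol y ^ j) *\<^sub>R F (?T p)) = (\<lambda>(y, g). of_real (gvol (y::real^'m^'k) ^ j) * F (g ** (u ** y)))"
    by (auto simp: scaleR_conv_of_real fun_eq_iff)
  have N: "?N = density (lborel \<Otimes>\<^sub>M haar) (\<lambda>p. ennreal (case p of (y, g) \<Rightarrow> gvol y ^ j))"
    by (simp add: case_prod_unfold)
  have "integrable lborel F \<longleftrightarrow> integrable (density lborel (\<lambda>_. ennreal \<kappa>)) F"
  proof -
    have "integrable (density lborel (\<lambda>_. ennreal \<kappa>)) F \<longleftrightarrow> integrable lborel (\<lambda>x. \<kappa> *\<^sub>R F x)"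
      using F \<kappa> by (subst integrable_density) auto
    moreover have "integrable lborel F" if "integrable lborel (\<lambda>x. \<kappa> *\<^sub>R F x)"
      using integrable_scaleR_right[of "inverse \<kappa>", OF that] \<kappa> by simp
    ultimately show ?thesis by auto
  qed
  also have "\<dots> \<longleftrightarrow> integrable ?N (\<lambda>p. F (?T p))"
    unfolding eq[symmetric] by (rule integrable_distr_eq) (use T F in simp_all)
  also have "\<dots> \<longleftrightarrow> integrable (lborel \<Otimes>\<^sub>M haar) (\<lambda>p. (case p of (y, g) \<Rightarrow> gvol y ^ j) *\<^sub>R F (?T p))"
    unfolding N by (rule integrable_density) (use FT w in \<open>auto simp: case_prod_unfold\<close>)
  finally show "integrable lborel F \<longleftrightarrow>
      integrable (lborel \<Otimes>\<^sub>M haar) (\<lambda>(y, g). of_real (gvol (y::real^'m^'k) ^ (CARD('a) - CARD('k))) * F (g ** (u ** y)))"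
    unfolding s unfolding j_def .
  have "of_real \<kappa> * integral\<^sup>L lborel F = integral\<^sup>L (density lborel (\<lambda>_. ennreal \<kappa>)) F"
    using F \<kappa> by (subst integral_density) (auto simp: scaleR_conv_of_real)
  also have "\<dots> = integral\<^sup>L ?N (\<lambda>p. F (?T p))"
    unfolding eq[symmetric] by (rule integral_distr) (use T F in simp_all)
  also have "\<dots> = integral\<^sup>L (lborel \<Otimes>\<^sub>M haar) (\<lambda>p. (case p of (y, g) \<Rightarrow> gvol y ^ j) *\<^sub>R F (?T p))"
    unfolding N by (rule integral_density) (use FT w in \<open>auto simp: case_prod_unfold\<close>)
  finally show "of_real (polar_const TYPE('a) TYPE('k) TYPE('m)) * integral\<^sup>L lborel F =
      integral\<^sup>L (lborel \<Otimes>\<^sub>M haar) (\<lambda>(y, g). of_real (gvol (y::real^'m^'k) ^ (CARD('a) - CARD('k))) * F (g ** (u ** y)))"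
    unfolding s unfolding j_def \<kappa>_def .
qed

section \<open>The Funk transform as a kernel\<close>

lemma stiefel_measure_left:
  assumes le: "CARD('m) \<le> CARD('p)" and \<delta>: "(\<delta> :: real^'p^'p) \<in> stiefel"
  shows "distr (stiefel_measure :: (real^'m^'p) measure) stiefel_measure (\<lambda>v. \<delta> ** v) = stiefel_measure"
  using invariant_stiefel_measure[OF le] \<delta>
  by (simp add: invariant_prob_on_stiefel_def orthogonal_matrix_iff_stiefel)

lemma measurable_stiefel_measure_left:
  assumes le: "CARD('m) \<le> CARD('p)" and \<delta>: "(\<delta> :: real^'p^'p) \<in> stiefel"
  shows "(\<lambda>v. \<delta> ** v) \<in> (stiefel_measure :: (real^'m^'p) measure) \<rightarrow>\<^sub>M stiefel_measure"
  unfolding measurable_cong_sets[OF refl sets_stiefel[OF le]]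
  by (rule measurable_into_stiefel)
     (auto intro!: measurable_from_stiefel[OF sets_stiefel[OF le]] stiefel_mult \<delta> simp: space_stiefel[OF le])

text \<open>The two transforms differ only in the types of their arguments, so everything proved for
  \<open>funk\<close> serves the dual as well.\<close>

lemma dual_funk_eq_funk: "dual_funk = funk"
  by (simp add: fun_eq_iff dual_funk_def funk_def)

lemma (in pair_sigma_finite) integrable_prod_mult:
  fixes f h :: "_ \<Rightarrow> real"
  assumes f: "integrable M1 f" and h: "integrable M2 h"
  shows "integrable (M1 \<Otimes>\<^sub>M M2) (\<lambda>(x, y). f x * h y)"
proof (rule Fubini_integrable)
  have [measurable]: "f \<in> borel_measurable M1" "h \<in> borel_measurable M2" using f h by auto
  show "(\<lambda>(x, y). f x * h y) \<in> borel_measurable (M1 \<Otimes>\<^sub>M M2)" by measurable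
  show "integrable M1 (\<lambda>x. \<integral>y. norm (case (x, y) of (x, y) \<Rightarrow> f x * h y) \<partial>M2)"
    using f by (simp add: abs_mult)
  show "AE x in M1. integrable M2 (\<lambda>y. case (x, y) of (x, y) \<Rightarrow> f x * h y)"
    using h by simp
qed

lemma (in pair_sigma_finite) integrable_prod_dominated:
  fixes c :: "_ \<Rightarrow> complex" and b :: "_ \<Rightarrow> real"
  assumes c: "integrable M2 c" and b: "integrable M1 b"
    and X[measurable]: "(\<lambda>(x, y). X x y) \<in> borel_measurable (M1 \<Otimes>\<^sub>M M2)"
    and bound: "\<And>x y. x \<in> space M1 \<Longrightarrow> y \<in> space M2 \<Longrightarrow> norm (X x y) \<le> b x"
  shows "integrable (M1 \<Otimes>\<^sub>M M2) (\<lambda>(x, y). c y * X x y)"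
proof (rule Bochner_Integration.integrable_bound[where f="\<lambda>(x, y). b x * norm (c y)"])
  show "integrable (M1 \<Otimes>\<^sub>M M2) (\<lambda>(x, y). b x * norm (c y))"
    using b c by (intro integrable_prod_mult) auto
  have [measurable]: "c \<in> borel_measurable M2" using c by simp
  show "(\<lambda>(x, y). c y * X x y) \<in> borel_measurable (M1 \<Otimes>\<^sub>M M2)"
    using X unfolding case_prod_unfold by measurable
  have "norm (c y * X x y) \<le> norm (b x * norm (c y))" if "x \<in> space M1" "y \<in> space M2" for x y
  proof -
    have "norm (c y * X x y) \<le> b x * norm (c y)"
      using bound[OF that] by (simp add: norm_mult mult.commute[of "norm (c _)"] mult_right_mono)
    then show ?thesis by (metis abs_ge_self order_trans real_norm_def)
  qed
  then show "AE p in M1 \<Otimes>\<^sub>M M2. norm (case p of (x, y) \<Rightarrow> c y * X x y) \<le> norm (case p of (x, y) \<Rightarrow> b x * norm (c y))"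
    by (intro AE_I2) (auto simp: space_pair_measure)
qed

section \<open>Independence of the rotation, measurability and adjointness of the Funk
  transform\<close>

context
  fixes e :: "'p::finite + 'k::finite \<Rightarrow> 'n::finite"
  assumes bij: "bij e"
begin

definition frame0 :: "real^'k^'n" where
  "frame0 = stack e 0 (mat 1)"

lemma frame0_stiefel: "frame0 \<in> stiefel"
  unfolding frame0_def by (rule stack_stiefel(2)[OF bij mat_1_stiefel])

lemma frame0_orthogonal: "transpose frame0 ** stack e \<omega> 0 = (0 :: real^'c^'k)"
  unfolding frame0_def by (rule stack_orthogonal(1)[OF bij])

lemma frame0_mult: "frame0 ** B = stack e 0 B"
  by (simp add: frame0_def stack_mult[OF bij])

text \<open>An orthogonal matrix that fixes the lower block preserves its orthogonal complement, the
  upper block, and acts there as an element of O(p).\<close>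

lemma stabilizer_frame0:
  assumes h: "h \<in> stiefel" "h ** frame0 = frame0"
  obtains \<delta> where "\<delta> \<in> stiefel" "\<And>\<omega> :: real^'m^'p. h ** stack e \<omega> 0 = stack e (\<delta> ** \<omega>) 0"
proof -
  obtain \<delta> B where d: "h ** stack e (mat 1 :: real^'p^'p) 0 = stack e \<delta> B" using stack_surj[OF bij] by blast
  have "transpose frame0 ** (h ** stack e (mat 1 :: real^'p^'p) 0) = transpose (h ** frame0) ** (h ** stack e (mat 1 :: real^'p^'p) 0)"
    by (simp add: h)
  also have "\<dots> = 0" using frame0_orthogonal by (simp add: gram_mult_stiefel[OF h(1)])
  finally have B: "B = 0" by (simp add: d frame0_def gram_stack[OF bij] transpose_0)
  have "h ** stack e (mat 1 :: real^'p^'p) 0 \<in> stiefel" by (intro stiefel_mult h stack_stiefel[OF bij] mat_1_stiefel)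
  then have "\<delta> \<in> stiefel" unfolding d B by (simp add: stiefel_def gram_stack[OF bij])
  moreover have "h ** stack e \<omega> 0 = stack e (\<delta> ** \<omega>) 0" for \<omega> :: "real^'m^'p"
  proof -
    have "h ** stack e \<omega> 0 = h ** stack e (mat 1 :: real^'p^'p) 0 ** \<omega>"
      by (simp add: matrix_mul_assoc[symmetric] stack_mult[OF bij])
    also have "\<dots> = stack e (\<delta> ** \<omega>) 0" by (simp only: d B) (simp add: stack_mult[OF bij])
    finally show ?thesis .
  qed
  ultimately show ?thesis using that by blast
qed

context
  fixes TM :: "'m::finite itself"
  assumes le: "CARD('m) \<le> CARD('p)"
begin

text \<open>For orthogonal g, the uniform law on the m-frames orthogonal to u =
  \<open>g ** frame0\<close>, regarded as a Borel measure on the whole matrix space.\<close>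

definition kern :: "real^'n^'n \<Rightarrow> (real^'m^'n) measure" where
  "kern g = distr (stiefel_measure :: (real^'m^'p) measure) borel (\<lambda>\<omega>. g ** stack e \<omega> 0)"

lemma measurable_kern_map: "(\<lambda>\<omega>. g ** stack e \<omega> 0) \<in> borel_measurable (stiefel_measure :: (real^'m^'p) measure)"
proof -
  note borel_measurable_stack[OF bij, measurable]
  show ?thesis by (rule measurable_from_stiefel[OF sets_stiefel[OF le]]) measurable
qed

text \<open>Two rotations that agree on the base frame differ by an element of its stabiliser. This
  acts on \<open>\<omega>\<close> by a rotation from the left, which the invariant measure
  absorbs.\<close>

lemma kern_cong:
  assumes g: "g \<in> stiefel" "g' \<in> stiefel" "g ** frame0 = g' ** frame0"
  shows "kern g = kern g'"
proof -
  define h where "h = transpose g ** g'"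
  have h: "h \<in> stiefel" unfolding h_def by (intro stiefel_mult stiefel_transpose g)
  have gh: "g ** h = g'" by (simp add: h_def matrix_mul_assoc stiefel_square_right g)
  have "h ** frame0 = transpose g ** (g ** frame0)" by (simp add: h_def matrix_mul_assoc[symmetric] g(3))
  also have "\<dots> = frame0" using g(1) by (simp add: matrix_mul_assoc stiefelD)
  finally obtain \<delta> where \<delta>: "\<delta> \<in> stiefel" "\<And>\<omega> :: real^'m^'p. h ** stack e \<omega> 0 = stack e (\<delta> ** \<omega>) 0"
    using stabilizer_frame0[OF h] by blast
  have "kern g = distr (distr (stiefel_measure :: (real^'m^'p) measure) stiefel_measure (\<lambda>v. \<delta> ** v)) borel (\<lambda>\<omega>. g ** stack e \<omega> 0)"
    unfolding kern_def stiefel_measure_left[OF le \<delta>(1)] ..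
  also have "\<dots> = distr (stiefel_measure :: (real^'m^'p) measure) borel ((\<lambda>\<omega>. g ** stack e \<omega> 0) \<circ> (\<lambda>v. \<delta> ** v))"
    by (rule distr_distr[OF measurable_kern_map measurable_stiefel_measure_left[OF le \<delta>(1)]])
  also have "(\<lambda>\<omega> :: real^'m^'p. g ** stack e \<omega> 0) \<circ> (\<lambda>v. \<delta> ** v) = (\<lambda>\<omega>. g' ** stack e \<omega> 0)"
    by (simp add: o_def \<delta>(2)[symmetric] matrix_mul_assoc gh)
  finally show ?thesis by (simp add: kern_def)
qed

text \<open>Gives a name to the choice made inside \<open>funk\<close>; nothing is known about how
  it depends on u.\<close>

definition choose_rot :: "real^'k^'n \<Rightarrow> real^'n^'n" where
  "choose_rot u = (SOME g. orthogonal_matrix g \<and> g ** stack e 0 (mat 1) = u)"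

lemma choose_rot:
  assumes "u \<in> stiefel" shows "choose_rot u \<in> stiefel" "choose_rot u ** frame0 = u"
proof -
  obtain g :: "real^'n^'n" where "g \<in> stiefel" "g ** frame0 = u" using stiefel_transitive[OF frame0_stiefel assms] .
  then have "\<exists>g. orthogonal_matrix g \<and> g ** stack e 0 (mat 1) = u"
    by (auto simp: orthogonal_matrix_iff_stiefel frame0_def)
  from someI_ex[OF this] show "choose_rot u \<in> stiefel" "choose_rot u ** frame0 = u"
    by (simp_all add: choose_rot_def orthogonal_matrix_iff_stiefel frame0_def)
qed

lemma funk_kern: "f \<in> borel_measurable borel \<Longrightarrow> funk e f u = integral\<^sup>L (kern (choose_rot u)) f"
  unfolding funk_def Let_def kern_def choose_rot_def[symmetric]
  by (rule integral_distr[symmetric, OF measurable_kern_map]) simp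

lemma funk_rotated:
  assumes f: "f \<in> borel_measurable borel" and g: "g \<in> stiefel"
  shows "funk e f (g ** frame0) = (LINT \<omega>|(stiefel_measure :: (real^'m^'p) measure). f (g ** stack e \<omega> 0))"
proof -
  have u: "g ** frame0 \<in> stiefel" by (intro stiefel_mult g frame0_stiefel)
  have "kern (choose_rot (g ** frame0)) = kern g" by (rule kern_cong) (simp_all add: choose_rot[OF u] g)
  then show ?thesis
    using funk_kern[OF f, of "g ** frame0"] integral_distr[OF measurable_kern_map, of f g] f by (simp add: kern_def)
qed

lemma prob_space_kern: "prob_space (kern g)"
  unfolding kern_def by (rule prob_space.prob_space_distr[OF prob_space_stiefel[OF le] measurable_kern_map])

text \<open>By the reverse Fatou lemma \<open>g \<mapsto> kern g A\<close> is upper semicontinuous for closed \<open>A\<close>; compactness of the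
  orthogonal group transfers this to the frame \<open>u\<close>, although \<open>choose_rot\<close> is not measurable.\<close>
lemma closed_kern_superlevel:
  assumes A: "closed A"
  shows "closed {u \<in> stiefel. t \<le> emeasure (kern (choose_rot u)) A}"
  unfolding closed_sequential_limits
proof (intro allI impI, elim conjE)
  fix x l assume x: "\<forall>n. x n \<in> {u \<in> stiefel. t \<le> emeasure (kern (choose_rot u)) A}" and lim: "x \<longlonglongrightarrow> l"
  have xs: "x n \<in> stiefel" "t \<le> emeasure (kern (choose_rot (x n))) A" for n using x by auto
  obtain g r where g: "g \<in> stiefel" "strict_mono r" "((\<lambda>n. choose_rot (x n)) \<circ> r) \<longlonglongrightarrow> g"
    using compact_stiefel[where 'm='n and 'n='n] choose_rot(1)[OF xs(1)] unfolding compact_def by metis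
  have l: "l \<in> stiefel" using closed_stiefel xs(1) lim by (auto simp: closed_sequential_limits)
  have cont: "continuous_on UNIV (\<lambda>g :: real^'n^'n. g ** frame0)" by (intro continuous_intros)
  have "(\<lambda>n. choose_rot (x (r n)) ** frame0) \<longlonglongrightarrow> g ** frame0"
    using continuous_on_tendsto_compose[OF cont g(3)] by (simp add: o_def)
  moreover have "(\<lambda>n. choose_rot (x (r n)) ** frame0) \<longlonglongrightarrow> l"
    using LIMSEQ_subseq_LIMSEQ[OF lim g(2)] by (simp add: choose_rot(2)[OF xs(1)] o_def)
  ultimately have gl: "g ** frame0 = l" by (rule LIMSEQ_unique)
  have em: "emeasure (kern h) A = (\<integral>\<^sup>+\<omega>. indicator A (h ** stack e \<omega> 0) \<partial>(stiefel_measure :: (real^'m^'p) measure))" for h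
  proof -
    have "emeasure (kern h) A = (\<integral>\<^sup>+x. indicator A x \<partial>kern h)" using A by (simp add: kern_def)
    also have "\<dots> = (\<integral>\<^sup>+\<omega>. indicator A (h ** stack e \<omega> 0) \<partial>(stiefel_measure :: (real^'m^'p) measure))"
      unfolding kern_def by (rule nn_integral_distr[OF measurable_kern_map]) (use A in simp)
    finally show ?thesis .
  qed
  interpret S: prob_space "stiefel_measure :: (real^'m^'p) measure" by (rule prob_space_stiefel[OF le])
  have "t \<le> limsup (\<lambda>n. \<integral>\<^sup>+\<omega>. indicator A (choose_rot (x (r n)) ** stack e \<omega> 0) \<partial>(stiefel_measure :: (real^'m^'p) measure))"
    using xs(2) unfolding em by (intro le_Limsup) auto
  also have "\<dots> \<le> (\<integral>\<^sup>+\<omega>. limsup (\<lambda>n. indicator A (choose_rot (x (r n)) ** stack e \<omega> 0)) \<partial>(stiefel_measure :: (real^'m^'p) measure))"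
  proof (rule nn_integral_limsup[where w="\<lambda>_. 1"])
    show "(\<lambda>\<omega>. indicator A (choose_rot (x (r i)) ** stack e \<omega> 0) :: ennreal) \<in> borel_measurable (stiefel_measure :: (real^'m^'p) measure)" for i
      using A by (intro measurable_compose[OF measurable_kern_map]) simp
  qed (auto simp: S.emeasure_space_1 indicator_def)
  also have "\<dots> \<le> (\<integral>\<^sup>+\<omega>. indicator A (g ** stack e \<omega> 0) \<partial>(stiefel_measure :: (real^'m^'p) measure))"
  proof (rule nn_integral_mono)
    fix \<omega> :: "real^'m^'p"
    have cont: "continuous_on UNIV (\<lambda>g :: real^'n^'n. g ** stack e \<omega> 0)" by (intro continuous_intros)
    have lim: "(\<lambda>n. choose_rot (x (r n)) ** stack e \<omega> 0) \<longlonglongrightarrow> g ** stack e \<omega> 0"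
      using continuous_on_tendsto_compose[OF cont g(3)] by (simp add: o_def)
    show "limsup (\<lambda>n. indicator A (choose_rot (x (r n)) ** stack e \<omega> 0)) \<le> (indicator A (g ** stack e \<omega> 0) :: ennreal)"
    proof (cases "g ** stack e \<omega> 0 \<in> A")
      case True
      then show ?thesis by (auto intro!: Limsup_bounded always_eventually simp: indicator_def)
    next
      case False
      have "eventually (\<lambda>n. choose_rot (x (r n)) ** stack e \<omega> 0 \<in> - A) sequentially"
        using lim A False by (intro topological_tendstoD) auto
      then have "eventually (\<lambda>n. indicator A (choose_rot (x (r n)) ** stack e \<omega> 0) \<le> (0::ennreal)) sequentially"
        by eventually_elim auto
      then show ?thesis using False by (intro Limsup_bounded) auto
    qed
  qed
  finally have "t \<le> emeasure (kern g) A" unfolding em .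
  moreover have "kern g = kern (choose_rot l)" by (rule kern_cong) (simp_all add: choose_rot[OF l] g gl)
  ultimately show "l \<in> {u \<in> stiefel. t \<le> emeasure (kern (choose_rot u)) A}" using l by simp
qed

text \<open>Closed sets form an intersection stable generator of the Borel sets, and for them all
  superlevel sets of the kernel are closed.\<close>

lemma measurable_kern: "(\<lambda>u. kern (choose_rot u)) \<in> stiefel_borel \<rightarrow>\<^sub>M subprob_algebra borel"
proof (rule measurable_subprob_algebra_generated[where \<Omega>=UNIV and G="Collect closed"])
  show "sets borel = sigma_sets UNIV (Collect closed :: (real^'m^'n) set set)"
    unfolding borel_eq_closed by (simp add: sets_measure_of)
  show "Int_stable (Collect closed :: (real^'m^'n) set set)" by (auto simp: Int_stable_def)
  show "subprob_space (kern (choose_rot a))" for a using prob_space_kern prob_space_imp_subprob_space by blast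
  show "sets (kern (choose_rot a)) = sets borel" for a by (simp add: kern_def)
  have UNIV: "emeasure (kern (choose_rot a)) UNIV = 1" for a
    using prob_space.emeasure_space_1[OF prob_space_kern] by (simp add: kern_def)
  show "(\<lambda>a. emeasure (kern (choose_rot a)) UNIV) \<in> borel_measurable stiefel_borel" by (simp add: UNIV)
  fix A :: "(real^'m^'n) set" assume "A \<in> Collect closed"
  then have A: "closed A" by simp
  show "(\<lambda>a. emeasure (kern (choose_rot a)) A) \<in> borel_measurable stiefel_borel"
  proof (rule borel_measurableI_ge)
    fix t
    have "closed {x \<in> stiefel. t \<le> emeasure (kern (choose_rot x)) A}" by (rule closed_kern_superlevel[OF A])
    then show "{x \<in> space stiefel_borel. t \<le> emeasure (kern (choose_rot x)) A} \<in> sets stiefel_borel"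
      unfolding space_stiefel_borel sets_stiefel_borel by auto
  qed
qed auto

lemma measurable_funk:
  fixes f :: "real^'m^'n \<Rightarrow> complex"
  assumes f: "f \<in> borel_measurable borel"
  shows "funk e f \<in> borel_measurable (stiefel_borel :: (real^'k^'n) measure)"
  using measurable_compose[OF measurable_kern integral_measurable_subprob_algebra[OF f]]
  by (simp add: funk_kern[OF f, symmetric] cong: measurable_cong)

lemma measurable_stiefel_measure_snd: "snd \<in> borel_measurable (M \<Otimes>\<^sub>M (stiefel_measure :: (real^'m^'p) measure))"
  by (rule measurable_compose[OF measurable_snd measurable_stiefel_borel_ident[OF sets_stiefel[OF le]]])

lemma measurable_stiefel_measure_fst: "fst \<in> borel_measurable ((stiefel_measure :: (real^'m^'p) measure) \<Otimes>\<^sub>M M)"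
  by (rule measurable_compose[OF measurable_fst measurable_stiefel_borel_ident[OF sets_stiefel[OF le]]])

text \<open>Both sides average over pairs of orthogonal frames. Integrating first over
  \<open>\<omega>\<close> yields the Funk transform; integrating first over g yields a value
  independent of \<open>\<omega>\<close>.\<close>

lemma funk_adjoint:
  fixes f :: "real^'m^'n \<Rightarrow> complex"
  assumes f[measurable]: "f \<in> borel_measurable borel" and int: "integrable stiefel_measure f"
    and T[measurable]: "T \<in> borel_measurable borel" and B: "\<And>u. norm (T u :: complex) \<le> B"
    and w: "w \<in> stiefel" "transpose frame0 ** w = 0"
  shows "integrable haar (\<lambda>g. funk e f (g ** frame0) * T (g ** frame0))"
    and "integral\<^sup>L haar (\<lambda>g. funk e f (g ** frame0) * T (g ** frame0)) = integral\<^sup>L haar (\<lambda>g. f (g ** w) * T (g ** frame0))"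
proof -
  let ?S = "stiefel_measure :: (real^'m^'p) measure" and ?H = "haar :: (real^'n^'n) measure"
  interpret S: prob_space ?S by (rule prob_space_stiefel[OF le])
  interpret H: prob_space ?H by (rule prob_space_haar)
  interpret P: pair_sigma_finite ?S ?H ..
  note [measurable] = measurable_stiefel_measure_fst measurable_stiefel_measure_snd borel_measurable_stack[OF bij]
  define F where "F = (\<lambda>(\<omega> :: real^'m^'p, g :: real^'n^'n). f (g ** stack e \<omega> 0) * T (g ** frame0))"
  have Fm: "F \<in> borel_measurable (?S \<Otimes>\<^sub>M ?H)" unfolding F_def case_prod_unfold by measurable
  have K: "(\<lambda>(x :: real^'k^'n, y :: real^'m^'n). f y * T x) \<in> borel_measurable borel"
    unfolding borel_prod[symmetric] by measurable
  have Kn: "(\<lambda>(x :: real^'k^'n, y :: real^'m^'n). norm (f y * T x)) \<in> borel_measurable borel"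
    unfolding borel_prod[symmetric] by measurable
  \<comment> \<open>For every \<open>\<omega>\<close> the pair of \<open>frame0\<close> and
    \<open>stack e \<omega> 0\<close> is exchanged for the fixed pair of \<open>frame0\<close> and
    w.\<close>
  have pair: "integral\<^sup>L ?H (\<lambda>g. f (g ** stack e \<omega> 0) * T (g ** frame0)) = integral\<^sup>L ?H (\<lambda>g. f (g ** w) * T (g ** frame0))"
    "integral\<^sup>L ?H (\<lambda>g. norm (f (g ** stack e \<omega> 0) * T (g ** frame0))) = integral\<^sup>L ?H (\<lambda>g. norm (f (g ** w) * T (g ** frame0)))"
    "integrable ?H (\<lambda>g. f (g ** stack e \<omega> 0) * T (g ** frame0)) \<longleftrightarrow> integrable ?H (\<lambda>g. f (g ** w) * T (g ** frame0))"
    if "\<omega> \<in> stiefel" for \<omega> :: "real^'m^'p"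
    using haar_integral_pair[OF frame0_stiefel stack_stiefel(1)[OF bij that] frame0_orthogonal frame0_stiefel w K]
      haar_integral_pair(1)[OF frame0_stiefel stack_stiefel(1)[OF bij that] frame0_orthogonal frame0_stiefel w Kn] by auto
  have fw: "integrable ?H (\<lambda>g. f (g ** w))" using int integral_stiefel(2)[OF w(1) f] by simp
  have iw: "integrable ?H (\<lambda>g. f (g ** w) * T (g ** frame0))"
  proof (rule Bochner_Integration.integrable_bound[where f="\<lambda>g. B * norm (f (g ** w))"])
    show "integrable ?H (\<lambda>g. B * norm (f (g ** w)))" using fw by simp
    show "(\<lambda>g. f (g ** w) * T (g ** frame0)) \<in> borel_measurable ?H"
      by (intro measurable_from_stiefel[OF sets_haar]) measurable
    have "norm (f (g ** w) * T (g ** frame0)) \<le> norm (B * norm (f (g ** w)))" for g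
      using mult_right_mono[OF B norm_ge_zero, of "g ** frame0" "f (g ** w)"] B[of 0] norm_ge_zero[of "T 0"]
      by (simp add: norm_mult mult.commute)
    then show "AE g in ?H. norm (f (g ** w) * T (g ** frame0)) \<le> norm (B * norm (f (g ** w)))" by simp
  qed
  have Fint: "integrable (?S \<Otimes>\<^sub>M ?H) F"
  proof (rule P.Fubini_integrable[OF Fm])
    have "integrable ?S (\<lambda>\<omega>. integral\<^sup>L ?H (\<lambda>g. norm (f (g ** w) * T (g ** frame0))))" by simp
    then show "integrable ?S (\<lambda>\<omega>. integral\<^sup>L ?H (\<lambda>g. norm (F (\<omega>, g))))"
      by (rule Bochner_Integration.integrable_cong[OF refl, THEN iffD1, rotated])
         (simp only: F_def prod.case pair(2) space_stiefel[OF le])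
    have "\<forall>\<omega>\<in>space ?S. integrable ?H (\<lambda>g. F (\<omega>, g))"
      using pair(3) iw by (simp add: F_def space_stiefel[OF le])
    then show "AE \<omega> in ?S. integrable ?H (\<lambda>g. F (\<omega>, g))" by (intro AE_I2) blast
  qed
  have fu: "(LINT \<omega>|?S. F (\<omega>, g)) = funk e f (g ** frame0) * T (g ** frame0)" if "g \<in> space ?H" for g
    using that by (simp add: F_def funk_rotated[OF f])
  have "integrable ?H (\<lambda>g. LINT \<omega>|?S. F (\<omega>, g))"
    using P.integrable_snd[of "\<lambda>\<omega> g. F (\<omega>, g)"] Fint by simp
  then show "integrable ?H (\<lambda>g. funk e f (g ** frame0) * T (g ** frame0))"
    by (rule Bochner_Integration.integrable_cong[OF refl, THEN iffD1, rotated]) (rule fu)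
  have "integral\<^sup>L ?H (\<lambda>g. funk e f (g ** frame0) * T (g ** frame0)) = integral\<^sup>L ?H (\<lambda>g. LINT \<omega>|?S. F (\<omega>, g))"
    by (rule Bochner_Integration.integral_cong[OF refl]) (simp add: fu)
  also have "\<dots> = (LINT \<omega>|?S. integral\<^sup>L ?H (\<lambda>g. F (\<omega>, g)))"
    by (rule P.Fubini_integral) (use Fint in simp)
  also have "\<dots> = (LINT \<omega>|?S. integral\<^sup>L ?H (\<lambda>g. f (g ** w) * T (g ** frame0)))"
    by (rule Bochner_Integration.integral_cong[OF refl]) (simp add: F_def pair(1) space_stiefel[OF le])
  also have "\<dots> = integral\<^sup>L ?H (\<lambda>g. f (g ** w) * T (g ** frame0))" by (simp add: S.prob_space)
  finally show "integral\<^sup>L haar (\<lambda>g. funk e f (g ** frame0) * T (g ** frame0)) = integral\<^sup>L haar (\<lambda>g. f (g ** w) * T (g ** frame0))" .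
qed

lemma funk_integrable:
  fixes f :: "real^'m^'n \<Rightarrow> complex"
  assumes f: "f \<in> borel_measurable borel" "integrable stiefel_measure f"
  shows "integrable haar (\<lambda>g. funk e f (g ** frame0))"
proof -
  obtain \<omega> :: "real^'m^'p" where \<omega>: "\<omega> \<in> stiefel" using stiefel_nonempty[OF le] by auto
  show ?thesis
    using funk_adjoint(1)[OF f, of "\<lambda>_. 1" 1 "stack e \<omega> 0"] stack_stiefel(1)[OF bij \<omega>] frame0_orthogonal[of \<omega>] by simp
qed

text \<open>Some h in O(n) maps the base frame to its multiple by \<open>\<gamma>\<close> and fixes
  the whole upper block. Replacing g by g h therefore changes u to u \<gamma> but none of the frames
  over which the average runs.\<close>

lemma funk_right_invariant:
  fixes f :: "real^'m^'n \<Rightarrow> complex"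
  assumes f: "f \<in> borel_measurable borel" and u: "u \<in> stiefel" and \<gamma>: "\<gamma> \<in> stiefel"
  shows "funk e f (u ** \<gamma>) = funk e f u"
proof -
  obtain g :: "real^'n^'n" where g: "g \<in> stiefel" "g ** frame0 = u" using stiefel_transitive[OF frame0_stiefel u] .
  let ?W = "stack e (mat 1 :: real^'p^'p) 0"
  have W: "?W \<in> stiefel" by (intro stack_stiefel[OF bij] mat_1_stiefel)
  have fg: "frame0 ** \<gamma> \<in> stiefel" by (intro stiefel_mult frame0_stiefel \<gamma>)
  have o: "transpose (frame0 ** \<gamma>) ** ?W = 0"
    by (simp add: matrix_transpose_mul matrix_mul_assoc[symmetric] frame0_orthogonal)
  obtain h :: "real^'n^'n" where h: "h \<in> stiefel" "h ** frame0 = frame0 ** \<gamma>" "h ** ?W = ?W"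
    using pair_transitive[OF frame0_stiefel W frame0_orthogonal fg W o] .
  have s: "stack e \<omega> 0 = ?W ** \<omega>" for \<omega> :: "real^'m^'p" by (simp add: stack_mult[OF bij])
  have gh: "g ** h \<in> stiefel" by (intro stiefel_mult g h)
  have "u ** \<gamma> = (g ** h) ** frame0" by (simp add: h(2) g(2)[symmetric] matrix_mul_assoc[symmetric])
  moreover have "(g ** h) ** stack e \<omega> 0 = g ** stack e \<omega> 0" for \<omega> :: "real^'m^'p"
  proof -
    have "(g ** h) ** stack e \<omega> 0 = g ** (h ** ?W ** \<omega>)" unfolding s by (simp only: matrix_mul_assoc)
    then show ?thesis unfolding h(3) s .
  qed
  ultimately show ?thesis using funk_rotated[OF f gh] funk_rotated[OF f g(1)] g(2) by simp
qed

end

end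

section \<open>Averaging over frames\<close>

text \<open>The decay of \<open>\<rho>\<close> absorbs the polynomial growth of the weight. As the
  bound refers to the norm of x only, it holds uniformly along rotations and so dominates integrals
  over y and g at once.\<close>

lemma gvol_rapid_bound:
  fixes \<rho> :: "'a::euclidean_space \<Rightarrow> complex"
  assumes \<rho>: "rapid \<rho>"
  shows "\<exists>b. integrable lborel b \<and> (\<forall>(y::real^'m^'j) x. norm x = norm y \<longrightarrow> gvol y ^ a * norm (\<rho> x) \<le> b y)"
proof -
  obtain C where C: "C > 0" "\<And>y::real^'m^'j. gvol y \<le> C * norm y ^ CARD('m)" using gvol_bound by blast
  obtain K where K: "\<And>x. norm (\<rho> x) \<le> K / (1 + norm x) ^ (CARD('m) * a + 2 * DIM(real^'m^'j))"
    using rapidD[OF \<rho>] by blast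
  have K0: "0 \<le> K" using K[of 0] by (simp add: order_trans[OF norm_ge_zero])
  show ?thesis
  proof (intro exI[of _ "\<lambda>y::real^'m^'j. C ^ a * K * (1 / (1 + norm y) ^ (2 * DIM(real^'m^'j)))"] conjI allI impI)
    show "integrable lborel (\<lambda>y::real^'m^'j. C ^ a * K * (1 / (1 + norm y) ^ (2 * DIM(real^'m^'j))))"
      by (intro integrable_mult_right integrable_inverse_power)
    fix y :: "real^'m^'j" and x :: 'a assume n: "norm x = norm y"
    have "gvol y ^ a \<le> (C * (1 + norm y) ^ CARD('m)) ^ a"
      using C(1) by (intro power_mono order_trans[OF C(2)] mult_left_mono) auto
    also have "\<dots> = C ^ a * (1 + norm y) ^ (CARD('m) * a)" by (simp add: power_mult_distrib power_mult)
    finally have "gvol y ^ a * norm (\<rho> x) \<le> (C ^ a * (1 + norm y) ^ (CARD('m) * a)) * (K / (1 + norm y) ^ (CARD('m) * a + 2 * DIM(real^'m^'j)))"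
      using K[of x] n C(1) by (intro mult_mono) auto
    also have "\<dots> = C ^ a * K * (1 / (1 + norm y) ^ (2 * DIM(real^'m^'j)))"
      by (simp add: power_add add_nonneg_eq_0_iff)
    finally show "gvol y ^ a * norm (\<rho> x) \<le> C ^ a * K * (1 / (1 + norm y) ^ (2 * DIM(real^'m^'j)))" .
  qed
qed

text \<open>A rotation \<open>\<delta>\<close> of the upper block may be inserted without changing
  the integral. Averaging over \<open>\<delta>\<close> then turns the inner integral into polar
  coordinates for the p-row matrices A, hence into an integral over the whole space orthogonal to
  the base frame.\<close>

lemma frame_average:
  fixes e :: "'p::finite + 'k::finite \<Rightarrow> 'n::finite" and h :: "real^'k^'n \<Rightarrow> complex"
    and \<rho> :: "real^'m^'n \<Rightarrow> complex" and \<omega> :: "real^'j^'p"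
  assumes bij: "bij e" and le: "CARD('m) \<le> CARD('j)" "CARD('j) \<le> CARD('p)"
    and h[measurable]: "h \<in> borel_measurable borel" and int: "integrable haar (\<lambda>g. h (g ** frame0 e))"
    and \<rho>: "rapid \<rho>" and \<omega>: "\<omega> \<in> stiefel"
  shows "integrable (lborel \<Otimes>\<^sub>M haar) (\<lambda>(y :: real^'m^'j, g). of_real (gvol y ^ (CARD('p) - CARD('j))) *
           (h (g ** frame0 e) * \<rho> (g ** (stack e \<omega> 0 ** y))))" (is "integrable _ ?F")
    and "integral\<^sup>L (lborel \<Otimes>\<^sub>M haar) (\<lambda>(y :: real^'m^'j, g). of_real (gvol y ^ (CARD('p) - CARD('j))) *
           (h (g ** frame0 e) * \<rho> (g ** (stack e \<omega> 0 ** y)))) =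
         of_real (polar_const TYPE('p) TYPE('j) TYPE('m)) *
         integral\<^sup>L haar (\<lambda>g. h (g ** frame0 e) * integral\<^sup>L lborel (\<lambda>A. \<rho> (g ** stack e A 0)))"
proof -
  let ?H = "haar :: (real^'n^'n) measure" and ?P = "haar :: (real^'p^'p) measure" and ?L = "lborel :: (real^'m^'j) measure"
  let ?u = "frame0 e :: real^'k^'n" and ?c = "CARD('p) - CARD('j)"
  interpret H: prob_space ?H by (rule prob_space_haar)
  interpret P: prob_space ?P by (rule prob_space_haar)
  interpret LH: pair_sigma_finite ?L ?H ..
  interpret LP: pair_sigma_finite ?L ?P ..
  interpret HP: pair_sigma_finite ?H ?P ..
  have [measurable]: "\<rho> \<in> borel_measurable borel" by (rule rapid_measurable[OF \<rho>])
  note [measurable] = borel_measurable_stack[OF bij]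
  obtain b where b: "integrable lborel b"
    and gb: "\<And>(y::real^'m^'j) x :: real^'m^'n. norm x = norm y \<Longrightarrow> gvol y ^ ?c * norm (\<rho> x) \<le> b y"
    using gvol_rapid_bound[OF \<rho>, of ?c, where 'm='m and 'j='j] by blast
  have b_meas[measurable]: "b \<in> borel_measurable borel" using b by simp
  define X where "X = (\<lambda>(\<delta> :: real^'p^'p) (y :: real^'m^'j) (g :: real^'n^'n).
    of_real (gvol y ^ ?c) * \<rho> (g ** stack e (\<delta> ** (\<omega> ** y)) 0))"
  define F where "F = (\<lambda>\<delta> (y, g). h (g ** ?u) * X \<delta> y g)"
  have Xm[measurable]: "(\<lambda>x. X (a x) (b x) (c x)) \<in> borel_measurable M"
    if [measurable]: "a \<in> borel_measurable M" "b \<in> borel_measurable M" "c \<in> borel_measurable M" for M and a b c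
    unfolding X_def by measurable
  have nX: "norm (X \<delta> y g) \<le> b y" if "\<delta> \<in> stiefel" "g \<in> stiefel" for \<delta> y g
  proof -
    have "norm (g ** stack e (\<delta> ** (\<omega> ** y)) 0) = norm y"
      using norm_stack[OF bij, of "\<delta> ** (\<omega> ** y)" 0]
      by (simp add: norm_stiefel_mult[OF that(2)] norm_Pair norm_stiefel_mult[OF that(1)] norm_stiefel_mult[OF \<omega>])
    from gb[OF this] show ?thesis by (simp add: X_def norm_mult norm_power)
  qed
  have Fint: "integrable (?L \<Otimes>\<^sub>M ?H) (F \<delta>)" if \<delta>: "\<delta> \<in> stiefel" for \<delta>
    unfolding F_def
  proof (rule LH.integrable_prod_dominated[OF int b])
    show "(\<lambda>(y, g). X \<delta> y g) \<in> borel_measurable (?L \<Otimes>\<^sub>M ?H)" unfolding case_prod_unfold by measurable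
    show "norm (X \<delta> y g) \<le> b y" if "g \<in> space ?H" for y g using nX[OF \<delta>] that by (simp add: space_haar)
  qed
  have sm: "stack e (\<delta> ** \<omega>) 0 ** y = stack e (\<delta> ** (\<omega> ** y)) 0" for \<delta> :: "real^'p^'p" and y :: "real^'m^'j"
    by (simp add: stack_mult[OF bij] matrix_mul_assoc)
  have s1: "stack e \<omega> 0 ** y = stack e (mat 1 ** (\<omega> ** y)) 0" for y :: "real^'m^'j"
    by (simp add: stack_mult[OF bij])
  have F1: "?F = F (mat 1)" unfolding F_def X_def s1[symmetric] by (auto simp: fun_eq_iff)
  show I: "integrable (lborel \<Otimes>\<^sub>M haar) ?F" unfolding F1 by (rule Fint[OF mat_1_stiefel])
  \<comment> \<open>\<open>stack e (\<delta> ** \<omega>) 0\<close> is again a frame orthogonal to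
    \<open>frame0 e\<close>, so this is an exchange of pairs for each fixed y.\<close>
  have indep: "integral\<^sup>L (?L \<Otimes>\<^sub>M ?H) (F \<delta>) = integral\<^sup>L (?L \<Otimes>\<^sub>M ?H) (F (mat 1))" if \<delta>: "\<delta> \<in> stiefel" for \<delta>
  proof -
    have "integral\<^sup>L (?L \<Otimes>\<^sub>M ?H) (F \<delta>) = (\<integral>y. \<integral>g. F \<delta> (y, g) \<partial>?H \<partial>?L)"
      by (rule LH.integral_fst'[symmetric, OF Fint[OF \<delta>]])
    also have "\<dots> = (\<integral>y. \<integral>g. F (mat 1) (y, g) \<partial>?H \<partial>?L)"
    proof (rule Bochner_Integration.integral_cong[OF refl])
      fix y
      have K: "(\<lambda>(u :: real^'k^'n, w :: real^'j^'n). h u * (of_real (gvol y ^ ?c) * \<rho> (w ** y))) \<in> borel_measurable borel"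
        unfolding borel_prod[symmetric] by measurable
      have dw: "\<delta> ** \<omega> \<in> stiefel" by (intro stiefel_mult \<delta> \<omega>)
      show "(\<integral>g. F \<delta> (y, g) \<partial>?H) = (\<integral>g. F (mat 1) (y, g) \<partial>?H)"
        using haar_integral_pair(1)[OF frame0_stiefel[OF bij] stack_stiefel(1)[OF bij dw] frame0_orthogonal[OF bij]
          frame0_stiefel[OF bij] stack_stiefel(1)[OF bij \<omega>] frame0_orthogonal[OF bij] K]
        by (simp add: F_def X_def matrix_mul_assoc[symmetric] sm s1)
    qed
    also have "\<dots> = integral\<^sup>L (?L \<Otimes>\<^sub>M ?H) (F (mat 1))"
      by (rule LH.integral_fst'[OF Fint[OF mat_1_stiefel]])
    finally show ?thesis .
  qed
  define Y where "Y = (\<lambda>g \<delta>. \<integral>y. X \<delta> y g \<partial>?L)"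
  have Ym: "(\<lambda>(g, \<delta>). h (g ** ?u) * Y g \<delta>) \<in> borel_measurable (?H \<Otimes>\<^sub>M ?P)"
    unfolding Y_def case_prod_unfold by measurable
  have Xint: "integrable ?L (\<lambda>y. X \<delta> y g)" if "\<delta> \<in> stiefel" "g \<in> stiefel" for \<delta> g
    by (rule Bochner_Integration.integrable_bound[OF b])
       (auto intro!: AE_I2 order_trans[OF nX[OF that] abs_ge_self])
  have nY: "norm (Y g \<delta>) \<le> integral\<^sup>L ?L b" if "\<delta> \<in> stiefel" "g \<in> stiefel" for \<delta> g
    unfolding Y_def by (rule order_trans[OF integral_norm_bound]) (intro integral_mono integrable_norm Xint b nX that)
  have Yint: "integrable (?H \<Otimes>\<^sub>M ?P) (\<lambda>(g, \<delta>). h (g ** ?u) * Y g \<delta>)"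
  proof (rule Bochner_Integration.integrable_bound[where f="\<lambda>(g, \<delta>). norm (h (g ** ?u)) * integral\<^sup>L ?L b"])
    show "integrable (?H \<Otimes>\<^sub>M ?P) (\<lambda>(g, \<delta>). norm (h (g ** ?u)) * integral\<^sup>L ?L b)"
      using int by (intro HP.integrable_prod_mult) auto
    have "norm (h (g ** ?u) * Y g \<delta>) \<le> norm (norm (h (g ** ?u)) * integral\<^sup>L ?L b)"
      if "g \<in> space ?H" "\<delta> \<in> space ?P" for g \<delta>
    proof -
      have "norm (h (g ** ?u) * Y g \<delta>) \<le> norm (h (g ** ?u)) * integral\<^sup>L ?L b"
        using nY[of \<delta> g] that by (simp add: norm_mult space_haar mult_left_mono)
      then show ?thesis by (metis abs_ge_self order_trans real_norm_def)
    qed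
    then show "AE p in ?H \<Otimes>\<^sub>M ?P. norm (case p of (g, \<delta>) \<Rightarrow> h (g ** ?u) * Y g \<delta>) \<le> norm (case p of (g, \<delta>) \<Rightarrow> norm (h (g ** ?u)) * integral\<^sup>L ?L b)"
      by (intro AE_I2) (auto simp: space_pair_measure)
  qed (rule Ym)
  have step: "integral\<^sup>L (?L \<Otimes>\<^sub>M ?H) (F \<delta>) = (\<integral>g. h (g ** ?u) * Y g \<delta> \<partial>?H)" if \<delta>: "\<delta> \<in> stiefel" for \<delta>
  proof -
    have "integral\<^sup>L (?L \<Otimes>\<^sub>M ?H) (F \<delta>) = (\<integral>g. \<integral>y. F \<delta> (y, g) \<partial>?L \<partial>?H)"
      using LH.integral_snd[of "\<lambda>y g. F \<delta> (y, g)"] Fint[OF \<delta>] by simp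
    then show ?thesis by (simp add: F_def Y_def)
  qed
  have "integral\<^sup>L (?L \<Otimes>\<^sub>M ?H) ?F = (\<integral>\<delta>. integral\<^sup>L (?L \<Otimes>\<^sub>M ?H) (F (mat 1)) \<partial>?P)"
    unfolding F1 using P.prob_space by simp
  also have "\<dots> = (\<integral>\<delta>. \<integral>g. h (g ** ?u) * Y g \<delta> \<partial>?H \<partial>?P)"
    by (intro Bochner_Integration.integral_cong refl) (simp add: step[symmetric] indep space_haar)
  also have "\<dots> = (\<integral>g. \<integral>\<delta>. h (g ** ?u) * Y g \<delta> \<partial>?P \<partial>?H)"
    by (rule HP.Fubini_integral) (rule Yint)
  also have "\<dots> = (\<integral>g. h (g ** ?u) * (of_real (polar_const TYPE('p) TYPE('j) TYPE('m)) * integral\<^sup>L lborel (\<lambda>A. \<rho> (g ** stack e A 0))) \<partial>?H)"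
  proof (intro Bochner_Integration.integral_cong refl)
    fix g assume "g \<in> space ?H"
    then have g: "g \<in> stiefel" by (simp add: space_haar)
    have cf: "rapid (\<lambda>A. \<rho> (g ** stack e A 0))"
      by (rule rapid_compose_norm_le[OF \<rho>])
         (auto intro!: continuous_intros continuous_on_stack[OF bij] simp: norm_stiefel_mult[OF g] norm_stack[OF bij] norm_Pair)
    have "integrable (?L \<Otimes>\<^sub>M ?P) (\<lambda>(y, \<delta>). X \<delta> y g)"
      using polar_integral(1)[OF le rapid_measurable[OF cf] \<omega>] rapid_integrable[OF cf] by (simp add: X_def)
    then have "(\<integral>\<delta>. Y g \<delta> \<partial>?P) = integral\<^sup>L (?L \<Otimes>\<^sub>M ?P) (\<lambda>(y, \<delta>). X \<delta> y g)"
      unfolding Y_def using LP.integral_snd[of "\<lambda>y \<delta>. X \<delta> y g"] by simp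
    also have "\<dots> = of_real (polar_const TYPE('p) TYPE('j) TYPE('m)) * integral\<^sup>L lborel (\<lambda>A. \<rho> (g ** stack e A 0))"
      using polar_integral(2)[OF le rapid_measurable[OF cf] \<omega>] by (simp add: X_def)
    finally show "(\<integral>\<delta>. h (g ** ?u) * Y g \<delta> \<partial>?P) = h (g ** ?u) * (of_real (polar_const TYPE('p) TYPE('j) TYPE('m)) * integral\<^sup>L lborel (\<lambda>A. \<rho> (g ** stack e A 0)))"
      by simp
  qed
  also have "\<dots> = of_real (polar_const TYPE('p) TYPE('j) TYPE('m)) *
         integral\<^sup>L haar (\<lambda>g. h (g ** ?u) * integral\<^sup>L lborel (\<lambda>A. \<rho> (g ** stack e A 0)))"
    by (simp add: mult.left_commute[of "h _"])
  finally show "integral\<^sup>L (lborel \<Otimes>\<^sub>M haar) ?F = of_real (polar_const TYPE('p) TYPE('j) TYPE('m)) *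
         integral\<^sup>L haar (\<lambda>g. h (g ** frame0 e) * integral\<^sup>L lborel (\<lambda>A. \<rho> (g ** stack e A 0)))" .
qed

section \<open>Homogeneous extensions as weighted averages\<close>

lemma E_ext_minus:
  fixes D :: "real^'m^'n \<Rightarrow> complex"
  shows "E_ext (- of_nat a) D x = (if gram_det x \<noteq> 0 then of_real (1 / gvol x ^ a) * D (polar_part x) else 0)"
proof (cases "gram_det x = 0")
  case False
  have r: "0 < gram_det x" using False gram_det_nonneg[of x] by simp
  have "complex_of_real (gram_det x) powr (- of_nat a / 2) = complex_of_real (gram_det x) powr of_real (- (real a / 2))"
    by simp
  also have "\<dots> = of_real (gram_det x powr (- (real a / 2)))"
    using r by (intro powr_of_real) simp
  also have "gram_det x powr (- (real a / 2)) = 1 / gvol x ^ a"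
  proof -
    have "gram_det x powr (real a / 2) = (gram_det x powr (1 / 2)) powr real a" by (simp add: powr_powr)
    also have "\<dots> = gvol x ^ a" using r by (simp add: gvol_def powr_half_sqrt powr_realpow)
    finally show ?thesis unfolding powr_minus by (simp only: inverse_eq_divide)
  qed
  finally show ?thesis using False by (simp add: E_ext_def rank_eq_iff_gram_det gram_det_def[symmetric])
qed (simp add: E_ext_def rank_eq_iff_gram_det)

lemma E_ext_cong:
  assumes "\<And>v. v \<in> stiefel \<Longrightarrow> D v = D' v"
  shows "E_ext a D = E_ext a (D' :: real^'m^'n \<Rightarrow> complex)"
  using assms polar_part(1) by (auto simp: fun_eq_iff E_ext_def rank_eq_iff_gram_det)

lemma borel_measurable_E_ext:
  fixes D :: "real^'m^'n \<Rightarrow> complex"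
  assumes D[measurable]: "D \<in> borel_measurable borel"
  shows "E_ext (- of_nat a) D \<in> borel_measurable borel"
proof -
  note [measurable] = measurable_polar_part[of 0] borel_measurable_gram_det
  have "E_ext (- of_nat a) D = (\<lambda>x. if gram_det x \<noteq> 0 then of_real (1 / gvol x ^ a) * D (if gram_det x \<noteq> 0 then polar_part x else 0) else 0)"
    by (auto simp: fun_eq_iff E_ext_minus)
  then show ?thesis by simp
qed

text \<open>Here right invariance enters: the polar part of g v y is g v times the polar part of y,
  a fixed element of O(m), which D ignores for almost every g.\<close>

lemma AE_E_ext_haar:
  fixes D :: "real^'m^'n \<Rightarrow> complex" and y :: "real^'m^'m"
  assumes inv: "right_invariant D" and v: "v \<in> stiefel" and y: "det y \<noteq> 0"
  shows "AE g in haar. E_ext (- of_nat a) D (g ** (v ** y)) = of_real (1 / gvol y ^ a) * D (g ** v)"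
proof -
  have y: "gram_det y \<noteq> 0" using y by (simp add: gram_det_square)
  have "AE w in stiefel_measure. D (w ** polar_part y) = D w"
    using inv polar_part(1)[OF y] by (simp add: right_invariant_def orthogonal_matrix_iff_stiefel)
  then have "AE g in haar. D (g ** v ** polar_part y) = D (g ** v)"
    unfolding stiefel_measure_eq[OF v] orbit_measure_def by (rule AE_distrD[OF measurable_haar_mult[OF v]])
  then show ?thesis
  proof (rule AE_mp, intro AE_I2 impI)
    fix g :: "real^'n^'n" assume "g \<in> space haar" and D: "D (g ** v ** polar_part y) = D (g ** v)"
    then have g: "g \<in> stiefel" by (simp add: space_haar)
    have vy: "gram_det (v ** y) \<noteq> 0" using y by (simp add: gram_det_mult_left v)
    have "polar_part (g ** (v ** y)) = g ** v ** polar_part y"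
      using polar_part_mult_left[OF vy g] polar_part_mult_left[OF y v] by (simp add: matrix_mul_assoc)
    then show "E_ext (- of_nat a) D (g ** (v ** y)) = of_real (1 / gvol y ^ a) * D (g ** v)"
      using vy by (simp add: E_ext_minus gram_det_mult_left g gvol_mult_left v D)
  qed
qed

text \<open>Polar coordinates with square y carry the weight
  \<open>gvol y ^ (CARD('n) - CARD('m))\<close>, and \<open>E_ext\<close> divides by
  \<open>gvol y ^ a\<close>. The condition on a leaves a nonnegative exponent, which makes the
  pairing with rapidly decreasing functions absolutely convergent.\<close>

lemma E_ext_integral:
  fixes D \<rho> :: "real^'m^'n \<Rightarrow> complex" and v :: "real^'m^'n"
  assumes le: "CARD('m) \<le> CARD('n)" and a: "a \<le> CARD('n) - CARD('m)"
    and D[measurable]: "D \<in> borel_measurable borel" and int: "integrable stiefel_measure D"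
    and inv: "right_invariant D" and \<rho>: "rapid \<rho>" and v: "v \<in> stiefel"
  shows "integrable lborel (\<lambda>x. E_ext (- of_nat a) D x * \<rho> x)"
    and "of_real (polar_const TYPE('n) TYPE('m) TYPE('m)) * integral\<^sup>L lborel (\<lambda>x. E_ext (- of_nat a) D x * \<rho> x) =
      integral\<^sup>L (lborel \<Otimes>\<^sub>M haar) (\<lambda>(y :: real^'m^'m, g). of_real (gvol y ^ (CARD('n) - CARD('m) - a)) *
        (D (g ** v) * \<rho> (g ** (v ** y))))"
    and "integrable (lborel \<Otimes>\<^sub>M haar) (\<lambda>(y :: real^'m^'m, g). of_real (gvol y ^ (CARD('n) - CARD('m) - a)) *
        (D (g ** v) * \<rho> (g ** (v ** y))))"
proof -
  let ?H = "haar :: (real^'n^'n) measure" and ?L = "lborel :: (real^'m^'m) measure"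
  let ?c = "CARD('n) - CARD('m)"
  let ?E = "\<lambda>x. E_ext (- of_nat a) D x * \<rho> x"
  let ?A = "\<lambda>(y :: real^'m^'m, g). of_real (gvol y ^ ?c) * ?E (g ** (v ** y))"
  let ?B = "\<lambda>(y :: real^'m^'m, g). of_real (gvol y ^ (?c - a)) * (D (g ** v) * \<rho> (g ** (v ** y)))"
  interpret H: prob_space ?H by (rule prob_space_haar)
  interpret LH: pair_sigma_finite ?L ?H ..
  have [measurable]: "\<rho> \<in> borel_measurable borel" by (rule rapid_measurable[OF \<rho>])
  note [measurable] = borel_measurable_E_ext[OF D]
  have Am: "?A \<in> borel_measurable (?L \<Otimes>\<^sub>M ?H)" and Bm: "?B \<in> borel_measurable (?L \<Otimes>\<^sub>M ?H)"
    unfolding case_prod_unfold by measurable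
  obtain b where b: "integrable lborel b"
    and gb: "\<And>(y::real^'m^'m) x :: real^'m^'n. norm x = norm y \<Longrightarrow> gvol y ^ (?c - a) * norm (\<rho> x) \<le> b y"
    using gvol_rapid_bound[OF \<rho>, of "?c - a", where 'm='m and 'j='m] by blast
  show Bint: "integrable (?L \<Otimes>\<^sub>M ?H) ?B"
  proof -
    have "integrable (?L \<Otimes>\<^sub>M ?H) (\<lambda>(y, g). D (g ** v) * (of_real (gvol y ^ (?c - a)) * \<rho> (g ** (v ** y))))"
    proof (rule LH.integrable_prod_dominated[OF _ b])
      show "integrable ?H (\<lambda>g. D (g ** v))" using int integral_stiefel(2)[OF v D] by simp
      show "(\<lambda>(y, g). complex_of_real (gvol y ^ (?c - a)) * \<rho> (g ** (v ** y))) \<in> borel_measurable (?L \<Otimes>\<^sub>M ?H)"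
        unfolding case_prod_unfold by measurable
      show "norm (complex_of_real (gvol y ^ (?c - a)) * \<rho> (g ** (v ** y))) \<le> b y" if "g \<in> space ?H" for y g
        using gb[of "g ** (v ** y)" y] that
        by (simp add: space_haar norm_stiefel_mult v norm_mult norm_power)
    qed
    then show ?thesis by (simp add: mult.left_commute case_prod_unfold)
  qed
  have AE: "AE p in ?L \<Otimes>\<^sub>M ?H. ?A p = ?B p"
  proof -
    have "AE y in ?L. AE g in ?H. ?A (y, g) = ?B (y, g)"
      using AE_det_nonzero
    proof eventually_elim
      case (elim y)
      then have gy: "gvol y \<noteq> 0" by (simp add: gram_det_square)
      have "gvol y ^ ?c * (1 / gvol y ^ a) = gvol y ^ (?c - a)"
        by (simp only: power_diff[OF gy a] times_divide_eq_right mult_1_right)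
      then have w: "complex_of_real (gvol y ^ ?c) * of_real (1 / gvol y ^ a) = of_real (gvol y ^ (?c - a))"
        by (simp only: of_real_mult[symmetric])
      show ?case
        using AE_E_ext_haar[OF inv v elim, of a]
      proof eventually_elim
        case (elim g)
        show "?A (y, g) = ?B (y, g)"
          unfolding prod.case elim w[symmetric] by (simp only: mult.assoc)
      qed
    qed
    moreover have "{p \<in> space (?L \<Otimes>\<^sub>M ?H). ?A p = ?B p} \<in> sets (?L \<Otimes>\<^sub>M ?H)" using Am Bm by measurable
    ultimately show ?thesis by (intro LH.AE_pair_measure)
  qed
  have Fm: "?E \<in> borel_measurable borel" by measurable
  have "integrable (?L \<Otimes>\<^sub>M ?H) ?A"
    using integrable_cong_AE[OF Am Bm AE] Bint by simp
  then show "integrable lborel ?E"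
    using polar_integral(1)[OF order_refl le Fm v] by simp
  show "of_real (polar_const TYPE('n) TYPE('m) TYPE('m)) * integral\<^sup>L lborel ?E = integral\<^sup>L (lborel \<Otimes>\<^sub>M haar) ?B"
    using polar_integral(2)[OF order_refl le Fm v] integral_cong_AE[OF Am Bm AE] by simp
qed

section \<open>The inversion formula\<close>

lemma lborel_integral_rotate:
  fixes F :: "real^'m^'n \<Rightarrow> 'b::{banach, second_countable_topology}"
  assumes g: "(g :: real^'n^'n) \<in> stiefel" and F: "F \<in> borel_measurable borel"
  shows "integral\<^sup>L lborel (\<lambda>x. F (g ** x)) = integral\<^sup>L lborel F"
proof -
  have "distr lborel borel (\<lambda>x :: real^'m^'n. g ** x) = lborel"
  proof (rule measure_eqI)
    fix A assume "A \<in> sets (distr lborel borel (\<lambda>x :: real^'m^'n. g ** x))"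
    then have A: "A \<in> sets borel" by simp
    have "emeasure (distr lborel borel (\<lambda>x :: real^'m^'n. g ** x)) A = (\<integral>\<^sup>+x. indicator A x \<partial>distr lborel borel (\<lambda>x. g ** x))"
      using A by simp
    also have "\<dots> = (\<integral>\<^sup>+x. indicator A (g ** x) \<partial>lborel)" using A by (intro nn_integral_distr) simp_all
    also have "\<dots> = (\<integral>\<^sup>+x. indicator A x \<partial>lborel)"
      using nn_integral_matrix_mult_left[of g "indicator A"] A abs_det_stiefel[OF g] by simp
    finally show "emeasure (distr lborel borel (\<lambda>x :: real^'m^'n. g ** x)) A = emeasure lborel A" using A by simp
  qed simp
  with integral_distr[of "\<lambda>x. g ** x" lborel borel F] F show ?thesis by simp
qed

lemma fourier_stack:
  fixes \<psi> :: "real^'c^'n \<Rightarrow> complex" and e :: "'p::finite + 'k::finite \<Rightarrow> 'n::finite"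
  assumes bij: "bij e" and g: "(g :: real^'n^'n) \<in> stiefel" and \<psi>: "\<psi> \<in> borel_measurable borel"
  shows "fourier (\<lambda>p. \<psi> (g ** stack e (fst p) (snd p))) \<xi> = fourier \<psi> (g ** stack e (fst \<xi>) (snd \<xi>))"
proof -
  let ?\<xi> = "stack e (fst \<xi>) (snd \<xi>)"
  have in1: "p \<bullet> \<xi> = stack e (fst p) (snd p) \<bullet> ?\<xi>" for p
    by (simp add: inner_stack[OF bij] inner_prod_def)
  have in2: "x \<bullet> ?\<xi> = (g ** x) \<bullet> (g ** ?\<xi>)" for x :: "real^'c^'n"
    by (simp add: matrix_inner_trace gram_mult_stiefel[OF g])
  have m: "(\<lambda>x. \<psi> x * cis (x \<bullet> (g ** ?\<xi>))) \<in> borel_measurable borel" using \<psi> by measurable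
  have "fourier (\<lambda>p. \<psi> (g ** stack e (fst p) (snd p))) \<xi> =
      (\<integral>p. (\<lambda>x. \<psi> (g ** x) * cis ((g ** x) \<bullet> (g ** ?\<xi>))) (stack e (fst p) (snd p)) \<partial>lborel)"
    unfolding fourier_def in1 in2 ..
  also have "\<dots> = (\<integral>x. \<psi> (g ** x) * cis ((g ** x) \<bullet> (g ** ?\<xi>)) \<partial>lborel)"
    by (rule integral_stack[OF bij, symmetric]) (use \<psi> in measurable)
  also have "\<dots> = fourier \<psi> (g ** ?\<xi>)"
    unfolding fourier_def by (rule lborel_integral_rotate[OF g m])
  finally show ?thesis .
qed

text \<open>Stacking followed by g is an isometry, and the Fourier transform commutes with it; so
  the product case \<open>integral_subspace_fourier\<close> covers all pairs of complementary
  coordinate blocks rotated by g.\<close>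

lemma integral_stack_fourier:
  fixes \<psi> :: "real^'c^'n \<Rightarrow> complex" and e :: "'p::finite + 'k::finite \<Rightarrow> 'n::finite"
  assumes bij: "bij e" and g: "(g :: real^'n^'n) \<in> stiefel" and \<psi>: "\<psi> \<in> schwartz"
  shows "(\<integral>B. fourier \<psi> (g ** stack e 0 B) \<partial>lborel) =
    of_real ((2 * pi) ^ DIM(real^'c^'k)) * (\<integral>A. \<psi> (g ** stack e A 0) \<partial>lborel)"
proof -
  let ?w = "\<lambda>p :: (real^'c^'p) \<times> (real^'c^'k). g ** stack e (fst p) (snd p)"
  have n: "norm (?w p) = norm p" for p
    by (simp add: norm_stiefel_mult[OF g] norm_stack[OF bij])
  have w: "continuous_on UNIV ?w"
    by (intro continuous_intros continuous_on_stack[OF bij] continuous_on_fst continuous_on_snd continuous_on_id)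
  have r: "rapid (\<lambda>p. \<psi> (?w p))"
    by (rule rapid_compose_norm_le[OF schwartz_rapid[OF \<psi>] w]) (simp add: n)
  have F: "fourier (\<lambda>p. \<psi> (?w p)) = (\<lambda>\<xi>. fourier \<psi> (?w \<xi>))"
    using fourier_stack[OF bij g rapid_measurable[OF schwartz_rapid[OF \<psi>]]] by (intro ext)
  have "rapid (fourier (\<lambda>p. \<psi> (?w p)))"
    unfolding F by (rule rapid_compose_norm_le[OF rapid_fourier[OF \<psi>] w]) (simp add: n)
  from integral_subspace_fourier[OF r this] show ?thesis unfolding F by simp
qed

lemma integral_stack_fourier':
  fixes \<psi> :: "real^'c^'n \<Rightarrow> complex" and e :: "'p::finite + 'k::finite \<Rightarrow> 'n::finite"
  assumes bij: "bij e" and g: "(g :: real^'n^'n) \<in> stiefel" and \<psi>: "\<psi> \<in> schwartz"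
  shows "(\<integral>A. fourier \<psi> (g ** stack e A 0) \<partial>lborel) =
    of_real ((2 * pi) ^ DIM(real^'c^'p)) * (\<integral>B. \<psi> (g ** stack e 0 B) \<partial>lborel)"
proof -
  \<comment> \<open>Swapping the two summands of the index type exchanges the roles of the upper and
    the lower block.\<close>
  define s where "s = (\<lambda>x :: 'k + 'p. case x of Inl b \<Rightarrow> Inr b | Inr a \<Rightarrow> Inl a)"
  have "bij s" by (rule o_bij[of "\<lambda>x. case x of Inl b \<Rightarrow> Inr b | Inr a \<Rightarrow> Inl a"]) (auto simp: s_def fun_eq_iff split: sum.splits)
  then have bij': "bij (e \<circ> s)" using bij by (rule bij_comp)
  have "stack (e \<circ> s) B A = stack e A B" for A :: "real^'c^'p" and B
  proof -
    have "stack (e \<circ> s) B A $ e (s x) = stack e A B $ e (s x)" for x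
      using stack_nth[OF bij', of B A x] by (simp add: stack_nth[OF bij] s_def split: sum.splits)
    then show ?thesis unfolding vec_eq_iff using bij' by (metis bij_pointE comp_apply)
  qed
  with integral_stack_fourier[OF bij' g \<psi>] show ?thesis by simp
qed

section \<open>The constant of the inversion formula\<close>

lemma siegel_Gamma_shift:
  assumes "real m \<le> x"
  shows "siegel_Gamma m (x / 2 + real l) = siegel_Gamma m (x / 2) * (\<Prod>i<m. pochhammer ((x - real i) / 2) l)"
    and "siegel_Gamma m (x / 2) > 0"
proof -
  have pos: "x / 2 - real j / 2 > 0" if "j < m" for j using that assms by simp
  have "Gamma (x / 2 + real l - real j / 2) = Gamma (x / 2 - real j / 2) * pochhammer ((x - real j) / 2) l" if "j < m" for j
  proof -
    let ?z = "(x - real j) / 2"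
    have z: "?z > 0" and e: "x / 2 + real l - real j / 2 = ?z + real l" "x / 2 - real j / 2 = ?z"
      using pos[OF that] by (auto simp: field_simps)
    have "?z \<notin> \<int>\<^sub>\<le>\<^sub>0" using z by (auto elim!: nonpos_Ints_cases)
    from pochhammer_Gamma[OF this, of l] Gamma_real_pos[OF z] show ?thesis unfolding e by simp
  qed
  then show "siegel_Gamma m (x / 2 + real l) = siegel_Gamma m (x / 2) * (\<Prod>i<m. pochhammer ((x - real i) / 2) l)"
    by (simp add: siegel_Gamma_def prod.distrib)
  show "siegel_Gamma m (x / 2) > 0"
    unfolding siegel_Gamma_def using pos by (intro mult_pos_pos prod_pos) (auto intro: Gamma_real_pos)
qed

text \<open>Each polar constant is a product of Pochhammer symbols over pi^(ml). These symbols are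
  the quotients \<open>siegel_Gamma m (x / 2 + l) / siegel_Gamma m (x / 2)\<close> for x = m and x =
  k, where m/2 + l = (n-k)/2 and k/2 + l = (n-m)/2. The power of 2 pi from the two inversions
  cancels all pi and leaves 4^(ml).\<close>

lemma funk_const_eq:
  fixes e :: "'p::finite + 'k::finite \<Rightarrow> 'n::finite" and e' :: "'q::finite + 'm::finite \<Rightarrow> 'n"
  assumes bij: "bij e" "bij e'" and le: "CARD('m) \<le> CARD('k)"
    and n: "CARD('n) = CARD('k) + CARD('m) + 2 * l"
  shows "funk_const CARD('n) CARD('m) CARD('k) * (polar_const TYPE('p) TYPE('m) TYPE('m) * polar_const TYPE('q) TYPE('k) TYPE('m) *
    (- 1) ^ (CARD('m) * l) * (2 * pi) ^ (2 * l * CARD('m))) = 1"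
proof -
  let ?m = "CARD('m)" and ?k = "CARD('k)"
  have p: "CARD('p) = ?m + 2 * l" and q: "CARD('q) = ?k + 2 * l"
    using CARD_Plus[OF bij(1)] CARD_Plus[OF bij(2)] n by auto
  define S where "S = (\<lambda>x. \<Prod>i<?m. pochhammer ((real x - real i) / 2) l)"
  have sp: "sqrt pi ^ (2 * j) = pi ^ j" for j by (simp add: power_mult)
  have sp': "sqrt pi ^ (l * (2 * j)) = pi ^ (l * j)" for j
    using sp[of "l * j"] by (simp add: mult.left_commute)
  have c1: "polar_const TYPE('p) TYPE('m) TYPE('m) = S ?m / pi ^ (l * ?m)"
    using gauss_moment_even[where 'a='m and 'm='m, of l]
    by (simp add: polar_const_def p S_def power_add distrib_right distrib_left sp sp' mult.assoc mult.left_commute[of 2])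
  have c2: "polar_const TYPE('q) TYPE('k) TYPE('m) = S ?k / pi ^ (l * ?m)"
    using gauss_moment_even[where 'a='k and 'm='m, of l]
    by (simp add: polar_const_def q S_def power_add distrib_right distrib_left sp sp' mult.assoc mult.left_commute[of 2] mult.commute[of ?m])
  have S: "S ?m > 0" "S ?k > 0" using le unfolding S_def by (auto intro!: prod_pos pochhammer_pos)
  have l: "(CARD('n) - ?k - ?m) div 2 = l" using n by simp
  have a1: "(real CARD('n) - real ?m) / 2 = real ?k / 2 + real l" and a2: "(real CARD('n) - real ?k) / 2 = real ?m / 2 + real l"
    using n by auto
  have G: "siegel_Gamma ?m (real ?k / 2 + real l) = siegel_Gamma ?m (real ?k / 2) * S ?k"
    "siegel_Gamma ?m (real ?m / 2 + real l) = siegel_Gamma ?m (real ?m / 2) * S ?m"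
    "siegel_Gamma ?m (real ?k / 2) > 0" "siegel_Gamma ?m (real ?m / 2) > 0"
    using le by (auto simp: siegel_Gamma_shift S_def)
  have fc: "funk_const CARD('n) ?m ?k = (- 1) ^ (?m * l) * (1 / 4) ^ (?m * l) / (S ?k * S ?m)"
    unfolding funk_const_def Let_def l a1 a2 G(1,2) using G(3,4) S by simp
  have pw: "(2 * pi) ^ (2 * l * ?m) = 4 ^ (?m * l) * (pi ^ (l * ?m)) ^ 2"
  proof -
    have "(2 * pi) ^ (2 * l * ?m) = ((2 * pi)\<^sup>2) ^ (?m * l)" by (simp only: power_mult[symmetric] ac_simps)
    also have "\<dots> = 4 ^ (?m * l) * (pi\<^sup>2) ^ (?m * l)" by (simp add: power_mult_distrib)
    also have "(pi\<^sup>2) ^ (?m * l) = (pi ^ (l * ?m)) ^ 2" by (simp only: power_mult[symmetric] ac_simps)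
    finally show ?thesis .
  qed
  have s: "(- 1 :: real) ^ (?m * l) * (- 1) ^ (?m * l) = 1" by (simp add: power_mult_distrib[symmetric])
  have f: "(1 / 4 :: real) ^ (?m * l) * 4 ^ (?m * l) = 1" by (simp add: power_mult_distrib[symmetric])
  have "funk_const CARD('n) ?m ?k * (polar_const TYPE('p) TYPE('m) TYPE('m) * polar_const TYPE('q) TYPE('k) TYPE('m) *
    (- 1) ^ (?m * l) * (2 * pi) ^ (2 * l * ?m)) =
    ((- 1) ^ (?m * l) * (- 1) ^ (?m * l)) * ((1 / 4) ^ (?m * l) * 4 ^ (?m * l)) *
    ((S ?m * S ?k) / (S ?k * S ?m)) * ((pi ^ (l * ?m)) ^ 2 / (pi ^ (l * ?m)) ^ 2)"
    unfolding fc c1 c2 pw by (simp add: power2_eq_square)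
  also have "\<dots> = 1" unfolding s f using S by simp
  finally show ?thesis .
qed

text \<open>Functions on the Stiefel manifold are measurable only for its trace sigma-algebra. Since
  the manifold is closed, extension by zero makes them Borel on the matrix space, as compositions
  with g -> g v require.\<close>

definition zero_ext :: "(real^'m^'n \<Rightarrow> complex) \<Rightarrow> real^'m^'n \<Rightarrow> complex" where
  "zero_ext h = (\<lambda>v. if v \<in> stiefel then h v else 0)"

lemma zero_ext [simp]: "v \<in> stiefel \<Longrightarrow> zero_ext h v = h v"
  by (simp add: zero_ext_def)

lemma measurable_zero_ext:
  "h \<in> borel_measurable stiefel_borel \<Longrightarrow> zero_ext h \<in> borel_measurable borel"
  unfolding zero_ext_def
  by (subst measurable_restrict_space_iff[of stiefel, symmetric]) (simp_all add: closed_stiefel)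

lemma rapid_cnj: "rapid f \<Longrightarrow> rapid (\<lambda>x. cnj (f x))"
  by (simp add: rapid_def continuous_on_cnj)

lemma borel_measurable_cnj [measurable]: "cnj \<in> borel_measurable borel"
  by (intro borel_measurable_continuous_onI continuous_intros)

text \<open>The inversion formula tested against \<open>\<psi>\<close>, with the differential
  operator already moved to the test function. In the proof W is an m-frame orthogonal to the base
  frame u and T a k-frame orthogonal to the base frame v, so (u, W) and (T, v) are interchangeable
  pairs.\<close>

lemma funk_inversion_pairing:
  fixes f \<psi> :: "real^'m^'n \<Rightarrow> complex"
    and e :: "'p::finite + 'k::finite \<Rightarrow> 'n" and e' :: "'q::finite + 'm \<Rightarrow> 'n"
  assumes bij: "bij e" "bij e'" and le: "CARD('m) \<le> CARD('k)"
    and n: "CARD('n) = CARD('k) + CARD('m) + 2 * l"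
    and f[measurable]: "f \<in> borel_measurable borel" and int: "integrable stiefel_measure f" and inv: "right_invariant f"
    and \<psi>: "\<psi> \<in> schwartz"
  defines "D \<equiv> zero_ext (funk e' (zero_ext (funk e f)))"
  shows "rapid \<rho> \<Longrightarrow> integrable lborel (\<lambda>x. E_ext (- of_nat CARD('k)) D x * \<rho> x)"
    and "(\<integral>x. E_ext (- of_nat (CARD('n) - CARD('m))) f x * cnj (\<psi> x) \<partial>lborel) =
      of_real (funk_const CARD('n) CARD('m) CARD('k)) *
        (\<integral>x. E_ext (- of_nat CARD('k)) D x * cnj ((cl_op ^^ l) \<psi> x) \<partial>lborel)"
proof -
  let ?H = "haar :: (real^'n^'n) measure" and ?Lm = "lborel :: (real^'m^'m) measure" and ?Lk = "lborel :: (real^'m^'k) measure"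
  let ?u = "frame0 e :: real^'k^'n" and ?v = "frame0 e' :: real^'m^'n"
  interpret H: prob_space ?H by (rule prob_space_haar)
  interpret LmH: pair_sigma_finite ?Lm ?H ..
  interpret LkH: pair_sigma_finite ?Lk ?H ..
  note [measurable] = borel_measurable_stack[OF bij(1)] borel_measurable_stack[OF bij(2)]
  have p: "CARD('p) = CARD('m) + 2 * l" and q: "CARD('q) = CARD('k) + 2 * l"
    using CARD_Plus[OF bij(1)] CARD_Plus[OF bij(2)] n by auto
  have mp: "CARD('m) \<le> CARD('p)" and kq: "CARD('k) \<le> CARD('q)" and mn: "CARD('m) \<le> CARD('n)"
    and pm: "CARD('p) - CARD('m) = 2 * l" and qk: "CARD('q) - CARD('k) = 2 * l"
    and nmk: "CARD('n) - CARD('m) - CARD('k) = 2 * l" and kn: "CARD('k) \<le> CARD('n) - CARD('m)"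
    using p q n by auto
  have u: "?u \<in> stiefel" by (rule frame0_stiefel[OF bij(1)])
  have v: "?v \<in> stiefel" by (rule frame0_stiefel[OF bij(2)])
  obtain \<omega> :: "real^'m^'p" where \<omega>: "\<omega> \<in> stiefel" using stiefel_nonempty[OF mp] by auto
  obtain \<theta> :: "real^'k^'q" where \<theta>: "\<theta> \<in> stiefel" using stiefel_nonempty[OF kq] by auto
  define W where "W = stack e \<omega> 0"
  define T where "T = stack e' \<theta> 0"
  have W: "W \<in> stiefel" "transpose ?u ** W = 0"
    unfolding W_def by (auto intro: stack_stiefel(1)[OF bij(1) \<omega>] frame0_orthogonal[OF bij(1)])
  have T: "T \<in> stiefel" "transpose ?v ** T = 0"
    unfolding T_def by (auto intro: stack_stiefel(1)[OF bij(2) \<theta>] frame0_orthogonal[OF bij(2)])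
  have T': "transpose T ** ?v = 0"
    using arg_cong[OF T(2), of transpose] by (simp add: matrix_transpose_mul transpose_0)
  define \<phi> where "\<phi> = zero_ext (funk e f)"
  have \<phi>m[measurable]: "\<phi> \<in> borel_measurable borel"
    unfolding \<phi>_def by (intro measurable_zero_ext measurable_funk[OF bij(1) mp] f)
  have cong_stiefel: "integrable ?H (\<lambda>g. zero_ext h (g ** w)) \<longleftrightarrow> integrable ?H (\<lambda>g. h (g ** w))"
    if "w \<in> stiefel" for h :: "real^'c^'n \<Rightarrow> complex" and w
    by (rule Bochner_Integration.integrable_cong) (simp_all add: that stiefel_mult)
  have \<phi>H: "integrable ?H (\<lambda>g. \<phi> (g ** ?u))"
    unfolding \<phi>_def cong_stiefel[OF u] by (rule funk_integrable[OF bij(1) mp f int])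
  have \<phi>int: "integrable stiefel_measure \<phi>"
    using \<phi>H integral_stiefel(2)[OF u \<phi>m] by simp
  have D: "D = zero_ext (funk e' \<phi>)" by (simp add: D_def \<phi>_def)
  have Dm[measurable]: "D \<in> borel_measurable borel"
    unfolding D by (intro measurable_zero_ext measurable_funk[OF bij(2) kq] \<phi>m)
  have DH: "integrable ?H (\<lambda>g. D (g ** ?v))"
    unfolding D cong_stiefel[OF v] by (rule funk_integrable[OF bij(2) kq \<phi>m \<phi>int])
  have Dint: "integrable stiefel_measure D"
    using DH integral_stiefel(2)[OF v Dm] by simp
  have Dinv: "right_invariant D"
    unfolding right_invariant_def
    by (auto intro!: AE_I2 simp: stiefel_mult D space_stiefel[OF mn] orthogonal_matrix_iff_stiefel funk_right_invariant[OF bij(2) kq \<phi>m])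
  show "integrable lborel (\<lambda>x. E_ext (- of_nat CARD('k)) D x * \<rho> x)" if "rapid \<rho>"
    by (rule E_ext_integral(1)[OF mn kn Dm Dint Dinv that v])
  define \<Psi> where "\<Psi> = (cl_op ^^ l) \<psi>"
  have \<Psi>: "\<Psi> \<in> schwartz" unfolding \<Psi>_def by (rule schwartz_cl_op_power[OF \<psi>])
  have r1: "rapid (\<lambda>x. cnj (\<Psi> x))" by (intro rapid_cnj schwartz_rapid \<Psi>)
  have r2: "rapid (\<lambda>x. cnj (fourier \<psi> x))" by (intro rapid_cnj rapid_fourier \<psi>)
  have r3: "rapid (\<lambda>x. cnj (\<psi> x))" by (intro rapid_cnj schwartz_rapid \<psi>)
  have r4: "rapid (fourier \<Psi>)" by (intro rapid_fourier \<Psi>)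
  note [measurable] = rapid_measurable[OF schwartz_rapid[OF \<Psi>]] rapid_measurable[OF r4]
    rapid_measurable[OF rapid_fourier[OF \<psi>]] rapid_measurable[OF schwartz_rapid[OF \<psi>]]
  let ?\<kappa> = "of_real (polar_const TYPE('n) TYPE('m) TYPE('m)) :: complex"
  let ?P = "of_real (polar_const TYPE('p) TYPE('m) TYPE('m)) :: complex"
  let ?Q = "of_real (polar_const TYPE('q) TYPE('k) TYPE('m)) :: complex"
  define c where "c = (\<lambda>y :: real^'m^'m. complex_of_real (gvol y ^ (2 * l)))"
  define d where "d = (\<lambda>y :: real^'m^'k. complex_of_real (gvol y ^ (2 * l)))"
  \<comment> \<open>Set to 0 off the Stiefel manifold, so that S is bounded and Borel everywhere, as
    \<open>funk_adjoint\<close> demands.\<close>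
  define S where "S = (\<lambda>w :: real^'k^'n. if w \<in> stiefel then \<integral>B. cnj (fourier \<Psi> (w ** B)) \<partial>?Lk else 0)"

  \<comment> \<open>Polar coordinates leave the exponent n - m - k = 2 l, and adjointness replaces D
    by \<open>\<phi>\<close>. As p - m = 2 l too, the same weight is the one of polar coordinates on
    {x. u'x = 0}.\<close>
  have step1: "?\<kappa> * (\<integral>x. E_ext (- of_nat CARD('k)) D x * cnj (\<Psi> x) \<partial>lborel) =
      ?P * (\<integral>g. \<phi> (g ** ?u) * (\<integral>A. cnj (\<Psi> (g ** stack e A 0)) \<partial>lborel) \<partial>?H)"
  proof -
    obtain B where B: "\<And>x. norm (\<Psi> x) \<le> B" using rapid_bound[OF schwartz_rapid[OF \<Psi>]] by blast
    have fr: "integrable (?Lm \<Otimes>\<^sub>M ?H) (\<lambda>(y, g). c y * (\<phi> (g ** ?u) * cnj (\<Psi> (g ** (W ** y)))))"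
      "integral\<^sup>L (?Lm \<Otimes>\<^sub>M ?H) (\<lambda>(y, g). c y * (\<phi> (g ** ?u) * cnj (\<Psi> (g ** (W ** y))))) =
        ?P * (\<integral>g. \<phi> (g ** ?u) * (\<integral>A. cnj (\<Psi> (g ** stack e A 0)) \<partial>lborel) \<partial>?H)"
      using frame_average[OF bij(1) order_refl mp \<phi>m \<phi>H r1 \<omega>] unfolding pm by (simp_all add: c_def W_def)
    have Dc: "integrable (?Lm \<Otimes>\<^sub>M ?H) (\<lambda>(y, g). c y * (D (g ** ?v) * cnj (\<Psi> (g ** (?v ** y)))))"
      using E_ext_integral(3)[OF mn kn Dm Dint Dinv r1 v] unfolding nmk by (simp add: c_def)
    have "?\<kappa> * (\<integral>x. E_ext (- of_nat CARD('k)) D x * cnj (\<Psi> x) \<partial>lborel) =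
        integral\<^sup>L (?Lm \<Otimes>\<^sub>M ?H) (\<lambda>(y, g). c y * (D (g ** ?v) * cnj (\<Psi> (g ** (?v ** y)))))"
      using E_ext_integral(2)[OF mn kn Dm Dint Dinv r1 v] unfolding nmk by (simp add: c_def)
    also have "\<dots> = (\<integral>y. \<integral>g. c y * (D (g ** ?v) * cnj (\<Psi> (g ** (?v ** y)))) \<partial>?H \<partial>?Lm)"
      using LmH.integral_fst'[OF Dc] by simp
    also have "\<dots> = (\<integral>y. \<integral>g. c y * (\<phi> (g ** ?u) * cnj (\<Psi> (g ** (W ** y)))) \<partial>?H \<partial>?Lm)"
    proof (rule Bochner_Integration.integral_cong[OF refl])
      fix y :: "real^'m^'m"
      have "(\<integral>g. D (g ** ?v) * cnj (\<Psi> (g ** (?v ** y))) \<partial>?H) = (\<integral>g. funk e' \<phi> (g ** ?v) * cnj (\<Psi> ((g ** ?v) ** y)) \<partial>?H)"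
        by (rule Bochner_Integration.integral_cong[OF refl]) (simp add: D stiefel_mult v matrix_mul_assoc)
      also have "\<dots> = (\<integral>g. \<phi> (g ** T) * cnj (\<Psi> ((g ** ?v) ** y)) \<partial>?H)"
        by (rule funk_adjoint(2)[OF bij(2) kq \<phi>m \<phi>int _ _ T, where B=B]) (measurable, simp add: B)
      also have "\<dots> = (\<integral>g. \<phi> (g ** ?u) * cnj (\<Psi> ((g ** W) ** y)) \<partial>?H)"
      proof (rule haar_integral_pair(1)[OF T(1) v T' u W])
        show "(\<lambda>(x, w). \<phi> x * cnj (\<Psi> (w ** y))) \<in> borel_measurable borel"
          unfolding borel_prod[symmetric] by measurable
      qed
      finally show "(\<integral>g. c y * (D (g ** ?v) * cnj (\<Psi> (g ** (?v ** y)))) \<partial>?H) = (\<integral>g. c y * (\<phi> (g ** ?u) * cnj (\<Psi> (g ** (W ** y)))) \<partial>?H)"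
        by (simp add: matrix_mul_assoc)
    qed
    also have "\<dots> = integral\<^sup>L (?Lm \<Otimes>\<^sub>M ?H) (\<lambda>(y, g). c y * (\<phi> (g ** ?u) * cnj (\<Psi> (g ** (W ** y)))))"
      using LmH.integral_fst'[OF fr(1)] by simp
    finally show ?thesis unfolding fr(2) .
  qed

  \<comment> \<open>Inversion passes from {x. u'x = 0} to the transform on {u B}. The result depends
    on u alone, so adjointness can replace \<open>\<phi>\<close> by f, after which (u, W) is
    exchanged for (T, v).\<close>
  have step2: "of_real ((2 * pi) ^ DIM(real^'m^'k)) * (\<integral>g. \<phi> (g ** ?u) * (\<integral>A. cnj (\<Psi> (g ** stack e A 0)) \<partial>lborel) \<partial>?H) =
      (\<integral>g. f (g ** ?v) * S (g ** T) \<partial>?H)"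
  proof -
    have Sm[measurable]: "S \<in> borel_measurable borel"
    proof -
      have "(\<lambda>w :: real^'k^'n. \<integral>B. cnj (fourier \<Psi> (w ** B)) \<partial>?Lk) \<in> borel_measurable borel" by measurable
      then show ?thesis unfolding S_def by (rule measurable_If_set) (simp_all add: closed_stiefel)
    qed
    obtain b where b: "integrable lborel b" "\<And>(y::real^'m^'k) x :: real^'m^'n. norm x = norm y \<Longrightarrow> norm (fourier \<Psi> x) \<le> b y"
      using gvol_rapid_bound[OF r4, of 0, where 'm='m and 'j='k] by auto
    have "norm (S w) \<le> \<bar>integral\<^sup>L ?Lk b\<bar>" for w
    proof (cases "w \<in> stiefel")
      case True
      have bw: "norm (fourier \<Psi> (w ** B)) \<le> b B" for B by (rule b(2)) (simp add: norm_stiefel_mult[OF True])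
      have "integrable ?Lk (\<lambda>B. cnj (fourier \<Psi> (w ** B)))"
        by (rule Bochner_Integration.integrable_bound[OF b(1)])
           (measurable, auto intro!: AE_I2 order_trans[OF bw abs_ge_self])
      then have "norm (S w) \<le> integral\<^sup>L ?Lk b"
        using True unfolding S_def if_P[OF True]
        by (intro order_trans[OF integral_norm_bound] integral_mono integrable_norm b(1)) (simp_all add: bw)
      then show ?thesis by simp
    qed (simp add: S_def)
    note Sb = this
    have "of_real ((2 * pi) ^ DIM(real^'m^'k)) * (\<integral>g. \<phi> (g ** ?u) * (\<integral>A. cnj (\<Psi> (g ** stack e A 0)) \<partial>lborel) \<partial>?H) =
        (\<integral>g. \<phi> (g ** ?u) * (of_real ((2 * pi) ^ DIM(real^'m^'k)) * (\<integral>A. cnj (\<Psi> (g ** stack e A 0)) \<partial>lborel)) \<partial>?H)"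
      by (subst integral_mult_right_zero[symmetric])
         (rule Bochner_Integration.integral_cong[OF refl], rule mult.left_commute)
    also have "\<dots> = (\<integral>g. funk e f (g ** ?u) * S (g ** ?u) \<partial>?H)"
    proof (rule Bochner_Integration.integral_cong[OF refl])
      fix g assume "g \<in> space ?H"
      then have g: "g \<in> stiefel" by (simp add: space_haar)
      have gu: "g ** ?u \<in> stiefel" by (intro stiefel_mult g u)
      have "S (g ** ?u) = cnj (\<integral>B. fourier \<Psi> (g ** stack e 0 B) \<partial>?Lk)"
        unfolding S_def if_P[OF gu] by (simp add: matrix_mul_assoc[symmetric] frame0_mult[OF bij(1)] del: stack_mult)
      also have "\<dots> = of_real ((2 * pi) ^ DIM(real^'m^'k)) * (\<integral>A. cnj (\<Psi> (g ** stack e A 0)) \<partial>lborel)"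
        unfolding integral_stack_fourier[OF bij(1) g \<Psi>] by simp
      finally show "\<phi> (g ** ?u) * (of_real ((2 * pi) ^ DIM(real^'m^'k)) * (\<integral>A. cnj (\<Psi> (g ** stack e A 0)) \<partial>lborel)) =
          funk e f (g ** ?u) * S (g ** ?u)"
        by (simp only: \<phi>_def zero_ext[OF gu])
    qed
    also have "\<dots> = (\<integral>g. f (g ** W) * S (g ** ?u) \<partial>?H)"
      by (rule funk_adjoint(2)[OF bij(1) mp f int Sm Sb W])
    also have "\<dots> = (\<integral>g. f (g ** ?v) * S (g ** T) \<partial>?H)"
    proof (rule haar_integral_pair(1)[OF u W T(1) v T'])
      show "(\<lambda>(x, y). f y * S x) \<in> borel_measurable borel"
        unfolding borel_prod[symmetric] by measurable
    qed
    finally show ?thesis .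
  qed

  \<comment> \<open>On {T B} the multiplier \<open>gram_det ^ l\<close> is
    \<open>gvol B ^ (2 * l)\<close>, and q - k = 2 l identifies it with the weight of polar
    coordinates on {x. v'x = 0}.\<close>
  have step3: "(\<integral>g. f (g ** ?v) * S (g ** T) \<partial>?H) =
      (- 1) ^ (CARD('m) * l) * ?Q * (\<integral>g. f (g ** ?v) * (\<integral>A. cnj (fourier \<psi> (g ** stack e' A 0)) \<partial>lborel) \<partial>?H)"
  proof -
    have fH: "integrable ?H (\<lambda>g. f (g ** ?v))" using int integral_stiefel(2)[OF v f] by simp
    have fr: "integrable (?Lk \<Otimes>\<^sub>M ?H) (\<lambda>(B, g). d B * (f (g ** ?v) * cnj (fourier \<psi> (g ** (T ** B)))))"
      "integral\<^sup>L (?Lk \<Otimes>\<^sub>M ?H) (\<lambda>(B, g). d B * (f (g ** ?v) * cnj (fourier \<psi> (g ** (T ** B))))) =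
        ?Q * (\<integral>g. f (g ** ?v) * (\<integral>A. cnj (fourier \<psi> (g ** stack e' A 0)) \<partial>lborel) \<partial>?H)"
      using frame_average[OF bij(2) le kq f fH r2 \<theta>] unfolding qk by (simp_all add: d_def T_def)
    have "(\<integral>g. f (g ** ?v) * S (g ** T) \<partial>?H) =
        (\<integral>g. (- 1) ^ (CARD('m) * l) * (\<integral>B. d B * (f (g ** ?v) * cnj (fourier \<psi> (g ** (T ** B)))) \<partial>?Lk) \<partial>?H)"
    proof (rule Bochner_Integration.integral_cong[OF refl])
      fix g assume "g \<in> space ?H"
      then have g: "g \<in> stiefel" by (simp add: space_haar)
      have gT: "g ** T \<in> stiefel" by (intro stiefel_mult g T)
      have F: "cnj (fourier \<Psi> ((g ** T) ** B)) = (- 1) ^ (CARD('m) * l) * (d B * cnj (fourier \<psi> (g ** (T ** B))))" for B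
        unfolding \<Psi>_def fourier_cl_op_power[OF \<psi>] d_def
        by (simp add: gram_det_mult_left[OF gT] power_mult gvol_power2 matrix_mul_assoc)
      show "f (g ** ?v) * S (g ** T) = (- 1) ^ (CARD('m) * l) * (\<integral>B. d B * (f (g ** ?v) * cnj (fourier \<psi> (g ** (T ** B)))) \<partial>?Lk)"
        unfolding S_def if_P[OF gT] F mult.left_commute[of "d _" "f (g ** ?v)"] integral_mult_right_zero
        by (rule mult.left_commute)
    qed
    also have "\<dots> = (- 1) ^ (CARD('m) * l) * (\<integral>g. \<integral>B. d B * (f (g ** ?v) * cnj (fourier \<psi> (g ** (T ** B)))) \<partial>?Lk \<partial>?H)"
      by (rule integral_mult_right_zero)
    also have "(\<integral>g. \<integral>B. d B * (f (g ** ?v) * cnj (fourier \<psi> (g ** (T ** B)))) \<partial>?Lk \<partial>?H) =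
        integral\<^sup>L (?Lk \<Otimes>\<^sub>M ?H) (\<lambda>(B, g). d B * (f (g ** ?v) * cnj (fourier \<psi> (g ** (T ** B)))))"
      by (rule LkH.integral_snd[OF fr(1)])
    finally show ?thesis unfolding fr(2) by (simp only: mult.assoc)
  qed

  \<comment> \<open>Inversion leads to {v y}. For a = n - m the weight exponent n - m - a is 0, so
    what remains is precisely the polar form of the pairing with \<open>E_ext\<close>.\<close>
  have step4: "(\<integral>g. f (g ** ?v) * (\<integral>A. cnj (fourier \<psi> (g ** stack e' A 0)) \<partial>lborel) \<partial>?H) =
      of_real ((2 * pi) ^ DIM(real^'m^'q)) * (?\<kappa> * (\<integral>x. E_ext (- of_nat (CARD('n) - CARD('m))) f x * cnj (\<psi> x) \<partial>lborel))"
  proof -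
    note E = E_ext_integral(2,3)[OF mn order_refl f int inv r3 v]
    have "(\<integral>g. f (g ** ?v) * (\<integral>A. cnj (fourier \<psi> (g ** stack e' A 0)) \<partial>lborel) \<partial>?H) =
        (\<integral>g. of_real ((2 * pi) ^ DIM(real^'m^'q)) * (\<integral>y. f (g ** ?v) * cnj (\<psi> (g ** (?v ** y))) \<partial>?Lm) \<partial>?H)"
    proof (rule Bochner_Integration.integral_cong[OF refl])
      fix g assume "g \<in> space ?H"
      then have g: "g \<in> stiefel" by (simp add: space_haar)
      have "(\<integral>A. cnj (fourier \<psi> (g ** stack e' A 0)) \<partial>lborel) = cnj (\<integral>A. fourier \<psi> (g ** stack e' A 0) \<partial>lborel)" by simp
      also have "\<dots> = of_real ((2 * pi) ^ DIM(real^'m^'q)) * (\<integral>y. cnj (\<psi> (g ** (?v ** y))) \<partial>?Lm)"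
        unfolding integral_stack_fourier'[OF bij(2) g \<psi>] frame0_mult[OF bij(2)] by simp
      finally show "f (g ** ?v) * (\<integral>A. cnj (fourier \<psi> (g ** stack e' A 0)) \<partial>lborel) =
          of_real ((2 * pi) ^ DIM(real^'m^'q)) * (\<integral>y. f (g ** ?v) * cnj (\<psi> (g ** (?v ** y))) \<partial>?Lm)"
        by (simp only: integral_mult_right_zero mult.left_commute)
    qed
    also have "\<dots> = of_real ((2 * pi) ^ DIM(real^'m^'q)) * (\<integral>g. \<integral>y. f (g ** ?v) * cnj (\<psi> (g ** (?v ** y))) \<partial>?Lm \<partial>?H)"
      by (rule integral_mult_right_zero)
    also have "(\<integral>g. \<integral>y. f (g ** ?v) * cnj (\<psi> (g ** (?v ** y))) \<partial>?Lm \<partial>?H) =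
        integral\<^sup>L (?Lm \<Otimes>\<^sub>M ?H) (\<lambda>(y, g). f (g ** ?v) * cnj (\<psi> (g ** (?v ** y))))"
      by (rule LmH.integral_snd) (use E(2) in simp)
    also have "\<dots> = ?\<kappa> * (\<integral>x. E_ext (- of_nat (CARD('n) - CARD('m))) f x * cnj (\<psi> x) \<partial>lborel)"
      using E(1) by simp
    finally show ?thesis .
  qed
  define X where "X = (\<integral>x. E_ext (- of_nat CARD('k)) D x * cnj (\<Psi> x) \<partial>lborel)"
  define Y where "Y = (\<integral>x. E_ext (- of_nat (CARD('n) - CARD('m))) f x * cnj (\<psi> x) \<partial>lborel)"
  let ?K = "of_real ((2 * pi) ^ DIM(real^'m^'k)) :: complex"
  have "polar_const TYPE('n) TYPE('m) TYPE('m) > 0" by (rule polar_const_pos) simp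
  then have K: "?K \<noteq> 0" and \<kappa>: "?\<kappa> \<noteq> 0" by simp_all
  \<comment> \<open>Because q = k + 2 l, the factors of the two inversions differ by a power of 2 pi
    with exponent 2 l m.\<close>
  have KQ: "of_real ((2 * pi) ^ DIM(real^'m^'q)) = ?K * of_real ((2 * pi) ^ (2 * l * CARD('m)))"
    by (simp add: q power_add distrib_right)
  have "?\<kappa> * X * ?K = ?P * ((- 1) ^ (CARD('m) * l) * ?Q * (?K * of_real ((2 * pi) ^ (2 * l * CARD('m))) * (?\<kappa> * Y)))"
    unfolding X_def step1 Y_def KQ[symmetric] step4[symmetric] step3[symmetric] step2[symmetric] by (simp only: ac_simps)
  then have "(?\<kappa> * ?K) * X = (?\<kappa> * ?K) * ((?P * ?Q * (- 1) ^ (CARD('m) * l) * of_real ((2 * pi) ^ (2 * l * CARD('m)))) * Y)"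
    by (simp only: ac_simps)
  then have X: "X = (?P * ?Q * (- 1) ^ (CARD('m) * l) * of_real ((2 * pi) ^ (2 * l * CARD('m)))) * Y"
    using K \<kappa> by (metis mult_cancel_left no_zero_divisors)
  have "of_real (funk_const CARD('n) CARD('m) CARD('k)) * (?P * ?Q * (- 1) ^ (CARD('m) * l) * of_real ((2 * pi) ^ (2 * l * CARD('m)))) = 1"
    using arg_cong[OF funk_const_eq[OF bij le n], of complex_of_real] by simp
  then have "Y = of_real (funk_const CARD('n) CARD('m) CARD('k)) * X"
    unfolding X mult.assoc[symmetric] by simp
  then show "(\<integral>x. E_ext (- of_nat (CARD('n) - CARD('m))) f x * cnj (\<psi> x) \<partial>lborel) =
      of_real (funk_const CARD('n) CARD('m) CARD('k)) *
        (\<integral>x. E_ext (- of_nat CARD('k)) D x * cnj ((cl_op ^^ l) \<psi> x) \<partial>lborel)"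
    unfolding X_def Y_def \<Psi>_def .
qed

lemma zero_ext_version:
  fixes f :: "real^'m^'n \<Rightarrow> complex"
  assumes le: "CARD('m) \<le> CARD('n)" and int: "integrable stiefel_measure f"
  shows "zero_ext f \<in> borel_measurable borel" and "integrable stiefel_measure (zero_ext f)"
    and "right_invariant f \<Longrightarrow> right_invariant (zero_ext f)"
proof -
  have "f \<in> borel_measurable stiefel_measure" using int by simp
  then show "zero_ext f \<in> borel_measurable borel"
    by (intro measurable_zero_ext) (simp add: measurable_cong_sets[OF sets_stiefel[OF le] refl])
  show "integrable stiefel_measure (zero_ext f)"
    using int by (rule Bochner_Integration.integrable_cong[OF refl, THEN iffD1, rotated]) (simp add: space_stiefel[OF le])
  show "right_invariant (zero_ext f)" if "right_invariant f"
    unfolding right_invariant_def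
  proof (intro allI impI)
    fix \<gamma> :: "real^'m^'m" assume \<gamma>: "orthogonal_matrix \<gamma>"
    then have "AE v in stiefel_measure. f (v ** \<gamma>) = f v" using that by (simp add: right_invariant_def)
    then show "AE v in stiefel_measure. zero_ext f (v ** \<gamma>) = zero_ext f v"
      using AE_space by eventually_elim
        (use \<gamma> in \<open>simp add: space_stiefel[OF le] stiefel_mult orthogonal_matrix_iff_stiefel\<close>)
  qed
qed

lemma funk_cong:
  fixes e :: "'p::finite + 'k::finite \<Rightarrow> 'n::finite" and f f' :: "real^'m^'n \<Rightarrow> complex"
  assumes bij: "bij e" and le: "CARD('m) \<le> CARD('p)" and u: "u \<in> stiefel"
    and eq: "\<And>v. v \<in> stiefel \<Longrightarrow> f v = f' v"
  shows "funk e f u = funk e f' u"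
  unfolding funk_def Let_def choose_rot_def[OF bij le, symmetric]
  by (intro Bochner_Integration.integral_cong refl eq stiefel_mult choose_rot(1)[OF bij le u] stack_stiefel(1)[OF bij])
     (simp add: space_stiefel[OF le])

lemma integrable_lebesgue_iff:
  fixes h :: "'a::euclidean_space \<Rightarrow> complex"
  shows "h \<in> borel_measurable borel \<Longrightarrow> integrable lebesgue h \<longleftrightarrow> integrable lborel h"
  by (rule integrable_completion) simp

lemma integral_lebesgue_eq:
  fixes h :: "'a::euclidean_space \<Rightarrow> complex"
  shows "h \<in> borel_measurable borel \<Longrightarrow> integral\<^sup>L lebesgue h = integral\<^sup>L lborel h"
  by (rule integral_completion) simp

lemma dist_of_eq:
  assumes "h \<in> borel_measurable borel" "\<psi> \<in> schwartz"
  shows "dist_of h \<psi> = (\<integral>x. h x * cnj (\<psi> x) \<partial>lborel)"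
proof -
  have [measurable]: "h \<in> borel_measurable borel" "\<psi> \<in> borel_measurable borel"
    using assms rapid_measurable[OF schwartz_rapid] by auto
  show ?thesis unfolding dist_of_def by (rule integral_lebesgue_eq) measurable
qed

lemma defines_temperedI:
  assumes h: "h \<in> borel_measurable borel" and "\<And>\<rho>. rapid \<rho> \<Longrightarrow> integrable lborel (\<lambda>x. h x * \<rho> x)"
  shows "defines_tempered h"
  unfolding defines_tempered_def
proof
  fix \<psi> :: "'a \<Rightarrow> complex" assume \<psi>: "\<psi> \<in> schwartz"
  have [measurable]: "h \<in> borel_measurable borel" "\<psi> \<in> borel_measurable borel"
    using h rapid_measurable[OF schwartz_rapid[OF \<psi>]] by auto
  show "integrable lebesgue (\<lambda>x. h x * cnj (\<psi> x))"
    by (subst integrable_lebesgue_iff) (measurable, intro assms(2) rapid_cnj schwartz_rapid \<psi>)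
qed

text \<open>Joins the pairing identity to the transposition of \<open>cayley_laplace\<close>. On
  frames the transforms depend only on the values of f on frames, so passing to zero extensions does
  not change G.\<close>

theorem funk_inversion:
  fixes f :: "real^'m^'n \<Rightarrow> complex"
    and e :: "'p::finite + 'k::finite \<Rightarrow> 'n" and e' :: "'q::finite + 'm \<Rightarrow> 'n"
  assumes bij: "bij e" "bij e'" and le: "CARD('m) \<le> CARD('k)"
    and n: "CARD('n) = CARD('k) + CARD('m) + 2 * l"
    and int: "integrable stiefel_measure f" and inv: "right_invariant f"
  defines "lhs \<equiv> E_ext (- of_nat (CARD('n) - CARD('m))) (zero_ext f)"
    and "G \<equiv> E_ext (- of_nat CARD('k)) (dual_funk e' (funk e f))"
  shows "lhs \<in> borel_measurable borel"
    and "rapid \<rho> \<Longrightarrow> integrable lborel (\<lambda>x. lhs x * \<rho> x)"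
    and "defines_tempered lhs" and "defines_tempered G"
    and "\<psi> \<in> schwartz \<Longrightarrow> dist_of lhs \<psi> =
      of_real (funk_const CARD('n) CARD('m) CARD('k)) * (cayley_laplace ^^ l) (dist_of G) \<psi>"
proof -
  have p: "CARD('m) \<le> CARD('p)" and q: "CARD('k) \<le> CARD('q)" and mn: "CARD('m) \<le> CARD('n)"
    using CARD_Plus[OF bij(1)] CARD_Plus[OF bij(2)] n by auto
  note z = zero_ext_version[OF mn int]
  define D where "D = zero_ext (funk e' (zero_ext (funk e (zero_ext f))))"
  have G: "G = E_ext (- of_nat CARD('k)) D"
    unfolding G_def D_def dual_funk_eq_funk
    by (intro E_ext_cong) (simp, intro funk_cong[OF bij(2) q], assumption, simp, intro funk_cong[OF bij(1) p], simp_all)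
  have Dm: "D \<in> borel_measurable borel"
    unfolding D_def by (intro measurable_zero_ext measurable_funk[OF bij(2) q] measurable_funk[OF bij(1) p] z)
  note main = funk_inversion_pairing[OF bij le n z(1,2) z(3)[OF inv], folded D_def, folded G]
  show lm: "lhs \<in> borel_measurable borel" unfolding lhs_def by (rule borel_measurable_E_ext[OF z(1)])
  have Gm: "G \<in> borel_measurable borel" unfolding G by (rule borel_measurable_E_ext[OF Dm])
  obtain v :: "real^'m^'n" where v: "v \<in> stiefel" using stiefel_nonempty[OF mn] by auto
  show li: "integrable lborel (\<lambda>x. lhs x * \<rho> x)" if "rapid \<rho>" for \<rho>
    unfolding lhs_def by (rule E_ext_integral(1)[OF mn order_refl z(1,2) z(3)[OF inv] that v])
  show "defines_tempered lhs" by (rule defines_temperedI[OF lm li])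
  show GT: "defines_tempered G" by (rule defines_temperedI[OF Gm]) (rule main(1)[OF schwartz_0])
  show "dist_of lhs \<psi> = of_real (funk_const CARD('n) CARD('m) CARD('k)) * (cayley_laplace ^^ l) (dist_of G) \<psi>"
    if \<psi>: "\<psi> \<in> schwartz"
    unfolding cayley_laplace_power[OF schwartz_linear_dist_of[OF GT] \<psi>] dist_of_eq[OF lm \<psi>]
      dist_of_eq[OF Gm schwartz_cl_op_power[OF \<psi>]]
    unfolding lhs_def by (rule main(2)[OF \<psi>])
qed

section \<open>Lebesgue points\<close>

lemma emeasure_ball_scale:
  fixes a b :: "'a::euclidean_space"
  assumes "0 \<le> r" "0 \<le> c"
  shows "emeasure lebesgue (ball a (c * r)) = ennreal (c ^ DIM('a)) * emeasure lebesgue (ball b r)"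
proof -
  have e: "emeasure lebesgue (ball x s) = ennreal (measure lborel (ball x s))" for x :: 'a and s
    using emeasure_lborel_ball_finite[of x s] by (simp add: emeasure_eq_ennreal_measure)
  have "0 \<le> c * r" using assms by simp
  then show ?thesis
    unfolding e content_ball_conv_unit_ball[OF \<open>0 \<le> c * r\<close>, of a] content_ball_conv_unit_ball[OF assms(1), of b]
    using assms by (simp add: power_mult_distrib ennreal_mult[symmetric] mult.assoc)
qed

lemma emeasure_UN_countable_le:
  assumes X[measurable]: "\<And>i. i \<in> I \<Longrightarrow> X i \<in> sets M" and I: "countable I"
  shows "emeasure M (\<Union>i\<in>I. X i) \<le> (\<integral>\<^sup>+i. emeasure M (X i) \<partial>count_space I)"
proof -
  have "(\<Union>i\<in>I. X i) \<in> sets M" using X I by (intro sets.countable_UN'') auto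
  then have "emeasure M (\<Union>i\<in>I. X i) = (\<integral>\<^sup>+x. indicator (\<Union>i\<in>I. X i) x \<partial>M)" by simp
  also have "\<dots> \<le> (\<integral>\<^sup>+x. \<integral>\<^sup>+i. indicator (X i) x \<partial>count_space I \<partial>M)"
  proof (rule nn_integral_mono)
    fix x
    show "indicator (\<Union>i\<in>I. X i) x \<le> (\<integral>\<^sup>+i. indicator (X i) x \<partial>count_space I)"
    proof (cases "x \<in> (\<Union>i\<in>I. X i)")
      case True
      then obtain j where j: "j \<in> I" "x \<in> X j" by blast
      have "indicator (X j) x \<le> (\<integral>\<^sup>+i. indicator (X i) x \<partial>count_space I)"
        by (rule nn_integral_ge_point[OF j(1)])
      with True j show ?thesis by simp
    qed simp
  qed
  also have "\<dots> = (\<integral>\<^sup>+i. \<integral>\<^sup>+x. indicator (X i) x \<partial>M \<partial>count_space I)"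
    by (rule nn_integral_count_space_nn_integral) (use I in simp_all)
  also have "\<dots> = (\<integral>\<^sup>+i. emeasure M (X i) \<partial>count_space I)"
    by (intro nn_integral_cong) simp
  finally show ?thesis .
qed

text \<open>By outer regularity the sets V j - A decrease to a null set, and since u has finite
  integral their mass with respect to the density u tends to 0.\<close>

lemma open_superset_small_integral:
  fixes u :: "'a::euclidean_space \<Rightarrow> ennreal"
  assumes u[measurable]: "u \<in> borel_measurable lebesgue" and fin: "(\<integral>\<^sup>+y. u y \<partial>lebesgue) < \<infinity>"
    and A[measurable]: "A \<in> sets lebesgue" and \<eta>: "\<eta> > 0"
  obtains V where "open V" "A \<subseteq> V" "(\<integral>\<^sup>+y. u y * indicator (V - A) y \<partial>lebesgue) < \<eta>"
proof -
  have "\<exists>T. open T \<and> A \<subseteq> T \<and> emeasure lebesgue (T - A) < ennreal (inverse (real (Suc j)))" for j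
    using sets_lebesgue_outer_open[OF A, of "inverse (real (Suc j))"] by (metis inverse_positive_iff_positive of_nat_0_less_iff zero_less_Suc)
  then obtain T where T: "\<And>j. open (T j)" "\<And>j. A \<subseteq> T j" "\<And>j. emeasure lebesgue (T j - A) < ennreal (inverse (real (Suc j)))"
    by metis
  define V where "V = (\<lambda>j. \<Inter>i\<le>j. T i)"
  have V: "open (V j)" "A \<subseteq> V j" for j using T unfolding V_def by (auto intro!: open_INT)
  have [measurable]: "V j \<in> sets lebesgue" for j using V(1) by (simp add: borel_open)
  define \<mu> where "\<mu> = density lebesgue u"
  have \<mu>: "emeasure \<mu> S = (\<integral>\<^sup>+y. u y * indicator S y \<partial>lebesgue)" if "S \<in> sets lebesgue" for S
    unfolding \<mu>_def using that by (simp add: emeasure_density)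
  have "(\<lambda>j. emeasure \<mu> (V j - A)) \<longlonglongrightarrow> emeasure \<mu> (\<Inter>j. V j - A)"
  proof (rule Lim_emeasure_decseq)
    show "range (\<lambda>j. V j - A) \<subseteq> sets \<mu>" by (auto simp: \<mu>_def)
    show "decseq (\<lambda>j. V j - A)" unfolding decseq_def V_def by auto
    show "emeasure \<mu> (V j - A) \<noteq> \<infinity>" for j
    proof -
      have "emeasure \<mu> (V j - A) \<le> (\<integral>\<^sup>+y. u y \<partial>lebesgue)"
        by (subst \<mu>) (auto intro!: nn_integral_mono simp: indicator_def)
      with fin show ?thesis by (auto simp: top_unique)
    qed
  qed
  moreover have "emeasure \<mu> (\<Inter>j. V j - A) = 0"
  proof -
    have m: "(\<Inter>j. V j - A) \<in> sets lebesgue" by measurable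
    have "emeasure lebesgue (\<Inter>j. V j - A) \<le> ennreal (inverse (real (Suc j)))" for j
    proof -
      have "emeasure lebesgue (\<Inter>j. V j - A) \<le> emeasure lebesgue (T j - A)"
        using T(1)[of j] by (intro emeasure_mono) (auto simp: V_def borel_open)
      with T(3)[of j] show ?thesis by simp
    qed
    then have "emeasure lebesgue (\<Inter>j. V j - A) \<le> ennreal 0"
      by (intro LIMSEQ_le_const[OF tendsto_ennrealI[OF LIMSEQ_inverse_real_of_nat]]) auto
    then have "(\<Inter>j. V j - A) \<in> null_sets lebesgue" using m by (simp add: null_sets_def)
    from AE_not_in[OF this] have "(\<Inter>j. V j - A) \<in> null_sets \<mu>"
      unfolding \<mu>_def null_sets_density_iff[OF u] using m by (auto elim: eventually_mono)
    then show ?thesis by (rule null_setsD1)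
  qed
  ultimately have "(\<lambda>j. emeasure \<mu> (V j - A)) \<longlonglongrightarrow> 0" by simp
  from order_tendstoD(2)[OF this \<eta>] obtain j where "emeasure \<mu> (V j - A) < \<eta>"
    by (auto simp: eventually_sequentially)
  then show ?thesis using that[OF V] by (simp add: \<mu>)
qed

text \<open>A disjoint subfamily of the balls on which the average of \<open>u\<close> exceeds \<open>t'\<close> carries too little mass
  of \<open>u\<close>, since it lies in an open set that hardly leaves \<open>{u \<le> t}\<close>.\<close>
lemma negligible_large_averages:
  fixes u :: "'a::euclidean_space \<Rightarrow> ennreal"
  assumes u[measurable]: "u \<in> borel_measurable lebesgue" and fin: "(\<integral>\<^sup>+y. u y \<partial>lebesgue) < \<infinity>"
    and t: "0 \<le> t" "t < t'"
  shows "negligible {x. u x \<le> ennreal t \<and>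
    (\<forall>\<delta>>0. \<exists>r>0. r < \<delta> \<and> ennreal t' * emeasure lebesgue (ball x r) < (\<integral>\<^sup>+y. u y * indicator (ball x r) y \<partial>lebesgue))}"
    (is "negligible ?E")
  unfolding negligible_outer_le
proof (intro allI impI)
  fix \<epsilon> :: real assume \<epsilon>: "\<epsilon> > 0"
  \<comment> \<open>The growth of volume when Vitali's covering lemma enlarges all radii by the
    factor 5.\<close>
  define N where "N = (5::real) ^ DIM('a)"
  have N: "N > 0" by (simp add: N_def)
  \<comment> \<open>The comparison of masses will give (t' - t) |B| <= \<eta>; this choice turns it
    into N |B| <= \<epsilon>.\<close>
  define \<eta> where "\<eta> = \<epsilon> * (t' - t) / N"
  have \<eta>: "\<eta> > 0" using \<epsilon> t N by (simp add: \<eta>_def)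
  define A where "A = {x. u x \<le> ennreal t}"
  have A[measurable]: "A \<in> sets lebesgue"
    using measurable_sets[OF u, of "{..ennreal t}"] by (simp add: A_def vimage_def)
  obtain V where V: "open V" "A \<subseteq> V" "(\<integral>\<^sup>+y. u y * indicator (V - A) y \<partial>lebesgue) < ennreal \<eta>"
    using open_superset_small_integral[OF u fin A, of "ennreal \<eta>"] \<eta> by auto
  define K where "K = {(x, r). x \<in> ?E \<and> 0 < r \<and> r \<le> 1 \<and> ball x r \<subseteq> V \<and>
    ennreal t' * emeasure lebesgue (ball x r) < (\<integral>\<^sup>+y. u y * indicator (ball x r) y \<partial>lebesgue)}"
  have "?E \<subseteq> (\<Union>i\<in>K. ball (fst i) (snd i))"
  proof
    fix x assume x: "x \<in> ?E"
    then have "x \<in> V" using V(2) by (auto simp: A_def)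
    then obtain \<delta> where \<delta>: "\<delta> > 0" "ball x \<delta> \<subseteq> V" using V(1) open_contains_ball by blast
    from x have "\<forall>\<delta>>0. \<exists>r>0. r < \<delta> \<and> ennreal t' * emeasure lebesgue (ball x r) < (\<integral>\<^sup>+y. u y * indicator (ball x r) y \<partial>lebesgue)"
      by simp
    from this[rule_format, of "min 1 \<delta>"] \<delta>(1)
    obtain r where r: "r > 0" "r < min 1 \<delta>" "ennreal t' * emeasure lebesgue (ball x r) < (\<integral>\<^sup>+y. u y * indicator (ball x r) y \<partial>lebesgue)"
      by auto
    have "ball x r \<subseteq> ball x \<delta>" using r(2) by (intro subset_ball) simp
    then have "(x, r) \<in> K" unfolding K_def using x r \<delta>(2) by simp
    then show "x \<in> (\<Union>i\<in>K. ball (fst i) (snd i))" using r(1) by force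
  qed
  moreover have "0 < snd i \<and> snd i \<le> 1" if "i \<in> K" for i using that by (auto simp: K_def)
  ultimately obtain C where C: "countable C" "C \<subseteq> K"
    "pairwise (\<lambda>i j. disjnt (ball (fst i) (snd i)) (ball (fst j) (snd j))) C"
    "?E \<subseteq> (\<Union>i\<in>C. ball (fst i) (5 * snd i))"
    by (rule Vitali_covering_lemma_balls)
  let ?b = "\<lambda>i :: 'a \<times> real. ball (fst i) (snd i)"
  define B where "B = (\<Union>i\<in>C. ?b i)"
  define T where "T = (\<Union>i\<in>C. ball (fst i) (5 * snd i))"
  have disj: "disjoint_family_on ?b C"
    using C(3) by (auto simp: disjoint_family_on_def pairwise_def disjnt_def)
  have "open B" "open T" by (auto simp: B_def T_def)
  then have B[measurable]: "B \<in> sets lebesgue" and T: "T \<in> sets lebesgue" by (simp_all add: borel_open)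
  have BV: "B \<subseteq> V"
  proof -
    have "?b i \<subseteq> V" if "i \<in> C" for i using that C(2) by (cases i) (auto simp: K_def)
    then show ?thesis unfolding B_def by blast
  qed
  define \<mu> where "\<mu> = density lebesgue u"
  have \<mu>: "emeasure \<mu> S = (\<integral>\<^sup>+y. u y * indicator S y \<partial>lebesgue)" if "S \<in> sets lebesgue" for S
    unfolding \<mu>_def using that by (simp add: emeasure_density)
  have eB: "emeasure lebesgue B = (\<integral>\<^sup>+i. emeasure lebesgue (?b i) \<partial>count_space C)"
    unfolding B_def by (rule emeasure_UN_countable) (auto simp: C disj)
  have "ennreal t' * emeasure lebesgue B = (\<integral>\<^sup>+i. ennreal t' * emeasure lebesgue (?b i) \<partial>count_space C)"
    unfolding eB by (simp add: nn_integral_cmult)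
  also have "\<dots> \<le> (\<integral>\<^sup>+i. emeasure \<mu> (?b i) \<partial>count_space C)"
    using C(2) by (intro nn_integral_mono) (auto simp: K_def \<mu> intro: less_imp_le)
  also have "\<dots> = emeasure \<mu> B"
    unfolding B_def by (rule emeasure_UN_countable[symmetric]) (auto simp: C disj \<mu>_def)
  finally have le: "ennreal t' * emeasure lebesgue B \<le> emeasure \<mu> B" .
  also have "emeasure \<mu> B = (\<integral>\<^sup>+y. u y * indicator (B \<inter> A) y + u y * indicator (B - A) y \<partial>lebesgue)"
    unfolding \<mu>[OF B] by (intro nn_integral_cong) (auto simp: indicator_def)
  also have "\<dots> = (\<integral>\<^sup>+y. u y * indicator (B \<inter> A) y \<partial>lebesgue) + (\<integral>\<^sup>+y. u y * indicator (B - A) y \<partial>lebesgue)"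
    by (rule nn_integral_add) measurable
  also have "\<dots> \<le> ennreal t * emeasure lebesgue B + ennreal \<eta>"
  proof (rule add_mono)
    have "(\<integral>\<^sup>+y. u y * indicator (B \<inter> A) y \<partial>lebesgue) \<le> (\<integral>\<^sup>+y. ennreal t * indicator B y \<partial>lebesgue)"
      by (intro nn_integral_mono) (auto simp: A_def indicator_def)
    also have "\<dots> = ennreal t * emeasure lebesgue B" by (rule nn_integral_cmult_indicator[OF B])
    finally show "(\<integral>\<^sup>+y. u y * indicator (B \<inter> A) y \<partial>lebesgue) \<le> ennreal t * emeasure lebesgue B" .
    have "(\<integral>\<^sup>+y. u y * indicator (B - A) y \<partial>lebesgue) \<le> (\<integral>\<^sup>+y. u y * indicator (V - A) y \<partial>lebesgue)"
      using BV by (intro nn_integral_mono) (auto simp: indicator_def)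
    with V(3) show "(\<integral>\<^sup>+y. u y * indicator (B - A) y \<partial>lebesgue) \<le> ennreal \<eta>" by simp
  qed
  finally have le2: "ennreal t' * emeasure lebesgue B \<le> ennreal t * emeasure lebesgue B + ennreal \<eta>" .
  \<comment> \<open>Finiteness allows t |B| to be subtracted on both sides.\<close>
  have finB: "emeasure lebesgue B < \<infinity>"
  proof -
    have "emeasure \<mu> B \<le> (\<integral>\<^sup>+y. u y \<partial>lebesgue)"
      unfolding \<mu>[OF B] by (intro nn_integral_mono) (auto simp: indicator_def)
    then have "ennreal t' * emeasure lebesgue B < \<infinity>" using le fin by (meson le_less_trans)
    then show ?thesis using t by (auto simp: ennreal_mult_less_top ennreal_mult_eq_top_iff less_top[symmetric])
  qed
  then obtain \<beta> where \<beta>: "\<beta> \<ge> 0" "emeasure lebesgue B = ennreal \<beta>" by (cases "emeasure lebesgue B") auto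
  have "t' * \<beta> \<le> t * \<beta> + \<eta>"
    using le2 t \<beta>(1) \<eta> unfolding \<beta>(2)
    by (simp add: ennreal_mult[symmetric] ennreal_plus[symmetric] del: ennreal_plus)
  then have "(t' - t) * (N * \<beta>) \<le> (t' - t) * \<epsilon>" using N by (simp add: \<eta>_def field_simps)
  then have \<beta>\<eta>: "N * \<beta> \<le> \<epsilon>" using t by simp
  have "emeasure lebesgue T \<le> (\<integral>\<^sup>+i. emeasure lebesgue (ball (fst i) (5 * snd i)) \<partial>count_space C)"
    unfolding T_def by (rule emeasure_UN_countable_le) (auto simp: C)
  also have "\<dots> = (\<integral>\<^sup>+i. ennreal N * emeasure lebesgue (?b i) \<partial>count_space C)"
    using C(2) unfolding N_def by (intro nn_integral_cong emeasure_ball_scale) (auto simp: K_def)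
  also have "\<dots> = ennreal N * emeasure lebesgue B" unfolding eB by (simp add: nn_integral_cmult)
  also have "\<dots> = ennreal (N * \<beta>)" using N \<beta>(1) by (simp add: \<beta>(2) ennreal_mult)
  also have "\<dots> \<le> ennreal \<epsilon>" using \<beta>\<eta> by (rule ennreal_leI)
  finally have eT: "emeasure lebesgue T \<le> ennreal \<epsilon>" .
  then have "T \<in> lmeasurable" using T by (intro fmeasurableI) (auto simp: le_less_trans)
  moreover have "measure lebesgue T \<le> \<epsilon>"
    using eT \<epsilon> by (simp add: measure_def enn2real_leI)
  ultimately show "\<exists>T. ?E \<subseteq> T \<and> T \<in> lmeasurable \<and> measure lebesgue T \<le> \<epsilon>"
    using C(4) unfolding T_def by blast
qed

text \<open>Phrased with the nonnegative integral, for which divergence means the value infinity. It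
  is therefore safer to transport than \<open>has_lebesgue_value\<close>, whose Bochner integral has
  the default value 0 for nonintegrable functions, and it implies the latter.\<close>

definition lebesgue_point :: "('a::euclidean_space \<Rightarrow> complex) \<Rightarrow> complex \<Rightarrow> 'a \<Rightarrow> bool" where
  "lebesgue_point w c x \<longleftrightarrow> (\<forall>\<eta>>0. \<exists>\<delta>>0. \<forall>r>0. r < \<delta> \<longrightarrow>
     (\<integral>\<^sup>+y. ennreal (norm (w y - c)) * indicator (ball x r) y \<partial>lebesgue) \<le> ennreal (\<eta> * measure lborel (ball x r)))"

lemma lebesgue_pointD:
  assumes "lebesgue_point w c x" "\<eta> > 0"
  shows "\<exists>\<delta>>0. \<forall>r. 0 < r \<longrightarrow> r < \<delta> \<longrightarrow>
     (\<integral>\<^sup>+y. ennreal (norm (w y - c)) * indicator (ball x r) y \<partial>lebesgue) \<le> ennreal (\<eta> * measure lborel (ball x r))"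
  using assms unfolding lebesgue_point_def by (elim allE impE)

lemma lebesgue_point_has_value:
  assumes "lebesgue_point w c x" shows "has_lebesgue_value w c x"
  unfolding has_lebesgue_value_def
proof (rule tendstoI)
  fix \<epsilon> :: real assume \<epsilon>: "\<epsilon> > 0"
  then have "\<epsilon> / 2 > 0" by simp
  obtain \<delta> where \<delta>: "\<delta> > 0" "\<forall>r. 0 < r \<longrightarrow> r < \<delta> \<longrightarrow>
     (\<integral>\<^sup>+y. ennreal (norm (w y - c)) * indicator (ball x r) y \<partial>lebesgue) \<le> ennreal (\<epsilon> / 2 * measure lborel (ball x r))"
    using lebesgue_pointD[OF assms \<open>\<epsilon> / 2 > 0\<close>] by (elim exE conjE) (rule that)
  have "dist ((LINT y:ball x r|lebesgue. norm (w y - c)) / measure lebesgue (ball x r)) 0 < \<epsilon>" if r: "0 < r" "r < \<delta>" for r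
  proof -
    define I where "I = (LINT y:ball x r|lebesgue. norm (w y - c))"
    have m: "measure lborel (ball x r) > 0" using content_ball_pos[OF r(1)] .
    have "0 \<le> I" unfolding I_def set_lebesgue_integral_def by (intro Bochner_Integration.integral_nonneg) simp
    moreover have "I \<le> \<epsilon> / 2 * measure lborel (ball x r)"
      unfolding I_def set_lebesgue_integral_def
    proof (rule integral_real_bounded)
      show "0 \<le> \<epsilon> / 2 * measure lborel (ball x r)" using \<epsilon> by simp
      have "(\<integral>\<^sup>+y. ennreal (indicat_real (ball x r) y *\<^sub>R norm (w y - c)) \<partial>lebesgue) =
          (\<integral>\<^sup>+y. ennreal (norm (w y - c)) * indicator (ball x r) y \<partial>lebesgue)"
        by (intro nn_integral_cong) (simp add: indicator_def)
      also have "\<dots> \<le> ennreal (\<epsilon> / 2 * measure lborel (ball x r))" by (rule \<delta>(2)[rule_format, OF r])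
      finally show "(\<integral>\<^sup>+y. ennreal (indicat_real (ball x r) y *\<^sub>R norm (w y - c)) \<partial>lebesgue) \<le> ennreal (\<epsilon> / 2 * measure lborel (ball x r))" .
    qed
    moreover have "\<epsilon> / 2 * measure lborel (ball x r) < \<epsilon> * measure lborel (ball x r)" using \<epsilon> m by simp
    ultimately have "0 \<le> I / measure lborel (ball x r)" "I / measure lborel (ball x r) < \<epsilon>"
      using m by (auto simp: pos_divide_less_eq)
    then show ?thesis unfolding I_def by simp
  qed
  then show "\<forall>\<^sub>F r in at_right 0. dist ((LINT y:ball x r|lebesgue. norm (w y - c)) / measure lebesgue (ball x r)) 0 < \<epsilon>"
    unfolding eventually_at_right_field using \<delta>(1) by auto
qed

text \<open>The bound on large averages is applied to |w - d| on an exhaustion by compact sets, for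
  d in a countable dense set and thresholds t k and 2 t k. Outside one null set, w x can then be
  approximated by any such d.\<close>

theorem AE_lebesgue_point:
  fixes w :: "'a::euclidean_space \<Rightarrow> complex"
  assumes w: "locally_integrable_on w U" and U: "open U"
  shows "AE x in lebesgue. x \<in> U \<longrightarrow> lebesgue_point w (w x) x"
proof -
  obtain C where C: "\<And>n. compact (C n)" "\<And>n. C n \<subseteq> U" "\<And>n. C n \<subseteq> interior (C (Suc n))" "\<Union>(range C) = U"
    using open_Union_compact_subsets[OF U] by metis
  obtain D :: "complex set" where D: "countable D" "\<And>X. open X \<Longrightarrow> X \<noteq> {} \<Longrightarrow> \<exists>d\<in>D. d \<in> X"
    using countable_dense_exists by blast
  define v where "v = (\<lambda>n d y. indicator (C n) y *\<^sub>R w y - indicator (C n) y *\<^sub>R (d::complex))"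
  define u where "u = (\<lambda>n d y. ennreal (norm (v n d y)))"
  have v: "integrable lebesgue (v n d)" for n d
  proof -
    have "integrable lebesgue (\<lambda>y. indicator (C n) y *\<^sub>R w y)"
      using w C(1,2) by (simp add: locally_integrable_on_def set_integrable_def)
    moreover have "integrable lebesgue (\<lambda>y. indicator (C n) y *\<^sub>R d)"
      using lmeasurable_compact[OF C(1), of n]
      by (intro integrable_scaleR_left integrable_real_indicator) (auto simp only: fmeasurable_def mem_Collect_eq infinity_ennreal_def)
    ultimately show ?thesis unfolding v_def by (rule Bochner_Integration.integrable_diff)
  qed
  have um[measurable]: "u n d \<in> borel_measurable lebesgue" for n d using v[of n d] unfolding u_def by simp
  have fin: "(\<integral>\<^sup>+y. u n d y \<partial>lebesgue) < \<infinity>" for n d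
    using v[of n d] unfolding u_def by (simp add: integrable_iff_bounded)
  define t where "t = (\<lambda>k. inverse (real (Suc k)))"
  have t: "t k > 0" for k by (simp add: t_def)
  define Bad where "Bad = (\<lambda>n d k. {x. u n d x \<le> ennreal (t k) \<and> (\<forall>\<delta>>0. \<exists>r>0. r < \<delta> \<and>
     ennreal (2 * t k) * emeasure lebesgue (ball x r) < (\<integral>\<^sup>+y. u n d y * indicator (ball x r) y \<partial>lebesgue))})"
  have "negligible (Bad n d k)" for n d k
    unfolding Bad_def by (rule negligible_large_averages[OF um fin]) (use t[of k] in auto)
  then have "AE x in lebesgue. x \<notin> Bad n d k" for n d k
    unfolding negligible_iff_null_sets by (rule AE_not_in)
  then have "AE x in lebesgue. \<forall>n. \<forall>d\<in>D. \<forall>k. x \<notin> Bad n d k"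
    by (simp add: AE_all_countable AE_ball_countable[OF D(1)])
  then show ?thesis
  proof eventually_elim
    case (elim x)
    show ?case unfolding lebesgue_point_def
    proof (intro impI allI)
      fix \<eta> :: real assume x: "x \<in> U" and \<eta>: "\<eta> > 0"
      obtain n where "x \<in> C n" using x C(4) by blast
      then have xi: "x \<in> interior (C (Suc n))" using C(3) by blast
      then obtain \<delta>1 where \<delta>1: "\<delta>1 > 0" "ball x \<delta>1 \<subseteq> C (Suc n)" using mem_interior by blast
      \<comment> \<open>The averages of |w - d| contribute 2 t k, and the distance from d to w x
        contributes another t k.\<close>
      obtain k where k: "t k < \<eta> / 3" using reals_Archimedean[of "\<eta> / 3"] \<eta> unfolding t_def by auto
      obtain d where d: "d \<in> D" "d \<in> ball (w x) (t k)" using D(2)[of "ball (w x) (t k)"] t[of k] by auto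
      have dx: "norm (w x - d) < t k" using d(2) by (simp add: dist_norm)
      have "u (Suc n) d x \<le> ennreal (t k)"
        using dx xi interior_subset[of "C (Suc n)"] by (auto simp: u_def v_def intro!: ennreal_leI)
      then have "\<not> (\<forall>\<delta>>0. \<exists>r>0. r < \<delta> \<and>
          ennreal (2 * t k) * emeasure lebesgue (ball x r) < (\<integral>\<^sup>+y. u (Suc n) d y * indicator (ball x r) y \<partial>lebesgue))"
        using elim[rule_format, OF d(1), of "Suc n" k] unfolding Bad_def by blast
      then obtain \<delta>2 where \<delta>2: "\<delta>2 > 0" "\<And>r. 0 < r \<Longrightarrow> r < \<delta>2 \<Longrightarrow>
          \<not> ennreal (2 * t k) * emeasure lebesgue (ball x r) < (\<integral>\<^sup>+y. u (Suc n) d y * indicator (ball x r) y \<partial>lebesgue)"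
        by blast
      have "(\<integral>\<^sup>+y. ennreal (norm (w y - w x)) * indicator (ball x r) y \<partial>lebesgue) \<le> ennreal (\<eta> * measure lborel (ball x r))"
        if r: "0 < r" "r < min \<delta>1 \<delta>2" for r
      proof -
        have "ball x r \<subseteq> C (Suc n)" using \<delta>1(2) subset_ball[of r \<delta>1 x] r by auto
        then have le: "ennreal (norm (w y - w x)) * indicator (ball x r) y \<le> u (Suc n) d y * indicator (ball x r) y + ennreal (t k) * indicator (ball x r) y" for y
        proof (cases "y \<in> ball x r")
          case True
          have "norm (w y - w x) \<le> norm (w y - d) + norm (w x - d)" using norm_triangle_ineq4[of "w y - d" "w x - d"] by simp
          then have "norm (w y - w x) \<le> norm (w y - d) + t k" using dx by linarith
          then have "ennreal (norm (w y - w x)) \<le> ennreal (norm (w y - d)) + ennreal (t k)"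
            using t[of k] by (simp add: ennreal_plus[symmetric] ennreal_leI del: ennreal_plus)
          moreover have "v (Suc n) d y = w y - d" using True \<open>ball x r \<subseteq> C (Suc n)\<close> by (auto simp: v_def)
          ultimately show ?thesis using True by (simp add: u_def)
        qed simp
        have b[measurable]: "ball x r \<in> sets lebesgue" by simp
        have m: "(\<lambda>y. u (Suc n) d y * indicator (ball x r) y) \<in> borel_measurable lebesgue"
          "(\<lambda>y. ennreal (t k) * indicator (ball x r) y) \<in> borel_measurable lebesgue" by measurable
        have "(\<integral>\<^sup>+y. ennreal (norm (w y - w x)) * indicator (ball x r) y \<partial>lebesgue) \<le>
            (\<integral>\<^sup>+y. u (Suc n) d y * indicator (ball x r) y + ennreal (t k) * indicator (ball x r) y \<partial>lebesgue)"
          by (intro nn_integral_mono le)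
        also have "\<dots> = (\<integral>\<^sup>+y. u (Suc n) d y * indicator (ball x r) y \<partial>lebesgue) + ennreal (t k) * emeasure lebesgue (ball x r)"
          unfolding nn_integral_add[OF m] nn_integral_cmult_indicator[OF b] ..
        also have "\<dots> \<le> ennreal (2 * t k) * emeasure lebesgue (ball x r) + ennreal (t k) * emeasure lebesgue (ball x r)"
          using \<delta>2(2)[OF r(1)] r(2) by (intro add_right_mono) (simp add: not_less)
        also have "\<dots> = ennreal (3 * t k * measure lborel (ball x r))"
          using t[of k] emeasure_lborel_ball_finite[of x r]
          by (simp add: emeasure_eq_ennreal_measure ennreal_mult[symmetric] ennreal_plus[symmetric] del: ennreal_plus)
        also have "\<dots> \<le> ennreal (\<eta> * measure lborel (ball x r))"
          using k by (intro ennreal_leI mult_right_mono) auto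
        finally show ?thesis .
      qed
      then show "\<exists>\<delta>>0. \<forall>r>0. r < \<delta> \<longrightarrow> (\<integral>\<^sup>+y. ennreal (norm (w y - w x)) * indicator (ball x r) y \<partial>lebesgue) \<le> ennreal (\<eta> * measure lborel (ball x r))"
        using \<delta>1(1) \<delta>2(1) by (intro exI[of _ "min \<delta>1 \<delta>2"]) auto
    qed
  qed
qed

section \<open>Bump functions\<close>

text \<open>The standard bump function times the polynomial and rational factors that appear when it
  is differentiated; sums of such terms are closed under differentiation.\<close>

definition bump_term :: "real poly \<Rightarrow> nat \<Rightarrow> real \<Rightarrow> real" where
  "bump_term p j t = (if \<bar>t\<bar> < 1 then poly p t * (1 / (1 - t\<^sup>2)) ^ j * exp (- (1 / (1 - t\<^sup>2))) else 0)"

text \<open>With d = 1 - t^2 the exponential beats all powers of 1 / d, so the term is bounded by a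
  multiple of d^2, and d is at most 2 |t - a|. Vanishing to second order gives the derivative 0 at
  every a outside the open interval, its end points included.\<close>

lemma bump_term_bound: "\<exists>K\<ge>0. \<forall>t a. 1 \<le> \<bar>a\<bar> \<longrightarrow> \<bar>bump_term p j t\<bar> \<le> K * (t - a)\<^sup>2"
proof -
  have "bounded (poly p ` {-1..1})" by (intro compact_imp_bounded compact_continuous_image continuous_intros) simp
  then obtain P where "\<forall>x\<in>{-1..1}. \<bar>poly p x\<bar> \<le> P" unfolding bounded_iff by auto
  then have P: "\<bar>poly p t\<bar> \<le> P" if "-1 \<le> t" "t \<le> 1" for t using that by simp
  have P0: "0 \<le> P" using P[of 0] by simp
  define K where "K = P * (fact (j + 2) * 4)"
  have "\<bar>bump_term p j t\<bar> \<le> K * (t - a)\<^sup>2" if a: "1 \<le> \<bar>a\<bar>" for t a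
  proof (cases "\<bar>t\<bar> < 1")
    case True
    define d where "d = 1 - t\<^sup>2"
    have d: "d = (1 - \<bar>t\<bar>) * (1 + \<bar>t\<bar>)" by (simp add: d_def algebra_simps power2_eq_square)
    then have d0: "0 < d" using True by simp
    have "(1 - \<bar>t\<bar>) * (1 + \<bar>t\<bar>) \<le> \<bar>t - a\<bar> * 2" using True a by (intro mult_mono) auto
    then have "d\<^sup>2 \<le> (\<bar>t - a\<bar> * 2)\<^sup>2" unfolding d[symmetric] using d0 by (intro power_mono) auto
    then have d2: "d\<^sup>2 \<le> 4 * (t - a)\<^sup>2" by (simp add: power_mult_distrib)
    have "(1 / d) ^ (j + 2) \<le> fact (j + 2) * exp (1 / d)" using d0 by (intro power_le_fact_mult_exp) simp
    then have "(1 / d) ^ (j + 2) * (exp (- (1 / d)) * d\<^sup>2) \<le> fact (j + 2) * exp (1 / d) * (exp (- (1 / d)) * d\<^sup>2)"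
      by (intro mult_right_mono) auto
    moreover have "(1 / d) ^ (j + 2) * (exp (- (1 / d)) * d\<^sup>2) = (1 / d) ^ j * exp (- (1 / d))"
      using d0 by (simp add: power_add power2_eq_square)
    moreover have "fact (j + 2) * exp (1 / d) * (exp (- (1 / d)) * d\<^sup>2) = fact (j + 2) * d\<^sup>2"
      by (simp add: exp_minus)
    ultimately have "(1 / d) ^ j * exp (- (1 / d)) \<le> fact (j + 2) * d\<^sup>2" by linarith
    also have "\<dots> \<le> fact (j + 2) * (4 * (t - a)\<^sup>2)" using d2 by (intro mult_left_mono) auto
    finally have X: "(1 / d) ^ j * exp (- (1 / d)) \<le> fact (j + 2) * (4 * (t - a)\<^sup>2)" .
    have "\<bar>poly p t\<bar> * ((1 / d) ^ j * exp (- (1 / d))) \<le> P * (fact (j + 2) * (4 * (t - a)\<^sup>2))"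
      by (rule mult_mono[OF P X]) (use True d0 P0 in auto)
    moreover have "\<bar>bump_term p j t\<bar> = \<bar>poly p t\<bar> * ((1 / d) ^ j * exp (- (1 / d)))"
      using True d0 by (simp add: bump_term_def d_def[symmetric] abs_mult)
    ultimately show ?thesis by (simp only: K_def mult.assoc)
  qed (simp add: bump_term_def K_def P0)
  moreover have "0 \<le> K" using P0 by (simp add: K_def)
  ultimately show ?thesis by blast
qed

lemma has_real_derivative_0_of_quadratic:
  fixes F :: "real \<Rightarrow> real"
  assumes F: "\<And>t. \<bar>F t\<bar> \<le> K * (t - a)\<^sup>2"
  shows "(F has_real_derivative 0) (at a)"
proof -
  have Fa: "F a = 0" using F[of a] by simp
  have "((\<lambda>t. (F t - F a) / (t - a)) \<longlongrightarrow> 0) (at a)"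
  proof (rule Lim_null_comparison)
    show "\<forall>\<^sub>F t in at a. norm ((F t - F a) / (t - a)) \<le> K * \<bar>t - a\<bar>"
    proof (rule eventually_at_topological[THEN iffD2], intro exI[of _ UNIV] conjI ballI impI)
      fix t assume "t \<noteq> a"
      then show "norm ((F t - F a) / (t - a)) \<le> K * \<bar>t - a\<bar>"
        using F[of t] Fa by (simp add: pos_divide_le_eq power2_eq_square abs_mult_self_eq mult.assoc)
    qed auto
    show "((\<lambda>t. K * \<bar>t - a\<bar>) \<longlongrightarrow> 0) (at a)" by (auto intro!: tendsto_eq_intros)
  qed
  then show ?thesis by (simp add: has_field_derivative_iff)
qed

text \<open>Inside the interval this is the product rule, with s' = 2 t s^2 for s = 1 / (1 - t^2);
  elsewhere the quadratic bound gives derivative 0, and all three terms on the right vanish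
  there.\<close>

lemma bump_term_derivative:
  "(bump_term p j has_real_derivative
    (bump_term (pderiv p) j t + bump_term (p * [:0, 2 * real j:]) (j + 1) t + bump_term (- p * [:0, 2:]) (j + 2) t)) (at t)"
proof (cases "\<bar>t\<bar> < 1")
  case True
  define s where "s = (\<lambda>t::real. 1 / (1 - t\<^sup>2))"
  have "t\<^sup>2 < 1" using True by (simp add: abs_square_less_1)
  then have ds: "(s has_real_derivative 2 * t * (s t)\<^sup>2) (at t)"
    unfolding s_def by (auto intro!: derivative_eq_intros simp: power2_eq_square)
  have bt: "bump_term q i t = poly q t * s t ^ i * exp (- s t)" for q i
    using True by (simp add: bump_term_def s_def)
  have "((\<lambda>t. poly p t * s t ^ j * exp (- s t)) has_real_derivative
      (poly (pderiv p) t * s t ^ j + poly p t * (real j * (2 * t * (s t)\<^sup>2) * s t ^ (j - Suc 0))) * exp (- s t)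
      + poly p t * s t ^ j * (exp (- s t) * - (2 * t * (s t)\<^sup>2))) (at t)"
    by (rule derivative_eq_intros poly_DERIV ds refl | simp add: algebra_simps)+
  moreover have "(poly (pderiv p) t * s t ^ j + poly p t * (real j * (2 * t * (s t)\<^sup>2) * s t ^ (j - Suc 0))) * exp (- s t)
      + poly p t * s t ^ j * (exp (- s t) * - (2 * t * (s t)\<^sup>2)) =
      bump_term (pderiv p) j t + bump_term (p * [:0, 2 * real j:]) (j + 1) t + bump_term (- p * [:0, 2:]) (j + 2) t"
    unfolding bt by (cases j) (simp_all add: algebra_simps power2_eq_square)
  ultimately have "((\<lambda>t. poly p t * s t ^ j * exp (- s t)) has_real_derivative
      bump_term (pderiv p) j t + bump_term (p * [:0, 2 * real j:]) (j + 1) t + bump_term (- p * [:0, 2:]) (j + 2) t) (at t)"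
    by simp
  then show ?thesis
    by (rule has_field_derivative_transform_within_open[where S="{-1<..<1}"])
       (use True in \<open>auto simp: bump_term_def s_def\<close>)
next
  case False
  obtain K where "\<And>t a. 1 \<le> \<bar>a\<bar> \<Longrightarrow> \<bar>bump_term p j t\<bar> \<le> K * (t - a)\<^sup>2" using bump_term_bound by blast
  then have "(bump_term p j has_real_derivative 0) (at t)"
    using False by (intro has_real_derivative_0_of_quadratic[of _ K]) auto
  moreover have "bump_term q i t = 0" for q i using False by (simp add: bump_term_def)
  ultimately show ?thesis by simp
qed

text \<open>Smoothness of one real variable as the existence of an entire chain of successive
  derivatives, which is easy to exhibit for bump functions and to transport along affine
  maps.\<close>

definition smooth1 :: "(real \<Rightarrow> real) set" where
  "smooth1 = {G. \<exists>F. F 0 = G \<and> (\<forall>n t. (F n has_real_derivative F (Suc n) t) (at t))}"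

lemma smooth1_derivative: "G \<in> smooth1 \<Longrightarrow> \<exists>G'\<in>smooth1. \<forall>t. (G has_real_derivative G' t) (at t)"
proof -
  assume "G \<in> smooth1"
  then obtain F where F: "F 0 = G" "\<And>n t. (F n has_real_derivative F (Suc n) t) (at t)"
    unfolding smooth1_def by blast
  then have "F (Suc 0) \<in> smooth1"
    unfolding smooth1_def by (intro CollectI exI[of _ "\<lambda>n. F (Suc n)"]) simp
  then show ?thesis using F(2)[of 0] F(1) by blast
qed

lemma smooth1_affine:
  assumes "G \<in> smooth1" shows "(\<lambda>t. G (a * t + b)) \<in> smooth1"
proof -
  obtain F where F: "F 0 = G" "\<And>n t. (F n has_real_derivative F (Suc n) t) (at t)"
    using assms unfolding smooth1_def by blast
  have "((\<lambda>t. a ^ n * F n (a * t + b)) has_real_derivative a ^ Suc n * F (Suc n) (a * t + b)) (at t)" for n t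
    by (rule derivative_eq_intros DERIV_chain'[OF _ F(2)] refl | simp)+
  then show ?thesis
    unfolding smooth1_def using F(1) by (intro CollectI exI[of _ "\<lambda>n t. a ^ n * F n (a * t + b)"]) auto
qed

text \<open>The closure of bump terms under addition, within which differentiation can be
  iterated.\<close>

inductive bump_sum :: "(real \<Rightarrow> real) \<Rightarrow> bool" where
  "bump_sum (bump_term p j)"
| "bump_sum F \<Longrightarrow> bump_sum G \<Longrightarrow> bump_sum (\<lambda>t. F t + G t)"

lemma bump_sum_derivative: "bump_sum F \<Longrightarrow> \<exists>F'. bump_sum F' \<and> (\<forall>t. (F has_real_derivative F' t) (at t))"
proof (induction rule: bump_sum.induct)
  case (1 p j)
  let ?F = "\<lambda>t. bump_term (pderiv p) j t + bump_term (p * [:0, 2 * real j:]) (j + 1) t + bump_term (- p * [:0, 2:]) (j + 2) t"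
  have "bump_sum ?F" by (intro bump_sum.intros)
  with bump_term_derivative[of p j] show ?case by blast
next
  case (2 F G)
  then obtain F' G' where "bump_sum F'" "bump_sum G'"
    "\<forall>t. (F has_real_derivative F' t) (at t)" "\<forall>t. (G has_real_derivative G' t) (at t)" by blast
  then show ?case by (intro exI[of _ "\<lambda>t. F' t + G' t"]) (auto intro: bump_sum.intros derivative_intros)
qed

lemma bump_sum_smooth1:
  assumes "bump_sum G" shows "G \<in> smooth1"
proof -
  obtain d where d: "\<And>F. bump_sum F \<Longrightarrow> bump_sum (d F)" "\<And>F t. bump_sum F \<Longrightarrow> (F has_real_derivative d F t) (at t)"
    using bump_sum_derivative by metis
  have "bump_sum ((d ^^ n) G)" for n by (induction n) (simp_all add: assms d)
  then show ?thesis unfolding smooth1_def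
    by (intro CollectI exI[of _ "\<lambda>n. (d ^^ n) G"]) (simp add: d)
qed

text \<open>A partial derivative of a product of functions of single coordinates replaces just one
  factor by its derivative. The class is thus closed under all iterated derivatives, without mixed
  terms.\<close>

definition prod_fun :: "('a::euclidean_space \<Rightarrow> real \<Rightarrow> real) \<Rightarrow> 'a \<Rightarrow> complex" where
  "prod_fun G y = complex_of_real (\<Prod>b\<in>Basis. G b (y \<bullet> b))"

lemma prod_fun_derivative:
  fixes G :: "'a::euclidean_space \<Rightarrow> real \<Rightarrow> real"
  assumes G: "\<And>b. b \<in> Basis \<Longrightarrow> G b \<in> smooth1"
  shows "prod_fun G differentiable (at y)"
    and "c \<in> Basis \<Longrightarrow> \<exists>G'. (\<forall>b\<in>Basis. G' b \<in> smooth1) \<and> (\<lambda>y. frechet_derivative (prod_fun G) (at y) c) = prod_fun G'"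
proof -
  obtain D where D: "\<And>b. b \<in> Basis \<Longrightarrow> D b \<in> smooth1" "\<And>b t. b \<in> Basis \<Longrightarrow> (G b has_real_derivative D b t) (at t)"
    using smooth1_derivative[OF G] by metis
  have 1: "((\<lambda>y. G b (y \<bullet> b)) has_derivative (\<lambda>v. D b (y \<bullet> b) * (v \<bullet> b))) (at y)" if "b \<in> Basis" for b y
  proof -
    have "((\<lambda>y :: 'a. y \<bullet> b) has_derivative (\<lambda>v. v \<bullet> b)) (at y)" by (intro derivative_eq_intros refl) auto
    from has_derivative_compose[OF this D(2)[OF that, unfolded has_field_derivative_def]] show ?thesis by simp
  qed
  define L where "L = (\<lambda>y v. \<Sum>b\<in>Basis. D b (y \<bullet> b) * (v \<bullet> b) * (\<Prod>j\<in>Basis - {b}. G j (y \<bullet> j)))"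
  have d: "(prod_fun G has_derivative (\<lambda>v. complex_of_real (L y v))) (at y)" for y
    unfolding prod_fun_def L_def by (intro has_derivative_of_real has_derivative_prod 1)
  show "prod_fun G differentiable (at y)" using d unfolding differentiable_def by blast
  assume c: "c \<in> Basis"
  have "L y c = (\<Prod>b\<in>Basis. (G(c := D c)) b (y \<bullet> b))" for y
  proof -
    have "L y c = (\<Sum>b\<in>Basis. if b = c then D c (y \<bullet> c) * (\<Prod>j\<in>Basis - {c}. G j (y \<bullet> j)) else 0)"
      unfolding L_def by (intro sum.cong) (auto simp: inner_Basis c)
    also have "\<dots> = D c (y \<bullet> c) * (\<Prod>j\<in>Basis - {c}. G j (y \<bullet> j))" using c by simp
    also have "\<dots> = (\<Prod>b\<in>Basis. (G(c := D c)) b (y \<bullet> b))"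
      by (subst prod.remove[OF finite_Basis c]) (auto intro!: prod.cong)
    finally show ?thesis .
  qed
  then have "(\<lambda>y. frechet_derivative (prod_fun G) (at y) c) = prod_fun (G(c := D c))"
    by (intro ext) (simp only: frechet_derivative_at[OF d, symmetric] prod_fun_def)
  then show "\<exists>G'. (\<forall>b\<in>Basis. G' b \<in> smooth1) \<and> (\<lambda>y. frechet_derivative (prod_fun G) (at y) c) = prod_fun G'"
    using G D(1) c by (intro exI[of _ "G(c := D c)"]) auto
qed

lemma smooth_prod_fun:
  fixes G :: "'a::euclidean_space \<Rightarrow> real \<Rightarrow> real"
  assumes G: "\<And>b. b \<in> Basis \<Longrightarrow> G b \<in> smooth1"
  shows "smooth (prod_fun G)"
proof -
  have "\<exists>G'. (\<forall>b\<in>Basis. G' b \<in> smooth1) \<and> iter_deriv bs (prod_fun G) = prod_fun G'" if "set bs \<subseteq> Basis" for bs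
    using that
  proof (induction bs)
    case Nil
    then show ?case using G by auto
  next
    case (Cons c bs)
    then obtain G' where "\<And>b. b \<in> Basis \<Longrightarrow> G' b \<in> smooth1" "iter_deriv bs (prod_fun G) = prod_fun G'" by auto
    with prod_fun_derivative(2)[of G' c] Cons.prems show ?case by auto
  qed
  then show ?thesis unfolding smooth_def using prod_fun_derivative(1) by metis
qed

text \<open>All derivatives vanish on the open complement of K, and on K they are continuous, hence
  bounded with every polynomial weight.\<close>

lemma schwartz_compact_support:
  fixes \<psi> :: "'a::euclidean_space \<Rightarrow> complex"
  assumes \<psi>: "smooth \<psi>" and K: "compact K" and 0: "\<And>x. x \<notin> K \<Longrightarrow> \<psi> x = 0"
  shows "\<psi> \<in> schwartz"
proof -
  have op: "open (- K)" using compact_imp_closed[OF K] by (simp add: open_Compl)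
  have z: "iter_deriv bs \<psi> x = 0" if "x \<notin> K" for bs x
    using that
  proof (induction bs arbitrary: x)
    case (Cons b bs)
    have "(iter_deriv bs \<psi> has_derivative (\<lambda>_. 0)) (at x)"
      by (rule has_derivative_transform_within_open[OF has_derivative_const[of 0] op])
         (use Cons in auto)
    then have "(\<lambda>_. 0) = frechet_derivative (iter_deriv bs \<psi>) (at x)" by (rule frechet_derivative_at)
    then show ?case by (metis iter_deriv.simps(2))
  qed (simp add: 0)
  have "bounded (range (\<lambda>x. (1 + norm x) ^ N *\<^sub>R iter_deriv bs \<psi> x))" if bs: "set bs \<subseteq> Basis" for bs N
  proof -
    have "continuous_on K (iter_deriv bs \<psi>)"
      using \<psi> bs unfolding smooth_def
      by (intro continuous_at_imp_continuous_on ballI differentiable_imp_continuous_within) blast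
    then have "compact ((\<lambda>x. (1 + norm x) ^ N *\<^sub>R iter_deriv bs \<psi> x) ` K)"
      by (intro compact_continuous_image continuous_intros K)
    then have "bounded (insert 0 ((\<lambda>x. (1 + norm x) ^ N *\<^sub>R iter_deriv bs \<psi> x) ` K))"
      by (simp add: compact_imp_bounded)
    then show ?thesis by (rule bounded_subset) (use z in fastforce)
  qed
  then show ?thesis using \<psi> by (simp add: schwartz_def)
qed

lemma test_function_bump:
  fixes x :: "'a::euclidean_space"
  assumes \<epsilon>: "\<epsilon> > 0"
  obtains \<psi> :: "'a \<Rightarrow> real" where "smooth (\<lambda>y. complex_of_real (\<psi> y))"
    "\<And>y. 0 \<le> \<psi> y" "\<And>y. \<psi> y \<le> 1" "\<And>y. y \<notin> cbox (x - \<epsilon> *\<^sub>R One) (x + \<epsilon> *\<^sub>R One) \<Longrightarrow> \<psi> y = 0"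
    "\<And>y. y \<in> cbox (x - (\<epsilon> / 2) *\<^sub>R One) (x + (\<epsilon> / 2) *\<^sub>R One) \<Longrightarrow> exp (- 2) ^ DIM('a) \<le> \<psi> y"
proof -
  define s where "s = (\<lambda>b y. (1 / \<epsilon>) * (y \<bullet> b) + (- (x \<bullet> b) / \<epsilon>))"
  have s: "s b y = ((y - x) \<bullet> b) / \<epsilon>" for b y by (simp add: s_def inner_diff_left diff_divide_distrib)
  define \<psi> where "\<psi> = (\<lambda>y::'a. \<Prod>b\<in>Basis. bump_term 1 0 (s b y))"
  have b: "0 \<le> bump_term 1 0 t" "bump_term 1 0 t \<le> 1" for t
    by (auto simp: bump_term_def abs_square_less_1 less_imp_le)
  show ?thesis
  proof (rule that[of \<psi>])
    have "(\<lambda>t. bump_term 1 0 ((1 / \<epsilon>) * t + (- (x \<bullet> b) / \<epsilon>))) \<in> smooth1" for b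
      by (intro smooth1_affine bump_sum_smooth1 bump_sum.intros)
    from smooth_prod_fun[OF this, where 'a='a] show "smooth (\<lambda>y. complex_of_real (\<psi> y))"
      unfolding prod_fun_def[abs_def] \<psi>_def s_def by simp
    show "0 \<le> \<psi> y" "\<psi> y \<le> 1" for y unfolding \<psi>_def using b by (auto intro!: prod_nonneg prod_le_1)
    show "\<psi> y = 0" if y: "y \<notin> cbox (x - \<epsilon> *\<^sub>R One) (x + \<epsilon> *\<^sub>R One)" for y
    proof -
      obtain b where b: "b \<in> Basis" "\<not> (x \<bullet> b - \<epsilon> \<le> y \<bullet> b \<and> y \<bullet> b \<le> x \<bullet> b + \<epsilon>)"
        using y by (auto simp: mem_box inner_diff_left inner_add_left)
      then have "\<not> \<bar>(y - x) \<bullet> b\<bar> < \<epsilon>" by (auto simp: inner_diff_left)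
      then have "\<not> \<bar>s b y\<bar> < 1" using \<epsilon> by (simp add: s)
      then have "bump_term 1 0 (s b y) = 0" by (simp add: bump_term_def)
      with b(1) show ?thesis unfolding \<psi>_def by (auto intro: prod_zero)
    qed
    show "exp (- 2) ^ DIM('a) \<le> \<psi> y" if y: "y \<in> cbox (x - (\<epsilon> / 2) *\<^sub>R One) (x + (\<epsilon> / 2) *\<^sub>R One)" for y
    proof -
      have "exp (- 2) \<le> bump_term 1 0 (s b y)" if bB: "b \<in> Basis" for b
      proof -
        have "x \<bullet> b - \<epsilon> / 2 \<le> y \<bullet> b" "y \<bullet> b \<le> x \<bullet> b + \<epsilon> / 2"
          using y bB by (auto simp: mem_box inner_diff_left inner_add_left)
        then have "\<bar>(y - x) \<bullet> b\<bar> \<le> \<epsilon> / 2" unfolding inner_diff_left by linarith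
        then have h: "\<bar>s b y\<bar> \<le> 1 / 2" using \<epsilon> by (simp add: s pos_divide_le_eq)
        have "(s b y)\<^sup>2 \<le> (1 / 2)\<^sup>2" using power_mono[OF h abs_ge_zero, of 2] by simp
        then have "1 / 2 \<le> 1 - (s b y)\<^sup>2" by (simp add: power2_eq_square)
        \<comment> \<open>In the cube of half the size each rescaled coordinate is at most 1/2 in
          modulus, so every factor of the bump is at least exp (-2).\<close>
        then have "1 / (1 - (s b y)\<^sup>2) \<le> 2" by (simp add: pos_divide_le_eq)
        then show ?thesis using h by (simp add: bump_term_def)
      qed
      then have "(\<Prod>b\<in>(Basis::'a set). exp (- 2)) \<le> \<psi> y" unfolding \<psi>_def by (intro prod_mono) auto
      then show ?thesis by simp
    qed
  qed
qed

lemma test_functions_schwartz: "\<psi> \<in> test_functions U \<Longrightarrow> \<psi> \<in> schwartz"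
  using closure_subset[of "{x. \<psi> x \<noteq> 0}"]
  by (intro schwartz_compact_support[of \<psi> "closure {x. \<psi> x \<noteq> 0}"]) (auto simp: test_functions_def)

lemma integrable_mult_test_function:
  assumes w: "locally_integrable_on w U" and \<psi>: "\<psi> \<in> test_functions U"
  shows "integrable lebesgue (\<lambda>x. w x * cnj (\<psi> x))"
proof -
  let ?K = "closure {x. \<psi> x \<noteq> 0}"
  note r = schwartz_rapid[OF test_functions_schwartz[OF \<psi>]]
  obtain B where B: "\<And>x. norm (\<psi> x) \<le> B" using rapid_bound[OF r] by blast
  have i: "integrable lebesgue (\<lambda>x. indicator ?K x *\<^sub>R w x)"
    using w \<psi> by (simp add: locally_integrable_on_def test_functions_def set_integrable_def)
  have m: "(\<lambda>x. cnj (\<psi> x)) \<in> borel_measurable lebesgue"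
    using rapid_measurable[OF rapid_cnj[OF r]] by (intro measurable_completion) simp
  have "integrable lebesgue (\<lambda>x. (indicator ?K x *\<^sub>R w x) * cnj (\<psi> x))"
  proof (rule Bochner_Integration.integrable_bound[where f="\<lambda>x. B *\<^sub>R (indicator ?K x *\<^sub>R w x)"])
    have "norm ((indicator ?K x *\<^sub>R w x) * cnj (\<psi> x)) \<le> norm (B *\<^sub>R (indicator ?K x *\<^sub>R w x))" for x
    proof -
      have "norm (indicator ?K x *\<^sub>R w x) * norm (\<psi> x) \<le> norm (indicator ?K x *\<^sub>R w x) * B"
        by (intro mult_left_mono B norm_ge_zero)
      moreover have "0 \<le> B" using B[of x] norm_ge_zero order_trans by blast
      ultimately show ?thesis by (simp only: norm_mult complex_mod_cnj norm_scaleR abs_of_nonneg mult.commute[of _ B])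
    qed
    then show "AE x in lebesgue. norm ((indicator ?K x *\<^sub>R w x) * cnj (\<psi> x)) \<le> norm (B *\<^sub>R (indicator ?K x *\<^sub>R w x))" by simp
    show "integrable lebesgue (\<lambda>x. B *\<^sub>R (indicator ?K x *\<^sub>R w x))" by (rule integrable_scaleR_right) (rule i)
    show "(\<lambda>x. (indicator ?K x *\<^sub>R w x) * cnj (\<psi> x)) \<in> borel_measurable lebesgue"
      by (intro borel_measurable_times borel_measurable_integrable[OF i] m)
  qed
  moreover have "(indicator ?K x *\<^sub>R w x) * cnj (\<psi> x) = w x * cnj (\<psi> x)" for x
    using closure_subset[of "{x. \<psi> x \<noteq> 0}"] by (auto simp: indicator_def)
  ultimately show ?thesis by simp
qed

text \<open>At a Lebesgue point x with w x nonzero, a bump on a small cube gives a contradiction: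
  its pairing with the constant w x has at least the order of the volume of the cube, while its
  pairing with w - w x is smaller.\<close>

lemma du_bois_reymond:
  fixes w :: "'a::euclidean_space \<Rightarrow> complex"
  assumes w: "locally_integrable_on w U" and U: "open U"
    and 0: "\<And>\<psi>. \<psi> \<in> test_functions U \<Longrightarrow> (LINT y|lebesgue. w y * cnj (\<psi> y)) = 0"
  shows "AE x in lebesgue. x \<in> U \<longrightarrow> w x = 0"
proof (rule AE_mp[OF AE_lebesgue_point[OF w U]], intro AE_I2 impI, rule ccontr)
  fix x assume lp: "x \<in> U \<longrightarrow> lebesgue_point w (w x) x" and x: "x \<in> U" and c: "w x \<noteq> 0"
  define N where "N = DIM('a)"
  \<comment> \<open>The cube with half side \<epsilon> lies in the ball of radius r = M \<epsilon>,
    since the norm is at most the sum of the N coordinates.\<close>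
  define M where "M = real N + 1"
  define v where "v = measure lborel (ball (0::'a) 1)"
  define q where "q = exp (- 2 :: real) ^ N"
  \<comment> \<open>Chosen such that \<open>\<eta>\<close> times the volume of the ball is half of
    norm (w x) q \<epsilon>^N, the lower bound for the pairing with the constant.\<close>
  define \<eta> where "\<eta> = norm (w x) * q / (2 * (M ^ N * v))"
  have pos: "M > 0" "v > 0" "q > 0" unfolding M_def v_def q_def using content_ball_pos[of 1 "0::'a"] by auto
  then have \<eta>: "\<eta> > 0" using c by (simp add: \<eta>_def)
  obtain \<delta>1 where \<delta>1: "\<delta>1 > 0" "\<forall>r. 0 < r \<longrightarrow> r < \<delta>1 \<longrightarrow>
     (\<integral>\<^sup>+y. ennreal (norm (w y - w x)) * indicator (ball x r) y \<partial>lebesgue) \<le> ennreal (\<eta> * measure lborel (ball x r))"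
    using lebesgue_pointD[OF mp[OF lp x] \<eta>] by (elim exE conjE) (rule that)
  obtain \<delta>2 where \<delta>2: "\<delta>2 > 0" "ball x \<delta>2 \<subseteq> U" using U x open_contains_ball by blast
  define r where "r = min \<delta>1 \<delta>2 / 2"
  have r: "0 < r" "r < \<delta>1" "r < \<delta>2" using \<delta>1(1) \<delta>2(1) by (auto simp: r_def)
  define \<epsilon> where "\<epsilon> = r / M"
  have \<epsilon>: "\<epsilon> > 0" and rM: "r = M * \<epsilon>" using r(1) pos by (auto simp: \<epsilon>_def)
  let ?Q = "cbox (x - \<epsilon> *\<^sub>R One) (x + \<epsilon> *\<^sub>R One)" and ?q = "cbox (x - (\<epsilon> / 2) *\<^sub>R One) (x + (\<epsilon> / 2) *\<^sub>R One)"
  obtain \<psi> where \<psi>: "smooth (\<lambda>y. complex_of_real (\<psi> y))" "\<And>y. 0 \<le> \<psi> y" "\<And>y. \<psi> y \<le> 1"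
    "\<And>y. y \<notin> ?Q \<Longrightarrow> \<psi> y = 0" "\<And>y. y \<in> ?q \<Longrightarrow> q \<le> \<psi> y"
    using test_function_bump[OF \<epsilon>, of x] unfolding q_def N_def by blast
  have Qb: "?Q \<subseteq> ball x r"
  proof
    fix y assume y: "y \<in> ?Q"
    have "norm (y - x) \<le> (\<Sum>b\<in>Basis. \<bar>(y - x) \<bullet> b\<bar>)" by (rule norm_le_l1)
    also have "\<dots> \<le> (\<Sum>b\<in>(Basis::'a set). \<epsilon>)"
      using y by (intro sum_mono) (auto simp: mem_box inner_diff_left inner_add_left abs_le_iff algebra_simps)
    also have "\<dots> < r" using \<epsilon> by (simp add: rM M_def N_def)
    finally show "y \<in> ball x r" by (simp add: dist_norm norm_minus_commute)
  qed
  have "ball x r \<subseteq> ball x \<delta>2" using r(3) by (intro subset_ball) simp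
  then have QU: "?Q \<subseteq> U" using Qb \<delta>2(2) by blast
  let ?\<psi> = "\<lambda>y. complex_of_real (\<psi> y)"
  have cl: "closure {y. ?\<psi> y \<noteq> 0} \<subseteq> ?Q" using \<psi>(4) by (intro closure_minimal) auto
  then have t: "?\<psi> \<in> test_functions U"
    using QU \<psi>(1) compact_Int_closed[OF compact_cbox closed_closure, of "x - \<epsilon> *\<^sub>R One" "x + \<epsilon> *\<^sub>R One" "{y. ?\<psi> y \<noteq> 0}"]
    by (auto simp: test_functions_def Int_absorb1)
  have \<psi>i: "integrable lebesgue ?\<psi>"
    using rapid_integrable[OF schwartz_rapid[OF test_functions_schwartz[OF t]]]
      rapid_measurable[OF schwartz_rapid[OF test_functions_schwartz[OF t]]] by (simp add: integrable_lebesgue_iff)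
  then have \<psi>r: "integrable lebesgue \<psi>" using integrable_Re by fastforce
  have w\<psi>: "integrable lebesgue (\<lambda>y. w y * ?\<psi> y)" using integrable_mult_test_function[OF w t] by simp
  have d: "(LINT y|lebesgue. (w y - w x) * ?\<psi> y) = - (w x * of_real (LINT y|lebesgue. \<psi> y))"
    using 0[OF t] w\<psi> \<psi>i by (simp add: left_diff_distrib)
  have "norm (LINT y|lebesgue. (w y - w x) * ?\<psi> y) \<le> (LINT y|lebesgue. norm ((w y - w x) * ?\<psi> y))"
    by (rule integral_norm_bound)
  also have "\<dots> \<le> \<eta> * measure lborel (ball x r)"
  proof (rule integral_real_bounded)
    have bd: "norm ((w y - w x) * ?\<psi> y) \<le> norm (w y - w x) * indicator (ball x r) y" for y
    proof (cases "y \<in> ball x r")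
      case True
      have "norm (w y - w x) * \<psi> y \<le> norm (w y - w x) * 1"
        by (intro mult_left_mono \<psi>(3) norm_ge_zero)
      then show ?thesis using True \<psi>(2)[of y] by (simp add: norm_mult)
    next
      case False
      then have "y \<notin> ?Q" using Qb by (meson subsetD)
      then have "\<psi> y = 0" by (rule \<psi>(4))
      then show ?thesis by simp
    qed
    have "(\<integral>\<^sup>+y. ennreal (norm ((w y - w x) * ?\<psi> y)) \<partial>lebesgue) \<le>
        (\<integral>\<^sup>+y. ennreal (norm (w y - w x)) * indicator (ball x r) y \<partial>lebesgue)"
    proof (rule nn_integral_mono)
      fix y
      have "ennreal (norm ((w y - w x) * ?\<psi> y)) \<le> ennreal (norm (w y - w x) * indicator (ball x r) y)"
        by (rule ennreal_leI[OF bd])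
      also have "\<dots> = ennreal (norm (w y - w x)) * indicator (ball x r) y" by (simp add: indicator_def)
      finally show "ennreal (norm ((w y - w x) * ?\<psi> y)) \<le> ennreal (norm (w y - w x)) * indicator (ball x r) y" .
    qed
    also have "\<dots> \<le> ennreal (\<eta> * measure lborel (ball x r))" by (rule \<delta>1(2)[rule_format, OF r(1,2)])
    finally show "(\<integral>\<^sup>+y. ennreal (norm ((w y - w x) * ?\<psi> y)) \<partial>lebesgue) \<le> ennreal (\<eta> * measure lborel (ball x r))" .
  qed (use \<eta> in simp)
  also have "\<dots> = norm (w x) * q * \<epsilon> ^ N / 2"
    using pos content_ball_conv_unit_ball[of r x] r(1)
    by (simp add: \<eta>_def v_def[symmetric] N_def[symmetric] rM power_mult_distrib)
  finally have up: "norm (w x) * (LINT y|lebesgue. \<psi> y) \<le> norm (w x) * q * \<epsilon> ^ N / 2"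
    unfolding d using Bochner_Integration.integral_nonneg[of lebesgue \<psi>] \<psi>(2) by (simp add: norm_mult)
  have "q * \<epsilon> ^ N = q * measure lborel ?q"
    using \<epsilon> by (subst content_cbox) (auto simp: inner_diff_left inner_add_left N_def)
  also have "\<dots> = (LINT y|lebesgue. q * indicator ?q y)" by simp
  also have "\<dots> \<le> (LINT y|lebesgue. \<psi> y)"
  proof (rule integral_mono)
    show "integrable lebesgue (\<lambda>y. q * indicator ?q y)"
      by (intro integrable_mult_right integrable_real_indicator) (use emeasure_lborel_cbox_finite in simp_all)
    show "q * indicator ?q y \<le> \<psi> y" for y using \<psi>(2)[of y] \<psi>(5)[of y] by (auto simp: indicator_def)
  qed (rule \<psi>r)
  finally have "norm (w x) * (q * \<epsilon> ^ N) \<le> norm (w x) * (LINT y|lebesgue. \<psi> y)" by (intro mult_left_mono) auto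
  with up have "norm (w x) * (q * \<epsilon> ^ N) \<le> norm (w x) * (q * \<epsilon> ^ N) / 2" unfolding mult.assoc by (rule order_trans[rotated])
  moreover have "norm (w x) * (q * \<epsilon> ^ N) > 0" using c pos \<epsilon> by simp
  ultimately show False by linarith
qed

section \<open>Lebesgue points on the Stiefel manifold\<close>

text \<open>The integrals ignore null sets and the value c is given separately. So functions equal
  almost everywhere share their Lebesgue values at every point, even on a null set such as the
  Stiefel manifold.\<close>

lemma lebesgue_point_cong_AE:
  assumes lp: "lebesgue_point w c x" and eq: "AE y in lebesgue. y \<in> U \<longrightarrow> w y = w' y" and U: "open U" "x \<in> U"
  shows "lebesgue_point w' c x"
  unfolding lebesgue_point_def
proof (intro allI impI)
  fix \<eta> :: real assume \<eta>: "\<eta> > 0"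
  obtain \<delta>1 where \<delta>1: "\<delta>1 > 0" "\<forall>r. 0 < r \<longrightarrow> r < \<delta>1 \<longrightarrow>
     (\<integral>\<^sup>+y. ennreal (norm (w y - c)) * indicator (ball x r) y \<partial>lebesgue) \<le> ennreal (\<eta> * measure lborel (ball x r))"
    using lebesgue_pointD[OF lp \<eta>] by (elim exE conjE) (rule that)
  obtain \<delta>2 where \<delta>2: "\<delta>2 > 0" "ball x \<delta>2 \<subseteq> U" using U open_contains_ball by blast
  have "(\<integral>\<^sup>+y. ennreal (norm (w' y - c)) * indicator (ball x r) y \<partial>lebesgue) \<le> ennreal (\<eta> * measure lborel (ball x r))"
    if r: "0 < r" "r < min \<delta>1 \<delta>2" for r
  proof -
    have "ball x r \<subseteq> U" using \<delta>2(2) subset_ball[of r \<delta>2 x] r by auto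
    with eq have "AE y in lebesgue. ennreal (norm (w y - c)) * indicator (ball x r) y = ennreal (norm (w' y - c)) * indicator (ball x r) y"
      by (auto elim!: eventually_mono simp: indicator_def)
    from nn_integral_cong_AE[OF this] \<delta>1(2)[rule_format, OF r(1)] r(2) show ?thesis by simp
  qed
  then show "\<exists>\<delta>>0. \<forall>r>0. r < \<delta> \<longrightarrow> (\<integral>\<^sup>+y. ennreal (norm (w' y - c)) * indicator (ball x r) y \<partial>lebesgue) \<le> ennreal (\<eta> * measure lborel (ball x r))"
    using \<delta>1(1) \<delta>2(1) by (intro exI[of _ "min \<delta>1 \<delta>2"]) auto
qed

text \<open>The map z -> z y sends the ball of radius r about v into the ball of radius C r about v
  y, with constant Jacobian, and homogeneity compares the values of L. Averages at v are thus
  controlled by averages at v y.\<close>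

lemma lebesgue_point_pullback:
  fixes L :: "real^'m^'n \<Rightarrow> complex" and y :: "real^'m^'m"
  assumes L[measurable]: "L \<in> borel_measurable borel" and y: "det y \<noteq> 0" and s: "s > 0"
    and hom: "AE z in lborel. L (z ** y) = of_real s * L z" and lp: "lebesgue_point L (of_real s * c) (v ** y)"
  shows "lebesgue_point L c v"
  unfolding lebesgue_point_def
proof (intro allI impI)
  fix \<eta> :: real assume \<eta>: "\<eta> > 0"
  have lin: "linear (\<lambda>z :: real^'m^'n. z ** y)"
    by (rule linearI) (simp_all add: matrix_matrix_mult_def vec_eq_iff distrib_right sum.distrib sum_distrib_left mult.assoc)
  then obtain C where C: "C > 0" "\<And>z :: real^'m^'n. norm (z ** y) \<le> C * norm z" using linear_bounded_pos by blast
  define N where "N = DIM(real^'m^'n)"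
  define d where "d = \<bar>det y\<bar> ^ CARD('n)"
  have d: "d > 0" using y by (simp add: d_def)
  \<comment> \<open>Compensates for the homogeneity factor s, the Jacobian d and the growth C^N of
    the volume of the ball.\<close>
  define \<eta>' where "\<eta>' = \<eta> * s * d / C ^ N"
  have \<eta>': "\<eta>' > 0" using \<eta> s d C(1) by (simp add: \<eta>'_def)
  obtain \<delta> where \<delta>: "\<delta> > 0" "\<forall>r. 0 < r \<longrightarrow> r < \<delta> \<longrightarrow>
     (\<integral>\<^sup>+x. ennreal (norm (L x - of_real s * c)) * indicator (ball (v ** y) r) x \<partial>lebesgue) \<le> ennreal (\<eta>' * measure lborel (ball (v ** y) r))"
    using lebesgue_pointD[OF lp \<eta>'] by (elim exE conjE) (rule that)
  have "(\<integral>\<^sup>+z. ennreal (norm (L z - c)) * indicator (ball v r) z \<partial>lebesgue) \<le> ennreal (\<eta> * measure lborel (ball v r))"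
    if r: "0 < r" "r < \<delta> / C" for r
  proof -
    have Cr: "0 < C * r" "C * r < \<delta>" using r C(1) by (auto simp: pos_less_divide_eq mult.commute)
    define F where "F = (\<lambda>x. ennreal (norm (L x - of_real s * c)) * indicator (ball (v ** y) (C * r)) x)"
    have [measurable]: "ball (v ** y) (C * r) \<in> sets borel" by simp
    have Fm[measurable]: "F \<in> borel_measurable borel" unfolding F_def by measurable
    have "AE z in lborel. ennreal (norm (L z - c)) * indicator (ball v r) z \<le> ennreal (1 / s) * F (z ** y)"
      using hom
    proof eventually_elim
      case (elim z)
      show ?case
      proof (cases "z \<in> ball v r")
        case True
        have "norm (v ** y - z ** y) \<le> C * norm (v - z)"
          using C(2)[of "v - z"] unfolding linear_diff[OF lin] .
        also have "\<dots> < C * r" using True C(1) by (simp add: dist_norm)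
        finally have "z ** y \<in> ball (v ** y) (C * r)" by (simp add: dist_norm)
        moreover have "norm (L (z ** y) - of_real s * c) = s * norm (L z - c)"
          unfolding elim right_diff_distrib[symmetric] using s by (simp add: norm_mult)
        ultimately show ?thesis using True s by (simp add: F_def ennreal_mult[symmetric])
      qed simp
    qed
    then have le: "(\<integral>\<^sup>+z. ennreal (norm (L z - c)) * indicator (ball v r) z \<partial>lborel) \<le> (\<integral>\<^sup>+z. ennreal (1 / s) * F (z ** y) \<partial>lborel)"
      by (rule nn_integral_mono_AE)
    have Fy: "(\<integral>\<^sup>+z. F (z ** y) \<partial>(lborel :: (real^'m^'n) measure)) = ennreal (1 / d) * (\<integral>\<^sup>+x. F x \<partial>lborel)"
    proof -
      have "ennreal (1 / d) * (ennreal d * (\<integral>\<^sup>+z. F (z ** y) \<partial>(lborel :: (real^'m^'n) measure))) = ennreal (1 / d) * (\<integral>\<^sup>+x. F x \<partial>lborel)"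
        unfolding d_def nn_integral_matrix_mult_right[OF y Fm] ..
      moreover have "ennreal (1 / d) * ennreal d = 1" using d by (simp add: ennreal_mult[symmetric])
      ultimately show ?thesis by (simp only: mult.assoc[symmetric] mult_1_left)
    qed
    have m: "measure lborel (ball (v ** y) (C * r)) = C ^ N * measure lborel (ball v r)"
      using C(1) r(1) content_ball_conv_unit_ball[of "C * r" "v ** y"] content_ball_conv_unit_ball[of r v]
      by (simp only: N_def power_mult_distrib mult.assoc) simp
    have "(\<integral>\<^sup>+x. F x \<partial>lborel) \<le> ennreal (\<eta>' * measure lborel (ball (v ** y) (C * r)))"
      using \<delta>(2)[rule_format, OF Cr] unfolding F_def nn_integral_completion .
    also have "\<eta>' * measure lborel (ball (v ** y) (C * r)) = \<eta> * s * d * measure lborel (ball v r)"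
      unfolding m \<eta>'_def using C(1) by simp
    finally have F: "(\<integral>\<^sup>+x. F x \<partial>lborel) \<le> ennreal (\<eta> * s * d * measure lborel (ball v r))" .
    note le
    also have "(\<integral>\<^sup>+z. ennreal (1 / s) * F (z ** y) \<partial>lborel) = ennreal (1 / s) * (ennreal (1 / d) * (\<integral>\<^sup>+x. F x \<partial>lborel))"
      unfolding Fy[symmetric] by (rule nn_integral_cmult) measurable
    also have "\<dots> \<le> ennreal (1 / s) * (ennreal (1 / d) * ennreal (\<eta> * s * d * measure lborel (ball v r)))"
      by (intro mult_left_mono F) auto
    also have "\<dots> = ennreal (1 / s * (1 / d * (\<eta> * s * d * measure lborel (ball v r))))"
      using s d \<eta> by (simp only: ennreal_mult[symmetric] measure_nonneg mult_nonneg_nonneg less_imp_le zero_le_divide_1_iff)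
    also have "1 / s * (1 / d * (\<eta> * s * d * measure lborel (ball v r))) = \<eta> * measure lborel (ball v r)"
      using s d by simp
    finally show ?thesis unfolding nn_integral_completion .
  qed
  then show "\<exists>\<delta>>0. \<forall>r>0. r < \<delta> \<longrightarrow> (\<integral>\<^sup>+z. ennreal (norm (L z - c)) * indicator (ball v r) z \<partial>lebesgue) \<le> ennreal (\<eta> * measure lborel (ball v r))"
    using \<delta>(1) C(1) by (intro exI[of _ "\<delta> / C"]) auto
qed

text \<open>Since D is invariant only almost everywhere, homogeneity is checked at g v t for almost
  every g, with t and t y both invertible. Polar coordinates then show that the exceptional set is
  Lebesgue null.\<close>

lemma AE_E_ext_mult_right:
  fixes D :: "real^'m^'n \<Rightarrow> complex" and y :: "real^'m^'m"
  assumes le: "CARD('m) \<le> CARD('n)" and D[measurable]: "D \<in> borel_measurable borel"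
    and inv: "right_invariant D" and y: "det y \<noteq> 0"
  shows "AE z in lborel. E_ext (- of_nat a) D (z ** y) = of_real (1 / gvol y ^ a) * E_ext (- of_nat a) D z"
proof -
  let ?L = "E_ext (- of_nat a) D"
  note [measurable] = borel_measurable_E_ext[OF D, of a]
  obtain v :: "real^'m^'n" where v: "v \<in> stiefel" using stiefel_nonempty[OF le] by auto
  define B where "B = {z. ?L (z ** y) \<noteq> of_real (1 / gvol y ^ a) * ?L z}"
  have B[measurable]: "B \<in> sets borel" unfolding B_def by measurable
  have inner: "(\<integral>\<^sup>+g. indicator B (g ** (v ** t)) \<partial>haar) = 0" if t: "det t \<noteq> 0" for t :: "real^'m^'m"
  proof -
    have ty: "det (t ** y) \<noteq> 0" using t y by (simp add: det_mul)
    have "AE g in haar. indicator B (g ** (v ** t)) = (0 :: ennreal)"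
      using AE_E_ext_haar[OF inv v t, of a] AE_E_ext_haar[OF inv v ty, of a]
    proof eventually_elim
      case (elim g)
      have "?L ((g ** (v ** t)) ** y) = ?L (g ** (v ** (t ** y)))" by (simp only: matrix_mul_assoc)
      then show ?case using elim by (simp add: B_def gvol_square det_mul abs_mult power_mult_distrib)
    qed
    from nn_integral_cong_AE[OF this] show ?thesis by simp
  qed
  have "AE t in lborel. (\<integral>\<^sup>+g. indicator B (g ** (v ** t)) \<partial>haar) * ennreal (gvol (t::real^'m^'m) ^ (CARD('n) - CARD('m))) = 0"
    using AE_det_nonzero by eventually_elim (simp add: inner)
  from nn_integral_cong_AE[OF this] have "(\<integral>\<^sup>+t. (\<integral>\<^sup>+g. indicator B (g ** (v ** t)) \<partial>haar) * ennreal (gvol (t::real^'m^'m) ^ (CARD('n) - CARD('m))) \<partial>lborel) = 0"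
    by simp
  then have "(\<integral>\<^sup>+x. indicator B x \<partial>lborel) = 0"
    using polar_integration[OF order_refl le _ v, of "indicator B"]
      gauss_moment_pos[of "CARD('n) - CARD('m)", where 'a='m and 'm='m] by simp
  then have "emeasure lborel B = 0" by simp
  then have "B \<in> null_sets lborel" by (simp add: null_sets_def)
  from AE_not_in[OF this] show ?thesis by (simp add: B_def)
qed

lemma locally_integrable_of_rapid:
  fixes L :: "'a::euclidean_space \<Rightarrow> complex"
  assumes L[measurable]: "L \<in> borel_measurable borel" and int: "\<And>\<rho>. rapid \<rho> \<Longrightarrow> integrable lborel (\<lambda>x. L x * \<rho> x)"
  shows "locally_integrable_on L UNIV"
  unfolding locally_integrable_on_def set_integrable_def
proof (intro allI impI)
  fix K :: "'a set" assume K: "compact K"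
  then obtain R where R: "\<And>x. x \<in> K \<Longrightarrow> norm x \<le> R" "R > 0" using compact_imp_bounded bounded_pos by metis
  \<comment> \<open>A continuous cutoff with compact support, at least 1 on the ball of radius R
    that contains K.\<close>
  define \<rho> where "\<rho> = (\<lambda>x :: 'a. complex_of_real (max 0 (R + 1 - norm x)))"
  have \<rho>: "norm (\<rho> x) = max 0 (R + 1 - norm x)" for x by (simp only: \<rho>_def norm_of_real)
  have "rapid \<rho>" unfolding rapid_def
  proof (intro conjI allI)
    show "continuous_on UNIV \<rho>" unfolding \<rho>_def by (intro continuous_intros)
    have "(1 + norm x) ^ N * norm (\<rho> x) \<le> (R + 2) ^ N * (R + 1)" for N and x :: 'a
    proof (cases "norm x \<le> R + 1")
      case True
      then show ?thesis using R(2) by (intro mult_mono power_mono) (auto simp: \<rho>)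
    next
      case False
      then show ?thesis using R(2) by (simp add: \<rho>)
    qed
    then show "\<exists>C. \<forall>x :: 'a. (1 + norm x) ^ N * norm (\<rho> x) \<le> C" for N by blast
  qed
  then have i: "integrable lborel (\<lambda>x. L x * \<rho> x)" by (rule int)
  have [measurable]: "K \<in> sets borel" using K by (intro borel_closed compact_imp_closed)
  have "integrable lborel (\<lambda>x. indicator K x *\<^sub>R L x)"
  proof (rule Bochner_Integration.integrable_bound[OF i])
    have "norm (indicator K x *\<^sub>R L x) \<le> norm (L x * \<rho> x)" for x
    proof (cases "x \<in> K")
      case True
      have "norm (\<rho> x) \<ge> 1" using R(1)[OF True] by (simp add: \<rho>)
      then show ?thesis using True mult_left_mono[of 1 "norm (\<rho> x)" "norm (L x)"] by (simp add: norm_mult)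
    qed simp
    then show "AE x in lborel. norm (indicator K x *\<^sub>R L x) \<le> norm (L x * \<rho> x)" by simp
  qed measurable
  moreover have "(\<lambda>x. indicator K x *\<^sub>R L x) \<in> borel_measurable borel" by measurable
  ultimately show "integrable lebesgue (\<lambda>x. indicator K x *\<^sub>R L x)" using integrable_lebesgue_iff by blast
qed

text \<open>Almost every matrix is a Lebesgue point of the homogeneous extension, so for almost every \<open>v\<close> and a suitable
  fixed \<open>y\<close> the matrix \<open>v y\<close> is one; homogeneity under \<open>z \<mapsto> z y\<close> carries this back to \<open>v\<close>.\<close>
lemma AE_lebesgue_point_stiefel:
  fixes D :: "real^'m^'n \<Rightarrow> complex"
  assumes le: "CARD('m) \<le> CARD('n)" and D[measurable]: "D \<in> borel_measurable borel" and inv: "right_invariant D"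
    and loc: "locally_integrable_on (E_ext (- of_nat a) D) UNIV"
  shows "AE v in stiefel_measure. lebesgue_point (E_ext (- of_nat a) D) (D v) v"
proof -
  let ?L = "E_ext (- of_nat a) D"
  note Lm[measurable] = borel_measurable_E_ext[OF D, of a]
  obtain v :: "real^'m^'n" where v: "v \<in> stiefel" using stiefel_nonempty[OF le] by auto
  have "AE x in lborel. lebesgue_point ?L (?L x) x"
    using AE_lebesgue_point[OF loc open_UNIV] by (simp add: AE_completion_iff)
  then obtain B where "{x \<in> space lborel. \<not> lebesgue_point ?L (?L x) x} \<subseteq> B"
    and B0: "emeasure lborel B = 0" "B \<in> sets lborel" by (rule AE_E)
  then have B: "{x. \<not> lebesgue_point ?L (?L x) x} \<subseteq> B" by simp
  have Bm[measurable]: "B \<in> sets borel" using B0(2) by simp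
  have "(\<integral>\<^sup>+t. (\<integral>\<^sup>+g. indicator B (g ** (v ** t)) \<partial>haar) * ennreal (gvol (t::real^'m^'m) ^ (CARD('n) - CARD('m))) \<partial>lborel) = 0"
    using polar_integration[OF order_refl le _ v, of "indicator B"] B0 by simp
  then have "AE t in lborel. (\<integral>\<^sup>+g. indicator B (g ** (v ** t)) \<partial>haar) * ennreal (gvol (t::real^'m^'m) ^ (CARD('n) - CARD('m))) = 0"
    by (rule nn_integral_0_iff_AE[THEN iffD1, rotated]) measurable
  then have ev: "AE t in (lborel :: (real^'m^'m) measure). det t \<noteq> 0 \<and> (\<integral>\<^sup>+g. indicator B (g ** (v ** t)) \<partial>haar) = 0"
    using AE_det_nonzero by eventually_elim (simp add: gvol_square)
  have "ae_filter (lborel :: (real^'m^'m) measure) \<noteq> bot" by (simp add: ae_filter_eq_bot_iff)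
  \<comment> \<open>The Lebesgue null set B is null along the orbit of v t for almost every t; one
    invertible t of this kind is fixed.\<close>
  from eventually_happens'[OF this ev] obtain t :: "real^'m^'m" where t: "det t \<noteq> 0" "(\<integral>\<^sup>+g. indicator B (g ** (v ** t)) \<partial>haar) = 0"
    by blast
  define s where "s = 1 / gvol t ^ a"
  have s: "s > 0" using t(1) by (simp add: s_def gvol_square)
  have "(\<lambda>g :: real^'n^'n. indicator B (g ** (v ** t)) :: ennreal) \<in> borel_measurable haar"
    by (intro measurable_from_stiefel[OF sets_haar]) measurable
  from nn_integral_0_iff_AE[THEN iffD1, OF this t(2)]
  have "AE g in haar. indicator B (g ** (v ** t)) = (0 :: ennreal)" .
  then have "AE g in haar. (g ** v) ** t \<notin> B \<and> ?L ((g ** v) ** t) = of_real s * D (g ** v)"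
    using AE_E_ext_haar[OF inv v t(1), of a]
    by eventually_elim (simp add: s_def matrix_mul_assoc indicator_eq_0_iff)
  then have "AE w in stiefel_measure. w ** t \<notin> B \<and> ?L (w ** t) = of_real s * D w"
  proof -
    assume ae: "AE g in haar. (g ** v) ** t \<notin> B \<and> ?L ((g ** v) ** t) = of_real s * D (g ** v)"
    have "{w. w ** t \<notin> B \<and> ?L (w ** t) = of_real s * D w} \<in> sets borel" by measurable
    then have "stiefel \<inter> {w. w ** t \<notin> B \<and> ?L (w ** t) = of_real s * D w} \<in> sets borel"
      by (rule sets.Int[OF borel_closed[OF closed_stiefel]])
    moreover have "{w \<in> space stiefel_borel. w ** t \<notin> B \<and> ?L (w ** t) = of_real s * D w} =
        stiefel \<inter> {w. w ** t \<notin> B \<and> ?L (w ** t) = of_real s * D w}"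
      by (auto simp: space_stiefel_borel)
    ultimately have "{w \<in> space stiefel_borel. w ** t \<notin> B \<and> ?L (w ** t) = of_real s * D w} \<in> sets stiefel_borel"
      unfolding sets_stiefel_borel by simp
    from AE_distr_iff[OF measurable_haar_mult[OF v] this] ae show ?thesis
      unfolding stiefel_measure_eq[OF v] orbit_measure_def by simp
  qed
  then show ?thesis
  proof eventually_elim
    case (elim w)
    then have "lebesgue_point ?L (of_real s * D w) (w ** t)" using B by (metis (mono_tags) mem_Collect_eq subsetD)
    then show ?case
      using lebesgue_point_pullback[OF Lm t(1) s] AE_E_ext_mult_right[OF le D inv t(1), of a] unfolding s_def by blast
  qed
qed

theorem theorem7p2:
  fixes f :: "real^'m^'n \<Rightarrow> complex"
    and e :: "'p::finite + 'k::finite \<Rightarrow> 'n"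
    and e' :: "'q::finite + 'm \<Rightarrow> 'n"
    and l :: nat
    and \<phi> :: "real^'k^'n \<Rightarrow> complex"
    and lhs G :: "real^'m^'n \<Rightarrow> complex"
    and rhs :: "(real^'m^'n) distribution"
  assumes bij: "bij e" "bij e'"
    and dims: "CARD('m) \<le> CARD('k)" "CARD('k) + CARD('m) \<le> CARD('n)"
    and even: "even (CARD('n) - CARD('k) - CARD('m))"
    and l: "l = (CARD('n) - CARD('k) - CARD('m)) div 2"
    and L1: "integrable stiefel_measure f"
    and inv: "right_invariant f"
    and \<phi>: "\<phi> = funk e f"
    and lhs: "lhs = E_ext (of_nat CARD('m) - of_nat CARD('n)) f"
    and G: "G = E_ext (- of_nat CARD('k)) (dual_funk e' \<phi>)"
    and rhs: "rhs = (\<lambda>\<psi>. of_real (funk_const CARD('n) CARD('m) CARD('k)) *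
                          (cayley_laplace ^^ l) (dist_of G) \<psi>)"
  shows "defines_tempered lhs \<and> defines_tempered G \<and>
         (\<forall>\<psi>\<in>schwartz. dist_of lhs \<psi> = rhs \<psi>) \<and>
         (\<forall>U h. open U \<longrightarrow> stiefel \<subseteq> U \<longrightarrow> locally_integrable_on h U \<longrightarrow>
            (\<forall>\<psi>\<in>test_functions U. rhs \<psi> = dist_of h \<psi>) \<longrightarrow>
            (AE v in stiefel_measure. has_lebesgue_value h (f v) v))"
proof -
  have n: "CARD('n) = CARD('k) + CARD('m) + 2 * l" and mn: "CARD('m) \<le> CARD('n)"
    using dims even l by auto
  define L where "L = E_ext (- of_nat (CARD('n) - CARD('m))) (zero_ext f)"
  note z = zero_ext_version[OF mn L1]
  note main = funk_inversion[OF bij dims(1) n L1 inv, folded L_def \<phi>, folded G]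
  have lhs_L: "lhs = L"
  proof -
    have "(of_nat CARD('m) - of_nat CARD('n) :: complex) = - of_nat (CARD('n) - CARD('m))"
      using mn by (simp add: of_nat_diff)
    then show ?thesis unfolding lhs L_def by (simp only:) (rule E_ext_cong, simp)
  qed
  have formula: "dist_of L \<psi> = rhs \<psi>" if "\<psi> \<in> schwartz" for \<psi>
    using main(5)[OF that] by (simp only: rhs)
  have locL: "locally_integrable_on L UNIV" by (rule locally_integrable_of_rapid[OF main(1,2)])
  have points: "AE v in stiefel_measure. lebesgue_point L (zero_ext f v) v"
    unfolding L_def by (rule AE_lebesgue_point_stiefel[OF mn z(1) z(3)[OF inv] locL[unfolded L_def]])
  have "AE v in stiefel_measure. has_lebesgue_value h (f v) v"
    if U: "open U" "stiefel \<subseteq> U" and h: "locally_integrable_on h U"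
      and eq: "\<forall>\<psi>\<in>test_functions U. rhs \<psi> = dist_of h \<psi>" for U h
  proof -
    have LU: "locally_integrable_on L U" using locL by (simp add: locally_integrable_on_def)
    have "locally_integrable_on (\<lambda>x. L x - h x) U"
      using LU h by (auto simp: locally_integrable_on_def intro!: set_integral_diff)
    then have "AE x in lebesgue. x \<in> U \<longrightarrow> L x - h x = 0"
    proof (rule du_bois_reymond[OF _ U(1)])
      fix \<psi> assume \<psi>: "\<psi> \<in> test_functions U"
      have "dist_of L \<psi> = dist_of h \<psi>"
        using formula[OF test_functions_schwartz[OF \<psi>]] eq \<psi> by simp
      then show "(LINT y|lebesgue. (L y - h y) * cnj (\<psi> y)) = 0"
        using integrable_mult_test_function[OF LU \<psi>] integrable_mult_test_function[OF h \<psi>]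
        by (simp add: dist_of_def left_diff_distrib)
    qed
    \<comment> \<open>By itself this says nothing on the null set of frames; Lebesgue points carry
      the value of L over to h there.\<close>
    then have Lh: "AE x in lebesgue. x \<in> U \<longrightarrow> L x = h x" by simp
    show ?thesis
      using points AE_space
    proof eventually_elim
      case (elim v)
      then have v: "v \<in> stiefel" by (simp add: space_stiefel[OF mn])
      have "lebesgue_point h (zero_ext f v) v"
        using lebesgue_point_cong_AE[OF elim(1) Lh U(1)] U(2) v by blast
      then show ?case using lebesgue_point_has_value v by simp
    qed
  qed
  then show ?thesis unfolding lhs_L using main(3,4) formula by blast
qed

end
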